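(* Let $S$ be a commutative semiring with $1_S\neq0_S$, let $(B,A,C)$ be a right-right Doi-Koppinen structure over $S$, and consider the corresponding $A$-semicoring $\mathcal{C}:=A\otimes_S C$ and the $A$-semiring $A\#^{op}C^*$. If $P:=(A\#^{op}C^*,\mathcal{C})$ satisfies the $\alpha$-condition, then $$\mathbb{S}(B)_A^C\simeq\mathrm{Rat}^{\mathcal{C}}(\mathbb{S}_{A\#^{op}C^*})=\sigma[\mathcal{C}_{A\#^{op}C^*}],$$ where $\simeq$ denotes an isomorphism of categories.
   Context: Semirings are unital; semimodules are modules not necessarily with subtraction; $\otimes_S$ is the natural tensor product of $S$-semimodules. $S$-semialgebras and $S$-semicoalgebras are monoids and comonoids in the symmetric monoidal category $\mathbb{S}_S$ of $S$-semimodules, and Sweedler notation is used. An $S$-bisemialgebra $B$ is an $S$-semialgebra and an $S$-semicoalgebra such that $\Delta_B,\varepsilon_B$ are semialgebra morphisms. A right $C$-semicomodule is an $S$-semimodule $M$ with a coassociative counital $S$-linear map $\rho^M:M\to M\otimes_S C$, $m\mapsto\sum m_{<0>}\otimes m_{<1>}$. A right-right Doi-Koppinen structure $(B,A,C)$ over $S$ consists of: - an $S$-bisemialgebra $B$; - a right $B$-semicomodule semialgebra $A$, i.e. an $S$-semialgebra that is a right $B$-semicomodule with $\sum(ab)_{<0>}\otimes(ab)_{<1>}=\sum a_{<0>}b_{<0>}\otimes a_{<1>}b_{<1>}$ for $a,b\in A$ and $\sum 1_{<0>}\otimes1_{<1>}=1_A\otimes1_B$; - a right $B$-semimodule semicoalgebra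 $C$, i.e. an $S$-semicoalgebra that is a right $B$-semimodule with $\sum(cb)_1\otimes(cb)_2=\sum c_1b_1\otimes c_2b_2$ and $\varepsilon_C(cb)=\varepsilon_C(c)\varepsilon_B(b)$. $\mathbb{S}(B)_A^C$ is the category of right-right Doi-Koppinen semimodules: right $A$-semimodules $M$ that are also right $C$-semicomodules with $\sum(ma)_{<0>}\otimes(ma)_{<1>}=\sum m_{<0>}a_{<0>}\otimes m_{<1>}a_{<1>}$; morphisms are the $A$-linear $C$-colinear maps. $\mathcal{C}=A\otimes_S C$ is an $A$-semicoring (comonoid in $(A,A)$-bisemimodules) with $\tilde a(a\otimes c)b=\sum\tilde aab_{<0>}\otimes cb_{<1>}$, comultiplication $a\otimes c\mapsto\sum(a\otimes c_1)\otimes_A(1_A\otimes c_2)$ and counit $a\otimes c\mapsto a\varepsilon_C(c)$. $C^*=\mathrm{Hom}_S(C,S)$ has the convolution product $(f*g)(c)=\sum f(c_1)g(c_2)$ and the left $B$-action $(bf)(c)=f(cb)$. $A\#^{op}C^*$ is $A\otimes_S C^*$ with $(A,A)$-bisemimodule structure $\tilde a(a\#f)=\sum\tilde a_{<0>}a\#\tilde a_{<1>}f$, $(a\#f)\tilde a=a\tilde a\#f$, multiplication $(a\#f)\cdot(b\#g)=\sum a_{<0>}b\#(a_{<1>}g)*f$ and unity $1_A\#\varepsilon_C$. $P$ satisfies the $\alpha$-condition iff for every right $A$-semimodule $M$ the map $$\alpha_M^P:M\otimes_A\mathcal{C}\to\mathrm{Hom}_{-A}(A\#^{op}C^*,M),\quad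 m\otimes_A(\tilde a\otimes c)\mapsto[a\#f\mapsto m\tilde aaf(c)]$$ is injective and uniform. Here $\mathrm{Hom}_{-A}$ denotes right $A$-linear maps. A linear map $f:M\to N$ is uniform iff it is both: - $i$-uniform: $f(M)=\{n\in N\mid n+f(m)=f(m')\text{ for some }m,m'\in M\}$; - $k$-uniform: $f(m)=f(m')$ implies $m+k=m'+k'$ for some $k,k'\in\mathrm{Ker}(f)$. For a right $A\#^{op}C^*$-semimodule $M$ (a right $A$-semimodule via $a\mapsto a\#\varepsilon_C$), let $\tilde\rho_M:M\to\mathrm{Hom}_{-A}(A\#^{op}C^*,M)$, $m\mapsto[t\mapsto mt]$, and $\mathrm{Rat}^{\mathcal{C}}(M)=\tilde\rho_M^{-1}(\alpha_M^P(M\otimes_A\mathcal{C}))$. $\mathrm{Rat}^{\mathcal{C}}(\mathbb{S}_{A\#^{op}C^*})$ is the full subcategory of right $A\#^{op}C^*$-semimodules $M$ with $\mathrm{Rat}^{\mathcal{C}}(M)=M$. $\mathcal{C}$ is a right $A\#^{op}C^*$-semimodule via $(a\otimes c)(b\#g)=\sum ab_{<0>}\otimes c_1b_{<1>}g(c_2)$. For a right $T$-semimodule $X$, $\sigma[X_T]$ is the smallest full subcategory of right $T$-semimodules containing $X$ and closed under direct sums, homomorphic images and subsemimodules. *)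

theory Defs
  imports "HOL-Library.Multiset" "HOL-Library.Equipollence" "HOL-Algebra.Module"
begin

section \<open>Semimodules\<close>

locale semimodule = R: semiring R + M: abelian_monoid M
  for R :: "('r, 'x) ring_scheme" and M :: "('r, 'm, 'y) module_scheme" +
  assumes smult_closed: "\<lbrakk>r \<in> carrier R; m \<in> carrier M\<rbrakk> \<Longrightarrow> r \<odot>\<^bsub>M\<^esub> m \<in> carrier M"
    and smult_l_distr: "\<lbrakk>r \<in> carrier R; r' \<in> carrier R; m \<in> carrier M\<rbrakk> \<Longrightarrow>
      (r \<oplus>\<^bsub>R\<^esub> r') \<odot>\<^bsub>M\<^esub> m = r \<odot>\<^bsub>M\<^esub> m \<oplus>\<^bsub>M\<^esub> r' \<odot>\<^bsub>M\<^esub> m"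
    and smult_r_distr: "\<lbrakk>r \<in> carrier R; m \<in> carrier M; m' \<in> carrier M\<rbrakk> \<Longrightarrow>
      r \<odot>\<^bsub>M\<^esub> (m \<oplus>\<^bsub>M\<^esub> m') = r \<odot>\<^bsub>M\<^esub> m \<oplus>\<^bsub>M\<^esub> r \<odot>\<^bsub>M\<^esub> m'"
    and smult_assoc: "\<lbrakk>r \<in> carrier R; r' \<in> carrier R; m \<in> carrier M\<rbrakk> \<Longrightarrow>
      (r \<otimes>\<^bsub>R\<^esub> r') \<odot>\<^bsub>M\<^esub> m = r \<odot>\<^bsub>M\<^esub> (r' \<odot>\<^bsub>M\<^esub> m)"
    and smult_one: "m \<in> carrier M \<Longrightarrow> \<one>\<^bsub>R\<^esub> \<odot>\<^bsub>M\<^esub> m = m"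
    and smult_l_null: "m \<in> carrier M \<Longrightarrow> \<zero>\<^bsub>R\<^esub> \<odot>\<^bsub>M\<^esub> m = \<zero>\<^bsub>M\<^esub>"
    and smult_r_null: "r \<in> carrier R \<Longrightarrow> r \<odot>\<^bsub>M\<^esub> \<zero>\<^bsub>M\<^esub> = \<zero>\<^bsub>M\<^esub>"

text \<open>Right semimodules. The fields \<open>mult\<close> and \<open>one\<close> inherited from the record \<open>ring\<close> carry no
  meaning here (as for the library's \<open>module\<close>).\<close>

record ('m, 'r) rmodule = "'m ring" +
  ract :: "'m \<Rightarrow> 'r \<Rightarrow> 'm"  (infixl \<open>\<star>\<index>\<close> 70)

locale right_semimodule = R: semiring R + M: abelian_monoid M
  for R :: "('r, 'x) ring_scheme" and M :: "('m, 'r, 'y) rmodule_scheme" +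
  assumes ract_closed: "\<lbrakk>m \<in> carrier M; r \<in> carrier R\<rbrakk> \<Longrightarrow> m \<star>\<^bsub>M\<^esub> r \<in> carrier M"
    and ract_l_distr: "\<lbrakk>m \<in> carrier M; m' \<in> carrier M; r \<in> carrier R\<rbrakk> \<Longrightarrow>
      (m \<oplus>\<^bsub>M\<^esub> m') \<star>\<^bsub>M\<^esub> r = m \<star>\<^bsub>M\<^esub> r \<oplus>\<^bsub>M\<^esub> m' \<star>\<^bsub>M\<^esub> r"
    and ract_r_distr: "\<lbrakk>m \<in> carrier M; r \<in> carrier R; r' \<in> carrier R\<rbrakk> \<Longrightarrow>
      m \<star>\<^bsub>M\<^esub> (r \<oplus>\<^bsub>R\<^esub> r') = m \<star>\<^bsub>M\<^esub> r \<oplus>\<^bsub>M\<^esub> m \<star>\<^bsub>M\<^esub> r'"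
    and ract_assoc: "\<lbrakk>m \<in> carrier M; r \<in> carrier R; r' \<in> carrier R\<rbrakk> \<Longrightarrow>
      m \<star>\<^bsub>M\<^esub> (r \<otimes>\<^bsub>R\<^esub> r') = (m \<star>\<^bsub>M\<^esub> r) \<star>\<^bsub>M\<^esub> r'"
    and ract_one: "m \<in> carrier M \<Longrightarrow> m \<star>\<^bsub>M\<^esub> \<one>\<^bsub>R\<^esub> = m"
    and ract_l_null: "r \<in> carrier R \<Longrightarrow> \<zero>\<^bsub>M\<^esub> \<star>\<^bsub>M\<^esub> r = \<zero>\<^bsub>M\<^esub>"
    and ract_r_null: "m \<in> carrier M \<Longrightarrow> m \<star>\<^bsub>M\<^esub> \<zero>\<^bsub>R\<^esub> = \<zero>\<^bsub>M\<^esub>"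

definition additive_map :: "('m, 'x) ring_scheme \<Rightarrow> ('n, 'y) ring_scheme \<Rightarrow> ('m \<Rightarrow> 'n) \<Rightarrow> bool" where
  "additive_map M N f \<longleftrightarrow> f \<in> carrier M \<rightarrow> carrier N \<and> f \<zero>\<^bsub>M\<^esub> = \<zero>\<^bsub>N\<^esub> \<and>
     (\<forall>m\<in>carrier M. \<forall>m'\<in>carrier M. f (m \<oplus>\<^bsub>M\<^esub> m') = f m \<oplus>\<^bsub>N\<^esub> f m')"

definition left_linear ::
  "('r, 'x) ring_scheme \<Rightarrow> ('r, 'm, 'y) module_scheme \<Rightarrow> ('r, 'n, 'z) module_scheme \<Rightarrow> ('m \<Rightarrow> 'n) \<Rightarrow> bool"
  where "left_linear R M N f \<longleftrightarrow> additive_map M N f \<and>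
     (\<forall>r\<in>carrier R. \<forall>m\<in>carrier M. f (r \<odot>\<^bsub>M\<^esub> m) = r \<odot>\<^bsub>N\<^esub> f m)"

definition right_linear ::
  "('r, 'x) ring_scheme \<Rightarrow> ('m, 'r, 'y) rmodule_scheme \<Rightarrow> ('n, 'r, 'z) rmodule_scheme \<Rightarrow> ('m \<Rightarrow> 'n) \<Rightarrow> bool"
  where "right_linear R M N f \<longleftrightarrow> additive_map M N f \<and>
     (\<forall>m\<in>carrier M. \<forall>r\<in>carrier R. f (m \<star>\<^bsub>M\<^esub> r) = f m \<star>\<^bsub>N\<^esub> r)"

definition right_hom ::
  "('r, 'x) ring_scheme \<Rightarrow> ('m, 'r, 'y) rmodule_scheme \<Rightarrow> ('n, 'r, 'z) rmodule_scheme \<Rightarrow> ('m \<Rightarrow> 'n) ring"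
  where "right_hom R M N =
    \<lparr>carrier = {f \<in> extensional (carrier M). right_linear R M N f},
     mult = undefined, one = undefined,
     zero = (\<lambda>m\<in>carrier M. \<zero>\<^bsub>N\<^esub>),
     add = (\<lambda>f g. \<lambda>m\<in>carrier M. f m \<oplus>\<^bsub>N\<^esub> g m)\<rparr>"

definition i_uniform :: "('m, 'x) ring_scheme \<Rightarrow> ('n, 'y) ring_scheme \<Rightarrow> ('m \<Rightarrow> 'n) \<Rightarrow> bool" where
  "i_uniform M N f \<longleftrightarrow> f ` carrier M =
     {n \<in> carrier N. \<exists>m\<in>carrier M. \<exists>m'\<in>carrier M. n \<oplus>\<^bsub>N\<^esub> f m = f m'}"

definition k_uniform :: "('m, 'x) ring_scheme \<Rightarrow> ('n, 'y) ring_scheme \<Rightarrow> ('m \<Rightarrow> 'n) \<Rightarrow> bool" where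
  "k_uniform M N f \<longleftrightarrow> (\<forall>m\<in>carrier M. \<forall>m'\<in>carrier M. f m = f m' \<longrightarrow>
     (\<exists>k\<in>carrier M. \<exists>k'\<in>carrier M. f k = \<zero>\<^bsub>N\<^esub> \<and> f k' = \<zero>\<^bsub>N\<^esub> \<and> m \<oplus>\<^bsub>M\<^esub> k = m' \<oplus>\<^bsub>M\<^esub> k'))"

definition uniform :: "('m, 'x) ring_scheme \<Rightarrow> ('n, 'y) ring_scheme \<Rightarrow> ('m \<Rightarrow> 'n) \<Rightarrow> bool" where
  "uniform M N f \<longleftrightarrow> i_uniform M N f \<and> k_uniform M N f"


section \<open>The natural tensor product\<close>

text \<open>
  The tensor product over \<open>R\<close> of a right \<open>R\<close>-semimodule \<open>M\<close> (action \<open>rm\<close>) and a left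
  \<open>R\<close>-semimodule \<open>N\<close> (action \<open>ln\<close>): the free commutative monoid on
  \<open>carrier M \<times> carrier N\<close>, that is, finite multisets of pairs, modulo the least congruence that makes
  \<open>(m, n) \<mapsto> m \<otimes> n\<close> biadditive (zeros included) and balanced. The relations for zeros are
  not consequences of the others: without them \<open>0 \<otimes> 0\<close> would only be an idempotent, and \<open>R\<close> would
  not be a unit for the tensor product.
\<close>

type_synonym ('m, 'n) tens = "('m \<times> 'n) multiset set"

inductive tensor_cong ::
  "('r, 'x) ring_scheme \<Rightarrow> ('m, 'y) ring_scheme \<Rightarrow> ('m \<Rightarrow> 'r \<Rightarrow> 'm) \<Rightarrow>
   ('n, 'z) ring_scheme \<Rightarrow> ('r \<Rightarrow> 'n \<Rightarrow> 'n) \<Rightarrow>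
   ('m \<times> 'n) multiset \<Rightarrow> ('m \<times> 'n) multiset \<Rightarrow> bool"
  for R M rm N ln where
  refl: "set_mset X \<subseteq> carrier M \<times> carrier N \<Longrightarrow> tensor_cong R M rm N ln X X"
| sym: "tensor_cong R M rm N ln X Y \<Longrightarrow> tensor_cong R M rm N ln Y X"
| trans: "\<lbrakk>tensor_cong R M rm N ln X Y; tensor_cong R M rm N ln Y Z\<rbrakk> \<Longrightarrow> tensor_cong R M rm N ln X Z"
| add: "\<lbrakk>tensor_cong R M rm N ln X Y; tensor_cong R M rm N ln X' Y'\<rbrakk> \<Longrightarrow>
    tensor_cong R M rm N ln (X + X') (Y + Y')"
| left_add: "\<lbrakk>m \<in> carrier M; m' \<in> carrier M; n \<in> carrier N\<rbrakk> \<Longrightarrow>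
    tensor_cong R M rm N ln {#(m \<oplus>\<^bsub>M\<^esub> m', n)#} {#(m, n), (m', n)#}"
| right_add: "\<lbrakk>m \<in> carrier M; n \<in> carrier N; n' \<in> carrier N\<rbrakk> \<Longrightarrow>
    tensor_cong R M rm N ln {#(m, n \<oplus>\<^bsub>N\<^esub> n')#} {#(m, n), (m, n')#}"
| left_zero: "n \<in> carrier N \<Longrightarrow> tensor_cong R M rm N ln {#(\<zero>\<^bsub>M\<^esub>, n)#} {#}"
| right_zero: "m \<in> carrier M \<Longrightarrow> tensor_cong R M rm N ln {#(m, \<zero>\<^bsub>N\<^esub>)#} {#}"
| balanced: "\<lbrakk>m \<in> carrier M; r \<in> carrier R; n \<in> carrier N\<rbrakk> \<Longrightarrow>
    tensor_cong R M rm N ln {#(rm m r, n)#} {#(m, ln r n)#}"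

definition tensor_class ::
  "('r, 'x) ring_scheme \<Rightarrow> ('m, 'y) ring_scheme \<Rightarrow> ('m \<Rightarrow> 'r \<Rightarrow> 'm) \<Rightarrow>
   ('n, 'z) ring_scheme \<Rightarrow> ('r \<Rightarrow> 'n \<Rightarrow> 'n) \<Rightarrow> ('m \<times> 'n) multiset \<Rightarrow> ('m, 'n) tens"
  where "tensor_class R M rm N ln X = {Y. tensor_cong R M rm N ln X Y}"

definition tensor_rep :: "('m, 'n) tens \<Rightarrow> ('m \<times> 'n) multiset" where
  "tensor_rep x = (SOME X. X \<in> x)"

definition tensor ::
  "('r, 'x) ring_scheme \<Rightarrow> ('m, 'y) ring_scheme \<Rightarrow> ('m \<Rightarrow> 'r \<Rightarrow> 'm) \<Rightarrow>
   ('n, 'z) ring_scheme \<Rightarrow> ('r \<Rightarrow> 'n \<Rightarrow> 'n) \<Rightarrow> ('m, 'n) tens ring"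
  where "tensor R M rm N ln =
    \<lparr>carrier = tensor_class R M rm N ln ` {X. set_mset X \<subseteq> carrier M \<times> carrier N},
     mult = undefined, one = undefined,
     zero = tensor_class R M rm N ln {#},
     add = (\<lambda>x y. tensor_class R M rm N ln (tensor_rep x + tensor_rep y))\<rparr>"

definition msum :: "('z, 'x) ring_scheme \<Rightarrow> 'z multiset \<Rightarrow> 'z" where
  "msum Z X = (\<Oplus>\<^bsub>Z\<^esub>z\<in>set_mset X. [count X z] \<cdot>\<^bsub>Z\<^esub> z)"

text \<open>
  \<open>tensor_lift Z h (\<Sum> m\<^sub>i \<otimes> n\<^sub>i) = \<Sum> h m\<^sub>i n\<^sub>i\<close> in \<open>Z\<close>. It is only applied to biadditive balanced maps \<open>h\<close>,
  for which the sum does not depend on the chosen representative. A Sweedler sum such as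
  \<open>\<Sum> h c\<^sub>1 c\<^sub>2\<close> is written \<open>tensor_lift Z (\<lambda>c1 c2. h c1 c2) (comult C c)\<close>.
\<close>

definition tensor_lift ::
  "('z, 'x) ring_scheme \<Rightarrow> ('m \<Rightarrow> 'n \<Rightarrow> 'z) \<Rightarrow> ('m, 'n) tens \<Rightarrow> 'z"
  where "tensor_lift Z h x = msum Z (image_mset (\<lambda>(m, n). h m n) (tensor_rep x))"

definition pure_tensor ::
  "('s, 'x) ring_scheme \<Rightarrow> ('s, 'm, 'y) module_scheme \<Rightarrow> ('s, 'n, 'z) module_scheme \<Rightarrow>
   'm \<Rightarrow> 'n \<Rightarrow> ('m, 'n) tens"
  where "pure_tensor S M N m n =
    tensor_class S M (\<lambda>m s. s \<odot>\<^bsub>M\<^esub> m) N (\<lambda>s n. s \<odot>\<^bsub>N\<^esub> n) {#(m, n)#}"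

text \<open>
  \<open>M \<otimes>\<^sub>S N\<close>. The fields \<open>mult\<close> and \<open>one\<close> hold the usual product of the tensor product of two
  \<open>S\<close>-semialgebras, and are meaningless otherwise.
\<close>

definition stensor ::
  "('s, 'x) ring_scheme \<Rightarrow> ('s, 'm, 'y) module_scheme \<Rightarrow> ('s, 'n, 'z) module_scheme \<Rightarrow>
   ('s, ('m, 'n) tens) module"
  where "stensor S M N =
    (let T = tensor S M (\<lambda>m s. s \<odot>\<^bsub>M\<^esub> m) N (\<lambda>s n. s \<odot>\<^bsub>N\<^esub> n) in
     \<lparr>carrier = carrier T,
      mult = (\<lambda>x y. tensor_lift T (\<lambda>m n. tensor_lift T (\<lambda>m' n'.
                pure_tensor S M N (m \<otimes>\<^bsub>M\<^esub> m') (n \<otimes>\<^bsub>N\<^esub> n')) y) x),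
      one = pure_tensor S M N \<one>\<^bsub>M\<^esub> \<one>\<^bsub>N\<^esub>,
      zero = \<zero>\<^bsub>T\<^esub>,
      add = add T,
      smult = (\<lambda>s. tensor_lift T (\<lambda>m n. pure_tensor S M N (s \<odot>\<^bsub>M\<^esub> m) n))\<rparr>)"


section \<open>Semialgebras, semicoalgebras, semicomodules\<close>

definition scalars :: "('s, 'x) ring_scheme \<Rightarrow> ('s, 's) module" where
  "scalars S = \<lparr>carrier = carrier S, mult = mult S, one = \<one>\<^bsub>S\<^esub>, zero = \<zero>\<^bsub>S\<^esub>, add = add S,
     smult = mult S\<rparr>"

definition semialgebra :: "('s, 'x) ring_scheme \<Rightarrow> ('s, 'a, 'y) module_scheme \<Rightarrow> bool" where
  "semialgebra S A \<longleftrightarrow> semiring A \<and> semimodule S A \<and>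
     (\<forall>s\<in>carrier S. \<forall>a\<in>carrier A. \<forall>a'\<in>carrier A.
        s \<odot>\<^bsub>A\<^esub> (a \<otimes>\<^bsub>A\<^esub> a') = (s \<odot>\<^bsub>A\<^esub> a) \<otimes>\<^bsub>A\<^esub> a' \<and>
        s \<odot>\<^bsub>A\<^esub> (a \<otimes>\<^bsub>A\<^esub> a') = a \<otimes>\<^bsub>A\<^esub> (s \<odot>\<^bsub>A\<^esub> a'))"

text \<open>The record is used for semicoalgebras (ignoring \<open>mult\<close>, \<open>one\<close>) and for bisemialgebras.\<close>

record ('s, 'c) coalgebra = "('s, 'c) module" +
  comult :: "'c \<Rightarrow> ('c, 'c) tens"
  counit :: "'c \<Rightarrow> 's"

text \<open>Coassociativity is stated in \<open>(M \<otimes>\<^sub>S C) \<otimes>\<^sub>S C\<close>, after composing \<open>id \<otimes> comult\<close> with the associator.\<close>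

definition coassociative ::
  "('s, 'x) ring_scheme \<Rightarrow> ('s, 'm, 'y) module_scheme \<Rightarrow> ('s, 'c, 'z) coalgebra_scheme \<Rightarrow>
   ('m \<Rightarrow> ('m, 'c) tens) \<Rightarrow> bool"
  where "coassociative S M C \<rho> \<longleftrightarrow>
    (let MC = stensor S M C; MCC = stensor S MC C in
     \<forall>m\<in>carrier M.
       tensor_lift MCC (\<lambda>m0 m1. pure_tensor S MC C (\<rho> m0) m1) (\<rho> m) =
       tensor_lift MCC (\<lambda>m0 m1. tensor_lift MCC (\<lambda>c1 c2.
         pure_tensor S MC C (pure_tensor S M C m0 c1) c2) (comult C m1)) (\<rho> m))"

definition semicoalgebra :: "('s, 'x) ring_scheme \<Rightarrow> ('s, 'c, 'z) coalgebra_scheme \<Rightarrow> bool" where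
  "semicoalgebra S C \<longleftrightarrow> semimodule S C \<and>
     left_linear S C (stensor S C C) (comult C) \<and>
     left_linear S C (scalars S) (counit C) \<and>
     coassociative S C C (comult C) \<and>
     (\<forall>c\<in>carrier C. tensor_lift C (\<lambda>c1 c2. counit C c1 \<odot>\<^bsub>C\<^esub> c2) (comult C c) = c \<and>
                    tensor_lift C (\<lambda>c1 c2. counit C c2 \<odot>\<^bsub>C\<^esub> c1) (comult C c) = c)"

definition bisemialgebra :: "('s, 'x) ring_scheme \<Rightarrow> ('s, 'b, 'z) coalgebra_scheme \<Rightarrow> bool" where
  "bisemialgebra S B \<longleftrightarrow> semialgebra S B \<and> semicoalgebra S B \<and>
     comult B \<in> ring_hom B (stensor S B B) \<and> counit B \<in> ring_hom B S"

definition right_semicomodule ::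
  "('s, 'x) ring_scheme \<Rightarrow> ('s, 'c, 'z) coalgebra_scheme \<Rightarrow> ('s, 'm, 'y) module_scheme \<Rightarrow>
   ('m \<Rightarrow> ('m, 'c) tens) \<Rightarrow> bool"
  where "right_semicomodule S C M \<rho> \<longleftrightarrow> semimodule S M \<and>
     left_linear S M (stensor S M C) \<rho> \<and>
     coassociative S M C \<rho> \<and>
     (\<forall>m\<in>carrier M. tensor_lift M (\<lambda>m0 m1. counit C m1 \<odot>\<^bsub>M\<^esub> m0) (\<rho> m) = m)"

definition semicomodule_semialgebra ::
  "('s, 'x) ring_scheme \<Rightarrow> ('s, 'b, 'z) coalgebra_scheme \<Rightarrow> ('s, 'a, 'y) module_scheme \<Rightarrow>
   ('a \<Rightarrow> ('a, 'b) tens) \<Rightarrow> bool"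
  where "semicomodule_semialgebra S B A \<rho> \<longleftrightarrow> semialgebra S A \<and> right_semicomodule S B A \<rho> \<and>
     \<rho> \<in> ring_hom A (stensor S A B)"

text \<open>The action of \<open>B\<close> is \<open>S\<close>-bilinear: \<open>C\<close> is a \<open>B\<close>-semimodule in the category of \<open>S\<close>-semimodules.\<close>

definition semimodule_semicoalgebra ::
  "('s, 'x) ring_scheme \<Rightarrow> ('s, 'b, 'z) coalgebra_scheme \<Rightarrow> ('s, 'c, 'y) coalgebra_scheme \<Rightarrow>
   ('c \<Rightarrow> 'b \<Rightarrow> 'c) \<Rightarrow> bool"
  where "semimodule_semicoalgebra S B C act \<longleftrightarrow> semicoalgebra S C \<and>
     right_semimodule B \<lparr>carrier = carrier C, mult = undefined, one = undefined,
       zero = \<zero>\<^bsub>C\<^esub>, add = add C, ract = act\<rparr> \<and>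
     (\<forall>s\<in>carrier S. \<forall>c\<in>carrier C. \<forall>b\<in>carrier B.
        act (s \<odot>\<^bsub>C\<^esub> c) b = s \<odot>\<^bsub>C\<^esub> act c b \<and> act c (s \<odot>\<^bsub>B\<^esub> b) = s \<odot>\<^bsub>C\<^esub> act c b) \<and>
     (\<forall>c\<in>carrier C. \<forall>b\<in>carrier B.
        comult C (act c b) =
          tensor_lift (stensor S C C) (\<lambda>c1 c2. tensor_lift (stensor S C C) (\<lambda>b1 b2.
            pure_tensor S C C (act c1 b1) (act c2 b2)) (comult B b)) (comult C c) \<and>
        counit C (act c b) = counit C c \<otimes>\<^bsub>S\<^esub> counit B b)"


section \<open>Categories\<close>

record ('o, 'f) cat =
  Obj :: "'o set"
  Hom :: "'o \<Rightarrow> 'o \<Rightarrow> 'f set"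
  Comp :: "'o \<Rightarrow> 'o \<Rightarrow> 'o \<Rightarrow> 'f \<Rightarrow> 'f \<Rightarrow> 'f"  \<comment> \<open>\<open>Comp X Y Z g f\<close> is \<open>X \<rightarrow> Y \<rightarrow> Z\<close>\<close>
  Ide :: "'o \<Rightarrow> 'f"

locale category =
  fixes C :: "('o, 'f) cat"
  assumes ide_in_hom: "X \<in> Obj C \<Longrightarrow> Ide C X \<in> Hom C X X"
    and comp_in_hom: "\<lbrakk>X \<in> Obj C; Y \<in> Obj C; Z \<in> Obj C; f \<in> Hom C X Y; g \<in> Hom C Y Z\<rbrakk> \<Longrightarrow>
      Comp C X Y Z g f \<in> Hom C X Z"
    and comp_ide: "\<lbrakk>X \<in> Obj C; Y \<in> Obj C; f \<in> Hom C X Y\<rbrakk> \<Longrightarrow> Comp C X X Y f (Ide C X) = f"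
    and ide_comp: "\<lbrakk>X \<in> Obj C; Y \<in> Obj C; f \<in> Hom C X Y\<rbrakk> \<Longrightarrow> Comp C X Y Y (Ide C Y) f = f"
    and comp_assoc: "\<lbrakk>W \<in> Obj C; X \<in> Obj C; Y \<in> Obj C; Z \<in> Obj C;
      f \<in> Hom C W X; g \<in> Hom C X Y; h \<in> Hom C Y Z\<rbrakk> \<Longrightarrow>
      Comp C W Y Z h (Comp C W X Y g f) = Comp C W X Z (Comp C X Y Z h g) f"

locale cat_functor = C: category C + D: category D
  for C :: "('o, 'f) cat" and D :: "('p, 'g) cat" +
  fixes Fo :: "'o \<Rightarrow> 'p" and Fm :: "'o \<Rightarrow> 'o \<Rightarrow> 'f \<Rightarrow> 'g"
  assumes map_obj: "X \<in> Obj C \<Longrightarrow> Fo X \<in> Obj D"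
    and map_hom: "\<lbrakk>X \<in> Obj C; Y \<in> Obj C; f \<in> Hom C X Y\<rbrakk> \<Longrightarrow> Fm X Y f \<in> Hom D (Fo X) (Fo Y)"
    and map_ide: "X \<in> Obj C \<Longrightarrow> Fm X X (Ide C X) = Ide D (Fo X)"
    and map_comp: "\<lbrakk>X \<in> Obj C; Y \<in> Obj C; Z \<in> Obj C; f \<in> Hom C X Y; g \<in> Hom C Y Z\<rbrakk> \<Longrightarrow>
      Fm X Z (Comp C X Y Z g f) = Comp D (Fo X) (Fo Y) (Fo Z) (Fm Y Z g) (Fm X Y f)"

definition isomorphic_categories :: "('o, 'f) cat \<Rightarrow> ('p, 'g) cat \<Rightarrow> bool" where
  "isomorphic_categories C D \<longleftrightarrow>
    (\<exists>Fo Fm Go Gm. cat_functor C D Fo Fm \<and> cat_functor D C Go Gm \<and>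
      (\<forall>X\<in>Obj C. Go (Fo X) = X) \<and>
      (\<forall>X\<in>Obj C. \<forall>Y\<in>Obj C. \<forall>f\<in>Hom C X Y. Gm (Fo X) (Fo Y) (Fm X Y f) = f) \<and>
      (\<forall>X\<in>Obj D. Fo (Go X) = X) \<and>
      (\<forall>X\<in>Obj D. \<forall>Y\<in>Obj D. \<forall>g\<in>Hom D X Y. Fm (Go X) (Go Y) (Gm X Y g) = g))"

definition full_subcategory :: "('o, 'f) cat \<Rightarrow> 'o set \<Rightarrow> ('o, 'f) cat" where
  "full_subcategory C K = C\<lparr>Obj := Obj C \<inter> K\<rparr>"

text \<open>
  Objects of the categories below have their carriers in a fixed type, and their operations are
  \<open>undefined\<close> outside the carriers (and in the meaningless fields), so that equality of records is
  equality of the structures. Likewise morphisms are extensional functions.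
\<close>

definition canonical_rmodule :: "('r, 'x) ring_scheme \<Rightarrow> ('m, 'r, 'y) rmodule_scheme \<Rightarrow> bool" where
  "canonical_rmodule R M \<longleftrightarrow>
     (\<lambda>(m, m'). m \<oplus>\<^bsub>M\<^esub> m') \<in> extensional (carrier M \<times> carrier M) \<and>
     (\<lambda>(m, r). m \<star>\<^bsub>M\<^esub> r) \<in> extensional (carrier M \<times> carrier R) \<and>
     mult M = (\<lambda>_ _. undefined) \<and> \<one>\<^bsub>M\<^esub> = undefined"

definition rmodule_cat :: "('r, 'x) ring_scheme \<Rightarrow> (('u, 'r) rmodule, 'u \<Rightarrow> 'u) cat" where
  "rmodule_cat R =
    \<lparr>Obj = {M. right_semimodule R M \<and> canonical_rmodule R M},
     Hom = (\<lambda>M N. {f \<in> extensional (carrier M). right_linear R M N f}),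
     Comp = (\<lambda>L M N g f. compose (carrier L) g f),
     Ide = (\<lambda>M. \<lambda>m\<in>carrier M. m)\<rparr>"

definition rmodule_iso ::
  "('r, 'x) ring_scheme \<Rightarrow> ('m, 'r, 'y) rmodule_scheme \<Rightarrow> ('n, 'r, 'z) rmodule_scheme \<Rightarrow> bool" where
  "rmodule_iso R M N \<longleftrightarrow> (\<exists>f. right_linear R M N f \<and> bij_betw f (carrier M) (carrier N))"

definition direct_sum :: "'i set \<Rightarrow> ('i \<Rightarrow> ('m, 'r) rmodule) \<Rightarrow> ('i \<Rightarrow> 'm, 'r) rmodule" where
  "direct_sum I M =
    \<lparr>carrier = {x \<in> \<Pi>\<^sub>E i\<in>I. carrier (M i). finite {i \<in> I. x i \<noteq> \<zero>\<^bsub>M i\<^esub>}},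
     mult = undefined, one = undefined,
     zero = (\<lambda>i\<in>I. \<zero>\<^bsub>M i\<^esub>),
     add = (\<lambda>x y. \<lambda>i\<in>I. x i \<oplus>\<^bsub>M i\<^esub> y i),
     ract = (\<lambda>x r. \<lambda>i\<in>I. x i \<star>\<^bsub>M i\<^esub> r)\<rparr>"

definition subsemimodule ::
  "('r, 'x) ring_scheme \<Rightarrow> ('m, 'r, 'y) rmodule_scheme \<Rightarrow> ('m, 'r, 'z) rmodule_scheme \<Rightarrow> bool" where
  "subsemimodule R N M \<longleftrightarrow> carrier N \<subseteq> carrier M \<and> \<zero>\<^bsub>N\<^esub> = \<zero>\<^bsub>M\<^esub> \<and>
     (\<forall>n\<in>carrier N. \<forall>n'\<in>carrier N. n \<oplus>\<^bsub>N\<^esub> n' = n \<oplus>\<^bsub>M\<^esub> n') \<and>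
     (\<forall>n\<in>carrier N. \<forall>r\<in>carrier R. n \<star>\<^bsub>N\<^esub> r = n \<star>\<^bsub>M\<^esub> r)"

text \<open>
  \<open>\<sigma>[X]\<close> inside the category of right \<open>R\<close>-semimodules with carriers in \<open>'u\<close>; \<open>X\<close> and the direct
  sums live on other types and are represented by their isomorphic copies on \<open>'u\<close>. Index sets in
  \<open>'u\<close> suffice, as a direct sum with a copy on \<open>'u\<close> has at most as many nonzero summands.
\<close>

definition sigma_closed ::
  "('r, 'x) ring_scheme \<Rightarrow> ('m, 'r) rmodule \<Rightarrow> ('u, 'r) rmodule set \<Rightarrow> bool" where
  "sigma_closed R X K \<longleftrightarrow> K \<subseteq> Obj (rmodule_cat R) \<and>
     (\<forall>N\<in>Obj (rmodule_cat R). rmodule_iso R X N \<longrightarrow> N \<in> K) \<and>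
     (\<forall>(I :: 'u set) M. \<forall>N\<in>Obj (rmodule_cat R).
        (\<forall>i\<in>I. M i \<in> K) \<and> rmodule_iso R (direct_sum I M) N \<longrightarrow> N \<in> K) \<and>
     (\<forall>M\<in>K. \<forall>N\<in>Obj (rmodule_cat R). \<forall>f.
        right_linear R M N f \<and> f ` carrier M = carrier N \<longrightarrow> N \<in> K) \<and>
     (\<forall>M\<in>K. \<forall>N\<in>Obj (rmodule_cat R). subsemimodule R N M \<longrightarrow> N \<in> K)"

definition sigma_cat ::
  "('r, 'x) ring_scheme \<Rightarrow> ('m, 'r) rmodule \<Rightarrow> (('u, 'r) rmodule, 'u \<Rightarrow> 'u) cat" where
  "sigma_cat R X = full_subcategory (rmodule_cat R) (\<Inter> {K. sigma_closed R X K})"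


section \<open>Doi-Koppinen structures\<close>

locale doi_koppinen_data =
  fixes S :: "'s ring"
    and B :: "('s, 'b) coalgebra"
    and A :: "('s, 'a) module"
    and \<rho>A :: "'a \<Rightarrow> ('a, 'b) tens"
    and C :: "('s, 'c) coalgebra"
    and actC :: "'c \<Rightarrow> 'b \<Rightarrow> 'c"
begin

text \<open>A right \<open>A\<close>-semimodule as an \<open>S\<close>-semimodule: \<open>s\<close> acts as \<open>s 1\<^sub>A\<close>.\<close>

definition over_S :: "('m, 'a, 'y) rmodule_scheme \<Rightarrow> ('s, 'm) module" where
  "over_S M = \<lparr>carrier = carrier M, mult = undefined, one = undefined, zero = \<zero>\<^bsub>M\<^esub>, add = add M,
     smult = (\<lambda>s m. m \<star>\<^bsub>M\<^esub> (s \<odot>\<^bsub>A\<^esub> \<one>\<^bsub>A\<^esub>))\<rparr>"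

definition dual :: "('s, 'c \<Rightarrow> 's) module" where
  "dual =
    \<lparr>carrier = {f \<in> extensional (carrier C). left_linear S C (scalars S) f},
     mult = (\<lambda>f g. \<lambda>c\<in>carrier C. tensor_lift S (\<lambda>c1 c2. f c1 \<otimes>\<^bsub>S\<^esub> g c2) (comult C c)),
     one = (\<lambda>c\<in>carrier C. counit C c),
     zero = (\<lambda>c\<in>carrier C. \<zero>\<^bsub>S\<^esub>),
     add = (\<lambda>f g. \<lambda>c\<in>carrier C. f c \<oplus>\<^bsub>S\<^esub> g c),
     smult = (\<lambda>s f. \<lambda>c\<in>carrier C. s \<otimes>\<^bsub>S\<^esub> f c)\<rparr>"

definition dual_act :: "'b \<Rightarrow> ('c \<Rightarrow> 's) \<Rightarrow> ('c \<Rightarrow> 's)" where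
  "dual_act b f = (\<lambda>c\<in>carrier C. f (actC c b))"

abbreviation hash :: "'a \<Rightarrow> ('c \<Rightarrow> 's) \<Rightarrow> ('a, 'c \<Rightarrow> 's) tens" where
  "hash \<equiv> pure_tensor S A dual"

text \<open>\<open>smash\<close> is \<open>A #\<^sup>o\<^sup>p C\<^sup>*\<close>: \<open>(a # f) (b # g) = \<Sum> a\<^sub><\<^sub>0\<^sub>> b # (a\<^sub><\<^sub>1\<^sub>> g) * f\<close>.\<close>

definition smash :: "('s, ('a, 'c \<Rightarrow> 's) tens) module" where
  "smash = (stensor S A dual)
    \<lparr>mult := (\<lambda>x y. tensor_lift (stensor S A dual) (\<lambda>a f. tensor_lift (stensor S A dual) (\<lambda>b g.
        tensor_lift (stensor S A dual) (\<lambda>a0 a1.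
          hash (a0 \<otimes>\<^bsub>A\<^esub> b) (dual_act a1 g \<otimes>\<^bsub>dual\<^esub> f)) (\<rho>A a)) y) x),
     one := hash \<one>\<^bsub>A\<^esub> \<one>\<^bsub>dual\<^esub>\<rparr>"

definition smash_over_A :: "(('a, 'c \<Rightarrow> 's) tens, 'a) rmodule" where
  "smash_over_A =
    \<lparr>carrier = carrier smash, mult = undefined, one = undefined, zero = \<zero>\<^bsub>smash\<^esub>, add = add smash,
     ract = (\<lambda>x b. tensor_lift smash (\<lambda>a f. hash (a \<otimes>\<^bsub>A\<^esub> b) f) x)\<rparr>"

text \<open>
  The two structures on \<open>\<C> = A \<otimes>\<^sub>S C\<close> that are used: \<open>coring\<close> is the left \<open>A\<close>-semimodule, needed for
  \<open>M \<otimes>\<^sub>A \<C>\<close>, and \<open>coring_smash\<close> is the right \<open>A #\<^sup>o\<^sup>p C\<^sup>*\<close>-semimodule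
  \<open>(a \<otimes> c) (b # g) = \<Sum> a b\<^sub><\<^sub>0\<^sub>> \<otimes> c\<^sub>1 b\<^sub><\<^sub>1\<^sub>> g(c\<^sub>2)\<close>.
\<close>

definition coring :: "('a, ('a, 'c) tens) module" where
  "coring = (let AC = stensor S A C in
    \<lparr>carrier = carrier AC, mult = undefined, one = undefined, zero = \<zero>\<^bsub>AC\<^esub>, add = add AC,
     smult = (\<lambda>b. tensor_lift AC (\<lambda>a c. pure_tensor S A C (b \<otimes>\<^bsub>A\<^esub> a) c))\<rparr>)"

definition coring_smash :: "(('a, 'c) tens, ('a, 'c \<Rightarrow> 's) tens) rmodule" where
  "coring_smash = (let AC = stensor S A C in
    \<lparr>carrier = carrier AC, mult = undefined, one = undefined, zero = \<zero>\<^bsub>AC\<^esub>, add = add AC,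
     ract = (\<lambda>x t. tensor_lift AC (\<lambda>a c. tensor_lift AC (\<lambda>b g.
       tensor_lift AC (\<lambda>b0 b1. tensor_lift AC (\<lambda>c1 c2.
         pure_tensor S A C (a \<otimes>\<^bsub>A\<^esub> b0) (g c2 \<odot>\<^bsub>C\<^esub> actC c1 b1))
       (comult C c)) (\<rho>A b)) t) x)\<rparr>)"

definition tensor_coring :: "('m, 'a, 'y) rmodule_scheme \<Rightarrow> ('m, ('a, 'c) tens) tens ring" where
  "tensor_coring M = tensor A M (\<lambda>m a. m \<star>\<^bsub>M\<^esub> a) coring (\<lambda>a x. a \<odot>\<^bsub>coring\<^esub> x)"

definition alpha ::
  "('m, 'a, 'y) rmodule_scheme \<Rightarrow> ('m, ('a, 'c) tens) tens \<Rightarrow> (('a, 'c \<Rightarrow> 's) tens \<Rightarrow> 'm)" where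
  "alpha M x = (\<lambda>t\<in>carrier smash. tensor_lift M (\<lambda>m y. tensor_lift M (\<lambda>b c. tensor_lift M (\<lambda>a f.
      f c \<odot>\<^bsub>over_S M\<^esub> (m \<star>\<^bsub>M\<^esub> b \<star>\<^bsub>M\<^esub> a)) t) y) x)"

text \<open>
  The type \<open>'u\<close> is the universe: it carries the right \<open>A\<close>-semimodules ranged over here and the
  objects of \<open>rat_cat\<close>, \<open>dk_cat\<close> and \<open>sigma_cat\<close>.
\<close>

definition alpha_condition :: "'u itself \<Rightarrow> bool" where
  "alpha_condition _ \<longleftrightarrow> (\<forall>M :: ('u, 'a) rmodule. right_semimodule A M \<longrightarrow>
     inj_on (alpha M) (carrier (tensor_coring M)) \<and>
     uniform (tensor_coring M) (right_hom A smash_over_A M) (alpha M))"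

definition over_A :: "('m, ('a, 'c \<Rightarrow> 's) tens, 'y) rmodule_scheme \<Rightarrow> ('m, 'a) rmodule" where
  "over_A M = \<lparr>carrier = carrier M, mult = undefined, one = undefined, zero = \<zero>\<^bsub>M\<^esub>, add = add M,
     ract = (\<lambda>m a. m \<star>\<^bsub>M\<^esub> hash a \<one>\<^bsub>dual\<^esub>)\<rparr>"

definition Rat :: "('m, ('a, 'c \<Rightarrow> 's) tens, 'y) rmodule_scheme \<Rightarrow> 'm set" where
  "Rat M = {m \<in> carrier M.
     (\<lambda>t\<in>carrier smash. m \<star>\<^bsub>M\<^esub> t) \<in> alpha (over_A M) ` carrier (tensor_coring (over_A M))}"

definition rat_cat :: "(('u, ('a, 'c \<Rightarrow> 's) tens) rmodule, 'u \<Rightarrow> 'u) cat" where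
  "rat_cat = full_subcategory (rmodule_cat smash) {M. Rat M = carrier M}"

end

record ('m, 'a, 'c) dk_module = "('m, 'a) rmodule" +
  coact :: "'m \<Rightarrow> ('m, 'c) tens"

context doi_koppinen_data
begin

definition doi_koppinen_semimodule :: "('m, 'a, 'c, 'y) dk_module_scheme \<Rightarrow> bool" where
  "doi_koppinen_semimodule M \<longleftrightarrow>
    right_semimodule A M \<and> right_semicomodule S C (over_S M) (coact M) \<and>
    (let MC = stensor S (over_S M) C in
     \<forall>m\<in>carrier M. \<forall>a\<in>carrier A. coact M (m \<star>\<^bsub>M\<^esub> a) =
       tensor_lift MC (\<lambda>m0 m1. tensor_lift MC (\<lambda>a0 a1.
         pure_tensor S (over_S M) C (m0 \<star>\<^bsub>M\<^esub> a0) (actC m1 a1)) (\<rho>A a)) (coact M m))"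

definition colinear ::
  "('m, 'a, 'c, 'y) dk_module_scheme \<Rightarrow> ('n, 'a, 'c, 'z) dk_module_scheme \<Rightarrow> ('m \<Rightarrow> 'n) \<Rightarrow> bool" where
  "colinear M N f \<longleftrightarrow> (\<forall>m\<in>carrier M. coact N (f m) =
     tensor_lift (stensor S (over_S N) C)
       (\<lambda>m0 m1. pure_tensor S (over_S N) C (f m0) m1) (coact M m))"

definition dk_cat :: "(('u, 'a, 'c) dk_module, 'u \<Rightarrow> 'u) cat" where
  "dk_cat =
    \<lparr>Obj = {M. doi_koppinen_semimodule M \<and> canonical_rmodule A M \<and> coact M \<in> extensional (carrier M)},
     Hom = (\<lambda>M N. {f \<in> extensional (carrier M). right_linear A M N f \<and> colinear M N f}),
     Comp = (\<lambda>L M N g f. compose (carrier L) g f),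
     Ide = (\<lambda>M. \<lambda>m\<in>carrier M. m)\<rparr>"

end

locale doi_koppinen = doi_koppinen_data S B A \<rho>A C actC
  for S :: "'s ring"
    and B :: "('s, 'b) coalgebra"
    and A :: "('s, 'a) module"
    and \<rho>A :: "'a \<Rightarrow> ('a, 'b) tens"
    and C :: "('s, 'c) coalgebra"
    and actC :: "'c \<Rightarrow> 'b \<Rightarrow> 'c" +
  assumes bisemialgebra: "bisemialgebra S B"
    and semicomodule_semialgebra: "semicomodule_semialgebra S B A \<rho>A"
    and semimodule_semicoalgebra: "semimodule_semicoalgebra S B C actC"

end

theory Submission
  imports Defs
begin

text \<open>The canonical isomorphism \<open>M \<otimes>\<^sub>A (A \<otimes>\<^sub>S C) \<cong> M \<otimes>\<^sub>S C\<close> turns \<open>\<alpha>\<close> into the pairing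
  \<open>m \<otimes> c \<mapsto> [a # f \<mapsto> f(c) m a]\<close>. A Doi-Koppinen semimodule is rational for
  \<open>m (a # f) = \<Sum> f(m\<^sub>1) m\<^sub>0 a\<close>. Conversely, injectivity of the pairing assigns to a rational element
  \<open>m\<close> a unique tensor \<open>\<rho>(m)\<close>, and identities such as coassociativity hold because both sides agree
  after pairing twice. Rational semimodules are closed under subsemimodules \<open>N \<subseteq> M\<close>: the coaction of
  an element of \<open>N\<close> dies in \<open>(M / N) \<otimes>\<^sub>S C\<close>, where \<open>M / N\<close> is the Bourne quotient; since
  \<open>- \<otimes>\<^sub>S C\<close> preserves cokernels it lies in the subtractive closure of the image of \<open>N \<otimes>\<^sub>S C\<close>, and
  \<open>i\<close>-uniformity of the pairing for \<open>N\<close> removes the closure. Finally a rational \<open>M\<close> embeds through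
  its coaction into \<open>M \<otimes>\<^sub>S C\<close>, which is an image of a direct sum of copies of \<open>A \<otimes>\<^sub>S C\<close>.\<close>

subsection \<open>Multiset sums in an abelian monoid\<close>

text \<open>The \<alpha>-condition speaks only of semimodules carried by \<open>'u\<close>, but
  coassociativity is an equation in \<open>(M \<otimes> C) \<otimes> C\<close> and closure under
  subobjects concerns a quotient of \<open>M\<close>; both live on other types. Injectivity of the
  pairing is therefore extended to every semimodule whose carrier embeds into \<open>'u\<close>;
  since \<open>'u\<close> is infinite and bounds \<open>A\<close> and \<open>C\<close>, the tensor
  products and direct sums that occur stay within that bound. \<open>M \<otimes> C\<close> carries
  two different A-actions. The one on \<open>M\<close> alone (\<open>triv\<close>) leaves the second
  factor untouched and allows the pairing to be iterated, which gives coassociativity. The diagonal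
  one through \<open>\<rho>A\<close> belongs to the smash product semimodule
  \<open>smash_tensor\<close>, into which a rational semimodule embeds. Since an isomorphism of
  categories is claimed, not an equivalence, the two constructions must be inverse to each other as
  records, including their values off the carriers. All Sweedler calculations are equations between
  maps linear in each variable, tested on pure tensors.\<close>

context abelian_monoid
begin

lemma msum_superset:
  assumes "finite F" "set_mset X \<subseteq> F" "F \<subseteq> carrier G"
  shows "msum G X = (\<Oplus>z\<in>F. [count X z] \<cdot> z)"
  unfolding msum_def
  by (rule add.finprod_mono_neutral_cong_left)
    (use assms in \<open>auto simp: not_in_iff\<close>)

lemma msum_empty [simp]: "msum G {#} = \<zero>"
  by (simp add: msum_def)

lemma msum_single [simp]: "z \<in> carrier G \<Longrightarrow> msum G {#z#} = z"
  by (simp add: msum_def)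

lemma msum_closed [intro, simp]: "set_mset X \<subseteq> carrier G \<Longrightarrow> msum G X \<in> carrier G"
  unfolding msum_def by (intro finsum_closed) auto

text \<open>Both sums are taken over the union of the supports; an element missing from one multiset
  has count 0 there and contributes nothing.\<close>

lemma msum_union:
  assumes "set_mset X \<subseteq> carrier G" "set_mset Y \<subseteq> carrier G"
  shows "msum G (X + Y) = msum G X \<oplus> msum G Y"
proof -
  let ?F = "set_mset X \<union> set_mset Y"
  have F: "finite ?F" "?F \<subseteq> carrier G"
    using assms by auto
  have "msum G (X + Y) = (\<Oplus>z\<in>?F. [(count X z + count Y z)] \<cdot> z)"
    by (subst msum_superset[of ?F]) (use F in auto)
  also have "\<dots> = (\<Oplus>z\<in>?F. [count X z] \<cdot> z \<oplus> [count Y z] \<cdot> z)"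
    by (rule finsum_cong') (use F in \<open>auto simp: add.nat_pow_mult\<close>)
  also have "\<dots> = (\<Oplus>z\<in>?F. [count X z] \<cdot> z) \<oplus> (\<Oplus>z\<in>?F. [count Y z] \<cdot> z)"
    by (rule finsum_addf) (use F in auto)
  also have "\<dots> = msum G X \<oplus> msum G Y"
    using msum_superset[of ?F X] msum_superset[of ?F Y] F by simp
  finally show ?thesis .
qed

lemma msum_add_mset:
  assumes "z \<in> carrier G" "set_mset X \<subseteq> carrier G"
  shows "msum G (add_mset z X) = z \<oplus> msum G X"
  using msum_union[of "{#z#}" X] assms by simp

lemma msum_zeros [simp]: "msum G (image_mset (\<lambda>x. \<zero>) X) = \<zero>"
  by (induction X) (simp_all add: msum_add_mset image_subset_iff)

lemma msum_addf:
  assumes "\<And>x. x \<in># X \<Longrightarrow> f x \<in> carrier G" "\<And>x. x \<in># X \<Longrightarrow> g x \<in> carrier G"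
  shows "msum G (image_mset (\<lambda>x. f x \<oplus> g x) X) = msum G (image_mset f X) \<oplus> msum G (image_mset g X)"
  using assms
proof (induction X)
  case (add x X)
  have "set_mset (image_mset f X) \<subseteq> carrier G" "set_mset (image_mset g X) \<subseteq> carrier G"
    "set_mset (image_mset (\<lambda>x. f x \<oplus> g x) X) \<subseteq> carrier G"
    using add.prems by auto
  with add show ?case
    by (simp add: msum_add_mset a_ac del: set_image_mset)
qed simp

lemma msum_swap:
  assumes "\<And>x y. x \<in># X \<Longrightarrow> y \<in># Y \<Longrightarrow> h x y \<in> carrier G"
  shows "msum G (image_mset (\<lambda>x. msum G (image_mset (h x) Y)) X)
       = msum G (image_mset (\<lambda>y. msum G (image_mset (\<lambda>x. h x y) X)) Y)"
  using assms
proof (induction X)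
  case (add x X)
  have c: "\<And>y. y \<in># Y \<Longrightarrow> msum G (image_mset (\<lambda>x. h x y) X) \<in> carrier G"
    "\<And>y. y \<in># Y \<Longrightarrow> h x y \<in> carrier G"
    using add.prems by (auto intro!: msum_closed)
  have "msum G (image_mset (\<lambda>x. msum G (image_mset (h x) Y)) (add_mset x X)) =
        msum G (image_mset (h x) Y) \<oplus> msum G (image_mset (\<lambda>x. msum G (image_mset (h x) Y)) X)"
    using add.prems by (simp add: msum_add_mset image_subset_iff)
  also have "\<dots> = msum G (image_mset (h x) Y) \<oplus> msum G (image_mset (\<lambda>y. msum G (image_mset (\<lambda>x. h x y) X)) Y)"
    using add by simp
  also have "\<dots> = msum G (image_mset (\<lambda>y. h x y \<oplus> msum G (image_mset (\<lambda>x. h x y) X)) Y)"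
    using c by (simp add: msum_addf)
  also have "\<dots> = msum G (image_mset (\<lambda>y. msum G (image_mset (\<lambda>x. h x y) (add_mset x X))) Y)"
    using add.prems by (intro arg_cong[of _ _ "msum G"] image_mset_cong) (simp add: msum_add_mset image_subset_iff)
  finally show ?case .
qed simp

end

lemma additive_map_closed: "additive_map M N f \<Longrightarrow> m \<in> carrier M \<Longrightarrow> f m \<in> carrier N"
  by (auto simp: additive_map_def)

lemma additive_map_msum:
  assumes "abelian_monoid M" "abelian_monoid N" "additive_map M N f" "set_mset X \<subseteq> carrier M"
  shows "f (msum M X) = msum N (image_mset f X)"
proof -
  interpret M: abelian_monoid M by fact
  interpret N: abelian_monoid N by fact
  show ?thesis
    using assms(4)
  proof (induction X)
    case (add x X)
    then have "set_mset (image_mset f X) \<subseteq> carrier N" "f x \<in> carrier N"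
      using assms(3) by (auto simp: additive_map_def)
    with add assms(3) show ?case
      by (simp add: M.msum_add_mset N.msum_add_mset additive_map_def del: set_image_mset)
  qed (use assms(3) in \<open>simp add: additive_map_def\<close>)
qed

text \<open>One additive monoid appears under several records (\<open>smash\<close> and
  \<open>AD\<close>, \<open>M\<close> and \<open>over_S M\<close>); \<open>msum\<close>, and with it
  \<open>tensor_lift\<close>, sees only carrier, addition and zero.\<close>

lemma msum_carrier_cong:
  assumes "carrier Z = carrier Z'" "add Z = add Z'" "\<zero>\<^bsub>Z\<^esub> = \<zero>\<^bsub>Z'\<^esub>"
  shows "msum Z = msum Z'"
  by (rule ext) (simp add: msum_def finsum_def add_pow_def finprod_def nat_pow_def assms)

lemma tensor_lift_carrier_cong:
  assumes "carrier Z = carrier Z'" "add Z = add Z'" "\<zero>\<^bsub>Z\<^esub> = \<zero>\<^bsub>Z'\<^esub>"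
  shows "tensor_lift Z = tensor_lift Z'"
  using msum_carrier_cong[OF assms] by (simp add: tensor_lift_def fun_eq_iff)

lemma abelian_monoid_carrier_cong:
  assumes "abelian_monoid Z" "carrier Z = carrier Z'" "add Z = add Z'" "\<zero>\<^bsub>Z\<^esub> = \<zero>\<^bsub>Z'\<^esub>"
  shows "abelian_monoid Z'"
proof -
  interpret abelian_monoid Z by fact
  show ?thesis
    by (rule abelian_monoidI) (use assms(2-)[symmetric] in \<open>simp_all add: a_ac\<close>)
qed

subsection \<open>Tensor products of commutative monoids\<close>

text \<open>Serves both the tensor product over \<open>S\<close> and
  \<open>M \<otimes> coring\<close> over \<open>A\<close>. Closure under the two actions keeps the
  congruence on multisets over the carriers; the generating relations do the rest.\<close>

locale tensor_setting = M: abelian_monoid M + N: abelian_monoid N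
  for R :: "('r, 'x) ring_scheme" and M :: "('m, 'y) ring_scheme" and rm :: "'m \<Rightarrow> 'r \<Rightarrow> 'm"
    and N :: "('n, 'z) ring_scheme" and ln :: "'r \<Rightarrow> 'n \<Rightarrow> 'n" +
  assumes rm_closed: "\<lbrakk>m \<in> carrier M; r \<in> carrier R\<rbrakk> \<Longrightarrow> rm m r \<in> carrier M"
    and ln_closed: "\<lbrakk>r \<in> carrier R; n \<in> carrier N\<rbrakk> \<Longrightarrow> ln r n \<in> carrier N"
begin

abbreviation "T \<equiv> tensor R M rm N ln"
abbreviation "cls \<equiv> tensor_class R M rm N ln"
abbreviation "cong \<equiv> tensor_cong R M rm N ln"
abbreviation "tset \<equiv> {X. set_mset X \<subseteq> carrier M \<times> carrier N}"

lemma cong_tset: "cong X Y \<Longrightarrow> X \<in> tset \<and> Y \<in> tset"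
  by (induction rule: tensor_cong.induct) (auto simp: rm_closed ln_closed)

lemma cls_eq_iff: "X \<in> tset \<Longrightarrow> cls X = cls Y \<longleftrightarrow> cong X Y"
  unfolding tensor_class_def
  by (auto intro: tensor_cong.trans tensor_cong.sym dest: tensor_cong.refl)

lemma carrier_T: "carrier T = cls ` tset"
  by (simp add: tensor_def)

lemma zero_T: "\<zero>\<^bsub>T\<^esub> = cls {#}"
  by (simp add: tensor_def)

lemma rep:
  assumes "x \<in> carrier T"
  shows "tensor_rep x \<in> tset" "cls (tensor_rep x) = x"
proof -
  obtain X where X: "X \<in> tset" "x = cls X"
    using assms by (auto simp: carrier_T)
  then have "X \<in> x"
    by (auto simp: tensor_class_def intro: tensor_cong.refl)
  then have "tensor_rep x \<in> x"
    unfolding tensor_rep_def by (rule someI)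
  then have "cong X (tensor_rep x)"
    using X by (simp add: tensor_class_def)
  then show "tensor_rep x \<in> tset" "cls (tensor_rep x) = x"
    using X cong_tset cls_eq_iff by blast+
qed

lemma cls_closed: "X \<in> tset \<Longrightarrow> cls X \<in> carrier T"
  by (auto simp: carrier_T)

lemma rep_cls: "X \<in> tset \<Longrightarrow> cong (tensor_rep (cls X)) X"
  using rep[of "cls X"] cls_closed cls_eq_iff by blast

lemma add_cls:
  assumes "X \<in> tset" "Y \<in> tset"
  shows "cls X \<oplus>\<^bsub>T\<^esub> cls Y = cls (X + Y)"
proof -
  have "cong (tensor_rep (cls X) + tensor_rep (cls Y)) (X + Y)"
    using assms by (intro tensor_cong.add rep_cls)
  then have "cls (tensor_rep (cls X) + tensor_rep (cls Y)) = cls (X + Y)"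
    using cls_eq_iff cong_tset by blast
  then show ?thesis
    by (simp add: tensor_def)
qed

lemma abelian_monoid_T: "abelian_monoid T"
proof (rule abelian_monoidI)
  show "\<zero>\<^bsub>T\<^esub> \<in> carrier T"
    unfolding zero_T by (rule cls_closed) simp
  fix x y assume "x \<in> carrier T" "y \<in> carrier T"
  then obtain X Y where xy: "X \<in> tset" "Y \<in> tset" "x = cls X" "y = cls Y"
    by (auto simp: carrier_T)
  show "x \<oplus>\<^bsub>T\<^esub> y \<in> carrier T"
    using xy by (auto simp: add_cls intro!: cls_closed)
  show "\<zero>\<^bsub>T\<^esub> \<oplus>\<^bsub>T\<^esub> x = x"
    using xy add_cls[of "{#}" X] by (simp add: zero_T)
  show "x \<oplus>\<^bsub>T\<^esub> y = y \<oplus>\<^bsub>T\<^esub> x"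
    using xy by (simp add: add_cls add.commute)
  fix z assume "z \<in> carrier T"
  then obtain Z where z: "Z \<in> tset" "z = cls Z"
    by (auto simp: carrier_T)
  show "(x \<oplus>\<^bsub>T\<^esub> y) \<oplus>\<^bsub>T\<^esub> z = x \<oplus>\<^bsub>T\<^esub> (y \<oplus>\<^bsub>T\<^esub> z)"
    using xy z by (simp add: add_cls add.assoc)
qed

sublocale T: abelian_monoid T
  by (rule abelian_monoid_T)

text \<open>Every class is represented by a finite multiset, and inserting one pair into it adds one
  pure tensor.\<close>

lemma induct [consumes 1, case_names zero pure add]:
  assumes "x \<in> carrier T" "P \<zero>\<^bsub>T\<^esub>"
    and "\<And>m n. m \<in> carrier M \<Longrightarrow> n \<in> carrier N \<Longrightarrow> P (cls {#(m, n)#})"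
    and "\<And>x y. x \<in> carrier T \<Longrightarrow> y \<in> carrier T \<Longrightarrow> P x \<Longrightarrow> P y \<Longrightarrow> P (x \<oplus>\<^bsub>T\<^esub> y)"
  shows "P x"
proof -
  obtain X where "X \<in> tset" "x = cls X"
    using assms(1) by (auto simp: carrier_T)
  moreover have "X \<in> tset \<Longrightarrow> P (cls X)"
  proof (induction X)
    case empty
    then show ?case using assms(2) by (simp add: zero_T)
  next
    case (add p X)
    obtain m n where p: "p = (m, n)" by (cases p)
    have "P (cls {#p#} \<oplus>\<^bsub>T\<^esub> cls X)"
      using add p by (intro assms(3,4) cls_closed) (auto intro: assms(3))
    then show ?case
      using add p add_cls[of "{#p#}" X] by simp
  qed
  ultimately show ?thesis by blast
qed

end

text \<open>The maps of the universal property. As \<open>additive_map\<close> includes preservation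
  of zero, the clauses answer the generating relations of \<open>tensor_cong\<close> one by one, the
  two zero relations included.\<close>

definition balanced_map ::
  "('r, 'x) ring_scheme \<Rightarrow> ('m, 'y) ring_scheme \<Rightarrow> ('m \<Rightarrow> 'r \<Rightarrow> 'm) \<Rightarrow>
   ('n, 'z) ring_scheme \<Rightarrow> ('r \<Rightarrow> 'n \<Rightarrow> 'n) \<Rightarrow> ('k, 'w) ring_scheme \<Rightarrow> ('m \<Rightarrow> 'n \<Rightarrow> 'k) \<Rightarrow> bool"
  where "balanced_map R M rm N ln Z h \<longleftrightarrow>
    (\<forall>n\<in>carrier N. additive_map M Z (\<lambda>m. h m n)) \<and> (\<forall>m\<in>carrier M. additive_map N Z (h m)) \<and>
    (\<forall>m\<in>carrier M. \<forall>r\<in>carrier R. \<forall>n\<in>carrier N. h (rm m r) n = h m (ln r n))"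

context tensor_setting
begin

text \<open>Induction over the congruence, one clause of \<open>balanced_map\<close> for each
  generator. It makes \<open>tensor_lift\<close> independent of the representative picked by
  \<open>tensor_rep\<close>.\<close>

lemma msum_cong:
  assumes "abelian_monoid Z" "balanced_map R M rm N ln Z h" "cong X Y"
  shows "msum Z (image_mset (\<lambda>(m, n). h m n) X) = msum Z (image_mset (\<lambda>(m, n). h m n) Y)"
proof -
  interpret Z: abelian_monoid Z by fact
  have cl: "h m n \<in> carrier Z" if "m \<in> carrier M" "n \<in> carrier N" for m n
    using assms(2) that by (auto simp: balanced_map_def additive_map_def)
  have cl': "set_mset (image_mset (\<lambda>(m, n). h m n) X) \<subseteq> carrier Z" if "X \<in> tset" for X
    using that cl by auto
  show ?thesis
    using assms(3)
  proof (induction rule: tensor_cong.induct)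
    case (add X Y X' Y')
    then show ?case
      using cl' cong_tset by (simp add: Z.msum_union del: set_image_mset)
  qed (use assms(2) cl in \<open>simp_all add: balanced_map_def additive_map_def Z.msum_add_mset
        rm_closed ln_closed\<close>)
qed

lemma lift_cls:
  assumes "abelian_monoid Z" "balanced_map R M rm N ln Z h" "X \<in> tset"
  shows "tensor_lift Z h (cls X) = msum Z (image_mset (\<lambda>(m, n). h m n) X)"
  unfolding tensor_lift_def by (rule msum_cong[OF assms(1,2) rep_cls[OF assms(3)]])

lemma lift_closed:
  assumes "abelian_monoid Z" "\<And>m n. m \<in> carrier M \<Longrightarrow> n \<in> carrier N \<Longrightarrow> h m n \<in> carrier Z" "x \<in> carrier T"
  shows "tensor_lift Z h x \<in> carrier Z"
  unfolding tensor_lift_def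
  by (rule abelian_monoid.msum_closed[OF assms(1)]) (use rep[OF assms(3)] assms(2) in auto)

lemma lift_pure:
  assumes "abelian_monoid Z" "balanced_map R M rm N ln Z h" "m \<in> carrier M" "n \<in> carrier N"
  shows "tensor_lift Z h (cls {#(m, n)#}) = h m n"
proof -
  have "h m n \<in> carrier Z"
    using assms(2-4) by (auto simp: balanced_map_def additive_map_def)
  then show ?thesis
    using assms by (subst lift_cls) (auto simp: abelian_monoid.msum_single)
qed

lemma lift_additive:
  assumes "abelian_monoid Z" "balanced_map R M rm N ln Z h"
  shows "additive_map T Z (tensor_lift Z h)"
proof -
  interpret Z: abelian_monoid Z by fact
  have cl: "h m n \<in> carrier Z" if "m \<in> carrier M" "n \<in> carrier N" for m n
    using assms(2) that by (auto simp: balanced_map_def additive_map_def)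
  have "tensor_lift Z h (cls X \<oplus>\<^bsub>T\<^esub> cls Y) = tensor_lift Z h (cls X) \<oplus>\<^bsub>Z\<^esub> tensor_lift Z h (cls Y)"
    if "X \<in> tset" "Y \<in> tset" for X Y
  proof -
    have "set_mset (image_mset (\<lambda>(m, n). h m n) X) \<subseteq> carrier Z"
      "set_mset (image_mset (\<lambda>(m, n). h m n) Y) \<subseteq> carrier Z"
      using that cl by auto
    then show ?thesis
      using that assms by (simp add: add_cls lift_cls Z.msum_union del: set_image_mset)
  qed
  moreover have "tensor_lift Z h \<zero>\<^bsub>T\<^esub> = \<zero>\<^bsub>Z\<^esub>"
    using assms by (simp add: zero_T lift_cls)
  ultimately show ?thesis
    using lift_closed[OF assms(1) cl] by (auto simp: additive_map_def carrier_T)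
qed

lemma lift_cong:
  assumes "x \<in> carrier T" "\<And>m n. m \<in> carrier M \<Longrightarrow> n \<in> carrier N \<Longrightarrow> h m n = h' m n"
  shows "tensor_lift Z h x = tensor_lift Z h' x"
  unfolding tensor_lift_def
  by (intro arg_cong[of _ _ "msum Z"] image_mset_cong) (use rep[OF assms(1)] assms(2) in auto)

text \<open>Both sides are finite sums over the same representative of \<open>x\<close>, so \<phi>
  is pulled inside term by term.\<close>

lemma additive_lift:
  assumes "abelian_monoid Z" "abelian_monoid Z'" "additive_map Z Z' \<phi>"
    and "x \<in> carrier T" "\<And>m n. m \<in> carrier M \<Longrightarrow> n \<in> carrier N \<Longrightarrow> h m n \<in> carrier Z"
  shows "\<phi> (tensor_lift Z h x) = tensor_lift Z' (\<lambda>m n. \<phi> (h m n)) x"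
  unfolding tensor_lift_def
  by (subst additive_map_msum[OF assms(1-3)])
    (use rep[OF assms(4)] assms(5) in \<open>auto simp: image_mset.compositionality comp_def case_prod_beta'\<close>)

lemma lift_addf:
  assumes "abelian_monoid Z" "x \<in> carrier T"
    and "\<And>m n. m \<in> carrier M \<Longrightarrow> n \<in> carrier N \<Longrightarrow> h m n \<in> carrier Z"
    and "\<And>m n. m \<in> carrier M \<Longrightarrow> n \<in> carrier N \<Longrightarrow> h' m n \<in> carrier Z"
  shows "tensor_lift Z (\<lambda>m n. h m n \<oplus>\<^bsub>Z\<^esub> h' m n) x = tensor_lift Z h x \<oplus>\<^bsub>Z\<^esub> tensor_lift Z h' x"
  unfolding tensor_lift_def case_prod_beta'
  by (rule abelian_monoid.msum_addf[OF assms(1)]) (use rep[OF assms(2)] assms(3,4) in auto)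

lemma lift_zero:
  assumes "abelian_monoid Z"
  shows "tensor_lift Z (\<lambda>m n. \<zero>\<^bsub>Z\<^esub>) x = \<zero>\<^bsub>Z\<^esub>"
  using abelian_monoid.msum_zeros[OF assms] by (simp add: tensor_lift_def case_prod_beta')

lemma cls_biadditive: "balanced_map R M rm N ln T (\<lambda>m n. cls {#(m, n)#})"
proof -
  have *: "cong X Y \<Longrightarrow> cls X = cls Y" for X Y
    using cls_eq_iff cong_tset by blast
  show ?thesis
    unfolding balanced_map_def additive_map_def
    by (auto intro!: cls_closed * tensor_cong.left_zero tensor_cong.right_zero tensor_cong.left_add
        tensor_cong.right_add tensor_cong.balanced simp: zero_T add_cls add_mset_commute)
qed

end

text \<open>Fubini for Sweedler sums: the representatives of \<open>x\<close> and \<open>y\<close>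
  are fixed multisets, and two finite sums are interchanged.\<close>

lemma lift_swap:
  assumes "tensor_setting R M rm N ln" "tensor_setting R' M' rm' N' ln'" "abelian_monoid Z"
    and "x \<in> carrier (tensor R M rm N ln)" "y \<in> carrier (tensor R' M' rm' N' ln')"
    and "\<And>m n m' n'. \<lbrakk>m \<in> carrier M; n \<in> carrier N; m' \<in> carrier M'; n' \<in> carrier N'\<rbrakk> \<Longrightarrow>
      h m n m' n' \<in> carrier Z"
  shows "tensor_lift Z (\<lambda>m n. tensor_lift Z (h m n) y) x =
    tensor_lift Z (\<lambda>m' n'. tensor_lift Z (\<lambda>m n. h m n m' n') x) y"
  unfolding tensor_lift_def case_prod_beta'
  by (rule abelian_monoid.msum_swap[OF assms(3)])
    (use tensor_setting.rep(1)[OF assms(1,4)] tensor_setting.rep(1)[OF assms(2,5)] in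
      \<open>force intro!: assms(6)\<close>)

text \<open>Records that agree on their carriers have literally the same tensors. Without this,
  elements of \<open>M \<otimes> C\<close> would have to be carried along an isomorphism whenever
  \<open>M\<close> is viewed through another record.\<close>

lemma tensor_cong_mono:
  assumes "tensor_cong R M rm N ln X Y"
    and eq: "carrier R = carrier R'" "carrier M = carrier M'" "add M = add M'" "\<zero>\<^bsub>M\<^esub> = \<zero>\<^bsub>M'\<^esub>"
    "carrier N = carrier N'" "add N = add N'" "\<zero>\<^bsub>N\<^esub> = \<zero>\<^bsub>N'\<^esub>"
    and rm: "\<And>m r. m \<in> carrier M' \<Longrightarrow> r \<in> carrier R' \<Longrightarrow> rm m r = rm' m r"
    and ln: "\<And>n r. n \<in> carrier N' \<Longrightarrow> r \<in> carrier R' \<Longrightarrow> ln r n = ln' r n"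
  shows "tensor_cong R' M' rm' N' ln' X Y"
  using assms(1)
proof (induction rule: tensor_cong.induct)
  case (trans X Y Z)
  show ?case by (rule tensor_cong.trans[OF trans.IH])
next
  case (balanced m r n)
  then have *: "m \<in> carrier M'" "r \<in> carrier R'" "n \<in> carrier N'"
    by (simp_all add: eq)
  then show ?case
    by (simp only: rm ln) (rule tensor_cong.balanced)
next
  case (sym X Y)
  show ?case by (rule tensor_cong.sym[OF sym.IH])
next
  case (add X Y X' Y')
  show ?case by (rule tensor_cong.add[OF add.IH])
qed (simp_all add: eq tensor_cong.refl tensor_cong.left_add tensor_cong.right_add
    tensor_cong.left_zero tensor_cong.right_zero)

lemma tensor_cong_agree:
  assumes "carrier R = carrier R'" "carrier M = carrier M'" "add M = add M'" "\<zero>\<^bsub>M\<^esub> = \<zero>\<^bsub>M'\<^esub>"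
    "carrier N = carrier N'" "add N = add N'" "\<zero>\<^bsub>N\<^esub> = \<zero>\<^bsub>N'\<^esub>"
    and "\<And>m r. m \<in> carrier M' \<Longrightarrow> r \<in> carrier R' \<Longrightarrow> rm m r = rm' m r"
    and "\<And>n r. n \<in> carrier N' \<Longrightarrow> r \<in> carrier R' \<Longrightarrow> ln r n = ln' r n"
  shows "tensor_cong R M rm N ln = tensor_cong R' M' rm' N' ln'"
proof (intro ext iffI)
  show "tensor_cong R' M' rm' N' ln' X Y" if "tensor_cong R M rm N ln X Y" for X Y
    by (rule tensor_cong_mono[OF that assms])
  show "tensor_cong R M rm N ln X Y" if "tensor_cong R' M' rm' N' ln' X Y" for X Y
    by (rule tensor_cong_mono[OF that assms(1-7)[symmetric]]) (simp_all add: assms)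
qed

subsection \<open>Linear algebra over a commutative semiring\<close>

text \<open>Rules that follow the syntax of Sweedler expressions: a term former gets one rule for
  membership and one for each argument in which it is linear, the latter stated for composites
  \<open>\<lambda>p. h (f p)\<close>. Backchaining through these rules then proves multilinearity of
  nested lifts.\<close>

named_theorems lins

locale commutative_semiring = S: semiring S + S: comm_monoid S for S :: "'s ring"
begin

abbreviation lin :: "('s, 'm, 'y) module_scheme \<Rightarrow> ('s, 'n, 'z) module_scheme \<Rightarrow> ('m \<Rightarrow> 'n) \<Rightarrow> bool"
  where "lin \<equiv> left_linear S"

abbreviation smod :: "('s, 'm, 'y) module_scheme \<Rightarrow> bool"
  where "smod \<equiv> semimodule S"

abbreviation tens_prod :: "('s, 'm, 'y) module_scheme \<Rightarrow> ('s, 'n, 'z) module_scheme \<Rightarrow> ('s, ('m, 'n) tens) module"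
    (infixl "\<boxtimes>" 75)
  where "M \<boxtimes> N \<equiv> stensor S M N"

abbreviation pure :: "('s, 'm, 'y) module_scheme \<Rightarrow> ('s, 'n, 'z) module_scheme \<Rightarrow> 'm \<Rightarrow> 'n \<Rightarrow> ('m, 'n) tens"
  where "pure \<equiv> pure_tensor S"

lemma smod_abelian: "smod M \<Longrightarrow> abelian_monoid M"
  by (simp add: semimodule_def)

lemma smod_zero: "smod M \<Longrightarrow> \<zero>\<^bsub>M\<^esub> \<in> carrier M"
  by (simp add: abelian_monoid.zero_closed smod_abelian)

lemma smod_add: "smod M \<Longrightarrow> x \<in> carrier M \<Longrightarrow> y \<in> carrier M \<Longrightarrow> x \<oplus>\<^bsub>M\<^esub> y \<in> carrier M"
  by (simp add: abelian_monoid.a_closed smod_abelian)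

lemma linI:
  assumes "\<And>m. m \<in> carrier M \<Longrightarrow> f m \<in> carrier Z" "f \<zero>\<^bsub>M\<^esub> = \<zero>\<^bsub>Z\<^esub>"
    "\<And>m m'. m \<in> carrier M \<Longrightarrow> m' \<in> carrier M \<Longrightarrow> f (m \<oplus>\<^bsub>M\<^esub> m') = f m \<oplus>\<^bsub>Z\<^esub> f m'"
    "\<And>s m. s \<in> carrier S \<Longrightarrow> m \<in> carrier M \<Longrightarrow> f (s \<odot>\<^bsub>M\<^esub> m) = s \<odot>\<^bsub>Z\<^esub> f m"
  shows "lin M Z f"
  using assms by (auto simp: left_linear_def additive_map_def)

lemma lin_closed: "lin M Z f \<Longrightarrow> m \<in> carrier M \<Longrightarrow> f m \<in> carrier Z"
  by (auto simp: left_linear_def additive_map_def)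

lemma lin_zero: "lin M Z f \<Longrightarrow> f \<zero>\<^bsub>M\<^esub> = \<zero>\<^bsub>Z\<^esub>"
  by (auto simp: left_linear_def additive_map_def)

lemma lin_add:
  "lin M Z f \<Longrightarrow> m \<in> carrier M \<Longrightarrow> m' \<in> carrier M \<Longrightarrow> f (m \<oplus>\<^bsub>M\<^esub> m') = f m \<oplus>\<^bsub>Z\<^esub> f m'"
  by (auto simp: left_linear_def additive_map_def)

lemma lin_smult: "lin M Z f \<Longrightarrow> s \<in> carrier S \<Longrightarrow> m \<in> carrier M \<Longrightarrow> f (s \<odot>\<^bsub>M\<^esub> m) = s \<odot>\<^bsub>Z\<^esub> f m"
  by (auto simp: left_linear_def additive_map_def)

lemma lin_additive: "lin M Z f \<Longrightarrow> additive_map M Z f"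
  by (simp add: left_linear_def)

lemma lin_id [lins]: "lin M M (\<lambda>x. x)"
  by (rule linI) auto

lemma lin_compose: "lin M N f \<Longrightarrow> lin N Z g \<Longrightarrow> lin M Z (\<lambda>x. g (f x))"
  by (simp add: left_linear_def additive_map_def Pi_iff)

lemma lin_cong:
  assumes "lin M Z f" "smod M" "\<And>m. m \<in> carrier M \<Longrightarrow> f m = g m"
  shows "lin M Z g"
  by (rule linI)
    (use assms in \<open>simp_all flip: assms(3) add: lin_closed lin_zero lin_add lin_smult smod_zero smod_add
        semimodule.smult_closed\<close>)

lemma scalars_simps [simp]:
  "carrier (scalars S) = carrier S" "\<zero>\<^bsub>scalars S\<^esub> = \<zero>\<^bsub>S\<^esub>" "add (scalars S) = add S"
  "mult (scalars S) = mult S" "smult (scalars S) = mult S" "\<one>\<^bsub>scalars S\<^esub> = \<one>\<^bsub>S\<^esub>"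
  by (simp_all add: scalars_def)

lemma smod_scalars [lins]: "smod (scalars S)"
  by (intro semimodule.intro semimodule_axioms.intro S.semiring_axioms
      abelian_monoid_carrier_cong[OF S.abelian_monoid_axioms])
    (simp_all add: S.l_distr S.r_distr S.m_assoc)

lemma mem_scalars [lins]: "x \<in> carrier S \<Longrightarrow> x \<in> carrier (scalars S)"
  by simp

lemma lift_scalars: "tensor_lift S = tensor_lift (scalars S)"
  by (rule tensor_lift_carrier_cong) simp_all

lemma mem_smult [lins]: "s \<in> carrier S \<Longrightarrow> z \<in> carrier Z \<Longrightarrow> smod Z \<Longrightarrow> s \<odot>\<^bsub>Z\<^esub> z \<in> carrier Z"
  by (simp add: semimodule.smult_closed)

lemma lin_smult1 [lins]:
  assumes "smod Z" "z \<in> carrier Z" "lin P (scalars S) f"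
  shows "lin P Z (\<lambda>p. f p \<odot>\<^bsub>Z\<^esub> z)"
  by (rule linI)
    (use assms lin_closed[OF assms(3)] in \<open>simp_all add: lin_zero[OF assms(3)] lin_add[OF assms(3)]
      lin_smult[OF assms(3)] semimodule.smult_closed semimodule.smult_l_null semimodule.smult_l_distr
      semimodule.smult_assoc\<close>)

lemma smult_left_commute:
  assumes "smod Z" "z \<in> carrier Z" "s \<in> carrier S" "t \<in> carrier S"
  shows "s \<odot>\<^bsub>Z\<^esub> (t \<odot>\<^bsub>Z\<^esub> z) = t \<odot>\<^bsub>Z\<^esub> (s \<odot>\<^bsub>Z\<^esub> z)"
  using semimodule.smult_assoc[OF assms(1), of s t z] semimodule.smult_assoc[OF assms(1), of t s z]
    assms S.m_comm[of s t] by simp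

lemma lin_smult2 [lins]:
  assumes "smod Z" "s \<in> carrier S" "lin P Z f"
  shows "lin P Z (\<lambda>p. s \<odot>\<^bsub>Z\<^esub> f p)"
  by (rule linI)
    (use assms lin_closed[OF assms(3)] in \<open>simp_all add: lin_zero[OF assms(3)] lin_add[OF assms(3)]
      lin_smult[OF assms(3)] semimodule.smult_closed semimodule.smult_r_null semimodule.smult_r_distr
      smult_left_commute\<close>)

lemma mem_mult_scalars [lins]: "a \<in> carrier S \<Longrightarrow> b \<in> carrier S \<Longrightarrow> a \<otimes>\<^bsub>S\<^esub> b \<in> carrier S"
  by simp

lemma lin_mult_scalars1 [lins]:
  "b \<in> carrier S \<Longrightarrow> lin P (scalars S) f \<Longrightarrow> lin P (scalars S) (\<lambda>p. f p \<otimes>\<^bsub>S\<^esub> b)"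
  using lin_smult1[of "scalars S" b P f] smod_scalars by simp

lemma lin_mult_scalars2 [lins]:
  "a \<in> carrier S \<Longrightarrow> lin P (scalars S) f \<Longrightarrow> lin P (scalars S) (\<lambda>p. a \<otimes>\<^bsub>S\<^esub> f p)"
  using lin_smult2[of "scalars S" a P f] smod_scalars by simp

subsection \<open>The tensor product of semimodules\<close>

abbreviation lact :: "('s, 'm, 'y) module_scheme \<Rightarrow> 's \<Rightarrow> 'm \<Rightarrow> 'm"
  where "lact M \<equiv> \<lambda>s m. s \<odot>\<^bsub>M\<^esub> m"

abbreviation stens :: "('s, 'm, 'y) module_scheme \<Rightarrow> ('s, 'n, 'z) module_scheme \<Rightarrow> ('m, 'n) tens ring"
  where "stens M N \<equiv> tensor S M (\<lambda>m s. s \<odot>\<^bsub>M\<^esub> m) N (lact N)"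

lemma setting: "smod M \<Longrightarrow> smod N \<Longrightarrow> tensor_setting S M (\<lambda>m s. s \<odot>\<^bsub>M\<^esub> m) N (lact N)"
  by (simp add: tensor_setting_def tensor_setting_axioms_def smod_abelian semimodule.smult_closed)

lemma stensor_simps:
  "carrier (M \<boxtimes> N) = carrier (stens M N)" "add (M \<boxtimes> N) = add (stens M N)" "\<zero>\<^bsub>M \<boxtimes> N\<^esub> = \<zero>\<^bsub>stens M N\<^esub>"
  by (simp_all add: stensor_def Let_def)

lemma lift_stensor: "tensor_lift (stens M N) = tensor_lift (M \<boxtimes> N)"
  by (rule tensor_lift_carrier_cong) (simp_all add: stensor_simps)

text \<open>Linearity in either variable gives \<open>h (s m) n = s (h m n) = h m (s n)\<close>, so
  a bilinear map is balanced.\<close>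

lemma balancedI:
  assumes "\<And>n. n \<in> carrier N \<Longrightarrow> lin M Z (\<lambda>m. h m n)" "\<And>m. m \<in> carrier M \<Longrightarrow> lin N Z (h m)"
  shows "balanced_map S M (\<lambda>m s. s \<odot>\<^bsub>M\<^esub> m) N (lact N) Z h"
  using assms lin_smult[OF assms(1)] lin_smult[OF assms(2)] by (simp add: balanced_map_def lin_additive)

lemma abelian_stensor: "smod M \<Longrightarrow> smod N \<Longrightarrow> abelian_monoid (M \<boxtimes> N)"
  by (rule abelian_monoid_carrier_cong[OF tensor_setting.abelian_monoid_T[OF setting]])
    (simp_all add: stensor_simps)

lemma mem_pure [lins]:
  "smod M \<Longrightarrow> smod N \<Longrightarrow> m \<in> carrier M \<Longrightarrow> n \<in> carrier N \<Longrightarrow> pure M N m n \<in> carrier (M \<boxtimes> N)"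
  by (auto simp: stensor_simps pure_tensor_def tensor_def)

lemma stensor_induct [consumes 3, case_names zero pure add]:
  assumes "smod M" "smod N" "x \<in> carrier (M \<boxtimes> N)" "P \<zero>\<^bsub>M \<boxtimes> N\<^esub>"
    and "\<And>m n. m \<in> carrier M \<Longrightarrow> n \<in> carrier N \<Longrightarrow> P (pure M N m n)"
    and "\<And>x y. x \<in> carrier (M \<boxtimes> N) \<Longrightarrow> y \<in> carrier (M \<boxtimes> N) \<Longrightarrow> P x \<Longrightarrow> P y \<Longrightarrow> P (x \<oplus>\<^bsub>M \<boxtimes> N\<^esub> y)"
  shows "P x"
  using tensor_setting.induct[OF setting[OF assms(1,2)], of x P] assms(3-)
  by (simp add: stensor_simps pure_tensor_def)

lemma lin_pure0:
  assumes "smod M" "smod N"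
  shows "m \<in> carrier M \<Longrightarrow> n \<in> carrier N \<Longrightarrow> s \<in> carrier S \<Longrightarrow>
      pure M N (s \<odot>\<^bsub>M\<^esub> m) n = pure M N m (s \<odot>\<^bsub>N\<^esub> n)"
    "n \<in> carrier N \<Longrightarrow> additive_map M (M \<boxtimes> N) (\<lambda>m. pure M N m n)"
    "m \<in> carrier M \<Longrightarrow> additive_map N (M \<boxtimes> N) (pure M N m)"
  using tensor_setting.cls_biadditive[OF setting[OF assms]]
  by (simp_all add: pure_tensor_def balanced_map_def additive_map_def stensor_simps Pi_iff)

lemma smult_stensor: "s \<odot>\<^bsub>M \<boxtimes> N\<^esub> x = tensor_lift (M \<boxtimes> N) (\<lambda>m n. pure M N (s \<odot>\<^bsub>M\<^esub> m) n) x"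
  unfolding lift_stensor[symmetric] by (simp add: stensor_def Let_def)

lemma smult_balanced:
  assumes "smod M" "smod N" "s \<in> carrier S"
  shows "balanced_map S M (\<lambda>m s. s \<odot>\<^bsub>M\<^esub> m) N (lact N) (M \<boxtimes> N) (\<lambda>m n. pure M N (s \<odot>\<^bsub>M\<^esub> m) n)"
proof -
  have 1: "lin M M (\<lambda>m. s \<odot>\<^bsub>M\<^esub> m)"
    by (intro lins assms)
  have "additive_map M (M \<boxtimes> N) (\<lambda>m. pure M N (s \<odot>\<^bsub>M\<^esub> m) n)" if "n \<in> carrier N" for n
    using lin_additive[OF 1] lin_pure0(2)[OF assms(1,2) that] by (simp add: additive_map_def Pi_iff)
  moreover have "additive_map N (M \<boxtimes> N) (pure M N (s \<odot>\<^bsub>M\<^esub> m))" if "m \<in> carrier M" for m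
    using lin_pure0(3)[OF assms(1,2)] that assms by (simp add: semimodule.smult_closed)
  ultimately show ?thesis
    using assms by (simp add: balanced_map_def smult_left_commute semimodule.smult_closed flip: lin_pure0(1))
qed

lemma smult_pure:
  assumes "smod M" "smod N" "s \<in> carrier S" "m \<in> carrier M" "n \<in> carrier N"
  shows "s \<odot>\<^bsub>M \<boxtimes> N\<^esub> pure M N m n = pure M N (s \<odot>\<^bsub>M\<^esub> m) n"
  using tensor_setting.lift_pure[OF setting[OF assms(1,2)] abelian_stensor[OF assms(1,2)]
      smult_balanced[OF assms(1-3)] assms(4,5)]
  by (simp add: smult_stensor pure_tensor_def)

lemma smult_additive:
  assumes "smod M" "smod N" "s \<in> carrier S"
  shows "additive_map (M \<boxtimes> N) (M \<boxtimes> N) (\<lambda>x. s \<odot>\<^bsub>M \<boxtimes> N\<^esub> x)"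
  using tensor_setting.lift_additive[OF setting abelian_stensor smult_balanced, OF assms(1,2) assms(1,2) assms]
  by (simp add: smult_stensor additive_map_def stensor_simps)

text \<open>Stated for additive rather than linear maps because it has to serve the proof that
  \<open>M \<boxtimes> N\<close> is a semimodule, where linearity is not yet available. Each axiom
  there is an identity between additive maps.\<close>

lemma additive_eqI:
  assumes "smod M" "smod N" "abelian_monoid Z" "additive_map (M \<boxtimes> N) Z f" "additive_map (M \<boxtimes> N) Z g"
    and "\<And>m n. m \<in> carrier M \<Longrightarrow> n \<in> carrier N \<Longrightarrow> f (pure M N m n) = g (pure M N m n)"
    and "x \<in> carrier (M \<boxtimes> N)"
  shows "f x = g x"
  using assms(1,2,7) by (induction x rule: stensor_induct) (use assms(4-6) in \<open>simp_all add: additive_map_def\<close>)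

lemma additive_comp: "additive_map M N f \<Longrightarrow> additive_map N Z g \<Longrightarrow> additive_map M Z (\<lambda>x. g (f x))"
  by (simp add: additive_map_def Pi_iff)

lemma additive_add:
  assumes "abelian_monoid Z" "additive_map M Z f" "additive_map M Z g"
  shows "additive_map M Z (\<lambda>x. f x \<oplus>\<^bsub>Z\<^esub> g x)"
proof -
  interpret Z: abelian_monoid Z by fact
  show ?thesis
    using assms(2,3) by (auto simp: additive_map_def Z.a_ac Pi_iff)
qed

lemma smod_stensor [lins]:
  assumes "smod M" "smod N"
  shows "smod (M \<boxtimes> N)"
proof -
  interpret MN: abelian_monoid "M \<boxtimes> N" by (rule abelian_stensor[OF assms])
  note cl = additive_map_closed[OF smult_additive[OF assms]]
  note [simp] = smult_pure[OF assms] semimodule.smult_closed[OF assms(1)]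
  have id: "additive_map (M \<boxtimes> N) (M \<boxtimes> N) (\<lambda>x. x)"
    by (simp add: additive_map_def)
  have add: "pure M N (m \<oplus>\<^bsub>M\<^esub> m') n = pure M N m n \<oplus>\<^bsub>M \<boxtimes> N\<^esub> pure M N m' n"
    if "m \<in> carrier M" "m' \<in> carrier M" "n \<in> carrier N" for m m' n
    using lin_pure0(2)[OF assms that(3)] that by (simp add: additive_map_def)
  have zero: "pure M N \<zero>\<^bsub>M\<^esub> n = \<zero>\<^bsub>M \<boxtimes> N\<^esub>" if "n \<in> carrier N" for n
    using lin_pure0(2)[OF assms that] by (simp add: additive_map_def)
  note ext = additive_eqI[OF assms MN.abelian_monoid_axioms]
  have z: "additive_map (M \<boxtimes> N) (M \<boxtimes> N) (\<lambda>x. \<zero>\<^bsub>M \<boxtimes> N\<^esub>)"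
    by (simp add: additive_map_def)
  have 1: "(r \<oplus>\<^bsub>S\<^esub> r') \<odot>\<^bsub>M \<boxtimes> N\<^esub> x = r \<odot>\<^bsub>M \<boxtimes> N\<^esub> x \<oplus>\<^bsub>M \<boxtimes> N\<^esub> r' \<odot>\<^bsub>M \<boxtimes> N\<^esub> x"
    if "r \<in> carrier S" "r' \<in> carrier S" "x \<in> carrier (M \<boxtimes> N)" for r r' x
    by (rule ext[OF smult_additive additive_add[OF _ smult_additive smult_additive] _ that(3)])
      (use that assms in \<open>simp_all add: MN.abelian_monoid_axioms semimodule.smult_l_distr add\<close>)
  have 2: "(r \<otimes>\<^bsub>S\<^esub> r') \<odot>\<^bsub>M \<boxtimes> N\<^esub> x = r \<odot>\<^bsub>M \<boxtimes> N\<^esub> (r' \<odot>\<^bsub>M \<boxtimes> N\<^esub> x)"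
    if "r \<in> carrier S" "r' \<in> carrier S" "x \<in> carrier (M \<boxtimes> N)" for r r' x
    by (rule ext[OF smult_additive additive_comp[OF smult_additive smult_additive] _ that(3)])
      (use that assms in \<open>simp_all add: semimodule.smult_assoc\<close>)
  have 3: "\<one>\<^bsub>S\<^esub> \<odot>\<^bsub>M \<boxtimes> N\<^esub> x = x" if "x \<in> carrier (M \<boxtimes> N)" for x
    by (rule ext[OF smult_additive id _ that]) (use assms in \<open>simp_all add: semimodule.smult_one\<close>)
  have 4: "\<zero>\<^bsub>S\<^esub> \<odot>\<^bsub>M \<boxtimes> N\<^esub> x = \<zero>\<^bsub>M \<boxtimes> N\<^esub>" if "x \<in> carrier (M \<boxtimes> N)" for x
    by (rule ext[OF smult_additive z _ that]) (use assms in \<open>simp_all add: semimodule.smult_l_null zero\<close>)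
  show ?thesis
    by (intro semimodule.intro semimodule_axioms.intro S.semiring_axioms MN.abelian_monoid_axioms)
      (use 1 2 3 4 cl smult_additive[OF assms] in \<open>simp_all add: additive_map_def\<close>)
qed

lemma pure_smult_right:
  "\<lbrakk>smod M; smod N; s \<in> carrier S; m \<in> carrier M; n \<in> carrier N\<rbrakk> \<Longrightarrow>
    s \<odot>\<^bsub>M \<boxtimes> N\<^esub> pure M N m n = pure M N m (s \<odot>\<^bsub>N\<^esub> n)"
  by (simp add: smult_pure lin_pure0(1))

lemma lin_pure1 [lins]:
  assumes "smod M" "smod N" "n \<in> carrier N" "lin P M f"
  shows "lin P (M \<boxtimes> N) (\<lambda>p. pure M N (f p) n)"
proof -
  have "lin M (M \<boxtimes> N) (\<lambda>m. pure M N m n)"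
    using assms by (simp add: left_linear_def lin_pure0(2) smult_pure)
  from lin_compose[OF assms(4) this] show ?thesis .
qed

lemma lin_pure2 [lins]:
  assumes "smod M" "smod N" "m \<in> carrier M" "lin P N f"
  shows "lin P (M \<boxtimes> N) (\<lambda>p. pure M N m (f p))"
proof -
  have "lin N (M \<boxtimes> N) (pure M N m)"
    using assms by (simp add: left_linear_def lin_pure0(3) pure_smult_right)
  from lin_compose[OF assms(4) this] show ?thesis .
qed

lemma mem_lift [lins]:
  assumes "x \<in> carrier (M \<boxtimes> N)" "smod M" "smod N" "smod Z"
    "\<And>m n. m \<in> carrier M \<Longrightarrow> n \<in> carrier N \<Longrightarrow> h m n \<in> carrier Z"
  shows "tensor_lift Z h x \<in> carrier Z"
  by (rule tensor_setting.lift_closed[OF setting smod_abelian]) (use assms in \<open>simp_all add: stensor_simps\<close>)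

lemma lift_pure:
  assumes "m \<in> carrier M" "n \<in> carrier N" "smod M" "smod N" "smod Z"
    and "\<And>n. n \<in> carrier N \<Longrightarrow> lin M Z (\<lambda>m. h m n)" "\<And>m. m \<in> carrier M \<Longrightarrow> lin N Z (h m)"
  shows "tensor_lift Z h (pure M N m n) = h m n"
  unfolding pure_tensor_def
  by (rule tensor_setting.lift_pure[OF setting[OF assms(3,4)] smod_abelian[OF assms(5)]
        balancedI[OF assms(6,7)] assms(1,2)])

lemma lift_cong:
  assumes "x \<in> carrier (M \<boxtimes> N)" "smod M" "smod N"
    "\<And>m n. m \<in> carrier M \<Longrightarrow> n \<in> carrier N \<Longrightarrow> h m n = h' m n"
  shows "tensor_lift Z h x = tensor_lift Z h' x"
  by (rule tensor_setting.lift_cong[OF setting]) (use assms in \<open>simp_all add: stensor_simps\<close>)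

lemma lin_lift:
  assumes "x \<in> carrier (M \<boxtimes> N)" "smod M" "smod N" "lin Z Z' \<phi>" "smod Z" "smod Z'"
    "\<And>m n. m \<in> carrier M \<Longrightarrow> n \<in> carrier N \<Longrightarrow> h m n \<in> carrier Z"
  shows "\<phi> (tensor_lift Z h x) = tensor_lift Z' (\<lambda>m n. \<phi> (h m n)) x"
  by (rule tensor_setting.additive_lift[OF setting smod_abelian smod_abelian lin_additive])
    (use assms in \<open>simp_all add: stensor_simps\<close>)

lemma lin_lift_arg0:
  assumes "smod M" "smod N" "smod Z"
    and "\<And>n. n \<in> carrier N \<Longrightarrow> lin M Z (\<lambda>m. h m n)" "\<And>m. m \<in> carrier M \<Longrightarrow> lin N Z (h m)"
  shows "lin (M \<boxtimes> N) Z (tensor_lift Z h)"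
proof -
  have add: "additive_map (M \<boxtimes> N) Z (tensor_lift Z h)"
    using tensor_setting.lift_additive[OF setting[OF assms(1,2)] smod_abelian[OF assms(3)] balancedI[OF assms(4,5)]]
    by (simp add: additive_map_def stensor_simps)
  have s: "additive_map Z Z (\<lambda>z. s \<odot>\<^bsub>Z\<^esub> z)" "additive_map (M \<boxtimes> N) (M \<boxtimes> N) (\<lambda>z. s \<odot>\<^bsub>M \<boxtimes> N\<^esub> z)"
    if "s \<in> carrier S" for s
    by (rule lin_additive, intro lins that assms)+
  have "tensor_lift Z h (s \<odot>\<^bsub>M \<boxtimes> N\<^esub> x) = s \<odot>\<^bsub>Z\<^esub> tensor_lift Z h x"
    if "s \<in> carrier S" "x \<in> carrier (M \<boxtimes> N)" for s x
    by (rule additive_eqI[OF assms(1,2) smod_abelian[OF assms(3)] additive_comp[OF s(2) add]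
          additive_comp[OF add s(1)] _ that(2)])
      (use that(1) assms in \<open>simp_all add: smult_pure lift_pure lin_smult semimodule.smult_closed
          lin_smult[OF assms(4)]\<close>)
  then show ?thesis
    using add by (simp add: left_linear_def)
qed

lemma lin_lift_arg [lins]:
  assumes "lin P (M \<boxtimes> N) f" "smod M" "smod N" "smod Z"
    and "\<And>n. n \<in> carrier N \<Longrightarrow> lin M Z (\<lambda>m. h m n)" "\<And>m. m \<in> carrier M \<Longrightarrow> lin N Z (h m)"
  shows "lin P Z (\<lambda>p. tensor_lift Z h (f p))"
  by (rule lin_compose[OF assms(1) lin_lift_arg0]) (use assms in auto)

text \<open>With \<open>x\<close> fixed its representative is fixed too, so this is linearity of a
  finite sum of linear terms, whereas \<open>lin_lift_arg\<close> varies the tensor and rests on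
  bilinearity of \<open>h\<close>.\<close>

lemma lin_lift_par [lins]:
  assumes "x \<in> carrier (M \<boxtimes> N)" "smod M" "smod N" "smod Z"
    and "\<And>m n. m \<in> carrier M \<Longrightarrow> n \<in> carrier N \<Longrightarrow> lin P Z (\<lambda>p. h p m n)"
  shows "lin P Z (\<lambda>p. tensor_lift Z (h p) x)"
proof (rule linI)
  have cl: "\<And>m n p. m \<in> carrier M \<Longrightarrow> n \<in> carrier N \<Longrightarrow> p \<in> carrier P \<Longrightarrow> h p m n \<in> carrier Z"
    using lin_closed[OF assms(5)] by blast
  show "tensor_lift Z (h p) x \<in> carrier Z" if "p \<in> carrier P" for p
    by (rule mem_lift) (use assms cl that in auto)
  have "tensor_lift Z (h \<zero>\<^bsub>P\<^esub>) x = tensor_lift Z (\<lambda>m n. \<zero>\<^bsub>Z\<^esub>) x"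
    by (rule lift_cong[OF assms(1-3)]) (use assms(5) in \<open>auto dest: lin_zero\<close>)
  then show "tensor_lift Z (h \<zero>\<^bsub>P\<^esub>) x = \<zero>\<^bsub>Z\<^esub>"
    using tensor_setting.lift_zero[OF setting[OF assms(2,3)] smod_abelian[OF assms(4)]] by simp
  show "tensor_lift Z (h (p \<oplus>\<^bsub>P\<^esub> q)) x = tensor_lift Z (h p) x \<oplus>\<^bsub>Z\<^esub> tensor_lift Z (h q) x"
    if "p \<in> carrier P" "q \<in> carrier P" for p q
  proof -
    have "tensor_lift Z (h (p \<oplus>\<^bsub>P\<^esub> q)) x = tensor_lift Z (\<lambda>m n. h p m n \<oplus>\<^bsub>Z\<^esub> h q m n) x"
      by (rule lift_cong[OF assms(1-3)]) (use lin_add[OF assms(5)] that in auto)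
    also have "\<dots> = tensor_lift Z (h p) x \<oplus>\<^bsub>Z\<^esub> tensor_lift Z (h q) x"
      by (rule tensor_setting.lift_addf[OF setting[OF assms(2,3)] smod_abelian[OF assms(4)]])
        (use assms(1) cl that in \<open>auto simp: stensor_simps\<close>)
    finally show ?thesis .
  qed
  show "tensor_lift Z (h (s \<odot>\<^bsub>P\<^esub> p)) x = s \<odot>\<^bsub>Z\<^esub> tensor_lift Z (h p) x"
    if "s \<in> carrier S" "p \<in> carrier P" for s p
  proof -
    have "lin Z Z (\<lambda>z. s \<odot>\<^bsub>Z\<^esub> z)"
      by (intro lins that assms)
    from lin_lift[OF assms(1-3) this assms(4,4), of "h p"] cl that
    have "s \<odot>\<^bsub>Z\<^esub> tensor_lift Z (h p) x = tensor_lift Z (\<lambda>m n. s \<odot>\<^bsub>Z\<^esub> h p m n) x"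
      by simp
    also have "\<dots> = tensor_lift Z (h (s \<odot>\<^bsub>P\<^esub> p)) x"
      by (rule lift_cong[OF assms(1-3)]) (use lin_smult[OF assms(5)] that in auto)
    finally show ?thesis by simp
  qed
qed

lemma lift_swap:
  assumes "x \<in> carrier (M \<boxtimes> N)" "y \<in> carrier (P \<boxtimes> Q)" "smod M" "smod N" "smod P" "smod Q" "smod Z"
    and "\<And>m n p q. \<lbrakk>m \<in> carrier M; n \<in> carrier N; p \<in> carrier P; q \<in> carrier Q\<rbrakk> \<Longrightarrow> h m n p q \<in> carrier Z"
  shows "tensor_lift Z (\<lambda>m n. tensor_lift Z (h m n) y) x = tensor_lift Z (\<lambda>p q. tensor_lift Z (\<lambda>m n. h m n p q) x) y"
  by (rule Submission.lift_swap[OF setting setting smod_abelian])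
    (use assms in \<open>simp_all add: stensor_simps\<close>)

lemma lin_eqI:
  assumes "x \<in> carrier (M \<boxtimes> N)" "smod M" "smod N" "smod Z" "lin (M \<boxtimes> N) Z f" "lin (M \<boxtimes> N) Z g"
    and "\<And>m n. m \<in> carrier M \<Longrightarrow> n \<in> carrier N \<Longrightarrow> f (pure M N m n) = g (pure M N m n)"
  shows "f x = g x"
  by (rule additive_eqI[OF assms(2,3) smod_abelian[OF assms(4)] lin_additive[OF assms(5)]
        lin_additive[OF assms(6)] assms(7,1)])

lemma lift_pure_id:
  assumes "x \<in> carrier (M \<boxtimes> N)" "smod M" "smod N"
  shows "tensor_lift (M \<boxtimes> N) (pure M N) x = x"
proof (rule lin_eqI[OF assms smod_stensor[OF assms(2,3)]])
  show "lin (M \<boxtimes> N) (M \<boxtimes> N) (tensor_lift (M \<boxtimes> N) (pure M N))"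
    by (intro lin_lift_arg0 lins assms)
  show "tensor_lift (M \<boxtimes> N) (pure M N) (pure M N m n) = pure M N m n"
    if "m \<in> carrier M" "n \<in> carrier N" for m n
    by (rule lift_pure[OF that assms(2,3)]) (intro lins assms, assumption?)+
qed (intro lins)

text \<open>The form in which coassociativity enters calculations. A trilinear \<open>K\<close>
  induces a linear map \<open>?\<Lambda>\<close> on \<open>(M \<boxtimes> C) \<boxtimes> C\<close>;
  applied to the two sides of the coassociativity equation it yields the two iterated Sweedler sums.
  It is used for \<open>\<rho>A\<close>, for \<open>comult C\<close> and for the coaction of a
  Doi-Koppinen semimodule.\<close>

lemma coassoc_lift:
  assumes "coassociative S M C \<rho>" "lin M (M \<boxtimes> C) \<rho>" "lin C (C \<boxtimes> C) (comult C)" "m \<in> carrier M"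
    and [lins]: "smod M" "smod C" "smod Z"
    and K [lins]: "\<And>c d. c \<in> carrier C \<Longrightarrow> d \<in> carrier C \<Longrightarrow> lin M Z (\<lambda>x. K x c d)"
      "\<And>x d. x \<in> carrier M \<Longrightarrow> d \<in> carrier C \<Longrightarrow> lin C Z (\<lambda>c. K x c d)"
      "\<And>x c. x \<in> carrier M \<Longrightarrow> c \<in> carrier C \<Longrightarrow> lin C Z (\<lambda>d. K x c d)"
  shows "tensor_lift Z (\<lambda>m0 m1. tensor_lift Z (\<lambda>x c. K x c m1) (\<rho> m0)) (\<rho> m)
       = tensor_lift Z (\<lambda>m0 m1. tensor_lift Z (\<lambda>c d. K m0 c d) (comult C m1)) (\<rho> m)"
proof -
  let ?\<Lambda> = "tensor_lift Z (\<lambda>u d. tensor_lift Z (\<lambda>x c. K x c d) u)"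
  note \<rho>cl = lin_closed[OF assms(2)] and \<Delta>cl = lin_closed[OF assms(3)]
  have i1: "lin (M \<boxtimes> C) Z (\<lambda>u. tensor_lift Z (\<lambda>x c. K x c d) u)" if "d \<in> carrier C" for d
    by (rule lin_lift_arg0) (use that in \<open>auto intro!: lins\<close>)
  have i2: "lin C Z (\<lambda>d. tensor_lift Z (\<lambda>x c. K x c d) u)" if "u \<in> carrier (M \<boxtimes> C)" for u
    by (rule lin_lift_par[OF that]) (auto intro!: lins)
  have L: "lin (M \<boxtimes> C \<boxtimes> C) Z ?\<Lambda>"
    by (rule lin_lift_arg0) (use i1 i2 in \<open>auto intro!: lins\<close>)
  have p: "?\<Lambda> (pure (M \<boxtimes> C) C u d) = tensor_lift Z (\<lambda>x c. K x c d) u"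
    if "u \<in> carrier (M \<boxtimes> C)" "d \<in> carrier C" for u d
    by (rule lift_pure[OF that]) (use i1 i2 in \<open>auto intro!: lins\<close>)
  have p': "tensor_lift Z (\<lambda>x c. K x c d) (pure M C x c) = K x c d"
    if "x \<in> carrier M" "c \<in> carrier C" "d \<in> carrier C" for x c d
    by (rule lift_pure) (use that in \<open>auto intro!: lins\<close>)
  have 1: "?\<Lambda> (tensor_lift (M \<boxtimes> C \<boxtimes> C) (\<lambda>m0 m1. pure (M \<boxtimes> C) C (\<rho> m0) m1) (\<rho> m)) =
      tensor_lift Z (\<lambda>m0 m1. tensor_lift Z (\<lambda>x c. K x c m1) (\<rho> m0)) (\<rho> m)"
    by (subst lin_lift[OF \<rho>cl[OF assms(4)] _ _ L])
      (auto intro!: lins \<rho>cl lift_cong[OF \<rho>cl[OF assms(4)]] p)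
  have "?\<Lambda> (tensor_lift (M \<boxtimes> C \<boxtimes> C) (\<lambda>m0 m1. tensor_lift (M \<boxtimes> C \<boxtimes> C) (\<lambda>c1 c2.
         pure (M \<boxtimes> C) C (pure M C m0 c1) c2) (comult C m1)) (\<rho> m)) =
      tensor_lift Z (\<lambda>m0 m1. ?\<Lambda> (tensor_lift (M \<boxtimes> C \<boxtimes> C) (\<lambda>c1 c2.
         pure (M \<boxtimes> C) C (pure M C m0 c1) c2) (comult C m1))) (\<rho> m)"
    by (rule lin_lift[OF \<rho>cl[OF assms(4)] _ _ L])
      (auto intro!: lins \<rho>cl \<Delta>cl mem_lift[OF \<Delta>cl])
  also have "\<dots> = tensor_lift Z (\<lambda>m0 m1. tensor_lift Z (\<lambda>c d. K m0 c d) (comult C m1)) (\<rho> m)"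
  proof (rule lift_cong[OF \<rho>cl[OF assms(4)]])
    fix m0 m1 assume m: "m0 \<in> carrier M" "m1 \<in> carrier C"
    show "?\<Lambda> (tensor_lift (M \<boxtimes> C \<boxtimes> C) (\<lambda>c1 c2. pure (M \<boxtimes> C) C (pure M C m0 c1) c2) (comult C m1)) =
      tensor_lift Z (K m0) (comult C m1)"
      by (subst lin_lift[OF \<Delta>cl[OF m(2)] _ _ L])
       (use m in \<open>auto intro!: lins lift_cong[OF \<Delta>cl[OF m(2)]] HOL.trans[OF p p']\<close>)
  qed (intro lins)+
  finally show ?thesis
    using 1 assms(1,4) by (simp add: coassociative_def Let_def)
qed

end

subsection \<open>Doi-Koppinen structures\<close>

text \<open>A constant for application, so that the rules on linearity do not unify with every term \<open>f c\<close>.\<close>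

definition ev :: "('c \<Rightarrow> 's) \<Rightarrow> 'c \<Rightarrow> 's" where "ev f c = f c"

locale doi_koppinen_setting = commutative_semiring S + doi_koppinen S B A \<rho>A C actC
  for S :: "'s ring"
    and B :: "('s, 'b) coalgebra"
    and A :: "('s, 'a) module"
    and \<rho>A :: "'a \<Rightarrow> ('a, 'b) tens"
    and C :: "('s, 'c) coalgebra"
    and actC :: "'c \<Rightarrow> 'b \<Rightarrow> 'c"
begin

lemma smod_A [lins]: "smod A" and semiring_A: "semiring A"
  and rho_comodule: "right_semicomodule S B A \<rho>A" and rho_hom: "\<rho>A \<in> ring_hom A (A \<boxtimes> B)"
  using semicomodule_semialgebra by (simp_all add: semicomodule_semialgebra_def semialgebra_def)

lemma alg_A:
  assumes "s \<in> carrier S" "a \<in> carrier A" "a' \<in> carrier A"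
  shows "s \<odot>\<^bsub>A\<^esub> (a \<otimes>\<^bsub>A\<^esub> a') = (s \<odot>\<^bsub>A\<^esub> a) \<otimes>\<^bsub>A\<^esub> a'"
    "s \<odot>\<^bsub>A\<^esub> (a \<otimes>\<^bsub>A\<^esub> a') = a \<otimes>\<^bsub>A\<^esub> (s \<odot>\<^bsub>A\<^esub> a')"
  using semicomodule_semialgebra assms unfolding semicomodule_semialgebra_def bisemialgebra_def semialgebra_def by metis+

lemma smod_B [lins]: "smod B" and semiring_B: "semiring B" and coalg_B: "semicoalgebra S B"
  using bisemialgebra by (simp_all add: bisemialgebra_def semialgebra_def)

lemma alg_B:
  assumes "s \<in> carrier S" "a \<in> carrier B" "a' \<in> carrier B"
  shows "s \<odot>\<^bsub>B\<^esub> (a \<otimes>\<^bsub>B\<^esub> a') = (s \<odot>\<^bsub>B\<^esub> a) \<otimes>\<^bsub>B\<^esub> a'"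
    "s \<odot>\<^bsub>B\<^esub> (a \<otimes>\<^bsub>B\<^esub> a') = a \<otimes>\<^bsub>B\<^esub> (s \<odot>\<^bsub>B\<^esub> a')"
  using bisemialgebra assms unfolding semicomodule_semialgebra_def bisemialgebra_def semialgebra_def by metis+

lemma smod_C [lins]: "smod C" and coalg_C: "semicoalgebra S C"
  using semimodule_semicoalgebra by (simp_all add: semimodule_semicoalgebra_def semicoalgebra_def)

sublocale A: semiring A by (rule semiring_A)
sublocale B: semiring B by (rule semiring_B)

lemma lin_rho0: "lin A (A \<boxtimes> B) \<rho>A" and coassoc_rho: "coassociative S A B \<rho>A"
  and counit_rho: "\<And>a. a \<in> carrier A \<Longrightarrow> tensor_lift A (\<lambda>a0 a1. counit B a1 \<odot>\<^bsub>A\<^esub> a0) (\<rho>A a) = a"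
  using rho_comodule by (simp_all add: right_semicomodule_def)

lemma lin_comultB0: "lin B (B \<boxtimes> B) (comult B)" and lin_counitB0: "lin B (scalars S) (counit B)"
  using coalg_B by (simp_all add: semicoalgebra_def)

lemma lin_comult0: "lin C (C \<boxtimes> C) (comult C)" and lin_counit0: "lin C (scalars S) (counit C)"
  and coassoc_C: "coassociative S C C (comult C)"
  and counit_C: "\<And>c. c \<in> carrier C \<Longrightarrow> tensor_lift C (\<lambda>c1 c2. counit C c1 \<odot>\<^bsub>C\<^esub> c2) (comult C c) = c"
    "\<And>c. c \<in> carrier C \<Longrightarrow> tensor_lift C (\<lambda>c1 c2. counit C c2 \<odot>\<^bsub>C\<^esub> c1) (comult C c) = c"
  using coalg_C by (simp_all add: semicoalgebra_def)

lemma mem_rho [lins]: "a \<in> carrier A \<Longrightarrow> \<rho>A a \<in> carrier (A \<boxtimes> B)"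
  by (rule lin_closed[OF lin_rho0])

lemma lin_rho [lins]: "lin P A f \<Longrightarrow> lin P (A \<boxtimes> B) (\<lambda>p. \<rho>A (f p))"
  by (rule lin_compose[OF _ lin_rho0])

lemma mem_comultB [lins]: "b \<in> carrier B \<Longrightarrow> comult B b \<in> carrier (B \<boxtimes> B)"
  by (rule lin_closed[OF lin_comultB0])

lemma mem_comult [lins]: "c \<in> carrier C \<Longrightarrow> comult C c \<in> carrier (C \<boxtimes> C)"
  by (rule lin_closed[OF lin_comult0])

lemma lin_comult [lins]: "lin P C f \<Longrightarrow> lin P (C \<boxtimes> C) (\<lambda>p. comult C (f p))"
  by (rule lin_compose[OF _ lin_comult0])

lemma mem_counit [lins]: "c \<in> carrier C \<Longrightarrow> counit C c \<in> carrier S"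
  using lin_closed[OF lin_counit0] by simp

lemma lin_counit [lins]: "lin P C f \<Longrightarrow> lin P (scalars S) (\<lambda>p. counit C (f p))"
  by (rule lin_compose[OF _ lin_counit0])

lemma mem_counitB [lins]: "b \<in> carrier B \<Longrightarrow> counit B b \<in> carrier S"
  using lin_closed[OF lin_counitB0] by simp

lemma mem_multA [lins]: "a \<in> carrier A \<Longrightarrow> b \<in> carrier A \<Longrightarrow> a \<otimes>\<^bsub>A\<^esub> b \<in> carrier A"
  by simp

lemma lin_multA1 [lins]: "b \<in> carrier A \<Longrightarrow> lin P A f \<Longrightarrow> lin P A (\<lambda>p. f p \<otimes>\<^bsub>A\<^esub> b)"
  by (rule lin_compose[of P A f A "\<lambda>x. x \<otimes>\<^bsub>A\<^esub> b"], assumption)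
    (rule linI, simp_all add: A.l_distr alg_A(1))

lemma lin_multA2 [lins]: "a \<in> carrier A \<Longrightarrow> lin P A f \<Longrightarrow> lin P A (\<lambda>p. a \<otimes>\<^bsub>A\<^esub> f p)"
  by (rule lin_compose[of P A f A "\<lambda>x. a \<otimes>\<^bsub>A\<^esub> x"], assumption)
    (rule linI, simp_all add: A.r_distr alg_A(2))

lemma mem_multB [lins]: "a \<in> carrier B \<Longrightarrow> b \<in> carrier B \<Longrightarrow> a \<otimes>\<^bsub>B\<^esub> b \<in> carrier B"
  by simp

lemma lin_multB1 [lins]: "b \<in> carrier B \<Longrightarrow> lin P B f \<Longrightarrow> lin P B (\<lambda>p. f p \<otimes>\<^bsub>B\<^esub> b)"
  by (rule lin_compose[of P B f B "\<lambda>x. x \<otimes>\<^bsub>B\<^esub> b"], assumption)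
    (rule linI, simp_all add: B.l_distr alg_B(1))

lemma mem_act [lins]: "c \<in> carrier C \<Longrightarrow> b \<in> carrier B \<Longrightarrow> actC c b \<in> carrier C"
  and act_assoc: "\<lbrakk>c \<in> carrier C; b \<in> carrier B; b' \<in> carrier B\<rbrakk> \<Longrightarrow> actC c (b \<otimes>\<^bsub>B\<^esub> b') = actC (actC c b) b'"
  and act_one: "c \<in> carrier C \<Longrightarrow> actC c \<one>\<^bsub>B\<^esub> = c"
  and lin_act01: "b \<in> carrier B \<Longrightarrow> lin C C (\<lambda>c. actC c b)"
  and lin_act02: "c \<in> carrier C \<Longrightarrow> lin B C (actC c)"
  and comult_act: "\<lbrakk>c \<in> carrier C; b \<in> carrier B\<rbrakk> \<Longrightarrow>
        comult C (actC c b) =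
          tensor_lift (C \<boxtimes> C) (\<lambda>c1 c2. tensor_lift (C \<boxtimes> C) (\<lambda>b1 b2.
            pure C C (actC c1 b1) (actC c2 b2)) (comult B b)) (comult C c)"
  and counit_act: "\<lbrakk>c \<in> carrier C; b \<in> carrier B\<rbrakk> \<Longrightarrow> counit C (actC c b) = counit C c \<otimes>\<^bsub>S\<^esub> counit B b"
proof -
  let ?M = "\<lparr>carrier = carrier C, mult = undefined, one = undefined,
       zero = \<zero>\<^bsub>C\<^esub>, add = add C, ract = actC\<rparr>"
  have "right_semimodule B ?M"
    and s: "\<forall>s\<in>carrier S. \<forall>c\<in>carrier C. \<forall>b\<in>carrier B.
        actC (s \<odot>\<^bsub>C\<^esub> c) b = s \<odot>\<^bsub>C\<^esub> actC c b \<and> actC c (s \<odot>\<^bsub>B\<^esub> b) = s \<odot>\<^bsub>C\<^esub> actC c b"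
    using semimodule_semicoalgebra by (simp_all add: semimodule_semicoalgebra_def)
  then interpret M: right_semimodule B ?M by simp
  show "c \<in> carrier C \<Longrightarrow> b \<in> carrier B \<Longrightarrow> actC c b \<in> carrier C"
    "\<lbrakk>c \<in> carrier C; b \<in> carrier B; b' \<in> carrier B\<rbrakk> \<Longrightarrow> actC c (b \<otimes>\<^bsub>B\<^esub> b') = actC (actC c b) b'"
    "c \<in> carrier C \<Longrightarrow> actC c \<one>\<^bsub>B\<^esub> = c"
    using M.ract_closed M.ract_assoc M.ract_one by simp_all
  show "b \<in> carrier B \<Longrightarrow> lin C C (\<lambda>c. actC c b)"
    by (rule linI) (use s M.ract_closed M.ract_l_distr M.ract_l_null in simp_all)
  show "c \<in> carrier C \<Longrightarrow> lin B C (actC c)"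
    by (rule linI) (use s M.ract_closed M.ract_r_distr M.ract_r_null in simp_all)
qed (use semimodule_semicoalgebra in \<open>simp_all add: semimodule_semicoalgebra_def\<close>)

lemma lin_act1 [lins]: "b \<in> carrier B \<Longrightarrow> lin P C f \<Longrightarrow> lin P C (\<lambda>p. actC (f p) b)"
  by (rule lin_compose[OF _ lin_act01])

lemma lin_act2 [lins]: "c \<in> carrier C \<Longrightarrow> lin P B f \<Longrightarrow> lin P C (\<lambda>p. actC c (f p))"
  by (rule lin_compose[OF _ lin_act02])

text \<open>Multiplicativity of \<open>\<rho>A\<close> under an arbitrary bilinear \<open>h\<close>.
  The product of \<open>A \<boxtimes> B\<close> is itself a nested lift, and the linear map induced
  by \<open>h\<close> is moved through its two layers.\<close>

lemma rho_mult_lift: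
  assumes "a \<in> carrier A" "a' \<in> carrier A" and [lins]: "smod Z"
    and [lins]: "\<And>b. b \<in> carrier B \<Longrightarrow> lin A Z (\<lambda>a. h a b)" "\<And>a. a \<in> carrier A \<Longrightarrow> lin B Z (h a)"
  shows "tensor_lift Z h (\<rho>A (a \<otimes>\<^bsub>A\<^esub> a')) =
    tensor_lift Z (\<lambda>a0 a1. tensor_lift Z (\<lambda>b0 b1. h (a0 \<otimes>\<^bsub>A\<^esub> b0) (a1 \<otimes>\<^bsub>B\<^esub> b1)) (\<rho>A a')) (\<rho>A a)"
proof -
  have L: "lin (A \<boxtimes> B) Z (tensor_lift Z h)"
    by (rule lin_lift_arg0; intro lins; assumption)
  have "\<rho>A (a \<otimes>\<^bsub>A\<^esub> a') = \<rho>A a \<otimes>\<^bsub>A \<boxtimes> B\<^esub> \<rho>A a'"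
    using rho_hom assms(1,2) by (simp add: ring_hom_def)
  also have "\<dots> = tensor_lift (A \<boxtimes> B) (\<lambda>a0 a1. tensor_lift (A \<boxtimes> B) (\<lambda>b0 b1.
       pure A B (a0 \<otimes>\<^bsub>A\<^esub> b0) (a1 \<otimes>\<^bsub>B\<^esub> b1)) (\<rho>A a')) (\<rho>A a)"
    unfolding lift_stensor[symmetric] by (simp add: stensor_def Let_def)
  finally have "tensor_lift Z h (\<rho>A (a \<otimes>\<^bsub>A\<^esub> a')) = tensor_lift Z h \<dots>"
    by simp
  also have "\<dots> = tensor_lift Z (\<lambda>a0 a1. tensor_lift Z h (tensor_lift (A \<boxtimes> B) (\<lambda>b0 b1.
       pure A B (a0 \<otimes>\<^bsub>A\<^esub> b0) (a1 \<otimes>\<^bsub>B\<^esub> b1)) (\<rho>A a'))) (\<rho>A a)"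
    by (rule lin_lift[OF mem_rho _ _ L]; (assumption | rule lins assms)+)
  also have "\<dots> = tensor_lift Z (\<lambda>a0 a1. tensor_lift Z (\<lambda>b0 b1. h (a0 \<otimes>\<^bsub>A\<^esub> b0) (a1 \<otimes>\<^bsub>B\<^esub> b1)) (\<rho>A a')) (\<rho>A a)"
  proof (rule lift_cong[OF mem_rho[OF assms(1)] smod_A smod_B])
    fix a0 a1 assume a: "a0 \<in> carrier A" "a1 \<in> carrier B"
    have "tensor_lift Z h (tensor_lift (A \<boxtimes> B) (\<lambda>b0 b1. pure A B (a0 \<otimes>\<^bsub>A\<^esub> b0) (a1 \<otimes>\<^bsub>B\<^esub> b1)) (\<rho>A a')) =
       tensor_lift Z (\<lambda>b0 b1. tensor_lift Z h (pure A B (a0 \<otimes>\<^bsub>A\<^esub> b0) (a1 \<otimes>\<^bsub>B\<^esub> b1))) (\<rho>A a')"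
      by (rule lin_lift[OF mem_rho _ _ L]; (assumption | rule lins assms a)+)
    also have "\<dots> = tensor_lift Z (\<lambda>b0 b1. h (a0 \<otimes>\<^bsub>A\<^esub> b0) (a1 \<otimes>\<^bsub>B\<^esub> b1)) (\<rho>A a')"
      by (rule lift_cong[OF mem_rho[OF assms(2)] smod_A smod_B], rule lift_pure;
          (assumption | rule lins assms a)+)
    finally show "tensor_lift Z h (tensor_lift (A \<boxtimes> B) (\<lambda>b0 b1. pure A B (a0 \<otimes>\<^bsub>A\<^esub> b0) (a1 \<otimes>\<^bsub>B\<^esub> b1)) (\<rho>A a'))
      = \<dots>" .
  qed
  finally show ?thesis .
qed

lemma rho_one_lift:
  assumes "smod Z" "\<And>b. b \<in> carrier B \<Longrightarrow> lin A Z (\<lambda>a. h a b)" "\<And>a. a \<in> carrier A \<Longrightarrow> lin B Z (h a)"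
  shows "tensor_lift Z h (\<rho>A \<one>\<^bsub>A\<^esub>) = h \<one>\<^bsub>A\<^esub> \<one>\<^bsub>B\<^esub>"
proof -
  have "\<rho>A \<one>\<^bsub>A\<^esub> = \<one>\<^bsub>A \<boxtimes> B\<^esub>"
    using rho_hom by (simp add: ring_hom_def)
  also have "\<dots> = pure A B \<one>\<^bsub>A\<^esub> \<one>\<^bsub>B\<^esub>"
    by (simp add: stensor_def Let_def)
  finally show ?thesis
    using lift_pure[OF A.one_closed B.one_closed smod_A smod_B assms] by simp
qed

text \<open>The same transport for the compatibility of \<open>comult C\<close> with the action of
  \<open>B\<close>.\<close>

lemma comult_act_lift:
  assumes "c \<in> carrier C" "b \<in> carrier B" and [lins]: "smod Z"
    and [lins]: "\<And>b. b \<in> carrier C \<Longrightarrow> lin C Z (\<lambda>a. h a b)" "\<And>a. a \<in> carrier C \<Longrightarrow> lin C Z (h a)"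
  shows "tensor_lift Z h (comult C (actC c b)) =
    tensor_lift Z (\<lambda>c1 c2. tensor_lift Z (\<lambda>b1 b2. h (actC c1 b1) (actC c2 b2)) (comult B b)) (comult C c)"
proof -
  have L: "lin (C \<boxtimes> C) Z (tensor_lift Z h)"
    by (rule lin_lift_arg0; intro lins; assumption)
  have "tensor_lift Z h (comult C (actC c b)) = tensor_lift Z h (tensor_lift (C \<boxtimes> C) (\<lambda>c1 c2. tensor_lift (C \<boxtimes> C) (\<lambda>b1 b2.
            pure C C (actC c1 b1) (actC c2 b2)) (comult B b)) (comult C c))"
    by (simp add: comult_act assms)
  also have "\<dots> = tensor_lift Z (\<lambda>c1 c2. tensor_lift Z h (tensor_lift (C \<boxtimes> C) (\<lambda>b1 b2.
            pure C C (actC c1 b1) (actC c2 b2)) (comult B b))) (comult C c)"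
    by (rule lin_lift[OF mem_comult _ _ L]; (assumption | rule lins assms)+)
  also have "\<dots> = tensor_lift Z (\<lambda>c1 c2. tensor_lift Z (\<lambda>b1 b2. h (actC c1 b1) (actC c2 b2)) (comult B b)) (comult C c)"
  proof (rule lift_cong[OF mem_comult[OF assms(1)] smod_C smod_C])
    fix c1 c2 assume c: "c1 \<in> carrier C" "c2 \<in> carrier C"
    have "tensor_lift Z h (tensor_lift (C \<boxtimes> C) (\<lambda>b1 b2. pure C C (actC c1 b1) (actC c2 b2)) (comult B b)) =
       tensor_lift Z (\<lambda>b1 b2. tensor_lift Z h (pure C C (actC c1 b1) (actC c2 b2))) (comult B b)"
      by (rule lin_lift[OF mem_comultB _ _ L]; (assumption | rule lins assms c)+)
    also have "\<dots> = tensor_lift Z (\<lambda>b1 b2. h (actC c1 b1) (actC c2 b2)) (comult B b)"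
      by (rule lift_cong[OF mem_comultB[OF assms(2)] smod_B smod_B], rule lift_pure;
          (assumption | rule lins assms c)+)
    finally show "tensor_lift Z h (tensor_lift (C \<boxtimes> C) (\<lambda>b1 b2. pure C C (actC c1 b1) (actC c2 b2)) (comult B b))
      = \<dots>" .
  qed
  finally show ?thesis .
qed

text \<open>The counit laws under a linear \<phi>, so that a comultiplication can be contracted
  inside any expression linear in \<open>c\<close>.\<close>

lemma lin_counit_lift:
  assumes "c \<in> carrier C" "smod Z" "lin C Z \<phi>"
  shows "tensor_lift Z (\<lambda>c1 c2. counit C c1 \<odot>\<^bsub>Z\<^esub> \<phi> c2) (comult C c) = \<phi> c"
    "tensor_lift Z (\<lambda>c1 c2. counit C c2 \<odot>\<^bsub>Z\<^esub> \<phi> c1) (comult C c) = \<phi> c"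
proof -
  have "\<phi> c = tensor_lift Z (\<lambda>c1 c2. \<phi> (counit C c1 \<odot>\<^bsub>C\<^esub> c2)) (comult C c)"
    by (subst (1) counit_C(1)[OF assms(1), symmetric], rule lin_lift[OF mem_comult _ _ assms(3)];
       (assumption | rule lins assms)+)
  also have "\<dots> = tensor_lift Z (\<lambda>c1 c2. counit C c1 \<odot>\<^bsub>Z\<^esub> \<phi> c2) (comult C c)"
    by (rule lift_cong[OF mem_comult _ _ lin_smult[OF assms(3)]]; (assumption | rule lins assms)+)
  finally show "tensor_lift Z (\<lambda>c1 c2. counit C c1 \<odot>\<^bsub>Z\<^esub> \<phi> c2) (comult C c) = \<phi> c" ..
  have "\<phi> c = tensor_lift Z (\<lambda>c1 c2. \<phi> (counit C c2 \<odot>\<^bsub>C\<^esub> c1)) (comult C c)"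
    by (subst (1) counit_C(2)[OF assms(1), symmetric], rule lin_lift[OF mem_comult _ _ assms(3)];
       (assumption | rule lins assms)+)
  also have "\<dots> = tensor_lift Z (\<lambda>c1 c2. counit C c2 \<odot>\<^bsub>Z\<^esub> \<phi> c1) (comult C c)"
    by (rule lift_cong[OF mem_comult _ _ lin_smult[OF assms(3)]]; (assumption | rule lins assms)+)
  finally show "tensor_lift Z (\<lambda>c1 c2. counit C c2 \<odot>\<^bsub>Z\<^esub> \<phi> c1) (comult C c) = \<phi> c" ..
qed

lemma lin_counit_rho_lift:
  assumes "a \<in> carrier A" "smod Z" "lin A Z \<phi>"
  shows "tensor_lift Z (\<lambda>a0 a1. counit B a1 \<odot>\<^bsub>Z\<^esub> \<phi> a0) (\<rho>A a) = \<phi> a"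
proof -
  have "\<phi> a = tensor_lift Z (\<lambda>a0 a1. \<phi> (counit B a1 \<odot>\<^bsub>A\<^esub> a0)) (\<rho>A a)"
    by (subst (1) counit_rho[OF assms(1), symmetric], rule lin_lift[OF mem_rho _ _ assms(3)];
       (assumption | rule lins assms)+)
  also have "\<dots> = tensor_lift Z (\<lambda>a0 a1. counit B a1 \<odot>\<^bsub>Z\<^esub> \<phi> a0) (\<rho>A a)"
    by (rule lift_cong[OF mem_rho _ _ lin_smult[OF assms(3)]]; (assumption | rule lins assms)+)
  finally show ?thesis ..
qed

subsection \<open>The dual\<close>

lemma dual_simps:
  "carrier dual = {f \<in> extensional (carrier C). lin C (scalars S) f}"
  "\<zero>\<^bsub>dual\<^esub> = (\<lambda>c\<in>carrier C. \<zero>\<^bsub>S\<^esub>)"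
  "f \<oplus>\<^bsub>dual\<^esub> g = (\<lambda>c\<in>carrier C. f c \<oplus>\<^bsub>S\<^esub> g c)"
  "s \<odot>\<^bsub>dual\<^esub> f = (\<lambda>c\<in>carrier C. s \<otimes>\<^bsub>S\<^esub> f c)"
  "\<one>\<^bsub>dual\<^esub> = (\<lambda>c\<in>carrier C. counit C c)"
  by (simp_all add: dual_def)

lemma dual_eqI: "f \<in> carrier dual \<Longrightarrow> g \<in> carrier dual \<Longrightarrow> (\<And>c. c \<in> carrier C \<Longrightarrow> ev f c = ev g c) \<Longrightarrow> f = g"
  by (auto simp: dual_simps ev_def intro: extensionalityI)

lemma dualI: "lin C (scalars S) f \<Longrightarrow> (\<lambda>c\<in>carrier C. f c) \<in> carrier dual"
  by (simp add: dual_simps) (rule lin_cong[OF _ smod_C], auto)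

lemma ev_dual [simp]:
  "c \<in> carrier C \<Longrightarrow> ev \<zero>\<^bsub>dual\<^esub> c = \<zero>\<^bsub>S\<^esub>"
  "c \<in> carrier C \<Longrightarrow> ev (f \<oplus>\<^bsub>dual\<^esub> g) c = ev f c \<oplus>\<^bsub>S\<^esub> ev g c"
  "c \<in> carrier C \<Longrightarrow> ev (s \<odot>\<^bsub>dual\<^esub> f) c = s \<otimes>\<^bsub>S\<^esub> ev f c"
  "c \<in> carrier C \<Longrightarrow> ev \<one>\<^bsub>dual\<^esub> c = counit C c"
  "c \<in> carrier C \<Longrightarrow> ev (f \<otimes>\<^bsub>dual\<^esub> g) c = tensor_lift (scalars S) (\<lambda>c1 c2. ev f c1 \<otimes>\<^bsub>S\<^esub> ev g c2) (comult C c)"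
  "c \<in> carrier C \<Longrightarrow> ev (dual_act b f) c = ev f (actC c b)"
  by (simp_all add: dual_simps ev_def dual_def lift_scalars dual_act_def)

lemma mem_ev [lins]: "c \<in> carrier C \<Longrightarrow> f \<in> carrier dual \<Longrightarrow> ev f c \<in> carrier S"
  using lin_closed[of C "scalars S" f c] by (simp add: dual_simps ev_def)

lemma lin_ev2 [lins]: "f \<in> carrier dual \<Longrightarrow> lin P C g \<Longrightarrow> lin P (scalars S) (\<lambda>p. ev f (g p))"
  using lin_compose[of P C g "scalars S" f] by (simp add: dual_simps ev_def)

lemma smod_dual [lins]: "smod dual"
proof -
  have 0: "\<zero>\<^bsub>dual\<^esub> \<in> carrier dual"
    unfolding dual_simps(2) by (rule dualI) (rule linI, simp_all)
  have a: "f \<oplus>\<^bsub>dual\<^esub> g \<in> carrier dual" if [lins]: "f \<in> carrier dual" "g \<in> carrier dual" for f g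
    unfolding dual_simps(3)
  proof (rule dualI, rule linI)
    note l = lin_ev2[OF that(1) lin_id, unfolded ev_def] lin_ev2[OF that(2) lin_id, unfolded ev_def]
    show "f (x \<oplus>\<^bsub>C\<^esub> y) \<oplus>\<^bsub>S\<^esub> g (x \<oplus>\<^bsub>C\<^esub> y) = f x \<oplus>\<^bsub>S\<^esub> g x \<oplus>\<^bsub>scalars S\<^esub> (f y \<oplus>\<^bsub>S\<^esub> g y)"
      if "x \<in> carrier C" "y \<in> carrier C" for x y
      using l[THEN lin_closed] l[THEN lin_add] that by (simp_all add: S.add.m_ac)
    show "f x \<oplus>\<^bsub>S\<^esub> g x \<in> carrier (scalars S)" if "x \<in> carrier C" for x
      using l[THEN lin_closed] that by simp
    show "f \<zero>\<^bsub>C\<^esub> \<oplus>\<^bsub>S\<^esub> g \<zero>\<^bsub>C\<^esub> = \<zero>\<^bsub>scalars S\<^esub>"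
      using l[THEN lin_zero] by simp
    show "f (s \<odot>\<^bsub>C\<^esub> x) \<oplus>\<^bsub>S\<^esub> g (s \<odot>\<^bsub>C\<^esub> x) = s \<odot>\<^bsub>scalars S\<^esub> (f x \<oplus>\<^bsub>S\<^esub> g x)"
      if "s \<in> carrier S" "x \<in> carrier C" for x s
      using l[THEN lin_closed] l[THEN lin_smult] that by (simp add: S.r_distr)
  qed
  have s: "s \<odot>\<^bsub>dual\<^esub> f \<in> carrier dual" if "s \<in> carrier S" "f \<in> carrier dual" for s f
    unfolding dual_simps(4)
    by (rule dualI) (use lin_mult_scalars2[OF that(1) lin_ev2[OF that(2) lin_id]] in \<open>simp add: ev_def\<close>)
  show ?thesis
    by (intro semimodule.intro semimodule_axioms.intro S.semiring_axioms abelian_monoidI)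
      (auto intro!: dual_eqI 0 a s simp: mem_ev S.add.m_ac S.l_distr S.r_distr S.m_assoc)
qed

lemma lin_ev1 [lins]:
  assumes "c \<in> carrier C" "lin P dual F"
  shows "lin P (scalars S) (\<lambda>p. ev (F p) c)"
proof -
  have "lin dual (scalars S) (\<lambda>f. ev f c)"
    by (rule linI) (use assms in \<open>simp_all add: mem_ev\<close>)
  from lin_compose[OF assms(2) this] show ?thesis .
qed

text \<open>The operations of the dual are pointwise, so linearity into it is tested by evaluation;
  this is how convolution and the action of \<open>B\<close> are seen to be linear.\<close>

lemma lin_dualI:
  assumes "smod P" "\<And>p. p \<in> carrier P \<Longrightarrow> F p \<in> carrier dual"
    and "\<And>c. c \<in> carrier C \<Longrightarrow> lin P (scalars S) (\<lambda>p. ev (F p) c)"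
  shows "lin P dual F"
proof (rule linI)
  note cl = smod_zero[OF assms(1)] smod_add[OF assms(1)] semimodule.smult_closed[OF assms(1)]
    smod_zero[OF smod_dual] smod_add[OF smod_dual] semimodule.smult_closed[OF smod_dual]
  show "F \<zero>\<^bsub>P\<^esub> = \<zero>\<^bsub>dual\<^esub>"
    by (rule dual_eqI) (use assms(2) lin_zero[OF assms(3)] cl in simp_all)
  show "F (m \<oplus>\<^bsub>P\<^esub> m') = F m \<oplus>\<^bsub>dual\<^esub> F m'" if "m \<in> carrier P" "m' \<in> carrier P" for m m'
    by (rule dual_eqI) (use assms(2) lin_add[OF assms(3)] cl that in simp_all)
  show "F (s \<odot>\<^bsub>P\<^esub> m) = s \<odot>\<^bsub>dual\<^esub> F m" if "s \<in> carrier S" "m \<in> carrier P" for m s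
    by (rule dual_eqI) (use assms(2) lin_smult[OF assms(3)] cl that in simp_all)
qed (use assms in auto)

lemma mem_one_dual [lins]: "\<one>\<^bsub>dual\<^esub> \<in> carrier dual"
  unfolding dual_simps(5) by (intro dualI lins)

lemma mem_conv [lins]:
  assumes "f \<in> carrier dual" "g \<in> carrier dual"
  shows "f \<otimes>\<^bsub>dual\<^esub> g \<in> carrier dual"
proof -
  have "f \<otimes>\<^bsub>dual\<^esub> g = (\<lambda>c\<in>carrier C. tensor_lift (scalars S) (\<lambda>c1 c2. ev f c1 \<otimes>\<^bsub>S\<^esub> ev g c2) (comult C c))"
    by (simp add: dual_def lift_scalars ev_def)
  also have "\<dots> \<in> carrier dual"
    by (rule dualI) (assumption | rule lins assms)+
  finally show ?thesis .
qed

lemma mem_dual_act [lins]: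
  assumes "b \<in> carrier B" "f \<in> carrier dual"
  shows "dual_act b f \<in> carrier dual"
proof -
  have "dual_act b f = (\<lambda>c\<in>carrier C. ev f (actC c b))"
    by (simp add: dual_act_def ev_def)
  also have "\<dots> \<in> carrier dual"
    by (rule dualI) (assumption | rule lins assms)+
  finally show ?thesis .
qed

lemma lin_conv01: "g \<in> carrier dual \<Longrightarrow> lin dual dual (\<lambda>f. f \<otimes>\<^bsub>dual\<^esub> g)"
  by (rule lin_dualI, rule lins, (rule lins; assumption), simp, (assumption | rule lins)+)

lemma lin_conv02: "g \<in> carrier dual \<Longrightarrow> lin dual dual (\<lambda>f. g \<otimes>\<^bsub>dual\<^esub> f)"
  by (rule lin_dualI, rule lins, (rule lins; assumption), simp, (assumption | rule lins)+)

lemma lin_dual_act01: "f \<in> carrier dual \<Longrightarrow> lin B dual (\<lambda>b. dual_act b f)"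
  by (rule lin_dualI, rule lins, (rule lins; assumption), simp, (assumption | rule lins)+)

lemma lin_dual_act02: "b \<in> carrier B \<Longrightarrow> lin dual dual (\<lambda>f. dual_act b f)"
  by (rule lin_dualI, rule lins, (rule lins; assumption), simp, (assumption | rule lins)+)

lemma lin_conv1 [lins]: "g \<in> carrier dual \<Longrightarrow> lin P dual F \<Longrightarrow> lin P dual (\<lambda>p. F p \<otimes>\<^bsub>dual\<^esub> g)"
  by (rule lin_compose[OF _ lin_conv01])
lemma lin_conv2 [lins]: "g \<in> carrier dual \<Longrightarrow> lin P dual F \<Longrightarrow> lin P dual (\<lambda>p. g \<otimes>\<^bsub>dual\<^esub> F p)"
  by (rule lin_compose[OF _ lin_conv02])
lemma lin_dual_act1 [lins]: "f \<in> carrier dual \<Longrightarrow> lin P B F \<Longrightarrow> lin P dual (\<lambda>p. dual_act (F p) f)"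
  by (rule lin_compose[OF _ lin_dual_act01])
lemma lin_dual_act2 [lins]: "b \<in> carrier B \<Longrightarrow> lin P dual F \<Longrightarrow> lin P dual (\<lambda>p. dual_act b (F p))"
  by (rule lin_compose[OF _ lin_dual_act02])

lemma conv_one:
  assumes [lins]: "f \<in> carrier dual"
  shows "\<one>\<^bsub>dual\<^esub> \<otimes>\<^bsub>dual\<^esub> f = f" "f \<otimes>\<^bsub>dual\<^esub> \<one>\<^bsub>dual\<^esub> = f"
proof -
  have "ev (\<one>\<^bsub>dual\<^esub> \<otimes>\<^bsub>dual\<^esub> f) c = ev f c" if c: "c \<in> carrier C" for c
  proof -
    have "ev (\<one>\<^bsub>dual\<^esub> \<otimes>\<^bsub>dual\<^esub> f) c = tensor_lift (scalars S) (\<lambda>c1 c2. counit C c1 \<odot>\<^bsub>scalars S\<^esub> ev f c2) (comult C c)"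
      by (simp add: c, rule lift_cong[OF mem_comult[OF c] smod_C smod_C]) simp
    then show ?thesis
      using lin_counit_lift(1)[OF c smod_scalars lin_ev2[OF assms lin_id]] by simp
  qed
  then show "\<one>\<^bsub>dual\<^esub> \<otimes>\<^bsub>dual\<^esub> f = f"
    by (intro dual_eqI lins)
  have "ev (f \<otimes>\<^bsub>dual\<^esub> \<one>\<^bsub>dual\<^esub>) c = ev f c" if c: "c \<in> carrier C" for c
  proof -
    have "ev (f \<otimes>\<^bsub>dual\<^esub> \<one>\<^bsub>dual\<^esub>) c = tensor_lift (scalars S) (\<lambda>c1 c2. counit C c2 \<odot>\<^bsub>scalars S\<^esub> ev f c1) (comult C c)"
      by (simp add: c, rule lift_cong[OF mem_comult[OF c] smod_C smod_C]) (simp add: S.m_comm mem_ev mem_counit assms)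
    then show ?thesis
      using lin_counit_lift(2)[OF c smod_scalars lin_ev2[OF assms lin_id]] by simp
  qed
  then show "f \<otimes>\<^bsub>dual\<^esub> \<one>\<^bsub>dual\<^esub> = f"
    by (intro dual_eqI lins)
qed

lemma conv_assoc:
  assumes [lins]: "f \<in> carrier dual" "g \<in> carrier dual" "h \<in> carrier dual"
  shows "f \<otimes>\<^bsub>dual\<^esub> g \<otimes>\<^bsub>dual\<^esub> h = f \<otimes>\<^bsub>dual\<^esub> (g \<otimes>\<^bsub>dual\<^esub> h)"
proof (rule dual_eqI)
  fix c assume c [lins]: "c \<in> carrier C"
  let ?K = "\<lambda>x y z. ev f x \<otimes>\<^bsub>S\<^esub> ev g y \<otimes>\<^bsub>S\<^esub> ev h z"
  have "ev (f \<otimes>\<^bsub>dual\<^esub> g \<otimes>\<^bsub>dual\<^esub> h) c =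
    tensor_lift (scalars S) (\<lambda>c1 c2. tensor_lift (scalars S) (\<lambda>x y. ev f x \<otimes>\<^bsub>S\<^esub> ev g y) (comult C c1) \<otimes>\<^bsub>S\<^esub> ev h c2) (comult C c)"
    by (simp add: c, rule lift_cong[OF mem_comult[OF c] smod_C smod_C]) simp
  also have "\<dots> = tensor_lift (scalars S) (\<lambda>c1 c2. tensor_lift (scalars S) (\<lambda>x y. ?K x y c2) (comult C c1)) (comult C c)"
    by (rule lift_cong[OF mem_comult[OF c] smod_C smod_C],
        rule lin_lift[where \<phi> = "\<lambda>v. v \<otimes>\<^bsub>S\<^esub> ev h d" for d]; (assumption | rule lins)+)
  also have "\<dots> = tensor_lift (scalars S) (\<lambda>c1 c2. tensor_lift (scalars S) (\<lambda>y z. ?K c1 y z) (comult C c2)) (comult C c)"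
    by (rule coassoc_lift[OF coassoc_C lin_comult0 lin_comult0 c]; (assumption | rule lins)+)
  also have "\<dots> = tensor_lift (scalars S) (\<lambda>c1 c2. tensor_lift (scalars S) (\<lambda>y z. ev f c1 \<otimes>\<^bsub>S\<^esub> (ev g y \<otimes>\<^bsub>S\<^esub> ev h z)) (comult C c2)) (comult C c)"
    by (rule lift_cong[OF mem_comult[OF c] smod_C smod_C], rule lift_cong[OF mem_comult _ _];
       (assumption | rule lins S.m_assoc)+)
  also have "\<dots> = tensor_lift (scalars S) (\<lambda>c1 c2. ev f c1 \<otimes>\<^bsub>S\<^esub> tensor_lift (scalars S) (\<lambda>y z. ev g y \<otimes>\<^bsub>S\<^esub> ev h z) (comult C c2)) (comult C c)"
    by (rule lift_cong[OF mem_comult[OF c] smod_C smod_C],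
        rule lin_lift[where \<phi> = "\<lambda>v. ev f d \<otimes>\<^bsub>S\<^esub> v" for d, symmetric]; (assumption | rule lins)+)
  also have "\<dots> = ev (f \<otimes>\<^bsub>dual\<^esub> (g \<otimes>\<^bsub>dual\<^esub> h)) c"
    by (simp add: c, rule lift_cong[OF mem_comult[OF c] smod_C smod_C]) simp
  finally show "ev (f \<otimes>\<^bsub>dual\<^esub> g \<otimes>\<^bsub>dual\<^esub> h) c = ev (f \<otimes>\<^bsub>dual\<^esub> (g \<otimes>\<^bsub>dual\<^esub> h)) c" .
qed (intro lins)+

lemma dual_act_assoc:
  assumes [lins]: "b \<in> carrier B" "b' \<in> carrier B" "f \<in> carrier dual"
  shows "dual_act (b \<otimes>\<^bsub>B\<^esub> b') f = dual_act b (dual_act b' f)"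
  by (rule dual_eqI, (rule lins)+) (simp add: act_assoc mem_act assms)

lemma dual_act_unit: "f \<in> carrier dual \<Longrightarrow> dual_act \<one>\<^bsub>B\<^esub> f = f"
  by (rule dual_eqI) (auto simp: act_one intro!: lins)

lemma dual_act_one: "b \<in> carrier B \<Longrightarrow> dual_act b \<one>\<^bsub>dual\<^esub> = counit B b \<odot>\<^bsub>dual\<^esub> \<one>\<^bsub>dual\<^esub>"
  by (rule dual_eqI) (auto simp: counit_act mem_act mem_counit mem_counitB S.m_comm intro!: lins)

text \<open>Dual to the compatibility of \<open>comult C\<close> with the action: together with
  \<open>dual_act_one\<close> it makes the dual of \<open>C\<close> a left B-semimodule semialgebra.
  Associativity of the smash product rests on it.\<close>

lemma dual_act_conv:
  assumes [lins]: "b \<in> carrier B" "f \<in> carrier dual" "g \<in> carrier dual"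
  shows "dual_act b (f \<otimes>\<^bsub>dual\<^esub> g) = tensor_lift dual (\<lambda>b1 b2. dual_act b1 f \<otimes>\<^bsub>dual\<^esub> dual_act b2 g) (comult B b)"
proof (rule dual_eqI)
  fix c assume c [lins]: "c \<in> carrier C"
  have "ev (dual_act b (f \<otimes>\<^bsub>dual\<^esub> g)) c =
     tensor_lift (scalars S) (\<lambda>c1 c2. ev f c1 \<otimes>\<^bsub>S\<^esub> ev g c2) (comult C (actC c b))"
    by (simp add: c mem_act assms)
  also have "\<dots> = tensor_lift (scalars S) (\<lambda>c1 c2. tensor_lift (scalars S) (\<lambda>b1 b2.
      ev f (actC c1 b1) \<otimes>\<^bsub>S\<^esub> ev g (actC c2 b2)) (comult B b)) (comult C c)"
    by (rule comult_act_lift; (assumption | rule lins)+)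
  also have "\<dots> = tensor_lift (scalars S) (\<lambda>b1 b2. tensor_lift (scalars S) (\<lambda>c1 c2.
      ev f (actC c1 b1) \<otimes>\<^bsub>S\<^esub> ev g (actC c2 b2)) (comult C c)) (comult B b)"
    by (rule lift_swap[OF mem_comult mem_comultB]; (assumption | rule lins)+)
  also have "\<dots> = tensor_lift (scalars S) (\<lambda>b1 b2. ev (dual_act b1 f \<otimes>\<^bsub>dual\<^esub> dual_act b2 g) c) (comult B b)"
    by (rule lift_cong[OF mem_comultB], (assumption | rule lins)+,
        simp add: c, rule lift_cong[OF mem_comult], (assumption | rule lins)+) simp
  also have "\<dots> = ev (tensor_lift dual (\<lambda>b1 b2. dual_act b1 f \<otimes>\<^bsub>dual\<^esub> dual_act b2 g) (comult B b)) c"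
    by (rule lin_lift[where \<phi> = "\<lambda>f. ev f c", symmetric]; (assumption | rule lins)+)
  finally show "ev (dual_act b (f \<otimes>\<^bsub>dual\<^esub> g)) c =
     ev (tensor_lift dual (\<lambda>b1 b2. dual_act b1 f \<otimes>\<^bsub>dual\<^esub> dual_act b2 g) (comult B b)) c" .
qed ((assumption | rule lins)+)

end

subsection \<open>The semiring \<open>A #\<^sup>o\<^sup>p C\<^sup>*\<close>\<close>

context doi_koppinen_setting
begin

abbreviation "AD \<equiv> A \<boxtimes> dual"

lemma smash_simps:
  "carrier smash = carrier AD" "\<zero>\<^bsub>smash\<^esub> = \<zero>\<^bsub>AD\<^esub>" "add smash = add AD"
  "\<one>\<^bsub>smash\<^esub> = hash \<one>\<^bsub>A\<^esub> \<one>\<^bsub>dual\<^esub>"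
  by (simp_all add: smash_def)

lemma lift_smash: "tensor_lift smash = tensor_lift AD"
  by (rule tensor_lift_carrier_cong) (simp_all add: smash_simps)

abbreviation smash_pure_mult :: "'a \<Rightarrow> ('c \<Rightarrow> 's) \<Rightarrow> 'a \<Rightarrow> ('c \<Rightarrow> 's) \<Rightarrow> ('a, 'c \<Rightarrow> 's) tens" where
  "smash_pure_mult a f b g \<equiv>
    tensor_lift AD (\<lambda>a0 a1. hash (a0 \<otimes>\<^bsub>A\<^esub> b) (dual_act a1 g \<otimes>\<^bsub>dual\<^esub> f)) (\<rho>A a)"

lemma smash_mult:
  "x \<otimes>\<^bsub>smash\<^esub> y = tensor_lift AD (\<lambda>a f. tensor_lift AD (smash_pure_mult a f) y) x"
  by (simp add: smash_def)

lemma mem_smash_mult [lins]: "x \<in> carrier AD \<Longrightarrow> y \<in> carrier AD \<Longrightarrow> x \<otimes>\<^bsub>smash\<^esub> y \<in> carrier AD"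
  unfolding smash_mult by (assumption | rule lins)+

lemma lin_smash1 [lins]: "y \<in> carrier AD \<Longrightarrow> lin P AD F \<Longrightarrow> lin P AD (\<lambda>p. F p \<otimes>\<^bsub>smash\<^esub> y)"
  unfolding smash_mult by (assumption | rule lins)+

lemma lin_smash2 [lins]: "x \<in> carrier AD \<Longrightarrow> lin P AD F \<Longrightarrow> lin P AD (\<lambda>p. x \<otimes>\<^bsub>smash\<^esub> F p)"
  unfolding smash_mult by (assumption | rule lins)+

lemma smash_pure:
  assumes [lins]: "a \<in> carrier A" "f \<in> carrier dual" "b \<in> carrier A" "g \<in> carrier dual"
  shows "hash a f \<otimes>\<^bsub>smash\<^esub> hash b g = smash_pure_mult a f b g"
proof -
  have "hash a f \<otimes>\<^bsub>smash\<^esub> hash b g = tensor_lift AD (smash_pure_mult a f) (hash b g)"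
    unfolding smash_mult by (rule lift_pure; (assumption | rule lins)+)
  also have "\<dots> = smash_pure_mult a f b g"
    by (rule lift_pure; (assumption | rule lins)+)
  finally show ?thesis .
qed

text \<open>Both products equal the sum of \<open>a0 b0 d # (a1 b1 h) * (a2 g) * f\<close>, where
  \<open>a0\<close>, \<open>a1\<close>, \<open>a2\<close> are the legs of the iterated coaction. The
  left side needs multiplicativity and coassociativity of \<open>\<rho>A\<close>, the right side
  \<open>dual_act_conv\<close>.\<close>

lemma smash_assoc_pure:
  assumes [lins]: "a \<in> carrier A" "f \<in> carrier dual" "b \<in> carrier A" "g \<in> carrier dual"
    "d \<in> carrier A" "h \<in> carrier dual"
  shows "hash a f \<otimes>\<^bsub>smash\<^esub> hash b g \<otimes>\<^bsub>smash\<^esub> hash d h = hash a f \<otimes>\<^bsub>smash\<^esub> (hash b g \<otimes>\<^bsub>smash\<^esub> hash d h)"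
proof -
  \<comment> \<open>The arguments \<open>x\<close>, \<open>c\<close>, \<open>e\<close> stand for the
    three legs of the iterated coaction of \<open>a\<close>.\<close>
  let ?K = "\<lambda>x c e. tensor_lift AD (\<lambda>b0 b1.
    hash (x \<otimes>\<^bsub>A\<^esub> b0 \<otimes>\<^bsub>A\<^esub> d) (dual_act (c \<otimes>\<^bsub>B\<^esub> b1) h \<otimes>\<^bsub>dual\<^esub> (dual_act e g \<otimes>\<^bsub>dual\<^esub> f))) (\<rho>A b)"
  have "hash a f \<otimes>\<^bsub>smash\<^esub> hash b g \<otimes>\<^bsub>smash\<^esub> hash d h =
    tensor_lift AD (\<lambda>a0 a1. hash (a0 \<otimes>\<^bsub>A\<^esub> b) (dual_act a1 g \<otimes>\<^bsub>dual\<^esub> f) \<otimes>\<^bsub>smash\<^esub> hash d h) (\<rho>A a)"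
    unfolding smash_pure[OF assms(1-4)]
    by (rule lin_lift[where \<phi> = "\<lambda>x. x \<otimes>\<^bsub>smash\<^esub> hash d h"]; (assumption | rule lins)+)
  also have "\<dots> = tensor_lift AD (\<lambda>a0 a1. tensor_lift AD (\<lambda>x c. ?K x c a1) (\<rho>A a0)) (\<rho>A a)"
    by (rule lift_cong[OF mem_rho[OF assms(1)] smod_A smod_B], subst smash_pure, (assumption | rule lins)+,
        rule rho_mult_lift; (assumption | rule lins)+)
  also have "\<dots> = tensor_lift AD (\<lambda>a0 a1. tensor_lift AD (?K a0) (comult B a1)) (\<rho>A a)"
    by (rule coassoc_lift[OF coassoc_rho lin_rho0 lin_comultB0]; (assumption | rule lins)+)
  also have "\<dots> = tensor_lift AD (\<lambda>a0 a1. tensor_lift AD (\<lambda>b0 b1. tensor_lift AD (\<lambda>c e.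
      hash (a0 \<otimes>\<^bsub>A\<^esub> b0 \<otimes>\<^bsub>A\<^esub> d) (dual_act (c \<otimes>\<^bsub>B\<^esub> b1) h \<otimes>\<^bsub>dual\<^esub> (dual_act e g \<otimes>\<^bsub>dual\<^esub> f)))
      (comult B a1)) (\<rho>A b)) (\<rho>A a)"
    by (rule lift_cong[OF mem_rho[OF assms(1)] smod_A smod_B], rule lift_swap; (assumption | rule lins)+)
  also have "\<dots> = tensor_lift AD (\<lambda>b0 b1. tensor_lift AD (\<lambda>a0 a1. tensor_lift AD (\<lambda>c e.
      hash (a0 \<otimes>\<^bsub>A\<^esub> b0 \<otimes>\<^bsub>A\<^esub> d) (dual_act (c \<otimes>\<^bsub>B\<^esub> b1) h \<otimes>\<^bsub>dual\<^esub> (dual_act e g \<otimes>\<^bsub>dual\<^esub> f)))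
      (comult B a1)) (\<rho>A a)) (\<rho>A b)"
    by (rule lift_swap; (assumption | rule lins)+)
  also have "\<dots> = tensor_lift AD (\<lambda>b0 b1. tensor_lift AD (\<lambda>a0 a1.
      hash (a0 \<otimes>\<^bsub>A\<^esub> (b0 \<otimes>\<^bsub>A\<^esub> d)) (dual_act a1 (dual_act b1 h \<otimes>\<^bsub>dual\<^esub> g) \<otimes>\<^bsub>dual\<^esub> f)) (\<rho>A a)) (\<rho>A b)"
  proof (rule lift_cong[OF mem_rho[OF assms(3)] smod_A smod_B], rule lift_cong[OF mem_rho[OF assms(1)] smod_A smod_B])
    fix b0 b1 a0 a1 assume x [lins]: "b0 \<in> carrier A" "b1 \<in> carrier B" "a0 \<in> carrier A" "a1 \<in> carrier B"
    have "tensor_lift AD (\<lambda>c e.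
      hash (a0 \<otimes>\<^bsub>A\<^esub> b0 \<otimes>\<^bsub>A\<^esub> d) (dual_act (c \<otimes>\<^bsub>B\<^esub> b1) h \<otimes>\<^bsub>dual\<^esub> (dual_act e g \<otimes>\<^bsub>dual\<^esub> f))) (comult B a1) =
      tensor_lift AD (\<lambda>c e. hash (a0 \<otimes>\<^bsub>A\<^esub> (b0 \<otimes>\<^bsub>A\<^esub> d))
        (dual_act c (dual_act b1 h) \<otimes>\<^bsub>dual\<^esub> dual_act e g \<otimes>\<^bsub>dual\<^esub> f)) (comult B a1)"
      by (rule lift_cong, (assumption | rule lins)+)
        (simp add: dual_act_assoc conv_assoc A.m_assoc mem_dual_act x assms)
    also have "\<dots> = hash (a0 \<otimes>\<^bsub>A\<^esub> (b0 \<otimes>\<^bsub>A\<^esub> d))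
       (tensor_lift dual (\<lambda>c e. dual_act c (dual_act b1 h) \<otimes>\<^bsub>dual\<^esub> dual_act e g) (comult B a1) \<otimes>\<^bsub>dual\<^esub> f)"
      by (rule lin_lift[where \<phi> = "\<lambda>k. hash (a0 \<otimes>\<^bsub>A\<^esub> (b0 \<otimes>\<^bsub>A\<^esub> d)) (k \<otimes>\<^bsub>dual\<^esub> f)", symmetric];
          (assumption | rule lins)+)
    also have "\<dots> = hash (a0 \<otimes>\<^bsub>A\<^esub> (b0 \<otimes>\<^bsub>A\<^esub> d)) (dual_act a1 (dual_act b1 h \<otimes>\<^bsub>dual\<^esub> g) \<otimes>\<^bsub>dual\<^esub> f)"
      by (subst dual_act_conv; (assumption | rule lins HOL.refl)+)
    finally show "tensor_lift AD (\<lambda>c e.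
      hash (a0 \<otimes>\<^bsub>A\<^esub> b0 \<otimes>\<^bsub>A\<^esub> d) (dual_act (c \<otimes>\<^bsub>B\<^esub> b1) h \<otimes>\<^bsub>dual\<^esub> (dual_act e g \<otimes>\<^bsub>dual\<^esub> f))) (comult B a1) = \<dots>" .
  qed
  also have "\<dots> = tensor_lift AD (\<lambda>b0 b1. hash a f \<otimes>\<^bsub>smash\<^esub> hash (b0 \<otimes>\<^bsub>A\<^esub> d) (dual_act b1 h \<otimes>\<^bsub>dual\<^esub> g)) (\<rho>A b)"
    by (rule lift_cong[OF mem_rho[OF assms(3)] smod_A smod_B], rule smash_pure[symmetric]; (assumption | rule lins)+)
  also have "\<dots> = hash a f \<otimes>\<^bsub>smash\<^esub> (hash b g \<otimes>\<^bsub>smash\<^esub> hash d h)"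
    unfolding smash_pure[OF assms(3-6)]
    by (rule lin_lift[where \<phi> = "\<lambda>x. hash a f \<otimes>\<^bsub>smash\<^esub> x", symmetric]; (assumption | rule lins)+)
  finally show ?thesis .
qed

lemma lin_eqI2:
  assumes "x \<in> carrier (M \<boxtimes> N)" "y \<in> carrier (M' \<boxtimes> N')" "smod M" "smod N" "smod M'" "smod N'" "smod Z"
    and "\<And>y. y \<in> carrier (M' \<boxtimes> N') \<Longrightarrow> lin (M \<boxtimes> N) Z (\<lambda>x. f x y)" "\<And>x. x \<in> carrier (M \<boxtimes> N) \<Longrightarrow> lin (M' \<boxtimes> N') Z (f x)"
    and "\<And>y. y \<in> carrier (M' \<boxtimes> N') \<Longrightarrow> lin (M \<boxtimes> N) Z (\<lambda>x. g x y)" "\<And>x. x \<in> carrier (M \<boxtimes> N) \<Longrightarrow> lin (M' \<boxtimes> N') Z (g x)"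
    and "\<And>m n m' n'. \<lbrakk>m \<in> carrier M; n \<in> carrier N; m' \<in> carrier M'; n' \<in> carrier N'\<rbrakk> \<Longrightarrow>
      f (pure M N m n) (pure M' N' m' n') = g (pure M N m n) (pure M' N' m' n')"
  shows "f x y = g x y"
proof (rule lin_eqI[OF assms(1,3,4,7) assms(8)[OF assms(2)] assms(10)[OF assms(2)]])
  fix m n assume m: "m \<in> carrier M" "n \<in> carrier N"
  then have p: "pure M N m n \<in> carrier (M \<boxtimes> N)"
    using assms by (intro mem_pure)
  show "f (pure M N m n) y = g (pure M N m n) y"
    by (rule lin_eqI[OF assms(2,5,6,7) assms(9)[OF p] assms(11)[OF p]]) (use assms(12) m in auto)
qed

lemma smash_assoc:
  assumes [lins]: "x \<in> carrier AD" "y \<in> carrier AD" "z \<in> carrier AD"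
  shows "x \<otimes>\<^bsub>smash\<^esub> y \<otimes>\<^bsub>smash\<^esub> z = x \<otimes>\<^bsub>smash\<^esub> (y \<otimes>\<^bsub>smash\<^esub> z)"
proof (rule lin_eqI[where f = "\<lambda>x. x \<otimes>\<^bsub>smash\<^esub> y \<otimes>\<^bsub>smash\<^esub> z" and x = x])
  fix m n assume mn [lins]: "m \<in> carrier A" "n \<in> carrier dual"
  show "hash m n \<otimes>\<^bsub>smash\<^esub> y \<otimes>\<^bsub>smash\<^esub> z = hash m n \<otimes>\<^bsub>smash\<^esub> (y \<otimes>\<^bsub>smash\<^esub> z)"
    by (rule lin_eqI2[where f = "\<lambda>y z. hash m n \<otimes>\<^bsub>smash\<^esub> y \<otimes>\<^bsub>smash\<^esub> z" and x = y and y = z,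
          OF assms(2,3) smod_A smod_dual smod_A smod_dual];
        (assumption | rule lins smash_assoc_pure)+)
qed (assumption | rule lins)+

text \<open>An element of \<open>B\<close> acts on the unit of the dual through its counit, which
  collapses \<open>\<rho>A a\<close> to \<open>a\<close>. Right multiplication by
  \<open>hash b \<one>\<close> is thus the right A-action, and restriction along it defines
  \<open>over_A\<close>.\<close>

lemma smash_pure_one_right:
  assumes [lins]: "a \<in> carrier A" "f \<in> carrier dual" "b \<in> carrier A"
  shows "hash a f \<otimes>\<^bsub>smash\<^esub> hash b \<one>\<^bsub>dual\<^esub> = hash (a \<otimes>\<^bsub>A\<^esub> b) f"
proof -
  have "hash a f \<otimes>\<^bsub>smash\<^esub> hash b \<one>\<^bsub>dual\<^esub> =
      tensor_lift AD (\<lambda>a0 a1. counit B a1 \<odot>\<^bsub>AD\<^esub> hash (a0 \<otimes>\<^bsub>A\<^esub> b) f) (\<rho>A a)"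
  proof (subst smash_pure, (assumption | rule lins)+, rule lift_cong, (assumption | rule lins)+)
    fix a0 a1 assume a [lins]: "a0 \<in> carrier A" "a1 \<in> carrier B"
    have "dual_act a1 \<one>\<^bsub>dual\<^esub> \<otimes>\<^bsub>dual\<^esub> f = counit B a1 \<odot>\<^bsub>dual\<^esub> (\<one>\<^bsub>dual\<^esub> \<otimes>\<^bsub>dual\<^esub> f)"
      using lin_smult[OF lin_conv01[OF assms(2)] mem_counitB[OF a(2)] mem_one_dual] a by (simp add: dual_act_one)
    then show "hash (a0 \<otimes>\<^bsub>A\<^esub> b) (dual_act a1 \<one>\<^bsub>dual\<^esub> \<otimes>\<^bsub>dual\<^esub> f) = counit B a1 \<odot>\<^bsub>AD\<^esub> hash (a0 \<otimes>\<^bsub>A\<^esub> b) f"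
      using a assms by (simp add: conv_one pure_smult_right smod_A smod_dual mem_counitB)
  qed
  also have "\<dots> = hash (a \<otimes>\<^bsub>A\<^esub> b) f"
    by (rule lin_counit_rho_lift; (assumption | rule lins)+)
  finally show ?thesis .
qed

text \<open>Here \<open>\<rho>A\<close> is applied to the unit only, so no action of
  \<open>B\<close> remains. At \<open>b = 1\<close> the product is the opposite convolution.\<close>

lemma smash_pure_one_left:
  assumes [lins]: "f \<in> carrier dual" "b \<in> carrier A" "g \<in> carrier dual"
  shows "hash \<one>\<^bsub>A\<^esub> f \<otimes>\<^bsub>smash\<^esub> hash b g = hash b (g \<otimes>\<^bsub>dual\<^esub> f)"
proof -
  note [lins] = A.one_closed B.one_closed
  have "hash \<one>\<^bsub>A\<^esub> f \<otimes>\<^bsub>smash\<^esub> hash b g = hash (\<one>\<^bsub>A\<^esub> \<otimes>\<^bsub>A\<^esub> b) (dual_act \<one>\<^bsub>B\<^esub> g \<otimes>\<^bsub>dual\<^esub> f)"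
    by (subst smash_pure, (assumption | rule lins)+, rule rho_one_lift; (assumption | rule lins)+)
  then show ?thesis
    using assms by (simp add: dual_act_unit)
qed

lemma smash_one:
  assumes "x \<in> carrier AD"
  shows "hash \<one>\<^bsub>A\<^esub> \<one>\<^bsub>dual\<^esub> \<otimes>\<^bsub>smash\<^esub> x = x" "x \<otimes>\<^bsub>smash\<^esub> hash \<one>\<^bsub>A\<^esub> \<one>\<^bsub>dual\<^esub> = x"
proof -
  note [lins] = A.one_closed
  have 1: "hash \<one>\<^bsub>A\<^esub> \<one>\<^bsub>dual\<^esub> \<otimes>\<^bsub>smash\<^esub> hash b g = hash b g"
    "hash b g \<otimes>\<^bsub>smash\<^esub> hash \<one>\<^bsub>A\<^esub> \<one>\<^bsub>dual\<^esub> = hash b g" if "b \<in> carrier A" "g \<in> carrier dual" for b g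
    using that by (simp_all add: smash_pure_one_left smash_pure_one_right conv_one mem_one_dual)
  show "hash \<one>\<^bsub>A\<^esub> \<one>\<^bsub>dual\<^esub> \<otimes>\<^bsub>smash\<^esub> x = x"
    by (rule lin_eqI[where f = "\<lambda>x. hash \<one>\<^bsub>A\<^esub> \<one>\<^bsub>dual\<^esub> \<otimes>\<^bsub>smash\<^esub> x" and g = "\<lambda>x. x", OF assms];
        (assumption | rule lins 1)+)
  show "x \<otimes>\<^bsub>smash\<^esub> hash \<one>\<^bsub>A\<^esub> \<one>\<^bsub>dual\<^esub> = x"
    by (rule lin_eqI[where f = "\<lambda>x. x \<otimes>\<^bsub>smash\<^esub> hash \<one>\<^bsub>A\<^esub> \<one>\<^bsub>dual\<^esub>" and g = "\<lambda>x. x", OF assms];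
        (assumption | rule lins 1)+)
qed

lemma semiring_smash: "semiring smash"
proof (intro semiring.intro semiring_axioms.intro)
  show "abelian_monoid smash"
    by (rule abelian_monoid_carrier_cong[OF abelian_stensor[OF smod_A smod_dual]]) (simp_all add: smash_simps)
  show "Group.monoid smash"
    by (rule monoidI) (auto simp: smash_simps smash_assoc smash_one A.one_closed intro!: lins)
qed (simp_all add: smash_simps lin_add[OF lin_smash1[OF _ lin_id]] lin_add[OF lin_smash2[OF _ lin_id]]
    lin_zero[OF lin_smash1[OF _ lin_id]] lin_zero[OF lin_smash2[OF _ lin_id]])

text \<open>A smash product action can be prescribed on generators: \<open>act z a f\<close> is
  trilinear, and by linearity associativity is tested on pure tensors. \<open>Z\<close> provides the
  S-semimodule and \<open>N\<close> the record under construction. Used for Doi-Koppinen semimodules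
  and for \<open>M \<otimes> C\<close>.\<close>

lemma smash_moduleI:
  fixes N :: "('z, ('a, 'c \<Rightarrow> 's) tens, 'y) rmodule_scheme" and Z :: "('s, 'z, 'w) module_scheme"
  assumes [lins]: "smod Z" and N: "carrier N = carrier Z" "add N = add Z" "\<zero>\<^bsub>N\<^esub> = \<zero>\<^bsub>Z\<^esub>"
    and l [lins]: "\<And>a f. a \<in> carrier A \<Longrightarrow> f \<in> carrier dual \<Longrightarrow> lin Z Z (\<lambda>z. act z a f)"
      "\<And>z f. z \<in> carrier Z \<Longrightarrow> f \<in> carrier dual \<Longrightarrow> lin A Z (\<lambda>a. act z a f)"
      "\<And>z a. z \<in> carrier Z \<Longrightarrow> a \<in> carrier A \<Longrightarrow> lin dual Z (act z a)"
    and ract: "\<And>z t. z \<in> carrier Z \<Longrightarrow> t \<in> carrier AD \<Longrightarrow> z \<star>\<^bsub>N\<^esub> t = tensor_lift Z (act z) t"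
    and assoc: "\<And>z a f b g. \<lbrakk>z \<in> carrier Z; a \<in> carrier A; f \<in> carrier dual; b \<in> carrier A; g \<in> carrier dual\<rbrakk> \<Longrightarrow>
      act (act z a f) b g =
        tensor_lift Z (\<lambda>a0 a1. act z (a0 \<otimes>\<^bsub>A\<^esub> b) (dual_act a1 g \<otimes>\<^bsub>dual\<^esub> f)) (\<rho>A a)"
    and one: "\<And>z. z \<in> carrier Z \<Longrightarrow> act z \<one>\<^bsub>A\<^esub> \<one>\<^bsub>dual\<^esub> = z"
  shows "right_semimodule smash N"
proof -
  define R where "R z t = tensor_lift Z (act z) t" for z t
  have memact [lins]: "\<And>z a f. \<lbrakk>z \<in> carrier Z; a \<in> carrier A; f \<in> carrier dual\<rbrakk> \<Longrightarrow> act z a f \<in> carrier Z"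
    using l(1)[THEN lin_closed] by blast
  have l1: "lin P Z (\<lambda>p. act (F p) a f)" if "lin P Z F" "a \<in> carrier A" "f \<in> carrier dual" for P :: "('s, 'p, 'q) module_scheme" and F a f
    by (rule lin_compose[OF that(1) l(1)[OF that(2,3)]])
  have l23: "lin AD Z (R z)" if "z \<in> carrier Z" for z
    unfolding R_def by (rule lin_lift_arg0; (assumption | rule lins that)+)
  have l12: "lin Z Z (\<lambda>z. R z t)" if "t \<in> carrier AD" for t
    unfolding R_def by (rule lin_lift_par[OF that]; (assumption | rule lins)+)
  have l2 [lins]: "lin P Z (\<lambda>p. R z (F p))" if "z \<in> carrier Z" "lin P AD F" for P :: "('s, 'p, 'q) module_scheme" and F z
    by (rule lin_compose[OF that(2) l23[OF that(1)]])
  have l1 [lins]: "lin P Z (\<lambda>p. R (F p) t)" if "t \<in> carrier AD" "lin P Z F" for P :: "('s, 'p, 'q) module_scheme" and F t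
    by (rule lin_compose[OF that(2) l12[OF that(1)]])
  have mem [lins]: "R z t \<in> carrier Z" if "z \<in> carrier Z" "t \<in> carrier AD" for z t
    by (rule lin_closed[OF l23]) fact+
  have pure: "R z (hash a f) = act z a f" if "z \<in> carrier Z" "a \<in> carrier A" "f \<in> carrier dual" for z a f
    unfolding R_def by (rule lift_pure; (assumption | rule lins that)+)
  have as: "R z (t \<otimes>\<^bsub>smash\<^esub> u) = R (R z t) u" if [lins]: "z \<in> carrier Z" "t \<in> carrier AD" "u \<in> carrier AD" for z t u
  proof (rule lin_eqI2[where f = "\<lambda>t u. R z (t \<otimes>\<^bsub>smash\<^esub> u)", OF that(2,3)])
    fix a f b g assume x [lins]: "a \<in> carrier A" "f \<in> carrier dual" "b \<in> carrier A" "g \<in> carrier dual"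
    have "R z (hash a f \<otimes>\<^bsub>smash\<^esub> hash b g) =
        tensor_lift Z (\<lambda>a0 a1. R z (hash (a0 \<otimes>\<^bsub>A\<^esub> b) (dual_act a1 g \<otimes>\<^bsub>dual\<^esub> f))) (\<rho>A a)"
      unfolding smash_pure[OF x] by (rule lin_lift; (assumption | rule lins)+)
    also have "\<dots> = tensor_lift Z (\<lambda>a0 a1. act z (a0 \<otimes>\<^bsub>A\<^esub> b) (dual_act a1 g \<otimes>\<^bsub>dual\<^esub> f)) (\<rho>A a)"
      by (rule lift_cong[OF mem_rho], (assumption | rule lins)+, rule pure; (assumption | rule lins)+)
    also have "\<dots> = R (R z (hash a f)) (hash b g)"
      using assoc[OF that(1) x] x that(1) by (simp add: pure memact)
    finally show "R z (hash a f \<otimes>\<^bsub>smash\<^esub> hash b g) = R (R z (hash a f)) (hash b g)" .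
  qed (assumption | rule lins)+
  have N': "z \<star>\<^bsub>N\<^esub> t = R z t" if "z \<in> carrier Z" "t \<in> carrier AD" for z t
    using ract[OF that] by (simp add: R_def)
  note ms = lin_closed[OF lin_id] smod_zero[OF \<open>smod Z\<close>] smod_add[OF \<open>smod Z\<close>]
    smod_zero[OF smod_stensor[OF smod_A smod_dual]] smod_add[OF smod_stensor[OF smod_A smod_dual]]
  show ?thesis
    by (intro right_semimodule.intro right_semimodule_axioms.intro semiring_smash
        abelian_monoid_carrier_cong[OF smod_abelian[OF \<open>smod Z\<close>]])
      (simp_all add: N N' smash_simps mem ms lin_add[OF l23] lin_add[OF l12] lin_zero[OF l23] lin_zero[OF l12]
        as mem_smash_mult mem_pure A.one_closed mem_one_dual smod_A smod_dual pure one)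
qed

subsection \<open>Right semimodules over \<open>A\<close>\<close>

abbreviation "amod M \<equiv> right_semimodule A M"

lemma over_S_simps [simp]:
  "carrier (over_S M) = carrier M" "\<zero>\<^bsub>over_S M\<^esub> = \<zero>\<^bsub>M\<^esub>" "add (over_S M) = add M"
  by (simp_all add: over_S_def)

lemma lift_over_S: "tensor_lift M = tensor_lift (over_S M)" for M :: "('m, 'a, 'y) rmodule_scheme"
  by (rule tensor_lift_carrier_cong) simp_all

lemma smult_over_S: "s \<odot>\<^bsub>over_S M\<^esub> m = m \<star>\<^bsub>M\<^esub> (s \<odot>\<^bsub>A\<^esub> \<one>\<^bsub>A\<^esub>)"
  by (simp add: over_S_def)

lemma scalar_central:
  assumes "s \<in> carrier S" "a \<in> carrier A"
  shows "s \<odot>\<^bsub>A\<^esub> \<one>\<^bsub>A\<^esub> \<otimes>\<^bsub>A\<^esub> a = s \<odot>\<^bsub>A\<^esub> a" "a \<otimes>\<^bsub>A\<^esub> (s \<odot>\<^bsub>A\<^esub> \<one>\<^bsub>A\<^esub>) = s \<odot>\<^bsub>A\<^esub> a"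
  using alg_A(1)[OF assms(1) A.one_closed assms(2)] alg_A(2)[OF assms A.one_closed] assms
  by simp_all

text \<open>Scalars act through the central elements \<open>s 1\<close>. A right action reverses
  their order, and commutativity of \<open>S\<close> restores it.\<close>

lemma smod_over_S [lins]:
  assumes "amod M"
  shows "smod (over_S M)"
proof -
  interpret M: right_semimodule A M by fact
  note c = semimodule.smult_closed[OF smod_A]
  have "m \<star>\<^bsub>M\<^esub> (r \<otimes>\<^bsub>S\<^esub> r' \<odot>\<^bsub>A\<^esub> \<one>\<^bsub>A\<^esub>) = m \<star>\<^bsub>M\<^esub> (r' \<odot>\<^bsub>A\<^esub> \<one>\<^bsub>A\<^esub>) \<star>\<^bsub>M\<^esub> (r \<odot>\<^bsub>A\<^esub> \<one>\<^bsub>A\<^esub>)"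
    if "r \<in> carrier S" "r' \<in> carrier S" "m \<in> carrier M" for r r' m
    using that by (simp add: c scalar_central semimodule.smult_assoc[OF smod_A] smult_left_commute[OF smod_A, of _ r]
        flip: M.ract_assoc)
  then show ?thesis
    by (intro semimodule.intro semimodule_axioms.intro S.semiring_axioms
        abelian_monoid_carrier_cong[OF M.M.abelian_monoid_axioms])
      (simp_all add: smult_over_S c M.ract_closed M.ract_l_distr M.ract_r_distr M.ract_one M.ract_l_null
        M.ract_r_null semimodule.smult_l_distr[OF smod_A] semimodule.smult_one[OF smod_A]
        semimodule.smult_l_null[OF smod_A])
qed

lemma mem_ract [lins]: "amod M \<Longrightarrow> m \<in> carrier M \<Longrightarrow> a \<in> carrier A \<Longrightarrow> m \<star>\<^bsub>M\<^esub> a \<in> carrier M"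
  by (rule right_semimodule.ract_closed)

lemma mem_over_S [lins]: "m \<in> carrier M \<Longrightarrow> m \<in> carrier (over_S M)"
  by simp

lemma lin_ract01:
  assumes "amod M" "a \<in> carrier A"
  shows "lin (over_S M) (over_S M) (\<lambda>m. m \<star>\<^bsub>M\<^esub> a)"
proof -
  interpret M: right_semimodule A M by fact
  show ?thesis
    by (rule linI)
      (use assms(2) in \<open>simp_all add: smult_over_S semimodule.smult_closed[OF smod_A] M.ract_closed M.ract_l_distr M.ract_l_null
        scalar_central flip: M.ract_assoc\<close>)
qed

lemma lin_ract02:
  assumes "amod M" "m \<in> carrier M"
  shows "lin A (over_S M) (\<lambda>a. m \<star>\<^bsub>M\<^esub> a)"
proof -
  interpret M: right_semimodule A M by fact
  show ?thesis
    by (rule linI)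
      (use assms(2) in \<open>simp_all add: smult_over_S semimodule.smult_closed[OF smod_A] M.ract_closed M.ract_r_distr M.ract_r_null
        scalar_central flip: M.ract_assoc\<close>)
qed

lemma lin_ract1 [lins]:
  "amod M \<Longrightarrow> a \<in> carrier A \<Longrightarrow> lin P (over_S M) F \<Longrightarrow> lin P (over_S M) (\<lambda>p. F p \<star>\<^bsub>M\<^esub> a)"
  by (rule lin_compose[OF _ lin_ract01])

lemma lin_ract2 [lins]:
  "amod M \<Longrightarrow> m \<in> carrier M \<Longrightarrow> lin P A F \<Longrightarrow> lin P (over_S M) (\<lambda>p. m \<star>\<^bsub>M\<^esub> F p)"
  by (rule lin_compose[OF _ lin_ract02])

text \<open>\<open>S\<close> acts through \<open>A\<close>, so A-linearity contains
  S-linearity.\<close>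

lemma right_linear_lin:
  "right_linear A M N \<phi> \<Longrightarrow> lin (over_S M) (over_S N) \<phi>"
  by (auto simp: right_linear_def left_linear_def additive_map_def smult_over_S semimodule.smult_closed[OF smod_A])

end

section \<open>Functoriality of the tensor product in its first factor\<close>

context commutative_semiring
begin

definition tmap :: "('s, 'n, 'y) module_scheme \<Rightarrow> ('s, 'c, 'z) module_scheme \<Rightarrow> ('m \<Rightarrow> 'n) \<Rightarrow> ('m, 'c) tens \<Rightarrow> ('n, 'c) tens"
  where "tmap N C \<phi> = tensor_lift (N \<boxtimes> C) (\<lambda>m c. pure N C (\<phi> m) c)"

lemma lin_tmap:
  assumes [lins]: "smod M" "smod N" "smod C" and \<phi>: "lin M N \<phi>"
  shows "lin (M \<boxtimes> C) (N \<boxtimes> C) (tmap N C \<phi>)"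
  unfolding tmap_def by (rule lin_lift_arg0; (assumption | rule lins \<phi> lin_closed[OF \<phi>])+)

lemma tmap_pure:
  assumes [lins]: "smod M" "smod N" "smod C" and \<phi>: "lin M N \<phi>" and "m \<in> carrier M" "c \<in> carrier C"
  shows "tmap N C \<phi> (pure M C m c) = pure N C (\<phi> m) c"
  unfolding tmap_def by (rule lift_pure; (assumption | rule lins \<phi> lin_closed[OF \<phi>] assms)+)

lemma tmap_tmap:
  assumes [lins]: "smod M" "smod N" "smod C" "smod L" and \<phi>: "lin M N \<phi>" and \<psi>: "lin N L \<psi>"
    and id: "\<And>m. m \<in> carrier M \<Longrightarrow> \<psi> (\<phi> m) = \<chi> m" and z: "z \<in> carrier (M \<boxtimes> C)"
  shows "tmap L C \<psi> (tmap N C \<phi> z) = tmap L C \<chi> z"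
proof -
  have \<chi>: "lin M L \<chi>"
    by (rule lin_cong[OF lin_compose[OF \<phi> \<psi>]]) (use assms in auto)
  show ?thesis
    by (rule lin_eqI[where f = "\<lambda>z. tmap L C \<psi> (tmap N C \<phi> z)", OF z _ _ _ lin_compose[OF lin_tmap lin_tmap] lin_tmap],
        (assumption | rule lins \<phi> \<psi> \<chi>)+)
      (simp add: tmap_pure[OF _ _ _ \<phi>] tmap_pure[OF _ _ _ \<psi>] tmap_pure[OF _ _ _ \<chi>] assms lin_closed[OF \<phi>])
qed

lemma tmap_id:
  assumes "smod M" "smod C" "z \<in> carrier (M \<boxtimes> C)"
  shows "tmap M C (\<lambda>m. m) z = z"
  unfolding tmap_def by (rule lift_pure_id) (use assms in auto)

lemma stensor_agree:
  assumes "carrier M = carrier M'" "add M = add M'" "\<zero>\<^bsub>M\<^esub> = \<zero>\<^bsub>M'\<^esub>"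
    and "\<And>s m. m \<in> carrier M' \<Longrightarrow> s \<in> carrier S \<Longrightarrow> s \<odot>\<^bsub>M\<^esub> m = s \<odot>\<^bsub>M'\<^esub> m"
  shows "carrier (M \<boxtimes> N) = carrier (M' \<boxtimes> N)" "\<zero>\<^bsub>M \<boxtimes> N\<^esub> = \<zero>\<^bsub>M' \<boxtimes> N\<^esub>" "add (M \<boxtimes> N) = add (M' \<boxtimes> N)"
    "pure M N = pure M' N" "tensor_lift (M \<boxtimes> N) = tensor_lift (M' \<boxtimes> N)"
proof -
  have "tensor_cong S M (\<lambda>m s. s \<odot>\<^bsub>M\<^esub> m) N (lact N) = tensor_cong S M' (\<lambda>m s. s \<odot>\<^bsub>M'\<^esub> m) N (lact N)"
    by (rule tensor_cong_agree) (use assms in auto)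
  then have "tensor_class S M (\<lambda>m s. s \<odot>\<^bsub>M\<^esub> m) N (lact N) = tensor_class S M' (\<lambda>m s. s \<odot>\<^bsub>M'\<^esub> m) N (lact N)"
    by (simp add: tensor_class_def fun_eq_iff)
  then show e: "carrier (M \<boxtimes> N) = carrier (M' \<boxtimes> N)" "\<zero>\<^bsub>M \<boxtimes> N\<^esub> = \<zero>\<^bsub>M' \<boxtimes> N\<^esub>" "add (M \<boxtimes> N) = add (M' \<boxtimes> N)"
    "pure M N = pure M' N"
    by (simp_all add: stensor_simps tensor_def assms(1) pure_tensor_def fun_eq_iff)
  show "tensor_lift (M \<boxtimes> N) = tensor_lift (M' \<boxtimes> N)"
    by (rule tensor_lift_carrier_cong) (use e in auto)
qed

end

context doi_koppinen_setting
begin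

subsection \<open>Comparison of \<open>M \<otimes>\<^sub>A (A \<otimes>\<^sub>S C)\<close> with \<open>M \<otimes>\<^sub>S C\<close>\<close>

definition pairing :: "('m, 'a, 'y) rmodule_scheme \<Rightarrow> ('m, 'c) tens \<Rightarrow> ('a, 'c \<Rightarrow> 's) tens \<Rightarrow> 'm" where
  "pairing M z t = tensor_lift (over_S M) (\<lambda>m c. tensor_lift (over_S M) (\<lambda>a f.
     ev f c \<odot>\<^bsub>over_S M\<^esub> (m \<star>\<^bsub>M\<^esub> a)) t) z"

lemma lin_pairing1 [lins]:
  assumes [lins]: "amod M" "t \<in> carrier AD" "lin P (over_S M \<boxtimes> C) F"
  shows "lin P (over_S M) (\<lambda>p. pairing M (F p) t)"
  unfolding pairing_def by (assumption | rule lins | (simp; fail))+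

lemma lin_pairing2 [lins]:
  assumes [lins]: "amod M" "z \<in> carrier (over_S M \<boxtimes> C)" "lin P AD F"
  shows "lin P (over_S M) (\<lambda>p. pairing M z (F p))"
  unfolding pairing_def by (assumption | rule lins | (simp; fail))+

lemma mem_pairing [lins]:
  assumes "amod M" "z \<in> carrier (over_S M \<boxtimes> C)" "t \<in> carrier AD"
  shows "pairing M z t \<in> carrier M"
  using lin_closed[OF lin_pairing2[OF assms(1,2) lin_id] assms(3)] by simp

lemma pairing_pure:
  assumes [lins]: "amod M" "m \<in> carrier M" "c \<in> carrier C" "a \<in> carrier A" "f \<in> carrier dual"
  shows "pairing M (pure (over_S M) C m c) (hash a f) = ev f c \<odot>\<^bsub>over_S M\<^esub> (m \<star>\<^bsub>M\<^esub> a)"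
proof -
  have "pairing M (pure (over_S M) C m c) (hash a f) = tensor_lift (over_S M) (\<lambda>a f.
     ev f c \<odot>\<^bsub>over_S M\<^esub> (m \<star>\<^bsub>M\<^esub> a)) (hash a f)"
    unfolding pairing_def by (rule lift_pure; (assumption | rule lins | (simp; fail))+)
  also have "\<dots> = ev f c \<odot>\<^bsub>over_S M\<^esub> (m \<star>\<^bsub>M\<^esub> a)"
    by (rule lift_pure; (assumption | rule lins | (simp; fail))+)
  finally show ?thesis .
qed

lemma pairing_right_pure:
  assumes [lins]: "amod M" "z \<in> carrier (over_S M \<boxtimes> C)" "a \<in> carrier A" "f \<in> carrier dual"
  shows "pairing M z (hash a f) = tensor_lift (over_S M) (\<lambda>m c. ev f c \<odot>\<^bsub>over_S M\<^esub> (m \<star>\<^bsub>M\<^esub> a)) z"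
  unfolding pairing_def by (rule lift_cong, (assumption | rule lins)+, rule lift_pure; (assumption | rule lins | (simp; fail))+)

lemma coring_simps:
  "carrier coring = carrier (A \<boxtimes> C)" "\<zero>\<^bsub>coring\<^esub> = \<zero>\<^bsub>A \<boxtimes> C\<^esub>" "add coring = add (A \<boxtimes> C)"
  "b \<odot>\<^bsub>coring\<^esub> x = tensor_lift (A \<boxtimes> C) (\<lambda>a c. pure A C (b \<otimes>\<^bsub>A\<^esub> a) c) x"
  by (simp_all add: coring_def Let_def)

lemma lin_coring_smult:
  assumes [lins]: "b \<in> carrier A"
  shows "lin (A \<boxtimes> C) (A \<boxtimes> C) (\<lambda>x. b \<odot>\<^bsub>coring\<^esub> x)"
  unfolding coring_simps by (rule lin_lift_arg0; (assumption | rule lins)+)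

lemma coring_smult_pure:
  assumes [lins]: "b \<in> carrier A" "a \<in> carrier A" "c \<in> carrier C"
  shows "b \<odot>\<^bsub>coring\<^esub> pure A C a c = pure A C (b \<otimes>\<^bsub>A\<^esub> a) c"
  unfolding coring_simps by (rule lift_pure; (assumption | rule lins)+)

lemma coring_setting:
  assumes "amod M"
  shows "tensor_setting A M (\<lambda>m a. m \<star>\<^bsub>M\<^esub> a) coring (\<lambda>a x. a \<odot>\<^bsub>coring\<^esub> x)"
proof (intro tensor_setting.intro tensor_setting_axioms.intro)
  show "abelian_monoid M"
    using assms by (simp add: right_semimodule_def)
  show "abelian_monoid coring"
    by (rule abelian_monoid_carrier_cong[OF abelian_stensor[OF smod_A smod_C]]) (simp_all add: coring_simps)
  show "r \<odot>\<^bsub>coring\<^esub> n \<in> carrier coring" if "r \<in> carrier A" "n \<in> carrier coring" for r n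
    using lin_closed[OF lin_coring_smult] that by (simp add: coring_simps(1))
qed (use assms in \<open>simp add: mem_ract\<close>)

text \<open>For fixed \<open>b\<close> the map \<open>y \<mapsto> b y\<close> on the coring is
  S-linear, so balancing over \<open>A\<close> is an equation of linear maps in \<open>y\<close> and
  pure \<open>y\<close> suffice.\<close>

lemma coring_balanced:
  assumes [lins]: "amod M" "smod Z" and 1 [lins]: "\<And>y. y \<in> carrier (A \<boxtimes> C) \<Longrightarrow> lin (over_S M) Z (\<lambda>m. h m y)"
    and 2 [lins]: "\<And>m. m \<in> carrier M \<Longrightarrow> lin (A \<boxtimes> C) Z (h m)"
    and p: "\<And>m b a c. \<lbrakk>m \<in> carrier M; b \<in> carrier A; a \<in> carrier A; c \<in> carrier C\<rbrakk> \<Longrightarrow>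
      h (m \<star>\<^bsub>M\<^esub> b) (pure A C a c) = h m (pure A C (b \<otimes>\<^bsub>A\<^esub> a) c)"
  shows "balanced_map A M (\<lambda>m a. m \<star>\<^bsub>M\<^esub> a) coring (\<lambda>a x. a \<odot>\<^bsub>coring\<^esub> x) Z h"
proof -
  have "h (m \<star>\<^bsub>M\<^esub> b) y = h m (b \<odot>\<^bsub>coring\<^esub> y)" if "m \<in> carrier M" "b \<in> carrier A" "y \<in> carrier (A \<boxtimes> C)" for m b y
    by (rule lin_eqI[where g = "\<lambda>y. h m (b \<odot>\<^bsub>coring\<^esub> y)", OF that(3) _ _ _ 2 lin_compose[OF lin_coring_smult 2]])
      (use p that assms mem_ract in \<open>simp_all add: coring_smult_pure smod_A smod_C\<close>)
  then show ?thesis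
    using lin_additive[OF 1] lin_additive[OF 2]
    by (simp add: balanced_map_def additive_map_def coring_simps(1-3))
qed

text \<open>The canonical map \<open>m \<otimes> (b \<otimes> c) \<mapsto> m b \<otimes> c\<close>.
  Its surjectivity is what the transfer uses: \<open>alpha\<close> factors through it, hence
  injectivity of \<open>alpha\<close> passes to the pairing without constructing an inverse.\<close>

definition theta :: "('m, 'a, 'y) rmodule_scheme \<Rightarrow> ('m, ('a, 'c) tens) tens \<Rightarrow> ('m, 'c) tens" where
  "theta M = tensor_lift (over_S M \<boxtimes> C) (\<lambda>m. tensor_lift (over_S M \<boxtimes> C) (\<lambda>b c. pure (over_S M) C (m \<star>\<^bsub>M\<^esub> b) c))"

lemma theta_balanced:
  assumes [lins]: "amod M"
  shows "balanced_map A M (\<lambda>m a. m \<star>\<^bsub>M\<^esub> a) coring (\<lambda>a x. a \<odot>\<^bsub>coring\<^esub> x) (over_S M \<boxtimes> C)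
    (\<lambda>m. tensor_lift (over_S M \<boxtimes> C) (\<lambda>b c. pure (over_S M) C (m \<star>\<^bsub>M\<^esub> b) c))"
proof (rule coring_balanced)
  fix m b a c assume x [lins]: "m \<in> carrier M" "b \<in> carrier A" "a \<in> carrier A" "c \<in> carrier C"
  have "tensor_lift (over_S M \<boxtimes> C) (\<lambda>ba. pure (over_S M) C (m \<star>\<^bsub>M\<^esub> b \<star>\<^bsub>M\<^esub> ba)) (pure A C a c) =
      pure (over_S M) C (m \<star>\<^bsub>M\<^esub> b \<star>\<^bsub>M\<^esub> a) c"
    by (rule lift_pure; (assumption | rule lins | (simp; fail))+)
  also have "\<dots> = pure (over_S M) C (m \<star>\<^bsub>M\<^esub> (b \<otimes>\<^bsub>A\<^esub> a)) c"
    using right_semimodule.ract_assoc[OF assms x(1,2,3)] by simp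
  also have "\<dots> = tensor_lift (over_S M \<boxtimes> C) (\<lambda>b. pure (over_S M) C (m \<star>\<^bsub>M\<^esub> b)) (pure A C (b \<otimes>\<^bsub>A\<^esub> a) c)"
    by (rule lift_pure[symmetric]; (assumption | rule lins | (simp; fail))+)
  finally show "tensor_lift (over_S M \<boxtimes> C) (\<lambda>ba. pure (over_S M) C (m \<star>\<^bsub>M\<^esub> b \<star>\<^bsub>M\<^esub> ba)) (pure A C a c) = \<dots>" .
qed (assumption | rule lins | (simp; fail))+

text \<open>A preimage of \<open>m \<otimes> c\<close> is
  \<open>m \<otimes> (1 \<otimes> c)\<close>, and the image of an additive map is closed under
  sums.\<close>

lemma theta_surj:
  assumes [lins]: "amod M" and z: "z \<in> carrier (over_S M \<boxtimes> C)"
  obtains x where "x \<in> carrier (tensor_coring M)" "theta M x = z"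
proof -
  interpret tensor_setting A M "\<lambda>m a. m \<star>\<^bsub>M\<^esub> a" coring "\<lambda>a x. a \<odot>\<^bsub>coring\<^esub> x"
    by (rule coring_setting) fact
  have Mc: "tensor_coring M = T"
    by (simp add: tensor_coring_def)
  note ab = smod_abelian[OF smod_stensor[OF smod_over_S[OF assms(1)] smod_C]]
  have add: "additive_map T (over_S M \<boxtimes> C) (theta M)"
    unfolding theta_def by (rule lift_additive[OF ab theta_balanced[OF assms(1)]])
  have "\<exists>x\<in>carrier T. theta M x = z"
    using smod_over_S[OF assms(1)] smod_C z
  proof (induction z rule: stensor_induct)
    case zero
    then show ?case using add T.zero_closed unfolding additive_map_def by blast
  next
    case (pure m c)
    then have x [lins]: "m \<in> carrier M" "c \<in> carrier C" "\<one>\<^bsub>A\<^esub> \<in> carrier A"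
      by simp_all
    have "theta M (cls {#(m, pure_tensor S A C \<one>\<^bsub>A\<^esub> c)#}) =
      tensor_lift (over_S M \<boxtimes> C) (\<lambda>b c. pure_tensor S (over_S M) C (m \<star>\<^bsub>M\<^esub> b) c) (pure_tensor S A C \<one>\<^bsub>A\<^esub> c)"
      unfolding theta_def
      by (rule tensor_setting.lift_pure[OF tensor_setting_axioms ab theta_balanced[OF assms(1)]])
        (simp_all add: coring_simps(1) mem_pure smod_A smod_C x)
    also have "\<dots> = pure_tensor S (over_S M) C (m \<star>\<^bsub>M\<^esub> \<one>\<^bsub>A\<^esub>) c"
      by (rule commutative_semiring.lift_pure[OF commutative_semiring_axioms]; (assumption | rule lins | (simp; fail))+)
    finally have "theta M (cls {#(m, pure_tensor S A C \<one>\<^bsub>A\<^esub> c)#}) = pure_tensor S (over_S M) C m c"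
      using right_semimodule.ract_one[OF assms(1) x(1)] by simp
    moreover have "cls {#(m, pure_tensor S A C \<one>\<^bsub>A\<^esub> c)#} \<in> carrier T"
      by (rule cls_closed) (simp add: coring_simps(1) mem_pure smod_A smod_C x)
    ultimately show ?case by blast
  next
    case (add y z)
    then obtain u v where "u \<in> carrier T" "theta M u = y" "v \<in> carrier T" "theta M v = z"
      by blast
    with \<open>additive_map T (over_S M \<boxtimes> C) (theta M)\<close> show ?case
      unfolding additive_map_def by (intro bexI[of _ "u \<oplus>\<^bsub>T\<^esub> v"]) auto
  qed
  then show thesis using that by (auto simp: Mc)
qed

lemma theta_closed: "amod M \<Longrightarrow> x \<in> carrier (tensor_coring M) \<Longrightarrow> theta M x \<in> carrier (over_S M \<boxtimes> C)"
  using tensor_setting.lift_additive[OF coring_setting smod_abelian theta_balanced, of M]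
  by (simp add: additive_map_def theta_def tensor_coring_def Pi_iff smod_stensor smod_over_S smod_C)

text \<open>Both sides are additive in \<open>x\<close>, so it suffices to compare them on
  \<open>m \<otimes> y\<close>, where the pairing is moved inside the lift over
  \<open>y\<close>.\<close>

lemma alpha_theta:
  assumes [lins]: "amod M" and x: "x \<in> carrier (tensor_coring M)"
  shows "alpha M x = (\<lambda>t\<in>carrier smash. pairing M (theta M x) t)"
proof (unfold alpha_def, rule restrict_ext)
  fix t assume "t \<in> carrier smash"
  then have t [lins]: "t \<in> carrier AD" by (simp add: smash_simps)
  interpret tensor_setting A M "\<lambda>m a. m \<star>\<^bsub>M\<^esub> a" coring "\<lambda>a x. a \<odot>\<^bsub>coring\<^esub> x"
    by (rule coring_setting) fact
  let ?h = "\<lambda>m y. tensor_lift (over_S M) (\<lambda>b c. tensor_lift (over_S M) (\<lambda>a f.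
      ev f c \<odot>\<^bsub>over_S M\<^esub> (m \<star>\<^bsub>M\<^esub> b \<star>\<^bsub>M\<^esub> a)) t) y"
  have bal: "balanced_map A M (\<lambda>m a. m \<star>\<^bsub>M\<^esub> a) coring (\<lambda>a x. a \<odot>\<^bsub>coring\<^esub> x) (over_S M) ?h"
  proof (rule coring_balanced)
    fix m b a c assume x [lins]: "m \<in> carrier M" "b \<in> carrier A" "a \<in> carrier A" "c \<in> carrier C"
    have "?h (m \<star>\<^bsub>M\<^esub> b) (pure_tensor S A C a c) = tensor_lift (over_S M) (\<lambda>a' f.
      ev f c \<odot>\<^bsub>over_S M\<^esub> (m \<star>\<^bsub>M\<^esub> b \<star>\<^bsub>M\<^esub> a \<star>\<^bsub>M\<^esub> a')) t"
      by (rule commutative_semiring.lift_pure[OF commutative_semiring_axioms]; (assumption | rule lins | (simp; fail))+)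
    also have "\<dots> = tensor_lift (over_S M) (\<lambda>a' f. ev f c \<odot>\<^bsub>over_S M\<^esub> (m \<star>\<^bsub>M\<^esub> (b \<otimes>\<^bsub>A\<^esub> a) \<star>\<^bsub>M\<^esub> a')) t"
      using right_semimodule.ract_assoc[OF assms(1) x(1,2,3)] by simp
    also have "\<dots> = ?h m (pure_tensor S A C (b \<otimes>\<^bsub>A\<^esub> a) c)"
      by (rule commutative_semiring.lift_pure[OF commutative_semiring_axioms, symmetric]; (assumption | rule lins | (simp; fail))+)
    finally show "?h (m \<star>\<^bsub>M\<^esub> b) (pure_tensor S A C a c) = ?h m (pure_tensor S A C (b \<otimes>\<^bsub>A\<^esub> a) c)" .
  qed (assumption | rule lins | (simp; fail))+
  note ab = smod_abelian[OF smod_over_S[OF assms(1)]]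
  note abC = smod_abelian[OF smod_stensor[OF smod_over_S[OF assms(1)] smod_C]]
  have add: "additive_map T (over_S M \<boxtimes> C) (theta M)"
    unfolding theta_def by (rule lift_additive[OF abC theta_balanced[OF assms(1)]])
  have pa: "additive_map (over_S M \<boxtimes> C) (over_S M) (\<lambda>z. pairing M z t)"
    by (rule lin_additive, (assumption | rule lins)+)
  have "tensor_lift (over_S M) ?h x = pairing M (theta M x) t"
    using x unfolding tensor_coring_def
  proof (induction x rule: induct)
    case zero
    then show ?case
      using add pa lift_additive[OF ab bal] by (simp add: additive_map_def)
  next
    case (pure m y)
    then have y [lins]: "m \<in> carrier M" "y \<in> carrier (A \<boxtimes> C)"
      by (simp_all add: coring_simps)
    have "tensor_lift (over_S M) ?h (cls {#(m, y)#}) = ?h m y"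
      by (rule lift_pure[OF ab bal]) fact+
    also have "\<dots> = tensor_lift (over_S M) (\<lambda>b c. pairing M (pure_tensor S (over_S M) C (m \<star>\<^bsub>M\<^esub> b) c) t) y"
      unfolding pairing_def
      by (rule commutative_semiring.lift_cong[OF commutative_semiring_axioms], (assumption | rule lins)+,
          rule commutative_semiring.lift_pure[OF commutative_semiring_axioms, symmetric]; (assumption | rule lins | (simp; fail))+)
    also have "\<dots> = pairing M (tensor_lift (over_S M \<boxtimes> C) (\<lambda>b c. pure_tensor S (over_S M) C (m \<star>\<^bsub>M\<^esub> b) c) y) t"
      by (rule lin_lift[where \<phi> = "\<lambda>z. pairing M z t", symmetric]; (assumption | rule lins | (simp; fail))+)
    also have "\<dots> = pairing M (theta M (cls {#(m, y)#})) t"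
      unfolding theta_def
      by (rule arg_cong[where f = "\<lambda>z. pairing M z t"], rule lift_pure[OF abC theta_balanced[OF assms(1)], symmetric]) fact+
    finally show ?case .
  next
    case (add y z)
    then show ?case
      using \<open>additive_map T (over_S M \<boxtimes> C) (theta M)\<close> pa lift_additive[OF ab bal] by (simp add: additive_map_def Pi_iff)
  qed
  then show "tensor_lift M (\<lambda>m. tensor_lift M (\<lambda>b c. tensor_lift M (\<lambda>a f. f c \<odot>\<^bsub>over_S M\<^esub> (m \<star>\<^bsub>M\<^esub> b \<star>\<^bsub>M\<^esub> a)) t)) x
     = pairing M (theta M x) t"
    by (simp add: lift_over_S ev_def)
qed

text \<open>Surjectivity of \<open>theta\<close> turns rationality into a condition on elements of
  \<open>M \<otimes> C\<close>.\<close>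

lemma alpha_image:
  assumes "amod M"
  shows "alpha M ` carrier (tensor_coring M) =
    (\<lambda>z. \<lambda>t\<in>carrier smash. pairing M z t) ` carrier (over_S M \<boxtimes> C)"
proof (intro equalityI subsetI; elim imageE)
  fix u x assume "u = alpha M x" "x \<in> carrier (tensor_coring M)"
  then show "u \<in> (\<lambda>z. \<lambda>t\<in>carrier smash. pairing M z t) ` carrier (over_S M \<boxtimes> C)"
    using alpha_theta[OF assms] theta_closed[OF assms] by auto
next
  fix u z assume u: "u = (\<lambda>t\<in>carrier smash. pairing M z t)" and "z \<in> carrier (over_S M \<boxtimes> C)"
  then obtain x where "x \<in> carrier (tensor_coring M)" "theta M x = z"
    using theta_surj[OF assms] by blast
  moreover from this have "u = alpha M x"
    using alpha_theta[OF assms, of x] u by simp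
  ultimately show "u \<in> alpha M ` carrier (tensor_coring M)"
    by blast
qed

text \<open>Checked on pure tensors. It is applied to inclusions, to quotient maps, to bijections
  onto copies and to morphisms of the categories.\<close>

lemma pairing_natural:
  assumes [lins]: "amod M" "amod N" and \<phi>: "right_linear A M N \<phi>"
    and z: "z \<in> carrier (over_S M \<boxtimes> C)" and t: "t \<in> carrier AD"
  shows "pairing N (tmap (over_S N) C \<phi> z) t = \<phi> (pairing M z t)"
proof -
  note l = right_linear_lin[OF \<phi>]
  note lm = lin_tmap[OF smod_over_S[OF assms(1)] smod_over_S[OF assms(2)] smod_C l]
  show ?thesis
  proof (rule lin_eqI2[where f = "\<lambda>z t. pairing N (tmap (over_S N) C \<phi> z) t" and g = "\<lambda>z t. \<phi> (pairing M z t)", OF z t])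
    fix m c a f assume x [lins]: "m \<in> carrier (over_S M)" "c \<in> carrier C" "a \<in> carrier A" "f \<in> carrier dual"
    have m [lins]: "m \<in> carrier M" using x by simp
    then have m' [lins]: "\<phi> m \<in> carrier N" using lin_closed[OF l] by simp
    have [lins]: "m \<star>\<^bsub>M\<^esub> a \<in> carrier (over_S M)" using m x by (simp add: mem_ract assms)
    have "\<phi> (m \<star>\<^bsub>M\<^esub> a) = \<phi> m \<star>\<^bsub>N\<^esub> a"
      using \<phi> m x by (simp add: right_linear_def)
    then show "pairing N (tmap (over_S N) C \<phi> (pure (over_S M) C m c)) (hash a f) = \<phi> (pairing M (pure (over_S M) C m c) (hash a f))"
      using x m m' by (simp add: tmap_pure[OF _ _ _ l] lins(1) pairing_pure assms smod_over_S smod_C lin_smult[OF l] mem_ev mem_ract)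
  qed (assumption | rule lins lm lin_closed[OF lm] lin_compose[OF _ l] lin_compose[OF lm, of _ "\<lambda>z. pairing N z t" for t])+
qed

end

subsection \<open>Cardinalities\<close>

text \<open>Lists of length n have cardinality at most that of \<open>'u\<close> by induction, as an
  infinite set absorbs its square, and a countable union of such sets is again bounded by
  \<open>'u\<close>.\<close>

lemma lists_lepoll:
  fixes A :: "'x set"
  assumes inf: "infinite (UNIV :: 'u set)" and A: "A \<lesssim> (UNIV :: 'u set)"
  shows "lists A \<lesssim> (UNIV :: 'u set)"
proof -
  define B where "B n = {xs \<in> lists A. length xs = n}" for n :: nat
  have sq: "(UNIV :: 'u set) \<times> (UNIV :: 'u set) \<lesssim> (UNIV :: 'u set)"
    using card_of_Times_same_infinite[OF inf] eqpoll_iff_card_of_ordIso eqpoll_imp_lepoll by blast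
  have "B n \<lesssim> (UNIV :: 'u set)" for n
  proof (induction n)
    case 0
    have "B 0 \<subseteq> {[]}"
      by (auto simp: B_def)
    then have "B 0 \<lesssim> {[] :: 'x list}"
      by (rule subset_imp_lepoll)
    also have "\<dots> \<lesssim> (UNIV :: 'u set)"
      by (rule finite_lepoll_infinite[OF inf]) simp
    finally show ?case .
  next
    case (Suc n)
    have "B (Suc n) \<subseteq> (\<lambda>(x, xs). x # xs) ` (A \<times> B n)"
      by (auto simp: B_def length_Suc_conv image_iff)
    then have "B (Suc n) \<lesssim> A \<times> B n"
      by (rule subset_image_lepoll)
    also have "\<dots> \<lesssim> (UNIV :: 'u set) \<times> (UNIV :: 'u set)"
      using A Suc by (rule times_lepoll_mono)
    also note sq
    finally show ?case .
  qed
  then have "\<forall>n\<in>UNIV. (card_of (B n), card_of (UNIV :: 'u set)) \<in> ordLeq"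
    unfolding lepoll_def card_of_ordLeq by blast
  then have "(card_of (\<Union>n\<in>UNIV. B n), card_of (UNIV :: 'u set)) \<in> ordLeq"
    using inf infinite_iff_card_of_nat by (intro card_of_UNION_ordLeq_infinite) blast+
  then have "(\<Union>n. B n) \<lesssim> (UNIV :: 'u set)"
    unfolding lepoll_def card_of_ordLeq .
  moreover have "lists A = (\<Union>n\<in>UNIV. B n)"
    by (auto simp: B_def)
  ultimately show ?thesis
    by simp
qed

lemma times_lepoll:
  assumes inf: "infinite (UNIV :: 'u set)" and "A \<lesssim> (UNIV :: 'u set)" "B \<lesssim> (UNIV :: 'u set)"
  shows "A \<times> B \<lesssim> (UNIV :: 'u set)"
proof -
  have "A \<times> B \<lesssim> (UNIV :: 'u set) \<times> (UNIV :: 'u set)"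
    using assms(2,3) by (rule times_lepoll_mono)
  also have "\<dots> \<lesssim> (UNIV :: 'u set)"
    using card_of_Times_same_infinite[OF inf] eqpoll_iff_card_of_ordIso eqpoll_imp_lepoll by blast
  finally show ?thesis .
qed

text \<open>A tensor is the class of a finite multiset of pairs, hence is named by a list of pairs.
  This bound allows \<open>M \<otimes> C\<close> to be copied onto \<open>'u\<close>.\<close>

lemma tensor_lepoll:
  assumes "infinite (UNIV :: 'u set)" "carrier M \<lesssim> (UNIV :: 'u set)" "carrier N \<lesssim> (UNIV :: 'u set)"
  shows "carrier (tensor R M rm N ln) \<lesssim> (UNIV :: 'u set)"
proof -
  have "carrier (tensor R M rm N ln) \<subseteq> (\<lambda>xs. tensor_class R M rm N ln (mset xs)) ` lists (carrier M \<times> carrier N)"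
  proof
    fix x assume "x \<in> carrier (tensor R M rm N ln)"
    then obtain X where X: "x = tensor_class R M rm N ln X" "set_mset X \<subseteq> carrier M \<times> carrier N"
      by (auto simp: tensor_def)
    moreover obtain xs where "X = mset xs"
      using ex_mset by metis
    ultimately show "x \<in> (\<lambda>xs. tensor_class R M rm N ln (mset xs)) ` lists (carrier M \<times> carrier N)"
      by (intro image_eqI[of _ _ xs]) (simp_all add: lists_eq_set)
  qed
  then have "carrier (tensor R M rm N ln) \<lesssim> lists (carrier M \<times> carrier N)"
    by (rule subset_image_lepoll)
  also have "\<dots> \<lesssim> (UNIV :: 'u set)"
    using assms by (intro lists_lepoll times_lepoll)
  finally show ?thesis .
qed

subsection \<open>Transport of structure\<close>

text \<open>One notion for injections, which transport a structure to another type, and for the map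
  onto Bourne classes, which forms a quotient. Addition varies in its left argument only;
  commutativity supplies the other.\<close>

definition congruent_map :: "('r, 'x) ring_scheme \<Rightarrow> ('m, 'r, 'y) rmodule_scheme \<Rightarrow> ('m \<Rightarrow> 'n) \<Rightarrow> bool" where
  "congruent_map R M \<pi> \<longleftrightarrow>
    (\<forall>x\<in>carrier M. \<forall>x'\<in>carrier M. \<pi> x = \<pi> x' \<longrightarrow>
       (\<forall>y\<in>carrier M. \<pi> (x \<oplus>\<^bsub>M\<^esub> y) = \<pi> (x' \<oplus>\<^bsub>M\<^esub> y)) \<and>
       (\<forall>r\<in>carrier R. \<pi> (x \<star>\<^bsub>M\<^esub> r) = \<pi> (x' \<star>\<^bsub>M\<^esub> r)))"

text \<open>The structure is \<open>undefined\<close> off the image to match \<open>canonical_rmodule\<close>, so that objects of a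
  category are equal when they agree on their carriers.\<close>

definition push :: "('r, 'x) ring_scheme \<Rightarrow> ('m, 'r, 'y) rmodule_scheme \<Rightarrow> ('m \<Rightarrow> 'n) \<Rightarrow> ('n, 'r) rmodule" where
  "push R M \<pi> = (let K = \<pi> ` carrier M; \<sigma> = inv_into (carrier M) \<pi> in
    \<lparr>carrier = K, mult = (\<lambda>_ _. undefined), one = undefined, zero = \<pi> \<zero>\<^bsub>M\<^esub>,
     add = (\<lambda>x y. if x \<in> K \<and> y \<in> K then \<pi> (\<sigma> x \<oplus>\<^bsub>M\<^esub> \<sigma> y) else undefined),
     ract = (\<lambda>x r. if x \<in> K \<and> r \<in> carrier R then \<pi> (\<sigma> x \<star>\<^bsub>M\<^esub> r) else undefined)\<rparr>)"

lemma congruent_map_inj: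
  "inj_on \<pi> (carrier M) \<Longrightarrow> congruent_map R M \<pi>"
  by (auto simp: congruent_map_def dest: inj_onD)

lemma push_simps: "carrier (push R M \<pi>) = \<pi> ` carrier M" "\<zero>\<^bsub>push R M \<pi>\<^esub> = \<pi> \<zero>\<^bsub>M\<^esub>"
  by (simp_all add: push_def Let_def)

lemma canonical_push: "canonical_rmodule R (push R M \<pi>)"
  by (auto simp: canonical_rmodule_def push_def Let_def extensional_def)

lemma
  assumes M: "right_semimodule R M" and c: "congruent_map R M \<pi>"
  shows push_add: "x \<in> carrier M \<Longrightarrow> y \<in> carrier M \<Longrightarrow> \<pi> x \<oplus>\<^bsub>push R M \<pi>\<^esub> \<pi> y = \<pi> (x \<oplus>\<^bsub>M\<^esub> y)"
    and push_ract: "x \<in> carrier M \<Longrightarrow> r \<in> carrier R \<Longrightarrow> \<pi> x \<star>\<^bsub>push R M \<pi>\<^esub> r = \<pi> (x \<star>\<^bsub>M\<^esub> r)"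
    and right_semimodule_push: "right_semimodule R (push R M \<pi>)"
    and right_linear_push: "right_linear R M (push R M \<pi>) \<pi>"
proof -
  interpret M: right_semimodule R M by fact
  let ?\<sigma> = "inv_into (carrier M) \<pi>"
  have c1: "\<pi> (x \<oplus>\<^bsub>M\<^esub> y) = \<pi> (x' \<oplus>\<^bsub>M\<^esub> y)"
    if "\<pi> x = \<pi> x'" "x \<in> carrier M" "x' \<in> carrier M" "y \<in> carrier M" for x x' y
    using c that unfolding congruent_map_def by blast
  have c2: "\<pi> (x \<star>\<^bsub>M\<^esub> r) = \<pi> (x' \<star>\<^bsub>M\<^esub> r)"
    if "\<pi> x = \<pi> x'" "x \<in> carrier M" "x' \<in> carrier M" "r \<in> carrier R" for x x' r
    using c that unfolding congruent_map_def by blast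
  have s: "?\<sigma> (\<pi> x) \<in> carrier M" "\<pi> (?\<sigma> (\<pi> x)) = \<pi> x" if "x \<in> carrier M" for x
    using that by (auto intro: inv_into_into f_inv_into_f)
  show add: "\<pi> x \<oplus>\<^bsub>push R M \<pi>\<^esub> \<pi> y = \<pi> (x \<oplus>\<^bsub>M\<^esub> y)" if xy: "x \<in> carrier M" "y \<in> carrier M" for x y
  proof -
    have "\<pi> x \<oplus>\<^bsub>push R M \<pi>\<^esub> \<pi> y = \<pi> (?\<sigma> (\<pi> x) \<oplus>\<^bsub>M\<^esub> ?\<sigma> (\<pi> y))"
      using xy by (simp add: push_def Let_def)
    also have "\<dots> = \<pi> (x \<oplus>\<^bsub>M\<^esub> ?\<sigma> (\<pi> y))"
      using s xy by (intro c1)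
    also have "\<dots> = \<pi> (?\<sigma> (\<pi> y) \<oplus>\<^bsub>M\<^esub> x)"
      using s(1) xy by (intro arg_cong[where f = \<pi>] M.M.a_comm)
    also have "\<dots> = \<pi> (y \<oplus>\<^bsub>M\<^esub> x)"
      using s xy by (intro c1)
    also have "\<dots> = \<pi> (x \<oplus>\<^bsub>M\<^esub> y)"
      using xy by (intro arg_cong[where f = \<pi>] M.M.a_comm)
    finally show ?thesis .
  qed
  show ract: "\<pi> x \<star>\<^bsub>push R M \<pi>\<^esub> r = \<pi> (x \<star>\<^bsub>M\<^esub> r)" if "x \<in> carrier M" "r \<in> carrier R" for x r
  proof -
    have "\<pi> x \<star>\<^bsub>push R M \<pi>\<^esub> r = \<pi> (?\<sigma> (\<pi> x) \<star>\<^bsub>M\<^esub> r)"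
      using that by (simp add: push_def Let_def)
    also have "\<dots> = \<pi> (x \<star>\<^bsub>M\<^esub> r)"
      using s that by (intro c2)
    finally show ?thesis .
  qed
  have "abelian_monoid (push R M \<pi>)"
    by (rule abelian_monoidI) (auto simp: push_simps add M.M.a_ac)
  then show "right_semimodule R (push R M \<pi>)"
    by (intro right_semimodule.intro right_semimodule_axioms.intro M.R.semiring_axioms)
      (auto simp: push_simps add ract M.ract_closed M.ract_l_distr M.ract_r_distr M.ract_assoc M.ract_one
        M.ract_l_null M.ract_r_null)
  show "right_linear R M (push R M \<pi>) \<pi>"
    by (auto simp: right_linear_def additive_map_def push_simps add ract)
qed

lemma right_linear_inv:
  assumes "right_semimodule R M" "right_linear R M N \<phi>" "bij_betw \<phi> (carrier M) (carrier N)"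
  shows "right_linear R N M (inv_into (carrier M) \<phi>)"
proof -
  interpret M: right_semimodule R M by fact
  let ?\<sigma> = "inv_into (carrier M) \<phi>"
  have s: "?\<sigma> (\<phi> x) = x" if "x \<in> carrier M" for x
    using assms(3) that by (simp add: bij_betw_def)
  have im: "carrier N = \<phi> ` carrier M"
    using assms(3) by (simp add: bij_betw_def)
  have \<phi>: "\<phi> x \<oplus>\<^bsub>N\<^esub> \<phi> y = \<phi> (x \<oplus>\<^bsub>M\<^esub> y)" "\<phi> x \<star>\<^bsub>N\<^esub> r = \<phi> (x \<star>\<^bsub>M\<^esub> r)" "\<zero>\<^bsub>N\<^esub> = \<phi> \<zero>\<^bsub>M\<^esub>"
    if "x \<in> carrier M" "y \<in> carrier M" "r \<in> carrier R" for x y r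
    using that assms(2) by (simp_all add: right_linear_def additive_map_def)
  show ?thesis
    unfolding right_linear_def additive_map_def im
    using \<phi>(3)[OF M.M.zero_closed M.M.zero_closed M.R.zero_closed] by (auto simp: \<phi>(1)[OF _ _ M.R.zero_closed] \<phi>(2)[OF _ M.M.zero_closed] s M.ract_closed)
qed

lemma right_linear_compose:
  "right_linear R L M f \<Longrightarrow> right_linear R M N g \<Longrightarrow> right_linear R L N (\<lambda>x. g (f x))"
  by (simp add: right_linear_def additive_map_def Pi_iff)

context doi_koppinen_setting
begin

subsection \<open>Right semimodules over \<open>A #\<^sup>o\<^sup>p C\<^sup>*\<close>\<close>

abbreviation "tmod M \<equiv> right_semimodule smash M"
abbreviation "TS M \<equiv> over_S (over_A M)"

lemma over_A_simps [simp]: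
  "carrier (over_A M) = carrier M" "\<zero>\<^bsub>over_A M\<^esub> = \<zero>\<^bsub>M\<^esub>" "add (over_A M) = add M"
  "m \<star>\<^bsub>over_A M\<^esub> a = m \<star>\<^bsub>M\<^esub> hash a \<one>\<^bsub>dual\<^esub>"
  by (simp_all add: over_A_def)

lemma mem_tract [lins]: "tmod M \<Longrightarrow> m \<in> carrier M \<Longrightarrow> t \<in> carrier AD \<Longrightarrow> m \<star>\<^bsub>M\<^esub> t \<in> carrier M"
  using right_semimodule.ract_closed[of smash M m t] by (simp add: smash_simps)

lemma tract_assoc:
  "\<lbrakk>tmod M; m \<in> carrier M; t \<in> carrier AD; u \<in> carrier AD\<rbrakk> \<Longrightarrow> m \<star>\<^bsub>M\<^esub> t \<star>\<^bsub>M\<^esub> u = m \<star>\<^bsub>M\<^esub> (t \<otimes>\<^bsub>smash\<^esub> u)"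
  using right_semimodule.ract_assoc[of smash M m t u] by (simp add: smash_simps)

lemma tract_one: "\<lbrakk>tmod M; m \<in> carrier M\<rbrakk> \<Longrightarrow> m \<star>\<^bsub>M\<^esub> hash \<one>\<^bsub>A\<^esub> \<one>\<^bsub>dual\<^esub> = m"
  using right_semimodule.ract_one[of smash M m] by (simp add: smash_simps)

lemma amod_over_A [lins]:
  assumes "tmod M"
  shows "amod (over_A M)"
proof -
  interpret M: right_semimodule smash M by fact
  note h = lin_pure1[OF smod_A smod_dual mem_one_dual lin_id]
  have hm [simp]: "hash a \<one>\<^bsub>dual\<^esub> \<in> carrier AD" if "a \<in> carrier A" for a
    using lin_closed[OF h that] .
  note M' = M.ract_closed M.ract_l_distr M.ract_r_distr M.ract_one M.ract_l_null M.ract_r_null M.ract_assoc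
  show ?thesis
    by (intro right_semimodule.intro right_semimodule_axioms.intro A.semiring_axioms
        abelian_monoid_carrier_cong[OF M.M.abelian_monoid_axioms])
      (use M'[unfolded smash_simps] in \<open>simp_all add: lin_add[OF h] lin_zero[OF h] tract_assoc assms
        smash_pure_one_right mem_one_dual\<close>)
qed

text \<open>The element \<open>s 1 # \<epsilon>\<close> is a scalar multiple of the unit, hence
  central. It follows that the smash action is linear for the S-structure that a smash semimodule
  inherits through \<open>A\<close>.\<close>

lemma hash_scalar:
  assumes [lins]: "s \<in> carrier S" "t \<in> carrier AD"
  shows "hash (s \<odot>\<^bsub>A\<^esub> \<one>\<^bsub>A\<^esub>) \<one>\<^bsub>dual\<^esub> \<otimes>\<^bsub>smash\<^esub> t = s \<odot>\<^bsub>AD\<^esub> t"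
    "t \<otimes>\<^bsub>smash\<^esub> hash (s \<odot>\<^bsub>A\<^esub> \<one>\<^bsub>A\<^esub>) \<one>\<^bsub>dual\<^esub> = s \<odot>\<^bsub>AD\<^esub> t"
proof -
  have h: "hash (s \<odot>\<^bsub>A\<^esub> \<one>\<^bsub>A\<^esub>) \<one>\<^bsub>dual\<^esub> = s \<odot>\<^bsub>AD\<^esub> hash \<one>\<^bsub>A\<^esub> \<one>\<^bsub>dual\<^esub>"
    by (rule smult_pure[symmetric]; (assumption | rule lins A.one_closed)+)
  have o: "hash \<one>\<^bsub>A\<^esub> \<one>\<^bsub>dual\<^esub> \<in> carrier AD"
    by (assumption | rule lins A.one_closed)+
  show "hash (s \<odot>\<^bsub>A\<^esub> \<one>\<^bsub>A\<^esub>) \<one>\<^bsub>dual\<^esub> \<otimes>\<^bsub>smash\<^esub> t = s \<odot>\<^bsub>AD\<^esub> t"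
    "t \<otimes>\<^bsub>smash\<^esub> hash (s \<odot>\<^bsub>A\<^esub> \<one>\<^bsub>A\<^esub>) \<one>\<^bsub>dual\<^esub> = s \<odot>\<^bsub>AD\<^esub> t"
    unfolding h using lin_smult[OF lin_smash1[OF assms(2) lin_id] assms(1) o]
      lin_smult[OF lin_smash2[OF assms(2) lin_id] assms(1) o] smash_one[OF assms(2)] by simp_all
qed

lemma smult_TS: "s \<odot>\<^bsub>TS M\<^esub> m = m \<star>\<^bsub>M\<^esub> hash (s \<odot>\<^bsub>A\<^esub> \<one>\<^bsub>A\<^esub>) \<one>\<^bsub>dual\<^esub>"
  by (simp add: smult_over_S)

lemma mem_scalar: "s \<in> carrier S \<Longrightarrow> hash (s \<odot>\<^bsub>A\<^esub> \<one>\<^bsub>A\<^esub>) \<one>\<^bsub>dual\<^esub> \<in> carrier AD"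
  by (assumption | rule lins A.one_closed)+

lemma lin_tract01:
  assumes "tmod M" "t \<in> carrier AD"
  shows "lin (TS M) (TS M) (\<lambda>m. m \<star>\<^bsub>M\<^esub> t)"
proof -
  interpret M: right_semimodule smash M by fact
  show ?thesis
    using M.ract_l_distr M.ract_l_null assms
    by (intro linI) (simp_all add: smult_TS mem_tract smash_simps tract_assoc mem_scalar hash_scalar)
qed

lemma lin_tract02:
  assumes "tmod M" "m \<in> carrier M"
  shows "lin AD (TS M) (\<lambda>t. m \<star>\<^bsub>M\<^esub> t)"
proof -
  interpret M: right_semimodule smash M by fact
  show ?thesis
    using M.ract_r_distr M.ract_r_null assms
    by (intro linI) (simp_all add: smult_TS mem_tract smash_simps tract_assoc mem_scalar hash_scalar)
qed

lemma lin_tract2 [lins]: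
  "tmod M \<Longrightarrow> m \<in> carrier M \<Longrightarrow> lin P AD F \<Longrightarrow> lin P (TS M) (\<lambda>p. m \<star>\<^bsub>M\<^esub> F p)"
  by (rule lin_compose[OF _ lin_tract02])

lemma right_linear_over_A:
  "right_linear smash M N \<phi> \<Longrightarrow> right_linear A (over_A M) (over_A N) \<phi>"
  by (auto simp: right_linear_def additive_map_def smash_simps mem_pure smod_A smod_dual mem_one_dual)

subsection \<open>Rational elements\<close>

text \<open>Membership in \<open>Rat\<close> rewritten through the pairing; the witness
  \<open>z\<close> is the future coaction of \<open>m\<close>.\<close>

definition rational :: "('m, ('a, 'c \<Rightarrow> 's) tens, 'y) rmodule_scheme \<Rightarrow> 'm \<Rightarrow> bool" where
  "rational M m \<longleftrightarrow> (\<exists>z\<in>carrier (TS M \<boxtimes> C). \<forall>t\<in>carrier AD. m \<star>\<^bsub>M\<^esub> t = pairing (over_A M) z t)"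

lemma Rat_iff:
  assumes "tmod M"
  shows "Rat M = {m \<in> carrier M. rational M m}"
proof -
  have "(\<lambda>t\<in>carrier smash. m \<star>\<^bsub>M\<^esub> t) \<in> alpha (over_A M) ` carrier (tensor_coring (over_A M)) \<longleftrightarrow> rational M m" for m
    unfolding alpha_image[OF amod_over_A[OF assms]] rational_def
    by (auto simp: image_iff fun_eq_iff restrict_def smash_simps)
  then show ?thesis
    by (simp add: Rat_def)
qed

text \<open>A witness for the image is obtained by applying \<open>\<phi> \<otimes> id\<close> to a
  witness for \<open>m\<close>, by naturality of the pairing.\<close>

lemma rational_map:
  assumes "tmod M" "tmod N" "right_linear smash M N \<phi>" "m \<in> carrier M" "rational M m"
  shows "rational N (\<phi> m)"
proof -
  obtain z where z: "z \<in> carrier (TS M \<boxtimes> C)" "\<And>t. t \<in> carrier AD \<Longrightarrow> m \<star>\<^bsub>M\<^esub> t = pairing (over_A M) z t"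
    using assms(5) by (auto simp: rational_def)
  note \<phi> = right_linear_over_A[OF assms(3)]
  have "\<phi> m \<star>\<^bsub>N\<^esub> t = pairing (over_A N) (tmap (TS N) C \<phi> z) t" if "t \<in> carrier AD" for t
  proof -
    have "\<phi> m \<star>\<^bsub>N\<^esub> t = \<phi> (m \<star>\<^bsub>M\<^esub> t)"
      using assms that by (simp add: right_linear_def smash_simps)
    then show ?thesis
      using pairing_natural[OF amod_over_A amod_over_A \<phi> z(1) that] z(2)[OF that] assms by simp
  qed
  moreover have "tmap (TS N) C \<phi> z \<in> carrier (TS N \<boxtimes> C)"
    by (rule lin_closed[OF lin_tmap z(1)]; (rule lins right_linear_lin \<phi> assms)+)
  ultimately show ?thesis
    unfolding rational_def by blast
qed

lemma rational_zero:
  assumes "tmod M"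
  shows "rational M \<zero>\<^bsub>M\<^esub>"
proof -
  have "\<zero>\<^bsub>M\<^esub> \<star>\<^bsub>M\<^esub> t = pairing (over_A M) \<zero>\<^bsub>TS M \<boxtimes> C\<^esub> t" if "t \<in> carrier AD" for t
    using lin_zero[OF lin_pairing1[OF amod_over_A[OF assms] that lin_id]] lin_zero[OF lin_tract01[OF assms that]]
    by simp
  then show ?thesis
    unfolding rational_def using assms
    by (intro bexI[of _ "\<zero>\<^bsub>TS M \<boxtimes> C\<^esub>"]) (auto intro!: smod_zero lins)
qed

lemma rational_add:
  assumes "tmod M" "m \<in> carrier M" "m' \<in> carrier M" "rational M m" "rational M m'"
  shows "rational M (m \<oplus>\<^bsub>M\<^esub> m')"
proof -
  obtain z where z: "z \<in> carrier (TS M \<boxtimes> C)" "\<And>t. t \<in> carrier AD \<Longrightarrow> m \<star>\<^bsub>M\<^esub> t = pairing (over_A M) z t"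
    using assms(4) by (auto simp: rational_def)
  obtain z' where z': "z' \<in> carrier (TS M \<boxtimes> C)" "\<And>t. t \<in> carrier AD \<Longrightarrow> m' \<star>\<^bsub>M\<^esub> t = pairing (over_A M) z' t"
    using assms(5) by (auto simp: rational_def)
  have "(m \<oplus>\<^bsub>M\<^esub> m') \<star>\<^bsub>M\<^esub> t = pairing (over_A M) (z \<oplus>\<^bsub>TS M \<boxtimes> C\<^esub> z') t" if "t \<in> carrier AD" for t
    using lin_add[OF lin_pairing1[OF amod_over_A[OF assms(1)] that lin_id] z(1) z'(1)]
      lin_add[OF lin_tract01[OF assms(1) that], of m m'] assms z(2)[OF that] z'(2)[OF that]
    by simp
  then show ?thesis
    unfolding rational_def using assms z z'
    by (intro bexI[of _ "z \<oplus>\<^bsub>TS M \<boxtimes> C\<^esub> z'"]) (auto intro!: smod_add lins)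
qed

subsection \<open>The trivial action on \<open>M \<otimes>\<^sub>S C\<close>\<close>

text \<open>\<open>M \<otimes> C\<close> with \<open>A\<close> acting on the first factor. It makes
  \<open>M \<otimes> C\<close> an A-semimodule to which the pairing applies again, so that elements
  of \<open>(M \<otimes> C) \<otimes> C\<close> can be compared, and of which Bourne quotients can
  be formed.\<close>

definition triv :: "('m, 'a, 'y) rmodule_scheme \<Rightarrow> (('m, 'c) tens, 'a) rmodule" where
  "triv M = \<lparr>carrier = carrier (over_S M \<boxtimes> C), mult = undefined, one = undefined,
     zero = \<zero>\<^bsub>over_S M \<boxtimes> C\<^esub>, add = add (over_S M \<boxtimes> C),
     ract = (\<lambda>u a. tensor_lift (over_S M \<boxtimes> C) (\<lambda>m c. pure (over_S M) C (m \<star>\<^bsub>M\<^esub> a) c) u)\<rparr>"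

lemma triv_simps:
  "carrier (triv M) = carrier (over_S M \<boxtimes> C)" "\<zero>\<^bsub>triv M\<^esub> = \<zero>\<^bsub>over_S M \<boxtimes> C\<^esub>"
  "add (triv M) = add (over_S M \<boxtimes> C)"
  "u \<star>\<^bsub>triv M\<^esub> a = tensor_lift (over_S M \<boxtimes> C) (\<lambda>m c. pure (over_S M) C (m \<star>\<^bsub>M\<^esub> a) c) u"
  by (simp_all add: triv_def)

lemma triv_pure:
  assumes [lins]: "amod M" "m \<in> carrier M" "c \<in> carrier C" "a \<in> carrier A"
  shows "pure (over_S M) C m c \<star>\<^bsub>triv M\<^esub> a = pure (over_S M) C (m \<star>\<^bsub>M\<^esub> a) c"
  unfolding triv_simps by (rule lift_pure; (assumption | rule lins | (simp; fail))+)

lemma lin_triv: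
  assumes [lins]: "amod M"
  shows "a \<in> carrier A \<Longrightarrow> lin (over_S M \<boxtimes> C) (over_S M \<boxtimes> C) (\<lambda>u. u \<star>\<^bsub>triv M\<^esub> a)"
    "u \<in> carrier (over_S M \<boxtimes> C) \<Longrightarrow> lin A (over_S M \<boxtimes> C) (\<lambda>a. u \<star>\<^bsub>triv M\<^esub> a)"
  unfolding triv_simps by (assumption | rule lins | (simp; fail))+

lemma amod_triv:
  assumes [lins]: "amod M"
  shows "amod (triv M)"
proof -
  interpret M: right_semimodule A M by fact
  note l = lin_triv[OF assms]
  have as: "u \<star>\<^bsub>triv M\<^esub> (a \<otimes>\<^bsub>A\<^esub> b) = u \<star>\<^bsub>triv M\<^esub> a \<star>\<^bsub>triv M\<^esub> b"
    if [lins]: "u \<in> carrier (over_S M \<boxtimes> C)" "a \<in> carrier A" "b \<in> carrier A" for u a b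
    by (rule lin_eqI[where g = "\<lambda>u. u \<star>\<^bsub>triv M\<^esub> a \<star>\<^bsub>triv M\<^esub> b", OF that(1) _ _ _ l(1) lin_compose[OF l(1) l(1)]],
        (assumption | rule lins)+)
      (simp add: triv_pure assms that M.ract_closed M.ract_assoc)
  have one: "u \<star>\<^bsub>triv M\<^esub> \<one>\<^bsub>A\<^esub> = u" if "u \<in> carrier (over_S M \<boxtimes> C)" for u
    by (rule lin_eqI[where g = "\<lambda>u. u", OF that _ _ _ l(1)], (assumption | rule lins A.one_closed)+)
      (simp add: triv_pure assms M.ract_one)
  show ?thesis
    by (intro right_semimodule.intro right_semimodule_axioms.intro A.semiring_axioms
        abelian_monoid_carrier_cong[OF abelian_stensor[OF smod_over_S[OF assms] smod_C]])
      (simp_all add: triv_simps(1-3) lin_add[OF l(1)] lin_add[OF l(2)] lin_zero[OF l(1)] lin_zero[OF l(2)]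
        lin_closed[OF l(1)] as one)
qed

text \<open>The scalars that \<open>triv M\<close> gets from \<open>A\<close> are those of the
  tensor product; hence tensoring \<open>triv M\<close> with \<open>C\<close> gives the iterated
  tensor product itself, not merely an isomorphic one.\<close>

lemma over_S_triv:
  assumes [lins]: "amod M" and u: "u \<in> carrier (over_S M \<boxtimes> C)" and s [lins]: "s \<in> carrier S"
  shows "s \<odot>\<^bsub>over_S (triv M)\<^esub> u = s \<odot>\<^bsub>over_S M \<boxtimes> C\<^esub> u"
  unfolding smult_over_S
  by (rule lin_eqI[where g = "\<lambda>u. s \<odot>\<^bsub>over_S M \<boxtimes> C\<^esub> u", OF u _ _ _ lin_triv(1)], (assumption | rule lins A.one_closed)+)
    (simp add: triv_pure assms lins(1) semimodule.smult_closed[OF smod_A] smult_pure smod_over_S smod_C smult_over_S)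

end

section \<open>Consequences of the \<alpha>-condition: injectivity and i-uniformity of the
  pairing\<close>

locale doi_koppinen_alpha = doi_koppinen_setting S B A \<rho>A C actC
  for S :: "'s ring"
    and B :: "('s, 'b) coalgebra"
    and A :: "('s, 'a) module"
    and \<rho>A :: "'a \<Rightarrow> ('a, 'b) tens"
    and C :: "('s, 'c) coalgebra"
    and actC :: "'c \<Rightarrow> 'b \<Rightarrow> 'c" +
  fixes U :: "'u itself"
  assumes inf: "infinite (UNIV :: 'u set)"
    and A_lepoll: "carrier A \<lesssim> (UNIV :: 'u set)" and C_lepoll: "carrier C \<lesssim> (UNIV :: 'u set)"
    and alpha_cond: "alpha_condition U"
begin

text \<open>Preimages of \<open>z\<close> and \<open>z'\<close> under \<open>theta\<close> have the
  same image under \<open>alpha\<close>, hence coincide.\<close>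

lemma pairing_inj0:
  fixes M :: "('u, 'a) rmodule"
  assumes "amod M" "z \<in> carrier (over_S M \<boxtimes> C)" "z' \<in> carrier (over_S M \<boxtimes> C)"
    and "\<And>t. t \<in> carrier AD \<Longrightarrow> pairing M z t = pairing M z' t"
  shows "z = z'"
proof -
  obtain x where x: "x \<in> carrier (tensor_coring M)" "theta M x = z"
    using theta_surj[OF assms(1,2)] .
  obtain x' where x': "x' \<in> carrier (tensor_coring M)" "theta M x' = z'"
    using theta_surj[OF assms(1,3)] .
  have "alpha M x = alpha M x'"
    using alpha_theta[OF assms(1)] x x' assms(4) by (simp add: smash_simps restrict_def fun_eq_iff)
  moreover have "inj_on (alpha M) (carrier (tensor_coring M))"
    using alpha_cond assms(1) by (simp add: alpha_condition_def)
  ultimately show ?thesis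
    using x x' by (auto dest: inj_onD)
qed

text \<open>A semimodule with small carrier is copied onto \<open>'u\<close> by an injection
  \<open>k\<close>, where the \<alpha>-condition applies. Naturality carries the pairing to the
  copy, and the inverse of \<open>k\<close>, tensored with \<open>C\<close>, brings the resulting
  equation back. By linearity it is enough to pair with pure elements.\<close>

lemma pairing_inj:
  fixes M :: "('m, 'a, 'y) rmodule_scheme"
  assumes M: "amod M" and le: "carrier M \<lesssim> (UNIV :: 'u set)"
    and z: "z \<in> carrier (over_S M \<boxtimes> C)" "z' \<in> carrier (over_S M \<boxtimes> C)"
    and eq: "\<And>a f. a \<in> carrier A \<Longrightarrow> f \<in> carrier dual \<Longrightarrow> pairing M z (hash a f) = pairing M z' (hash a f)"
  shows "z = z'"
proof -
  obtain k :: "'m \<Rightarrow> 'u" where k: "inj_on k (carrier M)"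
    using le by (auto simp: lepoll_def)
  let ?N = "push A M k"
  note N = right_semimodule_push[OF M congruent_map_inj[OF k]]
    and kl = right_linear_push[OF M congruent_map_inj[OF k]]
  have bij: "bij_betw k (carrier M) (carrier ?N)"
    using k by (simp add: bij_betw_def push_simps)
  note il = right_linear_inv[OF M kl bij]
  have e: "pairing M z t = pairing M z' t" if "t \<in> carrier AD" for t
    by (rule lin_eqI[OF that smod_A smod_dual smod_over_S[OF M] lin_pairing2[OF M z(1) lin_id] lin_pairing2[OF M z(2) lin_id] eq])
  have cl: "tmap (over_S ?N) C k u \<in> carrier (over_S ?N \<boxtimes> C)" if "u \<in> carrier (over_S M \<boxtimes> C)" for u
    by (rule lin_closed[OF lin_tmap that]; (rule lins right_linear_lin kl M N)+)
  have "tmap (over_S ?N) C k z = tmap (over_S ?N) C k z'"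
    by (rule pairing_inj0[OF N]) (use z in \<open>simp_all add: cl pairing_natural[OF M N kl] e\<close>)
  then have "tmap (over_S M) C (inv_into (carrier M) k) (tmap (over_S ?N) C k z) =
      tmap (over_S M) C (inv_into (carrier M) k) (tmap (over_S ?N) C k z')"
    by simp
  moreover have "tmap (over_S M) C (inv_into (carrier M) k) (tmap (over_S ?N) C k u) = u"
    if "u \<in> carrier (over_S M \<boxtimes> C)" for u
  proof -
    have "tmap (over_S M) C (inv_into (carrier M) k) (tmap (over_S ?N) C k u) = tmap (over_S M) C (\<lambda>m. m) u"
      by (rule tmap_tmap[OF smod_over_S[OF M] smod_over_S[OF N] smod_C smod_over_S[OF M]
            right_linear_lin[OF kl] right_linear_lin[OF il] _ that])
        (use k in simp)
    then show ?thesis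
      using tmap_id[OF smod_over_S[OF M] smod_C that] by simp
  qed
  ultimately show ?thesis
    using z by simp
qed

lemma smash_over_A_simps:
  "carrier smash_over_A = carrier AD" "\<zero>\<^bsub>smash_over_A\<^esub> = \<zero>\<^bsub>AD\<^esub>" "add smash_over_A = add AD"
  "x \<star>\<^bsub>smash_over_A\<^esub> b = tensor_lift AD (\<lambda>a f. hash (a \<otimes>\<^bsub>A\<^esub> b) f) x"
  by (simp_all add: smash_over_A_def smash_simps lift_smash)

lemma smash_over_A_ract:
  assumes [lins]: "x \<in> carrier AD" "b \<in> carrier A"
  shows "x \<star>\<^bsub>smash_over_A\<^esub> b = x \<otimes>\<^bsub>smash\<^esub> hash b \<one>\<^bsub>dual\<^esub>"
  unfolding smash_over_A_simps
proof (rule lin_eqI[OF assms(1), where g = "\<lambda>x. x \<otimes>\<^bsub>smash\<^esub> hash b \<one>\<^bsub>dual\<^esub>"])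
  fix a f assume [lins]: "a \<in> carrier A" "f \<in> carrier dual"
  have "tensor_lift AD (\<lambda>a. hash (a \<otimes>\<^bsub>A\<^esub> b)) (hash a f) = hash (a \<otimes>\<^bsub>A\<^esub> b) f"
    by (rule lift_pure; (assumption | rule lins)+)
  also have "\<dots> = hash a f \<otimes>\<^bsub>smash\<^esub> hash b \<one>\<^bsub>dual\<^esub>"
    by (rule smash_pure_one_right[symmetric]; (assumption | rule lins)+)
  finally show "tensor_lift AD (\<lambda>a. hash (a \<otimes>\<^bsub>A\<^esub> b)) (hash a f) = hash a f \<otimes>\<^bsub>smash\<^esub> hash b \<one>\<^bsub>dual\<^esub>" .
qed (assumption | rule lins)+

text \<open>The elementwise content of i-uniformity: a right A-linear map that becomes a pairing
  after adding a pairing is already a pairing.\<close>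

lemma pairing_i_uniform:
  fixes M :: "('u, 'a) rmodule"
  assumes M: "amod M" and h: "right_linear A smash_over_A M h"
    and u: "u \<in> carrier (over_S M \<boxtimes> C)" "u' \<in> carrier (over_S M \<boxtimes> C)"
    and eq: "\<And>t. t \<in> carrier AD \<Longrightarrow> h t \<oplus>\<^bsub>M\<^esub> pairing M u t = pairing M u' t"
  obtains z where "z \<in> carrier (over_S M \<boxtimes> C)" "\<And>t. t \<in> carrier AD \<Longrightarrow> h t = pairing M z t"
proof -
  \<comment> \<open>The elements of \<open>right_hom\<close> are extensional, so \<open>h\<close> is
    cut off outside the carrier; linearity survives because the action stays in the carrier.\<close>
  let ?H = "right_hom A smash_over_A M" and ?h = "\<lambda>t\<in>carrier smash. h t"
  obtain x where x: "x \<in> carrier (tensor_coring M)" "theta M x = u"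
    using theta_surj[OF M u(1)] .
  obtain x' where x': "x' \<in> carrier (tensor_coring M)" "theta M x' = u'"
    using theta_surj[OF M u(2)] .
  have "right_linear A smash_over_A M ?h"
  proof -
    have "x \<star>\<^bsub>smash_over_A\<^esub> b \<in> carrier AD" if "x \<in> carrier AD" "b \<in> carrier A" for x b
      using that by (simp add: smash_over_A_ract mem_smash_mult mem_pure smod_A smod_dual mem_one_dual)
    then show ?thesis
      using h by (simp add: right_linear_def additive_map_def smash_over_A_simps(1-3) smash_simps smod_zero smod_add
          smod_stensor smod_A smod_dual Pi_iff)
  qed
  then have "?h \<in> carrier ?H"
    by (simp add: right_hom_def smash_over_A_simps smash_simps)
  moreover have "?h \<oplus>\<^bsub>?H\<^esub> alpha M x = alpha M x'"
    using alpha_theta[OF M] x x' eq by (auto simp: right_hom_def smash_over_A_simps smash_simps fun_eq_iff)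
  moreover have "i_uniform (tensor_coring M) ?H (alpha M)"
    using alpha_cond M by (simp add: alpha_condition_def uniform_def)
  ultimately have "?h \<in> alpha M ` carrier (tensor_coring M)"
    using x(1) x'(1) unfolding i_uniform_def by blast
  then obtain z where "z \<in> carrier (over_S M \<boxtimes> C)" "?h = (\<lambda>t\<in>carrier smash. pairing M z t)"
    unfolding alpha_image[OF M] by blast
  then show thesis
    using that[of z] by (auto simp: fun_eq_iff restrict_def smash_simps split: if_splits)
qed

end

subsection \<open>Bourne quotients\<close>

text \<open>The class of \<open>m\<close> under the Bourne congruence, the substitute for
  \<open>m - m' \<in> I\<close> in the absence of subtraction. Being a class, it serves directly as
  quotient map for \<open>push\<close>.\<close>

definition bourne :: "('m, 'x) ring_scheme \<Rightarrow> 'm set \<Rightarrow> 'm \<Rightarrow> 'm set" where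
  "bourne M I m = {m' \<in> carrier M. \<exists>n\<in>I. \<exists>n'\<in>I. m \<oplus>\<^bsub>M\<^esub> n = m' \<oplus>\<^bsub>M\<^esub> n'}"

lemma bourne_eq_iff:
  assumes "abelian_monoid M" "I \<subseteq> carrier M" "\<zero>\<^bsub>M\<^esub> \<in> I" "\<And>n n'. n \<in> I \<Longrightarrow> n' \<in> I \<Longrightarrow> n \<oplus>\<^bsub>M\<^esub> n' \<in> I"
    and m: "m \<in> carrier M" "m' \<in> carrier M"
  shows "bourne M I m = bourne M I m' \<longleftrightarrow> (\<exists>n\<in>I. \<exists>n'\<in>I. m \<oplus>\<^bsub>M\<^esub> n = m' \<oplus>\<^bsub>M\<^esub> n')"
proof -
  interpret M: abelian_monoid M by fact
  \<comment> \<open>Transitivity adds the witnesses of the two equations, which is why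
    \<open>I\<close> has to be closed under addition.\<close>
  have tr: "\<exists>n\<in>I. \<exists>n'\<in>I. x \<oplus>\<^bsub>M\<^esub> n = z \<oplus>\<^bsub>M\<^esub> n'"
    if "x \<in> carrier M" "y \<in> carrier M" "z \<in> carrier M" "n1 \<in> I" "n2 \<in> I" "n3 \<in> I" "n4 \<in> I"
      "x \<oplus>\<^bsub>M\<^esub> n1 = y \<oplus>\<^bsub>M\<^esub> n2" "y \<oplus>\<^bsub>M\<^esub> n3 = z \<oplus>\<^bsub>M\<^esub> n4" for x y z n1 n2 n3 n4
  proof (intro bexI)
    have c: "n1 \<in> carrier M" "n2 \<in> carrier M" "n3 \<in> carrier M" "n4 \<in> carrier M"
      using that assms(2) by auto
    have "x \<oplus>\<^bsub>M\<^esub> (n1 \<oplus>\<^bsub>M\<^esub> n3) = y \<oplus>\<^bsub>M\<^esub> n2 \<oplus>\<^bsub>M\<^esub> n3"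
      using that(1,8) c by (simp flip: M.a_assoc)
    also have "\<dots> = y \<oplus>\<^bsub>M\<^esub> n3 \<oplus>\<^bsub>M\<^esub> n2"
      using that(2) c by (simp add: M.a_ac)
    also have "\<dots> = z \<oplus>\<^bsub>M\<^esub> (n4 \<oplus>\<^bsub>M\<^esub> n2)"
      using that(3,9) c by (simp add: M.a_assoc)
    finally show "x \<oplus>\<^bsub>M\<^esub> (n1 \<oplus>\<^bsub>M\<^esub> n3) = z \<oplus>\<^bsub>M\<^esub> (n4 \<oplus>\<^bsub>M\<^esub> n2)" .
  qed (use that assms(4) in auto)
  show ?thesis
  proof
    assume "bourne M I m = bourne M I m'"
    moreover have "m' \<in> bourne M I m'"
      using m assms(3) by (auto simp: bourne_def)
    ultimately have "m' \<in> bourne M I m"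
      by simp
    then show "\<exists>n\<in>I. \<exists>n'\<in>I. m \<oplus>\<^bsub>M\<^esub> n = m' \<oplus>\<^bsub>M\<^esub> n'"
      by (simp add: bourne_def)
  next
    assume "\<exists>n\<in>I. \<exists>n'\<in>I. m \<oplus>\<^bsub>M\<^esub> n = m' \<oplus>\<^bsub>M\<^esub> n'"
    then obtain n n' where n: "n \<in> I" "n' \<in> I" "m \<oplus>\<^bsub>M\<^esub> n = m' \<oplus>\<^bsub>M\<^esub> n'" by blast
    show "bourne M I m = bourne M I m'"
      unfolding bourne_def
    proof (intro Collect_cong conj_cong HOL.refl iffI; elim bexE)
      fix x k k' assume "x \<in> carrier M" "k \<in> I" "k' \<in> I" "m \<oplus>\<^bsub>M\<^esub> k = x \<oplus>\<^bsub>M\<^esub> k'"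
      then show "\<exists>n\<in>I. \<exists>n'\<in>I. m' \<oplus>\<^bsub>M\<^esub> n = x \<oplus>\<^bsub>M\<^esub> n'"
        using tr[of m' m x n' n k k'] m n by simp
    next
      fix x k k' assume "x \<in> carrier M" "k \<in> I" "k' \<in> I" "m' \<oplus>\<^bsub>M\<^esub> k = x \<oplus>\<^bsub>M\<^esub> k'"
      then show "\<exists>n\<in>I. \<exists>n'\<in>I. m \<oplus>\<^bsub>M\<^esub> n = x \<oplus>\<^bsub>M\<^esub> n'"
        using tr[of m m' x n n' k k'] m n by simp
    qed
  qed
qed

lemma congruent_map_bourne:
  assumes "right_semimodule R M" and I: "I \<subseteq> carrier M" "\<zero>\<^bsub>M\<^esub> \<in> I"
    "\<And>n n'. n \<in> I \<Longrightarrow> n' \<in> I \<Longrightarrow> n \<oplus>\<^bsub>M\<^esub> n' \<in> I" "\<And>n r. n \<in> I \<Longrightarrow> r \<in> carrier R \<Longrightarrow> n \<star>\<^bsub>M\<^esub> r \<in> I"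
  shows "congruent_map R M (bourne M I)"
  unfolding congruent_map_def
proof (intro ballI impI conjI)
  interpret M: right_semimodule R M by fact
  note iff = bourne_eq_iff[OF M.M.abelian_monoid_axioms I(1,2,3)]
  fix x x' assume x: "x \<in> carrier M" "x' \<in> carrier M" "bourne M I x = bourne M I x'"
  then obtain n n' where n: "n \<in> I" "n' \<in> I" "x \<oplus>\<^bsub>M\<^esub> n = x' \<oplus>\<^bsub>M\<^esub> n'"
    using iff by auto
  then have c: "n \<in> carrier M" "n' \<in> carrier M"
    using I(1) by auto
  show "bourne M I (x \<oplus>\<^bsub>M\<^esub> y) = bourne M I (x' \<oplus>\<^bsub>M\<^esub> y)" if y: "y \<in> carrier M" for y
  proof -
    have "x \<oplus>\<^bsub>M\<^esub> y \<oplus>\<^bsub>M\<^esub> n = x \<oplus>\<^bsub>M\<^esub> n \<oplus>\<^bsub>M\<^esub> y"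
      using x y c by (simp add: M.M.a_ac)
    also have "\<dots> = x' \<oplus>\<^bsub>M\<^esub> y \<oplus>\<^bsub>M\<^esub> n'"
      unfolding n(3) using x y c by (simp add: M.M.a_ac)
    finally show ?thesis
      using iff[of "x \<oplus>\<^bsub>M\<^esub> y" "x' \<oplus>\<^bsub>M\<^esub> y"] x y n by auto
  qed
  show "bourne M I (x \<star>\<^bsub>M\<^esub> r) = bourne M I (x' \<star>\<^bsub>M\<^esub> r)" if r: "r \<in> carrier R" for r
  proof -
    have "x \<star>\<^bsub>M\<^esub> r \<oplus>\<^bsub>M\<^esub> n \<star>\<^bsub>M\<^esub> r = x' \<star>\<^bsub>M\<^esub> r \<oplus>\<^bsub>M\<^esub> n' \<star>\<^bsub>M\<^esub> r"
      using x r c n(3) by (simp flip: M.ract_l_distr)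
    then show ?thesis
      using iff[of "x \<star>\<^bsub>M\<^esub> r" "x' \<star>\<^bsub>M\<^esub> r"] x r n I(4) by (auto simp: M.ract_closed)
  qed
qed

text \<open>Universal property of the quotient: a linear map that is constant on the fibres of
  \<open>\<pi>\<close> factors, the value being read off at any chosen preimage.\<close>

lemma push_factor:
  assumes M: "right_semimodule R M" and c: "congruent_map R M \<pi>" and \<phi>: "right_linear R M W \<phi>"
    and k: "\<And>m m'. \<lbrakk>m \<in> carrier M; m' \<in> carrier M; \<pi> m = \<pi> m'\<rbrakk> \<Longrightarrow> \<phi> m = \<phi> m'"
  shows "right_linear R (push R M \<pi>) W (\<lambda>q. \<phi> (inv_into (carrier M) \<pi> q))"
    "m \<in> carrier M \<Longrightarrow> \<phi> (inv_into (carrier M) \<pi> (\<pi> m)) = \<phi> m"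
proof -
  interpret M: right_semimodule R M by fact
  show s: "\<phi> (inv_into (carrier M) \<pi> (\<pi> m)) = \<phi> m" if "m \<in> carrier M" for m
    using that by (intro k) (auto intro: inv_into_into f_inv_into_f)
  show "right_linear R (push R M \<pi>) W (\<lambda>q. \<phi> (inv_into (carrier M) \<pi> q))"
    using \<phi> by (auto simp: right_linear_def additive_map_def push_simps push_add[OF M c] push_ract[OF M c] s
        M.ract_closed)
qed

context doi_koppinen_alpha
begin

subsection \<open>Subsemimodules of rational semimodules\<close>

text \<open>\<open>- \<otimes>\<^sub>S C\<close> preserves cokernels: an element of \<open>M \<otimes>\<^sub>S C\<close> that dies in \<open>(M / N) \<otimes>\<^sub>S C\<close> lies in the
  subtractive closure of the image of \<open>N \<otimes>\<^sub>S C\<close>.\<close>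

lemma tensor_cokernel:
  fixes M :: "('m, 'a, 'y) rmodule_scheme" and N :: "('m, 'a, 'z) rmodule_scheme"
  assumes M: "amod M" and N: "amod N" and i: "right_linear A N M (\<lambda>n. n)" and z: "z \<in> carrier (over_S M \<boxtimes> C)"
    and Q: "Q = push A M (bourne M (carrier N))"
    and 0: "tmap (over_S Q) C (bourne M (carrier N)) z = \<zero>\<^bsub>over_S Q \<boxtimes> C\<^esub>"
  obtains u u' where "u \<in> carrier (over_S N \<boxtimes> C)" "u' \<in> carrier (over_S N \<boxtimes> C)"
    "z \<oplus>\<^bsub>over_S M \<boxtimes> C\<^esub> tmap (over_S M) C (\<lambda>n. n) u = tmap (over_S M) C (\<lambda>n. n) u'"
proof -
  interpret M: right_semimodule A M by fact
  interpret N: right_semimodule A N by fact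
  note il = right_linear_lin[OF i]
  note jl = lin_tmap[OF smod_over_S[OF N] smod_over_S[OF M] smod_C il]
  let ?j = "tmap (over_S M) C (\<lambda>n. n)" and ?r = "bourne M (carrier N)" and ?L = "triv M"
  \<comment> \<open>The image of \<open>N \<otimes> C\<close> in \<open>M \<otimes> C\<close>. The
    tensored inclusion \<open>?j\<close> may fail to be injective, so the argument works with its
    image.\<close>
  let ?I = "?j ` carrier (over_S N \<boxtimes> C)"
  let ?p = "bourne ?L ?I"
  have ops: "n \<in> carrier M" "n \<oplus>\<^bsub>M\<^esub> n' \<in> carrier N" "\<zero>\<^bsub>M\<^esub> \<in> carrier N"
    "a \<in> carrier A \<Longrightarrow> n \<star>\<^bsub>M\<^esub> a \<in> carrier N" "a \<in> carrier A \<Longrightarrow> n \<star>\<^bsub>N\<^esub> a = n \<star>\<^bsub>M\<^esub> a"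
    if "n \<in> carrier N" "n' \<in> carrier N" for n n' a
    using that i N.M.a_closed N.M.zero_closed N.ract_closed[of n a]
    by (auto simp: right_linear_def additive_map_def)
  have sub: "carrier N \<subseteq> carrier M" and zN: "\<zero>\<^bsub>M\<^esub> \<in> carrier N"
    using ops(1,3) N.M.zero_closed by blast+
  have cr: "congruent_map A M ?r"
    by (rule congruent_map_bourne[OF M]) (use sub zN ops(2,4) in auto)
  have riff: "?r x = ?r y \<longleftrightarrow> (\<exists>n\<in>carrier N. \<exists>n'\<in>carrier N. x \<oplus>\<^bsub>M\<^esub> n = y \<oplus>\<^bsub>M\<^esub> n')"
    if "x \<in> carrier M" "y \<in> carrier M" for x y
    by (rule bourne_eq_iff[OF M.M.abelian_monoid_axioms sub zN ops(2) that])
  note Qm = right_semimodule_push[OF M cr, folded Q] and rl = right_linear_push[OF M cr, folded Q]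
  note tl = lin_tmap[OF smod_over_S[OF M] smod_over_S[OF Qm] smod_C right_linear_lin[OF rl]]
  note Lm = amod_triv[OF M] and tr = lin_triv[OF M]
  interpret L: right_semimodule A ?L by (rule Lm)
  have jtriv: "?j (u \<star>\<^bsub>triv N\<^esub> a) = ?j u \<star>\<^bsub>?L\<^esub> a" if "u \<in> carrier (over_S N \<boxtimes> C)" "a \<in> carrier A" for u a
    by (rule lin_eqI[where f = "\<lambda>u. ?j (u \<star>\<^bsub>triv N\<^esub> a)" and g = "\<lambda>u. ?j u \<star>\<^bsub>?L\<^esub> a", OF that(1) smod_over_S[OF N] smod_C
          smod_stensor[OF smod_over_S[OF M] smod_C] lin_compose[OF lin_triv(1)[OF N that(2)] jl]
          lin_compose[OF jl tr(1)[OF that(2)]]])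
      (use that(2) in \<open>simp add: triv_pure M N tmap_pure[OF smod_over_S[OF N] smod_over_S[OF M] smod_C il] ops(1,5)
        N.ract_closed flip: ops(5)\<close>)
  have Isub: "?I \<subseteq> carrier ?L"
    using lin_closed[OF jl] by (auto simp: triv_simps)
  have I0: "\<zero>\<^bsub>?L\<^esub> \<in> ?I"
    using lin_zero[OF jl] smod_zero[OF smod_stensor[OF smod_over_S[OF N] smod_C]]
    by (auto simp: triv_simps image_iff intro!: bexI[of _ "\<zero>\<^bsub>over_S N \<boxtimes> C\<^esub>"])
  have Iadd: "x \<oplus>\<^bsub>?L\<^esub> y \<in> ?I" if xy: "x \<in> ?I" "y \<in> ?I" for x y
  proof -
    obtain u v where "x = ?j u" "u \<in> carrier (over_S N \<boxtimes> C)" "y = ?j v" "v \<in> carrier (over_S N \<boxtimes> C)"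
      using xy by blast
    then show ?thesis
      by (intro image_eqI[of _ _ "u \<oplus>\<^bsub>over_S N \<boxtimes> C\<^esub> v"])
        (simp_all add: triv_simps lin_add[OF jl] smod_add smod_stensor smod_over_S N smod_C)
  qed
  have Iract: "x \<star>\<^bsub>?L\<^esub> a \<in> ?I" if xa: "x \<in> ?I" "a \<in> carrier A" for x a
  proof -
    obtain u where "x = ?j u" "u \<in> carrier (over_S N \<boxtimes> C)"
      using xa by blast
    then show ?thesis
      using jtriv xa(2) lin_closed[OF lin_triv(1)[OF N xa(2)]]
      by (intro image_eqI[of _ _ "u \<star>\<^bsub>triv N\<^esub> a"]) auto
  qed
  have cp: "congruent_map A ?L ?p"
    by (rule congruent_map_bourne[OF Lm Isub I0 Iadd Iract])
  \<comment> \<open>\<open>W\<close> is the quotient of \<open>M \<otimes> C\<close> by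
    \<open>?I\<close>. A map from \<open>Q \<otimes> C\<close> to \<open>W\<close> whose composite
    with the tensored quotient map is the projection \<open>?p\<close> shows that
    \<open>?p z\<close> vanishes.\<close>
  define W where "W = push A ?L ?p"
  note Wm = right_semimodule_push[OF Lm cp, folded W_def] and pl0 = right_linear_push[OF Lm cp, folded W_def]
  have piff: "?p x = ?p y \<longleftrightarrow> (\<exists>n\<in>?I. \<exists>n'\<in>?I. x \<oplus>\<^bsub>?L\<^esub> n = y \<oplus>\<^bsub>?L\<^esub> n')"
    if "x \<in> carrier ?L" "y \<in> carrier ?L" for x y
    by (rule bourne_eq_iff[OF L.M.abelian_monoid_axioms Isub I0 Iadd that])
  have pl: "lin (over_S M \<boxtimes> C) (over_S W) ?p"
    using right_linear_lin[OF pl0] over_S_triv[OF M]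
    by (auto simp: left_linear_def additive_map_def triv_simps(1-3))
  have \<phi>l: "right_linear A M W (\<lambda>m. ?p (pure (over_S M) C m c))" if "c \<in> carrier C" for c
  proof -
    have "lin (over_S M) (over_S W) (\<lambda>m. ?p (pure (over_S M) C m c))"
      by (rule lin_compose[OF _ pl]) (rule lins M that)+
    moreover have "?p (pure (over_S M) C (m \<star>\<^bsub>M\<^esub> a) c) = ?p (pure (over_S M) C m c) \<star>\<^bsub>W\<^esub> a"
      if m: "m \<in> carrier M" "a \<in> carrier A" for m a
    proof -
      have "pure (over_S M) C m c \<in> carrier ?L"
        unfolding triv_simps using m by (intro mem_pure smod_over_S M smod_C \<open>c \<in> carrier C\<close>) simp
      then show ?thesis
        using pl0 m(2) triv_pure[OF M m(1) \<open>c \<in> carrier C\<close> m(2)] unfolding right_linear_def by metis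
    qed
    ultimately show ?thesis
      by (simp add: right_linear_def left_linear_def additive_map_def)
  qed
  \<comment> \<open>If \<open>m + n = m' + n'\<close> with \<open>n\<close>, \<open>n'\<close> in
    \<open>N\<close>, tensoring with \<open>c\<close> gives the same relation with elements of
    \<open>?I\<close>. Hence \<open>m \<mapsto> ?p (m \<otimes> c)\<close> factors through
    \<open>Q\<close>.\<close>
  have k: "?p (pure (over_S M) C m c) = ?p (pure (over_S M) C m' c)"
    if m: "m \<in> carrier M" "m' \<in> carrier M" and c: "c \<in> carrier C" and eq: "?r m = ?r m'" for m m' c
  proof -
    obtain n n' where n: "n \<in> carrier N" "n' \<in> carrier N" "m \<oplus>\<^bsub>M\<^esub> n = m' \<oplus>\<^bsub>M\<^esub> n'"
      using riff[of m m'] m eq by auto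
    note p1 = lin_add[OF lin_pure1[OF smod_over_S[OF M] smod_C c lin_id]]
    have e: "pure (over_S M) C m c \<oplus>\<^bsub>?L\<^esub> ?j (pure (over_S N) C n c) = pure (over_S M) C m' c \<oplus>\<^bsub>?L\<^esub> ?j (pure (over_S N) C n' c)"
      using p1[of m n] p1[of m' n'] n m c ops(1)
      by (simp add: triv_simps(3) tmap_pure[OF smod_over_S[OF N] smod_over_S[OF M] smod_C il])
    have j: "?j (pure (over_S N) C x c) \<in> ?I" if "x \<in> carrier N" for x
      using that c by (intro imageI mem_pure smod_over_S N smod_C) auto
    have ex: "\<exists>x\<in>?I. \<exists>x'\<in>?I. pure (over_S M) C m c \<oplus>\<^bsub>?L\<^esub> x = pure (over_S M) C m' c \<oplus>\<^bsub>?L\<^esub> x'"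
      by (rule bexI[OF _ j[OF n(1)]], rule bexI[OF _ j[OF n(2)]], rule e)
    have "pure (over_S M) C x c \<in> carrier ?L" if "x \<in> carrier M" for x
      unfolding triv_simps using that c by (intro mem_pure smod_over_S M smod_C) simp_all
    from piff[THEN iffD2, OF this[OF m(1)] this[OF m(2)] ex] show ?thesis .
  qed
  let ?\<sigma> = "inv_into (carrier M) ?r"
  let ?h = "\<lambda>q c. ?p (pure (over_S M) C (?\<sigma> q) c)"
  have h1 [lins]: "lin (over_S Q) (over_S W) (\<lambda>q. ?h q c)" if "c \<in> carrier C" for c
    unfolding Q by (rule right_linear_lin[OF push_factor(1)[OF M cr \<phi>l[OF that]]]) (rule k[OF _ _ that])
  have h2 [lins]: "lin C (over_S W) (?h q)" if "q \<in> carrier (over_S Q)" for q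
  proof -
    have "?\<sigma> q \<in> carrier M"
      using that by (auto simp: Q push_simps intro: inv_into_into)
    then show ?thesis
      by (intro lin_compose[OF _ pl]) (rule lins M | simp)+
  qed
  \<comment> \<open>On pure tensors the induced map undoes the passage to \<open>Q\<close>, up to
    \<open>?p\<close>.\<close>
  have "tensor_lift (over_S W) ?h (tmap (over_S Q) C ?r z) = ?p z"
  proof (rule lin_eqI[where f = "\<lambda>z. tensor_lift (over_S W) ?h (tmap (over_S Q) C ?r z)", OF z])
    fix m c assume m: "m \<in> carrier (over_S M)" "c \<in> carrier C"
    have "tensor_lift (over_S W) ?h (tmap (over_S Q) C ?r (pure (over_S M) C m c)) = ?h (?r m) c"
      unfolding tmap_pure[OF smod_over_S[OF M] smod_over_S[OF Qm] smod_C right_linear_lin[OF rl] m]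
      by (rule lift_pure; (assumption | rule lins Qm Wm lin_closed[OF right_linear_lin[OF rl]] m)+)
    also have "\<dots> = ?p (pure (over_S M) C m c)"
      by (rule push_factor(2)[OF M cr \<phi>l[OF m(2)] k[OF _ _ m(2)]]) (use m(1) in simp_all)
    finally show "tensor_lift (over_S W) ?h (tmap (over_S Q) C ?r (pure (over_S M) C m c)) = ?p (pure (over_S M) C m c)" .
  qed (assumption | rule lins M Wm Qm pl tl)+
  moreover have "tensor_lift (over_S W) ?h (tmap (over_S Q) C ?r z) = \<zero>\<^bsub>over_S W\<^esub>"
    unfolding 0 by (rule lin_zero[OF lin_lift_arg0]; (assumption | rule lins Qm Wm)+)
  ultimately have "?p z = ?p \<zero>\<^bsub>?L\<^esub>"
    by (simp add: W_def push_simps)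
  \<comment> \<open>That \<open>z\<close> and zero have equal Bourne classes means precisely
    \<open>z + v = 0 + v'\<close> with \<open>v\<close>, \<open>v'\<close> from the image of
    \<open>N \<otimes> C\<close>.\<close>
  then obtain v v' where "v \<in> ?I" "v' \<in> ?I" "z \<oplus>\<^bsub>?L\<^esub> v = \<zero>\<^bsub>?L\<^esub> \<oplus>\<^bsub>?L\<^esub> v'"
    using piff[of z "\<zero>\<^bsub>?L\<^esub>"] z by (auto simp: triv_simps(1,2) smod_zero smod_stensor smod_over_S M smod_C)
  then show thesis
    using that Isub L.M.l_zero by (auto simp: triv_simps(3) subset_iff)
qed

lemma rational_sub:
  fixes M N :: "('u, ('a, 'c \<Rightarrow> 's) tens) rmodule"
  assumes M: "tmod M" and N: "tmod N" and sub: "subsemimodule smash N M" and n: "n \<in> carrier N" and r: "rational M n"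
  shows "rational N n"
proof -
  note AM = amod_over_A[OF M] and AN = amod_over_A[OF N]
  obtain z where z: "z \<in> carrier (TS M \<boxtimes> C)" "\<And>t. t \<in> carrier AD \<Longrightarrow> n \<star>\<^bsub>M\<^esub> t = pairing (over_A M) z t"
    using r by (auto simp: rational_def)
  have i0: "right_linear smash N M (\<lambda>n. n)"
    using sub by (auto simp: subsemimodule_def right_linear_def additive_map_def)
  note i = right_linear_over_A[OF i0]
  let ?r = "bourne (over_A M) (carrier (over_A N))"
  define Q where "Q = push A (over_A M) ?r"
  interpret M: right_semimodule A "over_A M" by (rule AM)
  interpret N: right_semimodule A "over_A N" by (rule AN)
  have sub': "carrier N \<subseteq> carrier M" "\<zero>\<^bsub>M\<^esub> \<in> carrier N"
    and add': "\<And>x y. x \<in> carrier N \<Longrightarrow> y \<in> carrier N \<Longrightarrow> x \<oplus>\<^bsub>M\<^esub> y \<in> carrier N"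
    and ract': "\<And>x t. x \<in> carrier N \<Longrightarrow> t \<in> carrier AD \<Longrightarrow> x \<star>\<^bsub>M\<^esub> t = x \<star>\<^bsub>N\<^esub> t"
    using sub N.M.zero_closed N.M.a_closed by (auto simp: subsemimodule_def smash_simps)
  have cr: "congruent_map A (over_A M) ?r"
    by (rule congruent_map_bourne[OF AM])
      (use sub' add' in \<open>simp_all add: ract' mem_tract N mem_pure smod_A smod_dual mem_one_dual\<close>)
  note Qm = right_semimodule_push[OF AM cr, folded Q_def] and rl = right_linear_push[OF AM cr, folded Q_def]
  note tl = lin_tmap[OF smod_over_S[OF AM] smod_over_S[OF Qm] smod_C right_linear_lin[OF rl]]
  \<comment> \<open>The elements of \<open>Q\<close> are sets, but there are no more of them than
    elements of \<open>M\<close>, as \<open>pairing_inj\<close> demands.\<close>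
  have Qle: "carrier Q \<lesssim> (UNIV :: 'u set)"
    unfolding Q_def push_simps by (rule lepoll_trans[OF image_lepoll]) (simp add: subset_imp_lepoll)
  have 0: "tmap (over_S Q) C ?r z = \<zero>\<^bsub>over_S Q \<boxtimes> C\<^esub>"
  proof (rule pairing_inj[OF Qm Qle])
    fix a f assume a: "a \<in> carrier A" "f \<in> carrier dual"
    then have t: "hash a f \<in> carrier AD" by (intro lins)
    have nt: "n \<star>\<^bsub>N\<^esub> hash a f \<in> carrier N"
      using mem_tract[OF N n t] .
    have "pairing Q (tmap (over_S Q) C ?r z) (hash a f) = ?r (n \<star>\<^bsub>M\<^esub> hash a f)"
      unfolding z(2)[OF t] by (rule pairing_natural[OF AM Qm rl z(1) t])
    \<comment> \<open>The element \<open>n t\<close> lies in \<open>N\<close>, and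
      \<open>n t + 0 = 0 + n t\<close> exhibits its class as that of zero.\<close>
    also have "\<dots> = ?r \<zero>\<^bsub>M\<^esub>"
    proof -
      have "n \<star>\<^bsub>N\<^esub> hash a f \<oplus>\<^bsub>M\<^esub> \<zero>\<^bsub>M\<^esub> = \<zero>\<^bsub>M\<^esub> \<oplus>\<^bsub>M\<^esub> n \<star>\<^bsub>N\<^esub> hash a f"
        using M.M.l_zero M.M.r_zero nt sub' by auto
      then show ?thesis
        using nt sub' add' ract'[OF n t]
        by (subst bourne_eq_iff[OF M.M.abelian_monoid_axioms]) (auto simp: subset_iff)
    qed
    also have "\<dots> = pairing Q \<zero>\<^bsub>over_S Q \<boxtimes> C\<^esub> (hash a f)"
      using lin_zero[OF lin_pairing1[OF Qm t lin_id]] by (simp add: Q_def push_simps)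
    finally show "pairing Q (tmap (over_S Q) C ?r z) (hash a f) = pairing Q \<zero>\<^bsub>over_S Q \<boxtimes> C\<^esub> (hash a f)" .
  qed (use lin_closed[OF tl z(1)] in \<open>simp_all add: smod_zero smod_stensor smod_over_S Qm smod_C\<close>)
  obtain u u' where u: "u \<in> carrier (TS N \<boxtimes> C)" "u' \<in> carrier (TS N \<boxtimes> C)"
    and eq: "z \<oplus>\<^bsub>TS M \<boxtimes> C\<^esub> tmap (TS M) C (\<lambda>n. n) u = tmap (TS M) C (\<lambda>n. n) u'"
    using tensor_cokernel[OF AM AN i z(1) Q_def 0] by blast
  note jl = lin_tmap[OF smod_over_S[OF AN] smod_over_S[OF AM] smod_C right_linear_lin[OF i]]
  \<comment> \<open>The map \<open>t \<mapsto> n t\<close> takes values in \<open>N\<close>, so it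
    is an element of the Hom monoid to which i-uniformity for \<open>N\<close> applies.\<close>
  have "right_linear A smash_over_A (over_A N) (\<lambda>t. n \<star>\<^bsub>N\<^esub> t)"
    using lin_additive[OF lin_tract02[OF N n]]
    by (simp add: right_linear_def additive_map_def smash_over_A_simps(1-3) smash_over_A_ract tract_assoc N n
        mem_pure smod_A smod_dual mem_one_dual)
  \<comment> \<open>The equation found in \<open>M \<otimes> C\<close> is paired with
    \<open>t\<close>. Naturality along the inclusion turns the pairings of \<open>u\<close> and
    \<open>u'\<close> into pairings over \<open>N\<close>, where addition is that of
    \<open>M\<close>.\<close>
  moreover have "n \<star>\<^bsub>N\<^esub> t \<oplus>\<^bsub>over_A N\<^esub> pairing (over_A N) u t = pairing (over_A N) u' t" if t: "t \<in> carrier AD" for t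
  proof -
    have "n \<star>\<^bsub>N\<^esub> t \<oplus>\<^bsub>N\<^esub> pairing (over_A N) u t = n \<star>\<^bsub>M\<^esub> t \<oplus>\<^bsub>M\<^esub> pairing (over_A N) u t"
      using sub ract'[OF n t] mem_tract[OF N n t] mem_pairing[OF AN u(1) t] by (simp add: subsemimodule_def)
    also have "\<dots> = pairing (over_A M) z t \<oplus>\<^bsub>M\<^esub> pairing (over_A M) (tmap (TS M) C (\<lambda>n. n) u) t"
      by (simp add: z(2)[OF t] pairing_natural[OF AN AM i u(1) t])
    also have "\<dots> = pairing (over_A M) (tmap (TS M) C (\<lambda>n. n) u') t"
      using lin_add[OF lin_pairing1[OF AM t lin_id] z(1) lin_closed[OF jl u(1)]] eq by simp
    finally show ?thesis
      by (simp add: pairing_natural[OF AN AM i u(2) t])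
  qed
  ultimately obtain z' where "z' \<in> carrier (TS N \<boxtimes> C)" "\<And>t. t \<in> carrier AD \<Longrightarrow> n \<star>\<^bsub>N\<^esub> t = pairing (over_A N) z' t"
    using pairing_i_uniform[OF AN _ u] by blast
  then show ?thesis
    by (auto simp: rational_def)
qed

end

context doi_koppinen_setting
begin

subsection \<open>From Doi-Koppinen semimodules to \<open>A #\<^sup>o\<^sup>p C\<^sup>*\<close>-semimodules\<close>

lemma mem_hash: "a \<in> carrier A \<Longrightarrow> f \<in> carrier dual \<Longrightarrow> hash a f \<in> carrier AD"
  by (intro lins)

abbreviation "dk M \<equiv> doi_koppinen_semimodule M"

lemma
  assumes "dk M"
  shows dk_amod: "amod M" and lin_coact0: "lin (over_S M) (over_S M \<boxtimes> C) (coact M)"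
    and coassoc_coact: "coassociative S (over_S M) C (coact M)"
    and counit_coact: "\<And>m. m \<in> carrier M \<Longrightarrow>
      tensor_lift (over_S M) (\<lambda>m0 m1. counit C m1 \<odot>\<^bsub>over_S M\<^esub> m0) (coact M m) = m"
    and coact_ract: "\<And>m a. m \<in> carrier M \<Longrightarrow> a \<in> carrier A \<Longrightarrow> coact M (m \<star>\<^bsub>M\<^esub> a) =
       tensor_lift (over_S M \<boxtimes> C) (\<lambda>m0 m1. tensor_lift (over_S M \<boxtimes> C) (\<lambda>a0 a1.
         pure (over_S M) C (m0 \<star>\<^bsub>M\<^esub> a0) (actC m1 a1)) (\<rho>A a)) (coact M m)"
  using assms by (simp_all add: doi_koppinen_semimodule_def right_semicomodule_def Let_def)

lemma mem_over_SD: "m \<in> carrier (over_S M) \<Longrightarrow> m \<in> carrier M"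
  by simp

lemma mem_coact [lins]: "dk M \<Longrightarrow> m \<in> carrier M \<Longrightarrow> coact M m \<in> carrier (over_S M \<boxtimes> C)"
  by (rule lin_closed[OF lin_coact0]) simp_all

lemma lin_coact [lins]: "dk M \<Longrightarrow> lin P (over_S M) F \<Longrightarrow> lin P (over_S M \<boxtimes> C) (\<lambda>p. coact M (F p))"
  by (rule lin_compose[OF _ lin_coact0])

lemma coact_ract_lift:
  assumes [lins]: "dk M" "m \<in> carrier M" "a \<in> carrier A" "smod Z"
    and [lins]: "\<And>c. c \<in> carrier C \<Longrightarrow> lin (over_S M) Z (\<lambda>m. h m c)" "\<And>m. m \<in> carrier M \<Longrightarrow> lin C Z (h m)"
  shows "tensor_lift Z h (coact M (m \<star>\<^bsub>M\<^esub> a)) =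
    tensor_lift Z (\<lambda>m0 m1. tensor_lift Z (\<lambda>a0 a1. h (m0 \<star>\<^bsub>M\<^esub> a0) (actC m1 a1)) (\<rho>A a)) (coact M m)"
proof -
  note [lins] = dk_amod[OF assms(1)]
  have L: "lin (over_S M \<boxtimes> C) Z (tensor_lift Z h)"
    by (rule lin_lift_arg0; (assumption | rule lins | erule mem_over_SD)+)
  have h: "h m c \<in> carrier Z" if "m \<in> carrier M" "c \<in> carrier C" for m c
    using lin_closed[OF assms(5)] that by simp
  have "tensor_lift Z h (coact M (m \<star>\<^bsub>M\<^esub> a)) = tensor_lift Z (\<lambda>m0 m1. tensor_lift Z h (tensor_lift (over_S M \<boxtimes> C) (\<lambda>a0 a1.
         pure (over_S M) C (m0 \<star>\<^bsub>M\<^esub> a0) (actC m1 a1)) (\<rho>A a))) (coact M m)"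
    unfolding coact_ract[OF assms(1-3)]
    by (rule lin_lift[OF _ _ _ L]; (assumption | rule lins | erule mem_over_SD)+)
  also have "\<dots> = tensor_lift Z (\<lambda>m0 m1. tensor_lift Z (\<lambda>a0 a1. h (m0 \<star>\<^bsub>M\<^esub> a0) (actC m1 a1)) (\<rho>A a)) (coact M m)"
  proof (rule lift_cong, (assumption | rule lins)+)
    fix m0 m1 assume "m0 \<in> carrier (over_S M)" and [lins]: "m1 \<in> carrier C"
    then have [lins]: "m0 \<in> carrier M" by simp
    have "tensor_lift Z h (tensor_lift (over_S M \<boxtimes> C) (\<lambda>a0 a1. pure (over_S M) C (m0 \<star>\<^bsub>M\<^esub> a0) (actC m1 a1)) (\<rho>A a)) =
      tensor_lift Z (\<lambda>a0 a1. tensor_lift Z h (pure (over_S M) C (m0 \<star>\<^bsub>M\<^esub> a0) (actC m1 a1))) (\<rho>A a)"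
      by (rule lin_lift[OF _ _ _ L]; (assumption | rule lins | erule mem_over_SD)+)
    also have "\<dots> = tensor_lift Z (\<lambda>a0 a1. h (m0 \<star>\<^bsub>M\<^esub> a0) (actC m1 a1)) (\<rho>A a)"
      by (rule lift_cong, (assumption | rule lins)+, rule lift_pure; (assumption | rule lins | erule mem_over_SD)+)
    finally show "tensor_lift Z h (tensor_lift (over_S M \<boxtimes> C) (\<lambda>a0 a1. pure (over_S M) C (m0 \<star>\<^bsub>M\<^esub> a0) (actC m1 a1)) (\<rho>A a)) = \<dots>" .
  qed
  finally show ?thesis .
qed

definition to_smash :: "('m, 'a, 'c) dk_module \<Rightarrow> ('m, ('a, 'c \<Rightarrow> 's) tens) rmodule" where
  "to_smash M = \<lparr>carrier = carrier M, mult = (\<lambda>_ _. undefined), one = undefined, zero = \<zero>\<^bsub>M\<^esub>, add = add M,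
     ract = (\<lambda>m t. if m \<in> carrier M \<and> t \<in> carrier smash then pairing M (coact M m) t else undefined)\<rparr>"

lemma to_smash_simps [simp]:
  "carrier (to_smash M) = carrier M" "\<zero>\<^bsub>to_smash M\<^esub> = \<zero>\<^bsub>M\<^esub>" "add (to_smash M) = add M"
  "m \<in> carrier M \<Longrightarrow> t \<in> carrier AD \<Longrightarrow> m \<star>\<^bsub>to_smash M\<^esub> t = pairing M (coact M m) t"
  by (simp_all add: to_smash_def smash_simps)

lemma smult_mult: "smod Z \<Longrightarrow> z \<in> carrier Z \<Longrightarrow> s \<in> carrier S \<Longrightarrow> t \<in> carrier S \<Longrightarrow>
    s \<odot>\<^bsub>Z\<^esub> (t \<odot>\<^bsub>Z\<^esub> z) = (t \<otimes>\<^bsub>S\<^esub> s) \<odot>\<^bsub>Z\<^esub> z"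
  by (simp add: semimodule.smult_assoc smult_left_commute)

text \<open>Associativity on generators: acting by \<open>a # f\<close> and then by
  \<open>b # g\<close> gives the sum of \<open>f(c) g(m1 a1) m0 a0 b\<close>, with
  \<open>m \<otimes> c\<close> running over the coaction of \<open>z\<close> and
  \<open>m0 \<otimes> m1\<close> over that of \<open>m\<close>. Coassociativity makes
  \<open>g\<close> and \<open>f\<close> see two halves of one comultiplication, and they combine to
  \<open>(a1 g) * f\<close>; the order is that of the smash product.\<close>

lemma tmod_to_smash:
  assumes [lins]: "dk M"
  shows "tmod (to_smash M)"
proof (rule smash_moduleI[where Z = "over_S M"])
  let ?O = "over_S M"
  let ?act = "\<lambda>z a f. tensor_lift ?O (\<lambda>m c. ev f c \<odot>\<^bsub>?O\<^esub> (m \<star>\<^bsub>M\<^esub> a)) (coact M z)"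
  note [lins] = dk_amod[OF assms]
  show "smod ?O" by (rule lins)+
  have lz: "lin ?O ?O (\<lambda>z. ?act z a f)" if [lins]: "a \<in> carrier A" "f \<in> carrier dual" for a f
    by (assumption | rule lins | erule mem_over_SD)+
  have la: "lin A ?O (\<lambda>a. ?act z a f)" if "z \<in> carrier M" and [lins]: "f \<in> carrier dual" for z f
  proof -
    note [lins] = that(1)
    show ?thesis by (assumption | rule lins | erule mem_over_SD)+
  qed
  have lf: "lin dual ?O (?act z a)" if [lins]: "z \<in> carrier M" "a \<in> carrier A" for z a
    by (assumption | rule lins | erule mem_over_SD)+
  show "lin ?O ?O (\<lambda>z. ?act z a f)" if "a \<in> carrier A" "f \<in> carrier dual" for a f
    by (rule lz[OF that])
  show "lin A ?O (\<lambda>a. ?act z a f)" if "z \<in> carrier ?O" "f \<in> carrier dual" for z f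
    using la that by simp
  show "lin dual ?O (?act z a)" if "z \<in> carrier ?O" "a \<in> carrier A" for z a
    using lf that by simp
  show "z \<star>\<^bsub>to_smash M\<^esub> t = tensor_lift ?O (?act z) t" if z0: "z \<in> carrier ?O" and t [lins]: "t \<in> carrier AD" for z t
  proof -
    have z [lins]: "z \<in> carrier M" using z0 by simp
    have "pairing M (coact M z) t = tensor_lift ?O (?act z) t"
    proof (rule lin_eqI[where f = "\<lambda>t. pairing M (coact M z) t", OF t])
      fix a f assume [lins]: "a \<in> carrier A" "f \<in> carrier dual"
      have "pairing M (coact M z) (hash a f) = ?act z a f"
        by (rule pairing_right_pure; (assumption | rule lins)+)
      also have "\<dots> = tensor_lift ?O (?act z) (hash a f)"
        by (rule lift_pure[symmetric]; (assumption | rule lins | erule mem_over_SD)+)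
      finally show "pairing M (coact M z) (hash a f) = tensor_lift ?O (?act z) (hash a f)" .
    qed (assumption | rule lins | erule mem_over_SD)+
    then show ?thesis using z t by simp
  qed
  show "?act (?act z a f) b g = tensor_lift ?O (\<lambda>a0 a1. ?act z (a0 \<otimes>\<^bsub>A\<^esub> b) (dual_act a1 g \<otimes>\<^bsub>dual\<^esub> f)) (\<rho>A a)"
    if z0: "z \<in> carrier ?O" and x [lins]: "a \<in> carrier A" "f \<in> carrier dual" "b \<in> carrier A" "g \<in> carrier dual" for z a f b g
  proof -
    have z [lins]: "z \<in> carrier M" using z0 by simp
    let ?K = "\<lambda>x c' c. tensor_lift ?O (\<lambda>a0 a1. ev f c \<odot>\<^bsub>?O\<^esub> (ev g (actC c' a1) \<odot>\<^bsub>?O\<^esub> (x \<star>\<^bsub>M\<^esub> a0 \<star>\<^bsub>M\<^esub> b))) (\<rho>A a)"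
    have "?act (?act z a f) b g = tensor_lift ?O (\<lambda>m c. ?act (ev f c \<odot>\<^bsub>?O\<^esub> (m \<star>\<^bsub>M\<^esub> a)) b g) (coact M z)"
      by (rule lin_lift[where \<phi> = "\<lambda>z. ?act z b g"]; (assumption | rule lins | erule mem_over_SD)+)
    also have "\<dots> = tensor_lift ?O (\<lambda>m c. tensor_lift ?O (\<lambda>x c'. ?K x c' c) (coact M m)) (coact M z)"
    proof (rule lift_cong, (assumption | rule lins)+)
      fix m c assume "m \<in> carrier ?O" and c [lins]: "c \<in> carrier C"
      then have m [lins]: "m \<in> carrier M" by simp
      have "?act (ev f c \<odot>\<^bsub>?O\<^esub> (m \<star>\<^bsub>M\<^esub> a)) b g = ev f c \<odot>\<^bsub>?O\<^esub> ?act (m \<star>\<^bsub>M\<^esub> a) b g"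
        by (rule lin_smult[OF lz]; (assumption | rule lins | erule mem_over_SD)+)
      also have "?act (m \<star>\<^bsub>M\<^esub> a) b g = tensor_lift ?O (\<lambda>x c'. tensor_lift ?O (\<lambda>a0 a1. ev g (actC c' a1) \<odot>\<^bsub>?O\<^esub> (x \<star>\<^bsub>M\<^esub> a0 \<star>\<^bsub>M\<^esub> b)) (\<rho>A a)) (coact M m)"
        by (rule coact_ract_lift; (assumption | rule lins | erule mem_over_SD)+)
      also have "ev f c \<odot>\<^bsub>?O\<^esub> \<dots> = tensor_lift ?O (\<lambda>x c'. ev f c \<odot>\<^bsub>?O\<^esub> tensor_lift ?O (\<lambda>a0 a1. ev g (actC c' a1) \<odot>\<^bsub>?O\<^esub> (x \<star>\<^bsub>M\<^esub> a0 \<star>\<^bsub>M\<^esub> b)) (\<rho>A a)) (coact M m)"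
        by (rule lin_lift[where \<phi> = "\<lambda>y. ev f c \<odot>\<^bsub>?O\<^esub> y"]; (assumption | rule lins | erule mem_over_SD)+)
      also have "\<dots> = tensor_lift ?O (\<lambda>x c'. ?K x c' c) (coact M m)"
        by (rule lift_cong, (assumption | rule lins)+, rule lin_lift[where \<phi> = "\<lambda>y. ev f c \<odot>\<^bsub>?O\<^esub> y"];
            (assumption | rule lins | erule mem_over_SD)+)
      finally show "?act (ev f c \<odot>\<^bsub>?O\<^esub> (m \<star>\<^bsub>M\<^esub> a)) b g = tensor_lift ?O (\<lambda>x c'. ?K x c' c) (coact M m)" .
    qed
    also have "\<dots> = tensor_lift ?O (\<lambda>m0 m1. tensor_lift ?O (?K m0) (comult C m1)) (coact M z)"
      by (rule coassoc_lift[OF coassoc_coact lin_coact0 lin_comult0]; (assumption | rule lins | erule mem_over_SD)+)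
    also have "\<dots> = tensor_lift ?O (\<lambda>m0 m1. tensor_lift ?O (\<lambda>a0 a1.
        ev (dual_act a1 g \<otimes>\<^bsub>dual\<^esub> f) m1 \<odot>\<^bsub>?O\<^esub> (m0 \<star>\<^bsub>M\<^esub> (a0 \<otimes>\<^bsub>A\<^esub> b))) (\<rho>A a)) (coact M z)"
    proof (rule lift_cong, (assumption | rule lins)+)
      fix m0 m1 assume "m0 \<in> carrier ?O" and c [lins]: "m1 \<in> carrier C"
      then have m [lins]: "m0 \<in> carrier M" by simp
      have "tensor_lift ?O (?K m0) (comult C m1) = tensor_lift ?O (\<lambda>a0 a1. tensor_lift ?O (\<lambda>c' c.
          ev f c \<odot>\<^bsub>?O\<^esub> (ev g (actC c' a1) \<odot>\<^bsub>?O\<^esub> (m0 \<star>\<^bsub>M\<^esub> a0 \<star>\<^bsub>M\<^esub> b))) (comult C m1)) (\<rho>A a)"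
        by (rule lift_swap; (assumption | rule lins | erule mem_over_SD)+)
      also have "\<dots> = tensor_lift ?O (\<lambda>a0 a1. ev (dual_act a1 g \<otimes>\<^bsub>dual\<^esub> f) m1 \<odot>\<^bsub>?O\<^esub> (m0 \<star>\<^bsub>M\<^esub> (a0 \<otimes>\<^bsub>A\<^esub> b))) (\<rho>A a)"
      proof (rule lift_cong, (assumption | rule lins)+)
        fix a0 a1 assume a [lins]: "a0 \<in> carrier A" "a1 \<in> carrier B"
        have "tensor_lift ?O (\<lambda>c' c. ev f c \<odot>\<^bsub>?O\<^esub> (ev g (actC c' a1) \<odot>\<^bsub>?O\<^esub> (m0 \<star>\<^bsub>M\<^esub> a0 \<star>\<^bsub>M\<^esub> b))) (comult C m1) =
          tensor_lift ?O (\<lambda>c' c. (ev (dual_act a1 g) c' \<otimes>\<^bsub>S\<^esub> ev f c) \<odot>\<^bsub>?O\<^esub> (m0 \<star>\<^bsub>M\<^esub> (a0 \<otimes>\<^bsub>A\<^esub> b))) (comult C m1)"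
          by (rule lift_cong, (assumption | rule lins)+)
            (simp add: smult_mult smod_over_S dk_amod assms mem_ract mem_ev mem_act a m x
              right_semimodule.ract_assoc[OF dk_amod[OF assms]])
        also have "\<dots> = tensor_lift (scalars S) (\<lambda>c' c. ev (dual_act a1 g) c' \<otimes>\<^bsub>S\<^esub> ev f c) (comult C m1) \<odot>\<^bsub>?O\<^esub> (m0 \<star>\<^bsub>M\<^esub> (a0 \<otimes>\<^bsub>A\<^esub> b))"
          by (rule lin_lift[where \<phi> = "\<lambda>s. s \<odot>\<^bsub>?O\<^esub> (m0 \<star>\<^bsub>M\<^esub> (a0 \<otimes>\<^bsub>A\<^esub> b))", symmetric]; (assumption | rule lins | erule mem_over_SD)+)
        finally show "tensor_lift ?O (\<lambda>c' c. ev f c \<odot>\<^bsub>?O\<^esub> (ev g (actC c' a1) \<odot>\<^bsub>?O\<^esub> (m0 \<star>\<^bsub>M\<^esub> a0 \<star>\<^bsub>M\<^esub> b))) (comult C m1) =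
           ev (dual_act a1 g \<otimes>\<^bsub>dual\<^esub> f) m1 \<odot>\<^bsub>?O\<^esub> (m0 \<star>\<^bsub>M\<^esub> (a0 \<otimes>\<^bsub>A\<^esub> b))"
          by (simp only: ev_dual(5)[OF c])
      qed
      finally show "tensor_lift ?O (?K m0) (comult C m1) = \<dots>" .
    qed
    also have "\<dots> = tensor_lift ?O (\<lambda>a0 a1. ?act z (a0 \<otimes>\<^bsub>A\<^esub> b) (dual_act a1 g \<otimes>\<^bsub>dual\<^esub> f)) (\<rho>A a)"
      by (rule lift_swap; (assumption | rule lins | erule mem_over_SD)+)
    finally show ?thesis .
  qed
  show "?act z \<one>\<^bsub>A\<^esub> \<one>\<^bsub>dual\<^esub> = z" if "z \<in> carrier ?O" for z
  proof -
    have z: "z \<in> carrier M" using that by simp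
    have "?act z \<one>\<^bsub>A\<^esub> \<one>\<^bsub>dual\<^esub> = tensor_lift ?O (\<lambda>m c. counit C c \<odot>\<^bsub>?O\<^esub> m) (coact M z)"
      by (rule lift_cong[OF mem_coact[OF assms z]], (rule lins)+)
        (simp add: right_semimodule.ract_one[OF dk_amod[OF assms]])
    then show ?thesis
      using counit_coact[OF assms z] by simp
  qed
qed simp_all

text \<open>By the counit law \<open>a # \<epsilon>\<close> acts as \<open>a\<close> did, so
  \<open>over_A\<close> recovers the original A-semimodule on its carrier.\<close>

lemma to_smash_ract_A:
  assumes [lins]: "dk M" "m \<in> carrier M" "a \<in> carrier A"
  shows "m \<star>\<^bsub>to_smash M\<^esub> hash a \<one>\<^bsub>dual\<^esub> = m \<star>\<^bsub>M\<^esub> a"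
proof -
  note [lins] = dk_amod[OF assms(1)]
  have h: "hash a \<one>\<^bsub>dual\<^esub> \<in> carrier AD" by (assumption | rule lins)+
  have "m \<star>\<^bsub>to_smash M\<^esub> hash a \<one>\<^bsub>dual\<^esub> = tensor_lift (over_S M) (\<lambda>m c. ev \<one>\<^bsub>dual\<^esub> c \<odot>\<^bsub>over_S M\<^esub> (m \<star>\<^bsub>M\<^esub> a)) (coact M m)"
    unfolding to_smash_simps(4)[OF assms(2) h] by (rule pairing_right_pure; (assumption | rule lins)+)
  also have "\<dots> = tensor_lift (over_S M) (\<lambda>m c. (counit C c \<odot>\<^bsub>over_S M\<^esub> m) \<star>\<^bsub>M\<^esub> a) (coact M m)"
    by (rule lift_cong, (assumption | rule lins)+)
      (simp add: lin_smult[OF lin_ract01[OF dk_amod]] assms mem_counit)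
  also have "\<dots> = tensor_lift (over_S M) (\<lambda>m c. counit C c \<odot>\<^bsub>over_S M\<^esub> m) (coact M m) \<star>\<^bsub>M\<^esub> a"
    by (rule lin_lift[where \<phi> = "\<lambda>x. x \<star>\<^bsub>M\<^esub> a", symmetric]; (assumption | rule lins | erule mem_over_SD)+)
  finally show ?thesis
    by (simp add: counit_coact assms)
qed

text \<open>Needed because \<open>M\<close> and \<open>over_A (to_smash M)\<close>, or
  \<open>to_dk M\<close> and \<open>over_A M\<close>, agree on their carriers without being the same
  record.\<close>

lemma pairing_agree:
  assumes "amod M" and N: "carrier M = carrier N" "add M = add N" "\<zero>\<^bsub>M\<^esub> = \<zero>\<^bsub>N\<^esub>"
    and r: "\<And>m a. m \<in> carrier N \<Longrightarrow> a \<in> carrier A \<Longrightarrow> m \<star>\<^bsub>M\<^esub> a = m \<star>\<^bsub>N\<^esub> a"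
    and z: "z \<in> carrier (over_S M \<boxtimes> C)" and t: "t \<in> carrier AD"
  shows "pairing M z t = pairing N z t"
proof -
  note [lins] = assms(1) t
  have l: "tensor_lift (over_S M) = tensor_lift (over_S N)"
    by (rule tensor_lift_carrier_cong) (simp_all add: N)
  have cl: "m \<star>\<^bsub>M\<^esub> a \<in> carrier N" if "m \<in> carrier N" "a \<in> carrier A" for m a
    using mem_ract[OF assms(1)] that N(1) by simp
  have "ev f c \<odot>\<^bsub>over_S M\<^esub> (m \<star>\<^bsub>M\<^esub> a) = ev f c \<odot>\<^bsub>over_S N\<^esub> (m \<star>\<^bsub>N\<^esub> a)"
    if "m \<in> carrier N" "a \<in> carrier A" "c \<in> carrier C" "f \<in> carrier dual" for m a c f
    using that r cl[OF that(1,2)] mem_ev by (simp add: smult_over_S semimodule.smult_closed[OF smod_A])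
  then show ?thesis
    unfolding pairing_def l
    by (intro lift_cong[OF z] lift_cong[OF t]) (rule lins | simp add: N)+
qed

lemma over_S_agree:
  assumes N: "carrier M = carrier N" "add M = add N" "\<zero>\<^bsub>M\<^esub> = \<zero>\<^bsub>N\<^esub>"
    and r: "\<And>m a. m \<in> carrier N \<Longrightarrow> a \<in> carrier A \<Longrightarrow> m \<star>\<^bsub>M\<^esub> a = m \<star>\<^bsub>N\<^esub> a"
  shows "carrier (over_S M \<boxtimes> C) = carrier (over_S N \<boxtimes> C)" "pure (over_S M) C = pure (over_S N) C"
    "tensor_lift (over_S M \<boxtimes> C) = tensor_lift (over_S N \<boxtimes> C)"
  by (rule stensor_agree; simp add: N smult_over_S r semimodule.smult_closed[OF smod_A])+

text \<open>The coaction of \<open>m\<close> is the witness, by the very definition of the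
  action.\<close>

lemma rational_to_smash:
  assumes M: "dk M" and m: "m \<in> carrier M"
  shows "rational (to_smash M) m"
proof -
  have r: "x \<star>\<^bsub>M\<^esub> a = x \<star>\<^bsub>over_A (to_smash M)\<^esub> a" if "x \<in> carrier M" "a \<in> carrier A" for x a
    using to_smash_ract_A[OF M that] by simp
  note e = over_S_agree[of M "over_A (to_smash M)", simplified over_A_simps to_smash_simps, OF HOL.refl HOL.refl HOL.refl r[unfolded over_A_simps]]
  have "m \<star>\<^bsub>to_smash M\<^esub> t = pairing (over_A (to_smash M)) (coact M m) t" if t: "t \<in> carrier AD" for t
    unfolding to_smash_simps(4)[OF m t]
    by (rule pairing_agree[OF dk_amod[OF M] _ _ _ _ mem_coact[OF M m] t]) (simp_all only: over_A_simps(1-3) to_smash_simps(1-3) r)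
  then show ?thesis
    unfolding rational_def using mem_coact[OF M m] e(1) by auto
qed

lemma dk_hom_imp_smash_linear:
  assumes M: "dk M" and N: "dk N" and f: "right_linear A M N f" and c: "colinear M N f"
  shows "right_linear smash (to_smash M) (to_smash N) f"
proof -
  have "f (m \<star>\<^bsub>to_smash M\<^esub> t) = f m \<star>\<^bsub>to_smash N\<^esub> t" if m: "m \<in> carrier M" and t: "t \<in> carrier AD" for m t
  proof -
    have fm: "f m \<in> carrier N" using f m by (auto simp: right_linear_def additive_map_def)
    have "coact N (f m) = tmap (over_S N) C f (coact M m)"
      using c m by (simp add: colinear_def tmap_def)
    then show ?thesis
      using pairing_natural[OF dk_amod[OF M] dk_amod[OF N] f mem_coact[OF M m] t] by (simp add: m t fm)
  qed
  then show ?thesis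
    using f by (simp add: right_linear_def additive_map_def smash_simps(1) Pi_iff)
qed

end

context doi_koppinen_alpha
begin

text \<open>A-linearity is the case \<open>t = a # \<epsilon>\<close>. For colinearity, the two
  sides pair with \<open>t\<close> to \<open>f m t\<close> and \<open>f (m t)\<close>, and the
  pairing over \<open>N\<close> is injective.\<close>

lemma smash_linear_imp_dk_hom:
  fixes M N :: "('u, 'a, 'c) dk_module"
  assumes M: "dk M" and N: "dk N" and f: "right_linear smash (to_smash M) (to_smash N) f"
  shows "right_linear A M N f" "colinear M N f"
proof -
  have fm: "f m \<in> carrier N" if "m \<in> carrier M" for m
    using f that by (auto simp: right_linear_def additive_map_def)
  have ft: "f (m \<star>\<^bsub>to_smash M\<^esub> t) = f m \<star>\<^bsub>to_smash N\<^esub> t" if m: "m \<in> carrier M" and t: "t \<in> carrier AD" for m t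
    using f m t by (simp add: right_linear_def smash_simps)
  have "f (m \<star>\<^bsub>M\<^esub> a) = f m \<star>\<^bsub>N\<^esub> a" if m: "m \<in> carrier M" and a: "a \<in> carrier A" for m a
  proof -
    have "hash a \<one>\<^bsub>dual\<^esub> \<in> carrier AD" by (assumption | rule lins a)+
    then show ?thesis
      using ft[OF m] to_smash_ract_A[OF M m a] to_smash_ract_A[OF N fm[OF m] a] by metis
  qed
  then show fA: "right_linear A M N f"
    using f by (simp add: right_linear_def additive_map_def Pi_iff)
  show "colinear M N f"
    unfolding colinear_def tmap_def[symmetric]
  proof
    fix m assume m: "m \<in> carrier M"
    show "coact N (f m) = tmap (over_S N) C f (coact M m)"
    proof (rule pairing_inj[OF dk_amod[OF N]])
      show "carrier N \<lesssim> (UNIV :: 'u set)" by (simp add: subset_imp_lepoll)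
      show "coact N (f m) \<in> carrier (over_S N \<boxtimes> C)" by (rule mem_coact[OF N fm[OF m]])
      show "tmap (over_S N) C f (coact M m) \<in> carrier (over_S N \<boxtimes> C)"
        by (rule lin_closed[OF lin_tmap[OF _ _ _ right_linear_lin[OF fA]] mem_coact[OF M m]]; (assumption | rule lins dk_amod M N)+)
      fix a g assume [lins]: "a \<in> carrier A" "g \<in> carrier dual"
      then have t: "hash a g \<in> carrier AD" by (intro lins)
      show "pairing N (coact N (f m)) (hash a g) = pairing N (tmap (over_S N) C f (coact M m)) (hash a g)"
        using pairing_natural[OF dk_amod[OF M] dk_amod[OF N] fA mem_coact[OF M m] t] ft[OF m t] fm[OF m] m t by simp
    qed
  qed
qed

subsection \<open>From rational semimodules to Doi-Koppinen semimodules\<close>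

text \<open>For a rational element of a smash semimodule the witness is unique by injectivity of the
  pairing, so the choice is harmless.\<close>

definition coaction :: "('u, ('a, 'c \<Rightarrow> 's) tens) rmodule \<Rightarrow> 'u \<Rightarrow> ('u, 'c) tens" where
  "coaction M m = (SOME z. z \<in> carrier (TS M \<boxtimes> C) \<and> (\<forall>t\<in>carrier AD. m \<star>\<^bsub>M\<^esub> t = pairing (over_A M) z t))"

definition to_dk :: "('u, ('a, 'c \<Rightarrow> 's) tens) rmodule \<Rightarrow> ('u, 'a, 'c) dk_module" where
  "to_dk M = \<lparr>carrier = carrier M, mult = (\<lambda>_ _. undefined), one = undefined, zero = \<zero>\<^bsub>M\<^esub>, add = add M,
     ract = (\<lambda>m a. if m \<in> carrier M \<and> a \<in> carrier A then m \<star>\<^bsub>M\<^esub> hash a \<one>\<^bsub>dual\<^esub> else undefined),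
     coact = (\<lambda>m\<in>carrier M. coaction M m)\<rparr>"

lemma to_dk_simps [simp]:
  "carrier (to_dk M) = carrier M" "\<zero>\<^bsub>to_dk M\<^esub> = \<zero>\<^bsub>M\<^esub>" "add (to_dk M) = add M"
  "m \<in> carrier M \<Longrightarrow> a \<in> carrier A \<Longrightarrow> m \<star>\<^bsub>to_dk M\<^esub> a = m \<star>\<^bsub>M\<^esub> hash a \<one>\<^bsub>dual\<^esub>"
  "m \<in> carrier M \<Longrightarrow> coact (to_dk M) m = coaction M m"
  by (simp_all add: to_dk_def)

section \<open>The coaction of a rational semimodule and its Doi-Koppinen axioms\<close>

context
  fixes M :: "('u, ('a, 'c \<Rightarrow> 's) tens) rmodule"
  assumes M: "tmod M" and rat: "\<And>m. m \<in> carrier M \<Longrightarrow> rational M m"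
begin

abbreviation "X \<equiv> to_dk M"
abbreviation "X\<^sub>S \<equiv> over_S X"

lemma amod_X [lins]: "amod X"
proof -
  interpret A': right_semimodule A "over_A M" by (rule amod_over_A[OF M])
  show ?thesis
    by (intro right_semimodule.intro right_semimodule_axioms.intro A.semiring_axioms
        abelian_monoid_carrier_cong[OF A'.M.abelian_monoid_axioms])
      (use A'.M.a_closed A'.M.zero_closed A'.ract_closed A'.ract_l_distr A'.ract_r_distr A'.ract_assoc A'.ract_one A'.ract_l_null A'.ract_r_null in simp_all)
qed

lemma X_le: "carrier X \<lesssim> (UNIV :: 'u set)"
  by (simp add: subset_imp_lepoll)

lemma TS_X:
  "carrier (TS M \<boxtimes> C) = carrier (X\<^sub>S \<boxtimes> C)" "pure (TS M) C = pure X\<^sub>S C" "tensor_lift (TS M \<boxtimes> C) = tensor_lift (X\<^sub>S \<boxtimes> C)"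
  by (rule over_S_agree; simp)+

lemma coaction:
  assumes "m \<in> carrier M"
  shows "coaction M m \<in> carrier (X\<^sub>S \<boxtimes> C)" "t \<in> carrier AD \<Longrightarrow> pairing X (coaction M m) t = m \<star>\<^bsub>M\<^esub> t"
proof -
  have "\<exists>z. z \<in> carrier (TS M \<boxtimes> C) \<and> (\<forall>t\<in>carrier AD. m \<star>\<^bsub>M\<^esub> t = pairing (over_A M) z t)"
    using rat[OF assms] by (auto simp: rational_def)
  note c = someI_ex[OF this, folded coaction_def]
  then show "coaction M m \<in> carrier (X\<^sub>S \<boxtimes> C)"
    using TS_X(1) by simp
  show "pairing X (coaction M m) t = m \<star>\<^bsub>M\<^esub> t" if "t \<in> carrier AD"
    using c that pairing_agree[OF amod_over_A[OF M], of X "coaction M m" t] by simp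
qed

lemma X_eqI:
  assumes "z \<in> carrier (X\<^sub>S \<boxtimes> C)" "z' \<in> carrier (X\<^sub>S \<boxtimes> C)"
    and "\<And>a f. a \<in> carrier A \<Longrightarrow> f \<in> carrier dual \<Longrightarrow> pairing X z (hash a f) = pairing X z' (hash a f)"
  shows "z = z'"
  by (rule pairing_inj[OF amod_X X_le assms])

lemma lin_tract_X:
  assumes "t \<in> carrier AD"
  shows "lin X\<^sub>S X\<^sub>S (\<lambda>m. m \<star>\<^bsub>M\<^esub> t)"
  using lin_tract01[OF M assms]
  by (simp add: left_linear_def additive_map_def smult_over_S semimodule.smult_closed[OF smod_A] mem_tract[OF M _ assms])

text \<open>Each equation is tested by pairing, where it becomes linearity of
  \<open>m \<mapsto> m t\<close>.\<close>

lemma lin_coaction: "lin X\<^sub>S (X\<^sub>S \<boxtimes> C) (coaction M)"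
proof (rule linI)
  note [lins] = amod_X
  have sX: "smod (X\<^sub>S \<boxtimes> C)" "smod X\<^sub>S" by (rule lins)+
  note p = lin_pairing1[OF amod_X mem_hash lin_id]
  show "coaction M m \<in> carrier (X\<^sub>S \<boxtimes> C)" if "m \<in> carrier X\<^sub>S" for m
    using coaction(1) that by simp
  show "coaction M \<zero>\<^bsub>X\<^sub>S\<^esub> = \<zero>\<^bsub>X\<^sub>S \<boxtimes> C\<^esub>"
  proof (rule X_eqI)
    show "coaction M \<zero>\<^bsub>X\<^sub>S\<^esub> \<in> carrier (X\<^sub>S \<boxtimes> C)"
      using smod_zero[OF sX(2)] coaction(1) by simp
    show "pairing X (coaction M \<zero>\<^bsub>X\<^sub>S\<^esub>) (hash a f) = pairing X \<zero>\<^bsub>X\<^sub>S \<boxtimes> C\<^esub> (hash a f)"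
      if "a \<in> carrier A" "f \<in> carrier dual" for a f
      using smod_zero[OF sX(2)] coaction(2)[OF _ mem_hash[OF that]] lin_zero[OF p[OF that]] lin_zero[OF lin_tract_X[OF mem_hash[OF that]]]
      by simp
  qed (rule smod_zero[OF sX(1)])
  show "coaction M (m \<oplus>\<^bsub>X\<^sub>S\<^esub> n) = coaction M m \<oplus>\<^bsub>X\<^sub>S \<boxtimes> C\<^esub> coaction M n" if mn: "m \<in> carrier X\<^sub>S" "n \<in> carrier X\<^sub>S" for m n
  proof (rule X_eqI)
    have c: "m \<oplus>\<^bsub>M\<^esub> n \<in> carrier M" "m \<in> carrier M" "n \<in> carrier M"
      using smod_add[OF sX(2) mn] mn by simp_all
    then show "coaction M (m \<oplus>\<^bsub>X\<^sub>S\<^esub> n) \<in> carrier (X\<^sub>S \<boxtimes> C)" "coaction M m \<oplus>\<^bsub>X\<^sub>S \<boxtimes> C\<^esub> coaction M n \<in> carrier (X\<^sub>S \<boxtimes> C)"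
      using coaction(1) smod_add[OF sX(1)] by simp_all
    show "pairing X (coaction M (m \<oplus>\<^bsub>X\<^sub>S\<^esub> n)) (hash a f) = pairing X (coaction M m \<oplus>\<^bsub>X\<^sub>S \<boxtimes> C\<^esub> coaction M n) (hash a f)"
      if "a \<in> carrier A" "f \<in> carrier dual" for a f
      using c coaction(1) coaction(2)[OF _ mem_hash[OF that]] lin_add[OF p[OF that], of "coaction M m" "coaction M n"]
        lin_add[OF lin_tract_X[OF mem_hash[OF that]] mn] by simp
  qed
  show "coaction M (s \<odot>\<^bsub>X\<^sub>S\<^esub> m) = s \<odot>\<^bsub>X\<^sub>S \<boxtimes> C\<^esub> coaction M m" if s: "s \<in> carrier S" and m: "m \<in> carrier X\<^sub>S" for s m
  proof (rule X_eqI)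
    have c: "s \<odot>\<^bsub>X\<^sub>S\<^esub> m \<in> carrier M" "m \<in> carrier M"
      using semimodule.smult_closed[OF sX(2) s m] m by simp_all
    then show "coaction M (s \<odot>\<^bsub>X\<^sub>S\<^esub> m) \<in> carrier (X\<^sub>S \<boxtimes> C)" "s \<odot>\<^bsub>X\<^sub>S \<boxtimes> C\<^esub> coaction M m \<in> carrier (X\<^sub>S \<boxtimes> C)"
      using coaction(1) semimodule.smult_closed[OF sX(1) s] by simp_all
    show "pairing X (coaction M (s \<odot>\<^bsub>X\<^sub>S\<^esub> m)) (hash a f) = pairing X (s \<odot>\<^bsub>X\<^sub>S \<boxtimes> C\<^esub> coaction M m) (hash a f)"
      if "a \<in> carrier A" "f \<in> carrier dual" for a f
      using c coaction(1) coaction(2)[OF _ mem_hash[OF that]] lin_smult[OF p[OF that] s, of "coaction M m"]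
        lin_smult[OF lin_tract_X[OF mem_hash[OF that]] s m] by simp
  qed
qed

lemma mem_coaction [lins]: "m \<in> carrier M \<Longrightarrow> coaction M m \<in> carrier (X\<^sub>S \<boxtimes> C)"
  by (rule coaction)

lemma mem_X [lins]: "m \<in> carrier M \<Longrightarrow> m \<in> carrier X"
  by simp

lemma mem_XD: "m \<in> carrier X\<^sub>S \<Longrightarrow> m \<in> carrier M"
  by simp

lemma coaction_eval:
  assumes [lins]: "m \<in> carrier M" "a \<in> carrier A" "f \<in> carrier dual"
  shows "tensor_lift X\<^sub>S (\<lambda>m0 m1. ev f m1 \<odot>\<^bsub>X\<^sub>S\<^esub> (m0 \<star>\<^bsub>X\<^esub> a)) (coaction M m) = m \<star>\<^bsub>M\<^esub> hash a f"
  using coaction(2)[OF assms(1) mem_hash[OF assms(2,3)]] pairing_right_pure[OF amod_X coaction(1)[OF assms(1)] assms(2,3)]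
  by simp

lemma coaction_eval_one:
  assumes [lins]: "m \<in> carrier M" "f \<in> carrier dual"
  shows "tensor_lift X\<^sub>S (\<lambda>m0 m1. ev f m1 \<odot>\<^bsub>X\<^sub>S\<^esub> m0) (coaction M m) = m \<star>\<^bsub>M\<^esub> hash \<one>\<^bsub>A\<^esub> f"
  unfolding coaction_eval[OF assms(1) A.one_closed assms(2), symmetric]
  by (rule lift_cong, (assumption | rule lins)+) (simp only: right_semimodule.ract_one[OF amod_X] over_S_simps)

lemma coaction_counit:
  assumes "m \<in> carrier M"
  shows "tensor_lift X\<^sub>S (\<lambda>m0 m1. counit C m1 \<odot>\<^bsub>X\<^sub>S\<^esub> m0) (coaction M m) = m"
proof -
  have "tensor_lift X\<^sub>S (\<lambda>m0 m1. counit C m1 \<odot>\<^bsub>X\<^sub>S\<^esub> m0) (coaction M m) =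
     tensor_lift X\<^sub>S (\<lambda>m0 m1. ev \<one>\<^bsub>dual\<^esub> m1 \<odot>\<^bsub>X\<^sub>S\<^esub> m0) (coaction M m)"
    by (rule lift_cong, (assumption | rule lins assms)+) simp
  then show ?thesis
    using coaction_eval_one[OF assms mem_one_dual] tract_one[OF M assms] by simp
qed

text \<open>Coassociativity with \<open>f\<close> applied to the last leg. Paired with
  \<open>b # g\<close>, the left side is \<open>m (1 # f) (b # g)\<close>, the right side is the sum
  of \<open>(g * f)(m1) m0 b\<close>, and both equal \<open>m (b # (g * f))\<close> by
  \<open>smash_pure_one_left\<close>.\<close>

lemma coaction_conv:
  assumes m [lins]: "m \<in> carrier M" and f [lins]: "f \<in> carrier dual"
  shows "tensor_lift (X\<^sub>S \<boxtimes> C) (\<lambda>m0 m1. ev f m1 \<odot>\<^bsub>X\<^sub>S \<boxtimes> C\<^esub> coaction M m0) (coaction M m) =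
    tensor_lift (X\<^sub>S \<boxtimes> C) (\<lambda>m0 m1. tensor_lift (X\<^sub>S \<boxtimes> C) (\<lambda>c1 c2. ev f c2 \<odot>\<^bsub>X\<^sub>S \<boxtimes> C\<^esub> pure X\<^sub>S C m0 c1) (comult C m1)) (coaction M m)"
    (is "?L = ?R")
proof (rule X_eqI)
  show "?L \<in> carrier (X\<^sub>S \<boxtimes> C)" "?R \<in> carrier (X\<^sub>S \<boxtimes> C)"
    by (assumption | rule lins | erule mem_over_SD mem_XD)+
  fix b g assume b [lins]: "b \<in> carrier A" "g \<in> carrier dual"
  have t [lins]: "hash b g \<in> carrier AD" by (intro lins)
  have l [lins]: "lin X\<^sub>S X\<^sub>S (\<lambda>m. m \<star>\<^bsub>M\<^esub> hash b g)" by (rule lin_tract_X[OF t])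
  have [lins]: "m0 \<star>\<^bsub>M\<^esub> hash b g \<in> carrier X\<^sub>S" if "m0 \<in> carrier M" for m0
    using lin_closed[OF l] that by simp
  have "pairing X ?L (hash b g) = tensor_lift X\<^sub>S (\<lambda>m0 m1. pairing X (ev f m1 \<odot>\<^bsub>X\<^sub>S \<boxtimes> C\<^esub> coaction M m0) (hash b g)) (coaction M m)"
    by (rule lin_lift[where \<phi> = "\<lambda>z. pairing X z (hash b g)"]; (assumption | rule lins | erule mem_over_SD mem_XD)+)
  also have "\<dots> = tensor_lift X\<^sub>S (\<lambda>m0 m1. (ev f m1 \<odot>\<^bsub>X\<^sub>S\<^esub> m0) \<star>\<^bsub>M\<^esub> hash b g) (coaction M m)"
  proof (rule lift_cong, (assumption | rule lins)+)
    fix m0 m1 assume x: "m0 \<in> carrier X\<^sub>S" "m1 \<in> carrier C"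
    then show "pairing X (ev f m1 \<odot>\<^bsub>X\<^sub>S \<boxtimes> C\<^esub> coaction M m0) (hash b g) = (ev f m1 \<odot>\<^bsub>X\<^sub>S\<^esub> m0) \<star>\<^bsub>M\<^esub> hash b g"
      using lin_smult[OF lin_pairing1[OF amod_X t lin_id] mem_ev[OF x(2) f], of "coaction M m0"]
        lin_smult[OF l mem_ev[OF x(2) f] x(1)] coaction[of m0] t by simp
  qed
  also have "\<dots> = tensor_lift X\<^sub>S (\<lambda>m0 m1. ev f m1 \<odot>\<^bsub>X\<^sub>S\<^esub> m0) (coaction M m) \<star>\<^bsub>M\<^esub> hash b g"
    by (rule lin_lift[where \<phi> = "\<lambda>z. z \<star>\<^bsub>M\<^esub> hash b g", symmetric]; (assumption | rule lins | erule mem_over_SD mem_XD)+)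
  also have "\<dots> = m \<star>\<^bsub>M\<^esub> hash \<one>\<^bsub>A\<^esub> f \<star>\<^bsub>M\<^esub> hash b g"
    by (simp only: coaction_eval_one[OF m f])
  also have "\<dots> = m \<star>\<^bsub>M\<^esub> hash b (g \<otimes>\<^bsub>dual\<^esub> f)"
    using b by (simp add: tract_assoc M m mem_hash A.one_closed f smash_pure_one_left)
  also have "\<dots> = tensor_lift X\<^sub>S (\<lambda>m0 m1. ev (g \<otimes>\<^bsub>dual\<^esub> f) m1 \<odot>\<^bsub>X\<^sub>S\<^esub> (m0 \<star>\<^bsub>X\<^esub> b)) (coaction M m)"
    by (rule coaction_eval[symmetric]; (assumption | rule lins)+)
  also have "\<dots> = tensor_lift X\<^sub>S (\<lambda>m0 m1. pairing X (tensor_lift (X\<^sub>S \<boxtimes> C) (\<lambda>c1 c2.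
      ev f c2 \<odot>\<^bsub>X\<^sub>S \<boxtimes> C\<^esub> pure X\<^sub>S C m0 c1) (comult C m1)) (hash b g)) (coaction M m)"
  proof (rule lift_cong, (assumption | rule lins)+)
    fix m0 m1 assume x [lins]: "m0 \<in> carrier X\<^sub>S" "m1 \<in> carrier C"
    have [lins]: "m0 \<in> carrier X" "m0 \<in> carrier M" using x by simp_all
    have "pairing X (tensor_lift (X\<^sub>S \<boxtimes> C) (\<lambda>c1 c2. ev f c2 \<odot>\<^bsub>X\<^sub>S \<boxtimes> C\<^esub> pure X\<^sub>S C m0 c1) (comult C m1)) (hash b g) =
      tensor_lift X\<^sub>S (\<lambda>c1 c2. pairing X (ev f c2 \<odot>\<^bsub>X\<^sub>S \<boxtimes> C\<^esub> pure X\<^sub>S C m0 c1) (hash b g)) (comult C m1)"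
      by (rule lin_lift[where \<phi> = "\<lambda>z. pairing X z (hash b g)"]; (assumption | rule lins | erule mem_over_SD mem_XD)+)
    also have "\<dots> = tensor_lift X\<^sub>S (\<lambda>c1 c2. (ev g c1 \<otimes>\<^bsub>S\<^esub> ev f c2) \<odot>\<^bsub>X\<^sub>S\<^esub> (m0 \<star>\<^bsub>X\<^esub> b)) (comult C m1)"
    proof (rule lift_cong, (assumption | rule lins)+)
      fix c1 c2 assume c [lins]: "c1 \<in> carrier C" "c2 \<in> carrier C"
      have p: "pure X\<^sub>S C m0 c1 \<in> carrier (X\<^sub>S \<boxtimes> C)" and q: "m0 \<star>\<^bsub>X\<^esub> b \<in> carrier X\<^sub>S"
        by (assumption | rule lins)+
      have "pairing X (ev f c2 \<odot>\<^bsub>X\<^sub>S \<boxtimes> C\<^esub> pure X\<^sub>S C m0 c1) (hash b g) = ev f c2 \<odot>\<^bsub>X\<^sub>S\<^esub> pairing X (pure X\<^sub>S C m0 c1) (hash b g)"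
        by (rule lin_smult[OF lin_pairing1[OF amod_X t lin_id] mem_ev[OF c(2) f] p])
      also have "pairing X (pure X\<^sub>S C m0 c1) (hash b g) = ev g c1 \<odot>\<^bsub>X\<^sub>S\<^esub> (m0 \<star>\<^bsub>X\<^esub> b)"
        by (rule pairing_pure; (assumption | rule lins)+)
      also have "ev f c2 \<odot>\<^bsub>X\<^sub>S\<^esub> \<dots> = (ev g c1 \<otimes>\<^bsub>S\<^esub> ev f c2) \<odot>\<^bsub>X\<^sub>S\<^esub> (m0 \<star>\<^bsub>X\<^esub> b)"
        by (rule smult_mult[OF _ q]; (assumption | rule lins)+)
      finally show "pairing X (ev f c2 \<odot>\<^bsub>X\<^sub>S \<boxtimes> C\<^esub> pure X\<^sub>S C m0 c1) (hash b g) = \<dots>" .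
    qed
    also have "\<dots> = tensor_lift (scalars S) (\<lambda>c1 c2. ev g c1 \<otimes>\<^bsub>S\<^esub> ev f c2) (comult C m1) \<odot>\<^bsub>X\<^sub>S\<^esub> (m0 \<star>\<^bsub>X\<^esub> b)"
      by (rule lin_lift[where \<phi> = "\<lambda>s. s \<odot>\<^bsub>X\<^sub>S\<^esub> (m0 \<star>\<^bsub>X\<^esub> b)", symmetric]; (assumption | rule lins)+)
    also have "\<dots> = ev (g \<otimes>\<^bsub>dual\<^esub> f) m1 \<odot>\<^bsub>X\<^sub>S\<^esub> (m0 \<star>\<^bsub>X\<^esub> b)"
      by (simp only: ev_dual(5)[OF x(2)])
    finally show "ev (g \<otimes>\<^bsub>dual\<^esub> f) m1 \<odot>\<^bsub>X\<^sub>S\<^esub> (m0 \<star>\<^bsub>X\<^esub> b) = pairing X (tensor_lift (X\<^sub>S \<boxtimes> C) (\<lambda>c1 c2.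
      ev f c2 \<odot>\<^bsub>X\<^sub>S \<boxtimes> C\<^esub> pure X\<^sub>S C m0 c1) (comult C m1)) (hash b g)" ..
  qed
  also have "\<dots> = pairing X ?R (hash b g)"
    by (rule lin_lift[where \<phi> = "\<lambda>z. pairing X z (hash b g)", symmetric]; (assumption | rule lins | erule mem_over_SD mem_XD)+)
  finally show "pairing X ?L (hash b g) = pairing X ?R (hash b g)" .
qed

text \<open>The last leg is paired off over the A-semimodule \<open>triv X\<close>. What remains is
  the equation \<open>coaction_conv\<close> in \<open>X \<otimes> C\<close>, acted on by
  \<open>a\<close>; that equation was itself proved by a pairing.\<close>

lemma coaction_coassoc: "coassociative S X\<^sub>S C (coaction M)"
proof -
  let ?N = "triv X"
  let ?NS = "over_S ?N" and ?XC = "X\<^sub>S \<boxtimes> C"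
  have Nm [lins]: "amod ?N" by (rule amod_triv[OF amod_X])
  have agree: "carrier (?NS \<boxtimes> C) = carrier (?XC \<boxtimes> C)" "pure ?NS C = pure ?XC C"
    "tensor_lift (?NS \<boxtimes> C) = tensor_lift (?XC \<boxtimes> C)"
    by (rule stensor_agree; simp add: triv_simps(1-3) over_S_triv[OF amod_X])+
  have lN: "tensor_lift ?NS = tensor_lift ?XC"
    by (rule tensor_lift_carrier_cong) (simp_all add: triv_simps(1-3))
  \<comment> \<open>The pairing has to be injective over \<open>X \<otimes> C\<close> itself;
    infinity of \<open>'u\<close> and the bound on \<open>C\<close> keep this semimodule small
    enough.\<close>
  have Nle: "carrier ?N \<lesssim> (UNIV :: 'u set)"
    unfolding triv_simps stensor_simps by (rule tensor_lepoll[OF inf _ C_lepoll]) (simp add: X_le subset_imp_lepoll)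
  have ren [lins]: "lin P ?NS F" if "lin P ?XC F" for P :: "('s, 'p, 'q) module_scheme" and F
    using that over_S_triv[OF amod_X] by (auto simp: left_linear_def additive_map_def triv_simps(1-3) Pi_iff)
  have [lins]: "u \<in> carrier ?N" if "u \<in> carrier ?XC" for u
    using that by (simp add: triv_simps)
  have memN [lins]: "u \<in> carrier ?NS" if "u \<in> carrier ?XC" for u
    using that by (simp add: triv_simps)
  show ?thesis
    unfolding coassociative_def Let_def agree(2,3)[symmetric]
  proof
    fix m assume "m \<in> carrier X\<^sub>S"
    then have m [lins]: "m \<in> carrier M" by simp
    let ?L = "tensor_lift (?NS \<boxtimes> C) (\<lambda>m0 m1. pure ?NS C (coaction M m0) m1) (coaction M m)"
    let ?R = "tensor_lift (?NS \<boxtimes> C) (\<lambda>m0 m1. tensor_lift (?NS \<boxtimes> C) (\<lambda>c1 c2. pure ?NS C (pure X\<^sub>S C m0 c1) c2) (comult C m1)) (coaction M m)"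
    show "?L = ?R"
    proof (rule pairing_inj[OF Nm Nle])
      show "?L \<in> carrier (?NS \<boxtimes> C)" "?R \<in> carrier (?NS \<boxtimes> C)"
        by (assumption | rule lins | erule mem_over_SD mem_XD)+
      fix a f assume a [lins]: "a \<in> carrier A" "f \<in> carrier dual"
      have t [lins]: "hash a f \<in> carrier AD" by (intro lins)
      \<comment> \<open>Pairing evaluates \<open>f\<close> on the outer leg and lets
        \<open>a\<close> act on the inner tensor through \<open>triv\<close>. This action is linear,
        so \<open>a\<close> can be taken out of the Sweedler sums.\<close>
      have pp: "pairing ?N (pure ?NS C u c) (hash a f) = (ev f c \<odot>\<^bsub>?XC\<^esub> u) \<star>\<^bsub>?N\<^esub> a"
        if u: "u \<in> carrier ?XC" and c: "c \<in> carrier C" for u c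
      proof -
        have "pairing ?N (pure ?NS C u c) (hash a f) = ev f c \<odot>\<^bsub>?NS\<^esub> (u \<star>\<^bsub>?N\<^esub> a)"
          using u c by (intro pairing_pure Nm a) (simp_all add: triv_simps(1))
        also have "\<dots> = ev f c \<odot>\<^bsub>?XC\<^esub> (u \<star>\<^bsub>?N\<^esub> a)"
          by (rule over_S_triv[OF amod_X lin_closed[OF lin_triv(1)[OF amod_X a(1)] u] mem_ev[OF c a(2)]])
        also have "\<dots> = (ev f c \<odot>\<^bsub>?XC\<^esub> u) \<star>\<^bsub>?N\<^esub> a"
          by (rule lin_smult[OF lin_triv(1)[OF amod_X a(1)] mem_ev[OF c a(2)] u, symmetric])
        finally show ?thesis .
      qed
      note lt [lins] = lin_triv(1)[OF amod_X a(1)]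
      have "pairing ?N ?L (hash a f) = tensor_lift ?NS (\<lambda>m0 m1. pairing ?N (pure ?NS C (coaction M m0) m1) (hash a f)) (coaction M m)"
        by (rule lin_lift[where \<phi> = "\<lambda>z. pairing ?N z (hash a f)"]; (assumption | rule lins | erule mem_over_SD mem_XD)+)
      also have "\<dots> = tensor_lift ?XC (\<lambda>m0 m1. (ev f m1 \<odot>\<^bsub>?XC\<^esub> coaction M m0) \<star>\<^bsub>?N\<^esub> a) (coaction M m)"
        unfolding lN by (rule lift_cong, (assumption | rule lins)+, rule pp) (simp_all add: coaction)
      also have "\<dots> = tensor_lift ?XC (\<lambda>m0 m1. ev f m1 \<odot>\<^bsub>?XC\<^esub> coaction M m0) (coaction M m) \<star>\<^bsub>?N\<^esub> a"
        by (rule lin_lift[where \<phi> = "\<lambda>z. z \<star>\<^bsub>?N\<^esub> a", OF _ _ _ lt, symmetric]; (assumption | rule lins | erule mem_over_SD mem_XD)+)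
      also have "\<dots> = tensor_lift ?XC (\<lambda>m0 m1. tensor_lift ?XC (\<lambda>c1 c2. ev f c2 \<odot>\<^bsub>?XC\<^esub> pure X\<^sub>S C m0 c1) (comult C m1)) (coaction M m) \<star>\<^bsub>?N\<^esub> a"
        by (simp only: coaction_conv[OF m a(2)])
      also have "\<dots> = tensor_lift ?XC (\<lambda>m0 m1. tensor_lift ?XC (\<lambda>c1 c2. ev f c2 \<odot>\<^bsub>?XC\<^esub> pure X\<^sub>S C m0 c1) (comult C m1) \<star>\<^bsub>?N\<^esub> a) (coaction M m)"
        by (rule lin_lift[where \<phi> = "\<lambda>z. z \<star>\<^bsub>?N\<^esub> a", OF _ _ _ lt]; (assumption | rule lins | erule mem_over_SD mem_XD)+)
      also have "\<dots> = tensor_lift ?NS (\<lambda>m0 m1. pairing ?N (tensor_lift (?NS \<boxtimes> C) (\<lambda>c1 c2. pure ?NS C (pure X\<^sub>S C m0 c1) c2) (comult C m1)) (hash a f)) (coaction M m)"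
        unfolding lN
      proof (rule lift_cong, (assumption | rule lins)+)
        fix m0 m1 assume x [lins]: "m0 \<in> carrier X\<^sub>S" "m1 \<in> carrier C"
        have "tensor_lift ?XC (\<lambda>c1 c2. ev f c2 \<odot>\<^bsub>?XC\<^esub> pure X\<^sub>S C m0 c1) (comult C m1) \<star>\<^bsub>?N\<^esub> a =
          tensor_lift ?XC (\<lambda>c1 c2. (ev f c2 \<odot>\<^bsub>?XC\<^esub> pure X\<^sub>S C m0 c1) \<star>\<^bsub>?N\<^esub> a) (comult C m1)"
          by (rule lin_lift[where \<phi> = "\<lambda>z. z \<star>\<^bsub>?N\<^esub> a", OF _ _ _ lt]; (assumption | rule lins | erule mem_over_SD mem_XD)+)
        also have "\<dots> = tensor_lift ?NS (\<lambda>c1 c2. pairing ?N (pure ?NS C (pure X\<^sub>S C m0 c1) c2) (hash a f)) (comult C m1)"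
          unfolding lN by (rule lift_cong, (assumption | rule lins)+, rule pp[symmetric]; (assumption | rule lins)+)
        also have "\<dots> = pairing ?N (tensor_lift (?NS \<boxtimes> C) (\<lambda>c1 c2. pure ?NS C (pure X\<^sub>S C m0 c1) c2) (comult C m1)) (hash a f)"
          by (rule lin_lift[where \<phi> = "\<lambda>z. pairing ?N z (hash a f)", symmetric]; (assumption | rule lins | erule mem_over_SD mem_XD)+)
        finally show "tensor_lift ?XC (\<lambda>c1 c2. ev f c2 \<odot>\<^bsub>?XC\<^esub> pure X\<^sub>S C m0 c1) (comult C m1) \<star>\<^bsub>?N\<^esub> a = \<dots>" .
      qed
      also have "\<dots> = pairing ?N ?R (hash a f)"
        by (rule lin_lift[where \<phi> = "\<lambda>z. pairing ?N z (hash a f)", symmetric]; (assumption | rule lins | erule mem_over_SD mem_XD)+)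
      finally show "pairing ?N ?L (hash a f) = pairing ?N ?R (hash a f)" .
    qed
  qed
qed

text \<open>Paired with \<open>b # g\<close>, the left side is
  \<open>m (a # \<epsilon>) (b # g)\<close>, the sum of \<open>m (a0 b # a1 g)\<close>. Evaluating
  the coaction of \<open>m\<close> moves \<open>a1\<close> from the functional to \<open>C\<close>,
  which gives the pairing of the right side.\<close>

lemma coaction_ract:
  assumes m [lins]: "m \<in> carrier M" and a [lins]: "a \<in> carrier A"
  shows "coaction M (m \<star>\<^bsub>X\<^esub> a) = tensor_lift (X\<^sub>S \<boxtimes> C) (\<lambda>m0 m1. tensor_lift (X\<^sub>S \<boxtimes> C) (\<lambda>a0 a1.
         pure X\<^sub>S C (m0 \<star>\<^bsub>X\<^esub> a0) (actC m1 a1)) (\<rho>A a)) (coaction M m)" (is "_ = ?R")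
proof (rule X_eqI)
  have ma: "m \<star>\<^bsub>X\<^esub> a \<in> carrier M"
    using mem_ract[OF amod_X _ a] m by simp
  then show "coaction M (m \<star>\<^bsub>X\<^esub> a) \<in> carrier (X\<^sub>S \<boxtimes> C)"
    by (rule coaction)
  show "?R \<in> carrier (X\<^sub>S \<boxtimes> C)"
    by (assumption | rule lins | erule mem_over_SD mem_XD)+
  fix b g assume b [lins]: "b \<in> carrier A" "g \<in> carrier dual"
  have t [lins]: "hash b g \<in> carrier AD" by (intro lins)
  have lm: "lin AD X\<^sub>S (\<lambda>t. m \<star>\<^bsub>M\<^esub> t)"
    using lin_tract02[OF M m]
    by (simp add: left_linear_def additive_map_def smult_over_S semimodule.smult_closed[OF smod_A] mem_tract[OF M m])
  have "pairing X (coaction M (m \<star>\<^bsub>X\<^esub> a)) (hash b g) = m \<star>\<^bsub>M\<^esub> hash a \<one>\<^bsub>dual\<^esub> \<star>\<^bsub>M\<^esub> hash b g"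
    using coaction(2)[OF ma t] m a by simp
  also have "\<dots> = m \<star>\<^bsub>M\<^esub> tensor_lift AD (\<lambda>a0 a1. hash (a0 \<otimes>\<^bsub>A\<^esub> b) (dual_act a1 g \<otimes>\<^bsub>dual\<^esub> \<one>\<^bsub>dual\<^esub>)) (\<rho>A a)"
    by (simp add: tract_assoc M m mem_hash a mem_one_dual t smash_pure b)
  also have "\<dots> = tensor_lift X\<^sub>S (\<lambda>a0 a1. m \<star>\<^bsub>M\<^esub> hash (a0 \<otimes>\<^bsub>A\<^esub> b) (dual_act a1 g \<otimes>\<^bsub>dual\<^esub> \<one>\<^bsub>dual\<^esub>)) (\<rho>A a)"
    by (rule lin_lift[OF _ _ _ lm]; (assumption | rule lins | erule mem_over_SD mem_XD)+)
  also have "\<dots> = tensor_lift X\<^sub>S (\<lambda>a0 a1. tensor_lift X\<^sub>S (\<lambda>m0 m1. ev g (actC m1 a1) \<odot>\<^bsub>X\<^sub>S\<^esub> (m0 \<star>\<^bsub>X\<^esub> a0 \<star>\<^bsub>X\<^esub> b)) (coaction M m)) (\<rho>A a)"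
  proof (rule lift_cong, (assumption | rule lins)+)
    fix a0 a1 assume x [lins]: "a0 \<in> carrier A" "a1 \<in> carrier B"
    have "m \<star>\<^bsub>M\<^esub> hash (a0 \<otimes>\<^bsub>A\<^esub> b) (dual_act a1 g \<otimes>\<^bsub>dual\<^esub> \<one>\<^bsub>dual\<^esub>) = m \<star>\<^bsub>M\<^esub> hash (a0 \<otimes>\<^bsub>A\<^esub> b) (dual_act a1 g)"
      by (simp add: conv_one mem_dual_act x b)
    also have "\<dots> = tensor_lift X\<^sub>S (\<lambda>m0 m1. ev (dual_act a1 g) m1 \<odot>\<^bsub>X\<^sub>S\<^esub> (m0 \<star>\<^bsub>X\<^esub> (a0 \<otimes>\<^bsub>A\<^esub> b))) (coaction M m)"
      by (rule coaction_eval[symmetric]; (assumption | rule lins)+)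
    also have "\<dots> = tensor_lift X\<^sub>S (\<lambda>m0 m1. ev g (actC m1 a1) \<odot>\<^bsub>X\<^sub>S\<^esub> (m0 \<star>\<^bsub>X\<^esub> a0 \<star>\<^bsub>X\<^esub> b)) (coaction M m)"
      by (rule lift_cong, (assumption | rule lins)+)
        (use x b right_semimodule.ract_assoc[OF amod_X _ x(1) b(1)] in \<open>simp del: to_dk_simps(4)\<close>)
    finally show "m \<star>\<^bsub>M\<^esub> hash (a0 \<otimes>\<^bsub>A\<^esub> b) (dual_act a1 g \<otimes>\<^bsub>dual\<^esub> \<one>\<^bsub>dual\<^esub>) = \<dots>" .
  qed
  also have "\<dots> = tensor_lift X\<^sub>S (\<lambda>m0 m1. tensor_lift X\<^sub>S (\<lambda>a0 a1. ev g (actC m1 a1) \<odot>\<^bsub>X\<^sub>S\<^esub> (m0 \<star>\<^bsub>X\<^esub> a0 \<star>\<^bsub>X\<^esub> b)) (\<rho>A a)) (coaction M m)"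
    by (rule lift_swap; (assumption | rule lins | erule mem_over_SD mem_XD)+)
  also have "\<dots> = tensor_lift X\<^sub>S (\<lambda>m0 m1. pairing X (tensor_lift (X\<^sub>S \<boxtimes> C) (\<lambda>a0 a1.
         pure X\<^sub>S C (m0 \<star>\<^bsub>X\<^esub> a0) (actC m1 a1)) (\<rho>A a)) (hash b g)) (coaction M m)"
  proof (rule lift_cong, (assumption | rule lins)+)
    fix m0 m1 assume x [lins]: "m0 \<in> carrier X\<^sub>S" "m1 \<in> carrier C"
    have [lins]: "m0 \<in> carrier X" using x by simp
    have "pairing X (tensor_lift (X\<^sub>S \<boxtimes> C) (\<lambda>a0 a1. pure X\<^sub>S C (m0 \<star>\<^bsub>X\<^esub> a0) (actC m1 a1)) (\<rho>A a)) (hash b g) =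
      tensor_lift X\<^sub>S (\<lambda>a0 a1. pairing X (pure X\<^sub>S C (m0 \<star>\<^bsub>X\<^esub> a0) (actC m1 a1)) (hash b g)) (\<rho>A a)"
      by (rule lin_lift[where \<phi> = "\<lambda>z. pairing X z (hash b g)"]; (assumption | rule lins)+)
    also have "\<dots> = tensor_lift X\<^sub>S (\<lambda>a0 a1. ev g (actC m1 a1) \<odot>\<^bsub>X\<^sub>S\<^esub> (m0 \<star>\<^bsub>X\<^esub> a0 \<star>\<^bsub>X\<^esub> b)) (\<rho>A a)"
      by (rule lift_cong, (assumption | rule lins)+, rule pairing_pure; (assumption | rule lins)+)
    finally show "tensor_lift X\<^sub>S (\<lambda>a0 a1. ev g (actC m1 a1) \<odot>\<^bsub>X\<^sub>S\<^esub> (m0 \<star>\<^bsub>X\<^esub> a0 \<star>\<^bsub>X\<^esub> b)) (\<rho>A a) =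
       pairing X (tensor_lift (X\<^sub>S \<boxtimes> C) (\<lambda>a0 a1. pure X\<^sub>S C (m0 \<star>\<^bsub>X\<^esub> a0) (actC m1 a1)) (\<rho>A a)) (hash b g)" ..
  qed
  also have "\<dots> = pairing X ?R (hash b g)"
    by (rule lin_lift[where \<phi> = "\<lambda>z. pairing X z (hash b g)", symmetric]; (assumption | rule lins | erule mem_over_SD mem_XD)+)
  finally show "pairing X (coaction M (m \<star>\<^bsub>X\<^esub> a)) (hash b g) = pairing X ?R (hash b g)" .
qed

lemma dk_to_dk: "dk X"
proof -
  have "lin X\<^sub>S (X\<^sub>S \<boxtimes> C) (coact X)"
    by (rule lin_cong[OF lin_coaction smod_over_S[OF amod_X]]) simp
  moreover have "coassociative S X\<^sub>S C (coact X)"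
  proof -
    have eq: "tensor_lift Z (\<lambda>m0 m1. pure (X\<^sub>S \<boxtimes> C) C (coact X m0) m1) (coaction M m) =
       tensor_lift Z (\<lambda>m0 m1. pure (X\<^sub>S \<boxtimes> C) C (coaction M m0) m1) (coaction M m)" if "m \<in> carrier M"
       for m and Z :: "('s, (('u, 'c) tens, 'c) tens) module"
      by (rule lift_cong[OF coaction(1)[OF that] smod_over_S[OF amod_X] smod_C]) simp
    show ?thesis
      using coaction_coassoc by (simp add: coassociative_def Let_def eq)
  qed
  moreover have "coact X (m \<star>\<^bsub>X\<^esub> a) = coaction M (m \<star>\<^bsub>X\<^esub> a)" if "m \<in> carrier M" "a \<in> carrier A" for m a
    using mem_ract[OF amod_X, of m a] that by simp
  ultimately show ?thesis
    by (simp add: doi_koppinen_semimodule_def right_semicomodule_def Let_def amod_X smod_over_S coaction_counit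
        coaction_ract del: to_dk_simps(4))
qed

end

end

subsection \<open>The isomorphism of categories\<close>

lemma right_linear_cong:
  assumes "right_semimodule R M" "right_linear R M N f" "\<And>m. m \<in> carrier M \<Longrightarrow> g m = f m"
  shows "right_linear R M N g"
proof -
  interpret M: right_semimodule R M by fact
  show ?thesis
    using assms(2) by (simp add: right_linear_def additive_map_def assms(3) M.ract_closed Pi_iff)
qed

lemma category_rmodule_cat: "category (rmodule_cat R)" for R :: "('r, 'x) ring_scheme"
proof (rule category.intro)
  fix X :: "('m, 'r) rmodule" assume X: "X \<in> Obj (rmodule_cat R)"
  show "Ide (rmodule_cat R) X \<in> Hom (rmodule_cat R) X X"
  proof -
    have "right_linear R X X (\<lambda>m. m)"
      by (simp add: right_linear_def additive_map_def)
    then have "right_linear R X X (\<lambda>m\<in>carrier X. m)"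
      by (rule right_linear_cong[rotated]) (use X in \<open>simp_all add: rmodule_cat_def\<close>)
    then show ?thesis
      by (simp add: rmodule_cat_def)
  qed
  fix Y :: "('m, 'r) rmodule" assume Y: "Y \<in> Obj (rmodule_cat R)"
  fix f assume f: "f \<in> Hom (rmodule_cat R) X Y"
  then have fc: "f \<in> carrier X \<rightarrow> carrier Y" "f \<in> extensional (carrier X)"
    by (auto simp: rmodule_cat_def right_linear_def additive_map_def)
  show "Comp (rmodule_cat R) X X Y f (Ide (rmodule_cat R) X) = f"
    "Comp (rmodule_cat R) X Y Y (Ide (rmodule_cat R) Y) f = f"
    using fc by (auto simp: rmodule_cat_def compose_def fun_eq_iff extensional_def)
  fix Z :: "('m, 'r) rmodule" assume Z: "Z \<in> Obj (rmodule_cat R)"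
  fix g assume g: "g \<in> Hom (rmodule_cat R) Y Z"
  show "Comp (rmodule_cat R) X Y Z g f \<in> Hom (rmodule_cat R) X Z"
    using X f g right_linear_cong[OF _ right_linear_compose[of R X Y f Z g]]
    by (simp add: rmodule_cat_def compose_def)
  fix W :: "('m, 'r) rmodule" and h assume "W \<in> Obj (rmodule_cat R)" "h \<in> Hom (rmodule_cat R) Z W"
  show "Comp (rmodule_cat R) X Z W h (Comp (rmodule_cat R) X Y Z g f) =
     Comp (rmodule_cat R) X Y W (Comp (rmodule_cat R) Y Z W h g) f"
    using fc by (auto simp: rmodule_cat_def compose_def fun_eq_iff)
qed

lemma category_full_subcategory: "category C \<Longrightarrow> category (full_subcategory C K)"
  by (auto simp: category_def full_subcategory_def)

context doi_koppinen_alpha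
begin

abbreviation "dkC \<equiv> (dk_cat :: (('u, 'a, 'c) dk_module, 'u \<Rightarrow> 'u) cat)"
abbreviation "ratC \<equiv> (rat_cat :: (('u, ('a, 'c \<Rightarrow> 's) tens) rmodule, 'u \<Rightarrow> 'u) cat)"

lemma rat_obj_iff: "M \<in> Obj ratC \<longleftrightarrow> tmod M \<and> canonical_rmodule smash M \<and> (\<forall>m\<in>carrier M. rational M m)"
  using Rat_iff[of M] by (auto simp: rat_cat_def full_subcategory_def rmodule_cat_def)

lemma dk_obj_iff: "M \<in> Obj dkC \<longleftrightarrow> dk M \<and> canonical_rmodule A M \<and> coact M \<in> extensional (carrier M)"
  by (simp add: dk_cat_def)

lemma category_ratC: "category ratC"
  unfolding rat_cat_def by (intro category_full_subcategory category_rmodule_cat)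

lemma to_smash_obj: "M \<in> Obj dkC \<Longrightarrow> to_smash M \<in> Obj ratC"
  using tmod_to_smash rational_to_smash
  by (auto simp: rat_obj_iff dk_obj_iff canonical_rmodule_def to_smash_def extensional_def dk_obj_iff canonical_rmodule_def)

lemma to_dk_obj: "M \<in> Obj ratC \<Longrightarrow> to_dk M \<in> Obj dkC"
  using dk_to_dk[of M]
  by (auto simp: rat_obj_iff dk_obj_iff canonical_rmodule_def to_dk_def extensional_def)

text \<open>On the carriers the pairing with the coaction is the given action; off the carriers both
  actions are \<open>undefined\<close>, by construction on one side and by
  \<open>canonical_rmodule\<close> on the other.\<close>

lemma to_smash_to_dk:
  assumes "M \<in> Obj ratC"
  shows "to_smash (to_dk M) = M"
proof -
  have M: "tmod M" "\<And>m. m \<in> carrier M \<Longrightarrow> rational M m" and c: "canonical_rmodule smash M"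
    using assms by (auto simp: rat_obj_iff)
  have "m \<star>\<^bsub>to_smash (to_dk M)\<^esub> t = m \<star>\<^bsub>M\<^esub> t" for m t
  proof (cases "m \<in> carrier M \<and> t \<in> carrier smash")
    case True
    then show ?thesis
      using coaction(2)[OF M] by (simp add: smash_simps)
  next
    case False
    then have "(\<lambda>(m, r). m \<star>\<^bsub>M\<^esub> r) (m, t) = undefined"
      using c unfolding canonical_rmodule_def by (intro extensional_arb[of _ "carrier M \<times> carrier smash"]) auto
    then show ?thesis
      using False by (auto simp: to_smash_def)
  qed
  then show ?thesis
    using c by (intro rmodule.equality) (auto simp: to_smash_def to_dk_def canonical_rmodule_def fun_eq_iff)
qed

text \<open>The coaction reconstructed from the smash action and the original one have the same
  pairings with pure elements, so injectivity identifies them.\<close>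

lemma to_dk_to_smash:
  assumes "M \<in> Obj dkC"
  shows "to_dk (to_smash M) = M"
proof -
  have M: "dk M" and c: "canonical_rmodule A M" and e: "coact M \<in> extensional (carrier M)"
    using assms by (auto simp: dk_obj_iff)
  note T = tmod_to_smash[OF M] rational_to_smash[OF M, folded to_smash_simps(1)]
  let ?X = "to_dk (to_smash M)"
  have h: "hash a \<one>\<^bsub>dual\<^esub> \<in> carrier AD" if "a \<in> carrier A" for a
    by (assumption | rule lins that)+
  have r: "m \<star>\<^bsub>?X\<^esub> a = m \<star>\<^bsub>M\<^esub> a" if "m \<in> carrier M" "a \<in> carrier A" for m a
    using to_smash_ract_A[OF M that] that by (simp del: to_smash_simps(4))
  have r': "m \<star>\<^bsub>?X\<^esub> a = m \<star>\<^bsub>M\<^esub> a" for m a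
  proof (cases "m \<in> carrier M \<and> a \<in> carrier A")
    case False
    then have "(\<lambda>(m, r). m \<star>\<^bsub>M\<^esub> r) (m, a) = undefined"
      using c unfolding canonical_rmodule_def by (intro extensional_arb[of _ "carrier M \<times> carrier A"]) auto
    then show ?thesis
      using False by (auto simp: to_dk_def)
  qed (use r in blast)
  have "coaction (to_smash M) m = coact M m" if m: "m \<in> carrier M" for m
  proof (rule pairing_inj[OF dk_amod[OF M]])
    have m': "m \<in> carrier (to_smash M)" using m by simp
    show "carrier M \<lesssim> (UNIV :: 'u set)" by (simp add: subset_imp_lepoll)
    show "coact M m \<in> carrier (over_S M \<boxtimes> C)" by (rule mem_coact[OF M m])
    have ag: "carrier (over_S ?X \<boxtimes> C) = carrier (over_S M \<boxtimes> C)"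
      by (rule over_S_agree(1)) (simp_all add: r del: to_dk_simps(4))
    then show c: "coaction (to_smash M) m \<in> carrier (over_S M \<boxtimes> C)"
      using coaction(1)[OF T m'] by simp
    fix a f assume "a \<in> carrier A" "f \<in> carrier dual"
    then have t: "hash a f \<in> carrier AD" by (rule mem_hash)
    have "pairing ?X (coaction (to_smash M) m) (hash a f) = m \<star>\<^bsub>to_smash M\<^esub> hash a f"
      by (rule coaction(2)[OF T m' t])
    moreover have "pairing ?X (coaction (to_smash M) m) (hash a f) = pairing M (coaction (to_smash M) m) (hash a f)"
      by (rule pairing_agree[OF amod_X[OF T]]) (simp_all add: r ag c t del: to_dk_simps(4))
    ultimately show "pairing M (coaction (to_smash M) m) (hash a f) = pairing M (coact M m) (hash a f)"
      using m t by simp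
  qed
  then have "coact ?X m = coact M m" for m
    using e by (cases "m \<in> carrier M") (auto simp: to_dk_def extensional_def)
  then show ?thesis
    using c r' by (intro dk_module.equality) (auto simp: to_smash_def to_dk_def canonical_rmodule_def fun_eq_iff)
qed

text \<open>Both functors are the identity on maps: one inclusion comes from naturality of the
  pairing, the other from its injectivity.\<close>

lemma Hom_to_smash:
  assumes "M \<in> Obj dkC" "N \<in> Obj dkC"
  shows "Hom dkC M N = Hom ratC (to_smash M) (to_smash N)"
  using assms dk_hom_imp_smash_linear[of M N] smash_linear_imp_dk_hom[of M N]
  by (auto simp: dk_obj_iff dk_cat_def rat_cat_def full_subcategory_def rmodule_cat_def)

lemma Ide_to_smash: "Ide dkC M = Ide ratC (to_smash M)"
  and Comp_to_smash: "Comp dkC L M N = Comp ratC (to_smash L) (to_smash M) (to_smash N)"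
  by (simp_all add: dk_cat_def rat_cat_def full_subcategory_def rmodule_cat_def)

text \<open>The axioms are pulled back from \<open>ratC\<close> along \<open>to_smash\<close>, since
  hom sets, composition and identities coincide.\<close>

lemma category_dkC: "category dkC"
  using category_ratC to_smash_obj
  by (simp add: category_def Hom_to_smash Ide_to_smash Comp_to_smash)

lemma Hom_to_dk:
  assumes "M \<in> Obj ratC" "N \<in> Obj ratC"
  shows "Hom dkC (to_dk M) (to_dk N) = Hom ratC M N"
  using assms by (simp add: Hom_to_smash to_dk_obj to_smash_to_dk)

theorem isomorphic_dk_rat: "isomorphic_categories dkC ratC"
  unfolding isomorphic_categories_def
proof (intro exI conjI ballI)
  show "cat_functor dkC ratC to_smash (\<lambda>_ _ f. f)"
    by (intro cat_functor.intro cat_functor_axioms.intro category_dkC category_ratC)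
      (auto simp: to_smash_obj Hom_to_smash Ide_to_smash Comp_to_smash)
  show "cat_functor ratC dkC to_dk (\<lambda>_ _ f. f)"
    by (intro cat_functor.intro cat_functor_axioms.intro category_dkC category_ratC)
      (auto simp: to_dk_obj Hom_to_dk Ide_to_smash Comp_to_smash to_smash_to_dk)
qed (auto simp: to_smash_to_dk to_dk_to_smash)

end

subsection \<open>\<open>M \<otimes>\<^sub>S C\<close> as a semimodule over \<open>A #\<^sup>o\<^sup>p C\<^sup>*\<close>\<close>

lemma (in commutative_semiring) lift_swap2:
  assumes [lins]: "x \<in> carrier (M \<boxtimes> N)" "y \<in> carrier (M' \<boxtimes> N')" "z \<in> carrier (P \<boxtimes> Q)"
    "smod M" "smod N" "smod M'" "smod N'" "smod P" "smod Q" "smod Z"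
    and [lins]: "\<And>m n m' n' p q. \<lbrakk>m \<in> carrier M; n \<in> carrier N; m' \<in> carrier M'; n' \<in> carrier N';
      p \<in> carrier P; q \<in> carrier Q\<rbrakk> \<Longrightarrow> h m n m' n' p q \<in> carrier Z"
  shows "tensor_lift Z (\<lambda>m n. tensor_lift Z (\<lambda>m' n'. tensor_lift Z (\<lambda>p q. h m n m' n' p q) z) y) x =
    tensor_lift Z (\<lambda>p q. tensor_lift Z (\<lambda>m n. tensor_lift Z (\<lambda>m' n'. h m n m' n' p q) y) x) z"
proof -
  have "tensor_lift Z (\<lambda>m n. tensor_lift Z (\<lambda>m' n'. tensor_lift Z (\<lambda>p q. h m n m' n' p q) z) y) x =
    tensor_lift Z (\<lambda>m n. tensor_lift Z (\<lambda>p q. tensor_lift Z (\<lambda>m' n'. h m n m' n' p q) y) z) x"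
    by (rule lift_cong[OF assms(1,4,5)], rule lift_swap; (assumption | rule lins)+)
  also have "\<dots> = tensor_lift Z (\<lambda>p q. tensor_lift Z (\<lambda>m n. tensor_lift Z (\<lambda>m' n'. h m n m' n' p q) y) x) z"
    by (rule lift_swap; (assumption | rule lins)+)
  finally show ?thesis .
qed

context doi_koppinen_setting
begin

definition tact :: "('m, 'a, 'y) rmodule_scheme \<Rightarrow> ('m, 'c) tens \<Rightarrow> 'a \<Rightarrow> ('c \<Rightarrow> 's) \<Rightarrow> ('m, 'c) tens" where
  "tact M u b g = tensor_lift (over_S M \<boxtimes> C) (\<lambda>m c. tensor_lift (over_S M \<boxtimes> C) (\<lambda>b0 b1.
     tensor_lift (over_S M \<boxtimes> C) (\<lambda>c1 c2. pure (over_S M) C (m \<star>\<^bsub>M\<^esub> b0) (ev g c2 \<odot>\<^bsub>C\<^esub> actC c1 b1))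
       (comult C c)) (\<rho>A b)) u"

text \<open>The formula of \<open>coring_smash\<close> with \<open>M\<close> in place of the factor
  \<open>A\<close>. The order of the nested lifts is kept, so that \<open>M = A\<close> gives
  \<open>coring_smash\<close> itself; \<open>smash_tensor_ract\<close> rewrites the action as a lift
  of \<open>tact\<close> over \<open>t\<close>.\<close>

definition smash_tensor :: "('m, 'a, 'y) rmodule_scheme \<Rightarrow> (('m, 'c) tens, ('a, 'c \<Rightarrow> 's) tens) rmodule" where
  "smash_tensor M = \<lparr>carrier = carrier (over_S M \<boxtimes> C), mult = undefined, one = undefined,
     zero = \<zero>\<^bsub>over_S M \<boxtimes> C\<^esub>, add = add (over_S M \<boxtimes> C),
     ract = (\<lambda>u t. tensor_lift (over_S M \<boxtimes> C) (\<lambda>m c. tensor_lift (over_S M \<boxtimes> C) (\<lambda>b g.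
       tensor_lift (over_S M \<boxtimes> C) (\<lambda>b0 b1. tensor_lift (over_S M \<boxtimes> C) (\<lambda>c1 c2.
         pure (over_S M) C (m \<star>\<^bsub>M\<^esub> b0) (ev g c2 \<odot>\<^bsub>C\<^esub> actC c1 b1)) (comult C c)) (\<rho>A b)) t) u)\<rparr>"

lemma smash_tensor_simps [simp]:
  "carrier (smash_tensor M) = carrier (over_S M \<boxtimes> C)" "\<zero>\<^bsub>smash_tensor M\<^esub> = \<zero>\<^bsub>over_S M \<boxtimes> C\<^esub>"
  "add (smash_tensor M) = add (over_S M \<boxtimes> C)"
  by (simp_all add: smash_tensor_def)

context
  fixes M :: "('m, 'a, 'y) rmodule_scheme"
  assumes M [lins]: "amod M"
begin

abbreviation "MC \<equiv> over_S M \<boxtimes> C"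
abbreviation "pu \<equiv> pure (over_S M) C"

lemma lin_tact1 [lins]: "b \<in> carrier A \<Longrightarrow> g \<in> carrier dual \<Longrightarrow> lin P MC F \<Longrightarrow> lin P MC (\<lambda>p. tact M (F p) b g)"
  unfolding tact_def by (assumption | rule lins | erule mem_over_SD)+

lemma lin_tact2 [lins]: "u \<in> carrier MC \<Longrightarrow> g \<in> carrier dual \<Longrightarrow> lin P A F \<Longrightarrow> lin P MC (\<lambda>p. tact M u (F p) g)"
  unfolding tact_def by (assumption | rule lins | erule mem_over_SD)+

lemma lin_tact3 [lins]: "u \<in> carrier MC \<Longrightarrow> b \<in> carrier A \<Longrightarrow> lin P dual F \<Longrightarrow> lin P MC (\<lambda>p. tact M u b (F p))"
  unfolding tact_def by (assumption | rule lins | erule mem_over_SD)+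

lemma mem_tact [lins]: "u \<in> carrier MC \<Longrightarrow> b \<in> carrier A \<Longrightarrow> g \<in> carrier dual \<Longrightarrow> tact M u b g \<in> carrier MC"
  unfolding tact_def by (assumption | rule lins | erule mem_over_SD)+

lemma tact_pure:
  assumes [lins]: "m \<in> carrier M" "c \<in> carrier C" "b \<in> carrier A" "g \<in> carrier dual"
  shows "tact M (pu m c) b g = tensor_lift MC (\<lambda>b0 b1. tensor_lift MC (\<lambda>c1 c2.
     pu (m \<star>\<^bsub>M\<^esub> b0) (ev g c2 \<odot>\<^bsub>C\<^esub> actC c1 b1)) (comult C c)) (\<rho>A b)"
  unfolding tact_def by (rule lift_pure; (assumption | rule lins | erule mem_over_SD)+)

lemma smash_tensor_ract:
  assumes u: "u \<in> carrier MC" and t: "t \<in> carrier AD"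
  shows "u \<star>\<^bsub>smash_tensor M\<^esub> t = tensor_lift MC (tact M u) t"
proof -
  let ?R = "\<lambda>u t. tensor_lift MC (\<lambda>m c. tensor_lift MC (\<lambda>b g.
       tensor_lift MC (\<lambda>b0 b1. tensor_lift MC (\<lambda>c1 c2.
         pu (m \<star>\<^bsub>M\<^esub> b0) (ev g c2 \<odot>\<^bsub>C\<^esub> actC c1 b1)) (comult C c)) (\<rho>A b)) t) u"
  have "?R u t = tensor_lift MC (tact M u) t"
  proof (rule lin_eqI2[where f = ?R and g = "\<lambda>u t. tensor_lift MC (tact M u) t", OF u t])
    fix m c b g assume "m \<in> carrier (over_S M)" and x [lins]: "c \<in> carrier C" "b \<in> carrier A" "g \<in> carrier dual"
    then have m [lins]: "m \<in> carrier M" by simp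
    have "?R (pu m c) (hash b g) = tensor_lift MC (\<lambda>b g. tensor_lift MC (\<lambda>b0 b1. tensor_lift MC (\<lambda>c1 c2.
         pu (m \<star>\<^bsub>M\<^esub> b0) (ev g c2 \<odot>\<^bsub>C\<^esub> actC c1 b1)) (comult C c)) (\<rho>A b)) (hash b g)"
      by (rule lift_pure; (assumption | rule lins | erule mem_over_SD)+)
    also have "\<dots> = tact M (pu m c) b g"
      unfolding tact_pure[OF m x] by (rule lift_pure; (assumption | rule lins | erule mem_over_SD)+)
    also have "\<dots> = tensor_lift MC (tact M (pu m c)) (hash b g)"
      by (rule lift_pure[symmetric]; (assumption | rule lins | erule mem_over_SD)+)
    finally show "?R (pu m c) (hash b g) = tensor_lift MC (tact M (pu m c)) (hash b g)" .
  qed (assumption | rule lins | erule mem_over_SD)+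
  then show ?thesis
    by (simp add: smash_tensor_def)
qed

lemma smash_tensor_ract_pure:
  assumes [lins]: "u \<in> carrier MC" "b \<in> carrier A" "g \<in> carrier dual"
  shows "u \<star>\<^bsub>smash_tensor M\<^esub> hash b g = tact M u b g"
proof -
  have "u \<star>\<^bsub>smash_tensor M\<^esub> hash b g = tensor_lift MC (tact M u) (hash b g)"
    by (rule smash_tensor_ract; (assumption | rule lins)+)
  also have "\<dots> = tact M u b g"
    by (rule lift_pure; (assumption | rule lins)+)
  finally show ?thesis .
qed

text \<open>One application of \<open>tact\<close> yields tensors with second factor
  \<open>s (c a)\<close>. Their comultiplication is split here, so that \<open>tact\<close> can be
  applied a second time.\<close>

lemma tact_pure_act:
  assumes x [lins]: "x \<in> carrier M" "s \<in> carrier S" "c \<in> carrier C" "a \<in> carrier B" "b \<in> carrier A" "g \<in> carrier dual"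
  shows "tact M (pu x (s \<odot>\<^bsub>C\<^esub> actC c a)) b g = tensor_lift MC (\<lambda>y y'. tensor_lift MC (\<lambda>p q. tensor_lift MC (\<lambda>b0 b1.
     pu (x \<star>\<^bsub>M\<^esub> b0) ((ev g (actC y' q) \<otimes>\<^bsub>S\<^esub> s) \<odot>\<^bsub>C\<^esub> actC (actC y p) b1)) (\<rho>A b)) (comult B a)) (comult C c)"
proof -
  have "tact M (pu x (s \<odot>\<^bsub>C\<^esub> actC c a)) b g = s \<odot>\<^bsub>MC\<^esub> tact M (pu x (actC c a)) b g"
    by (rule lin_smult[where f = "\<lambda>v. tact M (pu x v) b g"]; (assumption | rule lins)+)
  also have "\<dots> = s \<odot>\<^bsub>MC\<^esub> tensor_lift MC (\<lambda>b0 b1. tensor_lift MC (\<lambda>c1 c2.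
     pu (x \<star>\<^bsub>M\<^esub> b0) (ev g c2 \<odot>\<^bsub>C\<^esub> actC c1 b1)) (comult C (actC c a))) (\<rho>A b)"
    by (subst tact_pure; (assumption | rule lins HOL.refl)+)
  also have "\<dots> = tensor_lift MC (\<lambda>b0 b1. s \<odot>\<^bsub>MC\<^esub> tensor_lift MC (\<lambda>c1 c2.
     pu (x \<star>\<^bsub>M\<^esub> b0) (ev g c2 \<odot>\<^bsub>C\<^esub> actC c1 b1)) (comult C (actC c a))) (\<rho>A b)"
    by (rule lin_lift[where \<phi> = "\<lambda>v. s \<odot>\<^bsub>MC\<^esub> v"]; (assumption | rule lins)+)
  also have "\<dots> = tensor_lift MC (\<lambda>b0 b1. tensor_lift MC (\<lambda>y y'. tensor_lift MC (\<lambda>p q.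
     pu (x \<star>\<^bsub>M\<^esub> b0) ((ev g (actC y' q) \<otimes>\<^bsub>S\<^esub> s) \<odot>\<^bsub>C\<^esub> actC (actC y p) b1)) (comult B a)) (comult C c)) (\<rho>A b)"
  proof (rule lift_cong, (assumption | rule lins)+)
    fix b0 b1 assume b [lins]: "b0 \<in> carrier A" "b1 \<in> carrier B"
    have "s \<odot>\<^bsub>MC\<^esub> tensor_lift MC (\<lambda>c1 c2. pu (x \<star>\<^bsub>M\<^esub> b0) (ev g c2 \<odot>\<^bsub>C\<^esub> actC c1 b1)) (comult C (actC c a)) =
      tensor_lift MC (\<lambda>c1 c2. s \<odot>\<^bsub>MC\<^esub> pu (x \<star>\<^bsub>M\<^esub> b0) (ev g c2 \<odot>\<^bsub>C\<^esub> actC c1 b1)) (comult C (actC c a))"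
      by (rule lin_lift[where \<phi> = "\<lambda>v. s \<odot>\<^bsub>MC\<^esub> v"]; (assumption | rule lins)+)
    also have "\<dots> = tensor_lift MC (\<lambda>c1 c2. pu (x \<star>\<^bsub>M\<^esub> b0) ((ev g c2 \<otimes>\<^bsub>S\<^esub> s) \<odot>\<^bsub>C\<^esub> actC c1 b1)) (comult C (actC c a))"
      by (rule lift_cong, (assumption | rule lins)+)
        (simp add: pure_smult_right smult_mult smod_over_S smod_C M mem_ract mem_ev mem_act semimodule.smult_closed[OF smod_C] x b)
    also have "\<dots> = tensor_lift MC (\<lambda>y y'. tensor_lift MC (\<lambda>p q.
     pu (x \<star>\<^bsub>M\<^esub> b0) ((ev g (actC y' q) \<otimes>\<^bsub>S\<^esub> s) \<odot>\<^bsub>C\<^esub> actC (actC y p) b1)) (comult B a)) (comult C c)"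
      by (rule comult_act_lift; (assumption | rule lins)+)
    finally show "s \<odot>\<^bsub>MC\<^esub> tensor_lift MC (\<lambda>c1 c2. pu (x \<star>\<^bsub>M\<^esub> b0) (ev g c2 \<odot>\<^bsub>C\<^esub> actC c1 b1)) (comult C (actC c a)) = \<dots>" .
  qed
  also have "\<dots> = tensor_lift MC (\<lambda>y y'. tensor_lift MC (\<lambda>p q. tensor_lift MC (\<lambda>b0 b1.
     pu (x \<star>\<^bsub>M\<^esub> b0) ((ev g (actC y' q) \<otimes>\<^bsub>S\<^esub> s) \<odot>\<^bsub>C\<^esub> actC (actC y p) b1)) (\<rho>A b)) (comult B a)) (comult C c)"
    by (rule lift_swap2[symmetric]; (assumption | rule lins)+)
  finally show ?thesis .
qed

text \<open>Both sides are the sum of \<open>m a0 b0 \<otimes> g(c2 a2) f(c3) (c1 a1 b1)\<close>,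
  with \<open>c1\<close>, \<open>c2\<close>, \<open>c3\<close> from the iterated comultiplication
  and \<open>a0\<close>, \<open>a1\<close>, \<open>a2\<close> from the iterated coaction.
  Coassociativity of \<open>C\<close> and of \<open>\<rho>A\<close> is used once each.\<close>

lemma tact_assoc_pure:
  assumes x [lins]: "m \<in> carrier M" "c \<in> carrier C" "a \<in> carrier A" "f \<in> carrier dual" "b \<in> carrier A" "g \<in> carrier dual"
  shows "tact M (tact M (pu m c) a f) b g =
    tensor_lift MC (\<lambda>a0 a1. tact M (pu m c) (a0 \<otimes>\<^bsub>A\<^esub> b) (dual_act a1 g \<otimes>\<^bsub>dual\<^esub> f)) (\<rho>A a)"
proof -
  let ?E = "\<lambda>a0 b0 b1 p q x y z. pu (m \<star>\<^bsub>M\<^esub> (a0 \<otimes>\<^bsub>A\<^esub> b0)) ((ev g (actC y q) \<otimes>\<^bsub>S\<^esub> ev f z) \<odot>\<^bsub>C\<^esub> actC (actC x p) b1)"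
  let ?K = "\<lambda>a0 a1 x y z. tensor_lift MC (\<lambda>p q. tensor_lift MC (\<lambda>b0 b1. ?E a0 b0 b1 p q x y z) (\<rho>A b)) (comult B a1)"
  let ?L = "\<lambda>x u v. tensor_lift MC (\<lambda>b0 b1. tensor_lift MC (\<lambda>c1 c2.
      pu (m \<star>\<^bsub>M\<^esub> (x \<otimes>\<^bsub>A\<^esub> b0)) (ev (dual_act v g \<otimes>\<^bsub>dual\<^esub> f) c2 \<odot>\<^bsub>C\<^esub> actC c1 (u \<otimes>\<^bsub>B\<^esub> b1))) (comult C c)) (\<rho>A b)"
  have "tact M (tact M (pu m c) a f) b g = tensor_lift MC (\<lambda>a0 a1. tact M (tensor_lift MC (\<lambda>c1 c2.
     pu (m \<star>\<^bsub>M\<^esub> a0) (ev f c2 \<odot>\<^bsub>C\<^esub> actC c1 a1)) (comult C c)) b g) (\<rho>A a)"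
    unfolding tact_pure[OF x(1-4)] by (rule lin_lift[where \<phi> = "\<lambda>v. tact M v b g"]; (assumption | rule lins)+)
  also have "\<dots> = tensor_lift MC (\<lambda>a0 a1. tensor_lift MC (\<lambda>c1 c2. tensor_lift MC (\<lambda>y z. ?K a0 a1 c1 y z) (comult C c2)) (comult C c)) (\<rho>A a)"
  proof (rule lift_cong, (assumption | rule lins)+)
    fix a0 a1 assume a [lins]: "a0 \<in> carrier A" "a1 \<in> carrier B"
    have "tact M (tensor_lift MC (\<lambda>c1 c2. pu (m \<star>\<^bsub>M\<^esub> a0) (ev f c2 \<odot>\<^bsub>C\<^esub> actC c1 a1)) (comult C c)) b g =
      tensor_lift MC (\<lambda>c1 c2. tact M (pu (m \<star>\<^bsub>M\<^esub> a0) (ev f c2 \<odot>\<^bsub>C\<^esub> actC c1 a1)) b g) (comult C c)"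
      by (rule lin_lift[where \<phi> = "\<lambda>v. tact M v b g"]; (assumption | rule lins)+)
    also have "\<dots> = tensor_lift MC (\<lambda>c1 c2. tensor_lift MC (\<lambda>y y'. tensor_lift MC (\<lambda>p q. tensor_lift MC (\<lambda>b0 b1.
     pu (m \<star>\<^bsub>M\<^esub> a0 \<star>\<^bsub>M\<^esub> b0) ((ev g (actC y' q) \<otimes>\<^bsub>S\<^esub> ev f c2) \<odot>\<^bsub>C\<^esub> actC (actC y p) b1)) (\<rho>A b)) (comult B a1)) (comult C c1)) (comult C c)"
      by (rule lift_cong, (assumption | rule lins)+, rule tact_pure_act; (assumption | rule lins)+)
    also have "\<dots> = tensor_lift MC (\<lambda>c1 c2. tensor_lift MC (\<lambda>y y'. ?K a0 a1 y y' c2) (comult C c1)) (comult C c)"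
      by (intro lift_cong[OF mem_comult smod_C smod_C] lift_cong[OF mem_comultB smod_B smod_B] lift_cong[OF mem_rho smod_A smod_B])
        (simp_all add: right_semimodule.ract_assoc[OF M] x a)
    also have "\<dots> = tensor_lift MC (\<lambda>c1 c2. tensor_lift MC (\<lambda>y z. ?K a0 a1 c1 y z) (comult C c2)) (comult C c)"
      by (rule coassoc_lift[OF coassoc_C lin_comult0 lin_comult0]; (assumption | rule lins)+)
    finally show "tact M (tensor_lift MC (\<lambda>c1 c2. pu (m \<star>\<^bsub>M\<^esub> a0) (ev f c2 \<odot>\<^bsub>C\<^esub> actC c1 a1)) (comult C c)) b g = \<dots>" .
  qed
  also have "\<dots> = tensor_lift MC (\<lambda>a0 a1. tensor_lift MC (\<lambda>p q. ?L a0 p q) (comult B a1)) (\<rho>A a)"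
  proof (rule lift_cong, (assumption | rule lins)+)
    fix a0 a1 assume a [lins]: "a0 \<in> carrier A" "a1 \<in> carrier B"
    have "tensor_lift MC (\<lambda>c1 c2. tensor_lift MC (\<lambda>y z. ?K a0 a1 c1 y z) (comult C c2)) (comult C c) =
      tensor_lift MC (\<lambda>c1 c2. tensor_lift MC (\<lambda>p q. tensor_lift MC (\<lambda>b0 b1. tensor_lift MC (\<lambda>y z.
         ?E a0 b0 b1 p q c1 y z) (comult C c2)) (\<rho>A b)) (comult B a1)) (comult C c)"
      by (rule lift_cong, (assumption | rule lins)+, rule lift_swap2[symmetric]; (assumption | rule lins)+)
    also have "\<dots> = tensor_lift MC (\<lambda>p q. tensor_lift MC (\<lambda>b0 b1. tensor_lift MC (\<lambda>c1 c2. tensor_lift MC (\<lambda>y z.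
         ?E a0 b0 b1 p q c1 y z) (comult C c2)) (comult C c)) (\<rho>A b)) (comult B a1)"
      by (rule lift_swap2[symmetric]; (assumption | rule lins)+)
    also have "\<dots> = tensor_lift MC (\<lambda>p q. ?L a0 p q) (comult B a1)"
    proof (rule lift_cong, (assumption | rule lins)+, rule lift_cong, (assumption | rule lins)+, rule lift_cong, (assumption | rule lins)+)
      fix p q b0 b1 c1 c2 assume y [lins]: "p \<in> carrier B" "q \<in> carrier B" "b0 \<in> carrier A" "b1 \<in> carrier B"
        "c1 \<in> carrier C" "c2 \<in> carrier C"
      let ?w = "actC c1 (p \<otimes>\<^bsub>B\<^esub> b1)" and ?v = "m \<star>\<^bsub>M\<^esub> (a0 \<otimes>\<^bsub>A\<^esub> b0)"
      have "tensor_lift MC (\<lambda>y z. ?E a0 b0 b1 p q c1 y z) (comult C c2) =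
        tensor_lift MC (\<lambda>y z. pu ?v ((ev (dual_act q g) y \<otimes>\<^bsub>S\<^esub> ev f z) \<odot>\<^bsub>C\<^esub> ?w)) (comult C c2)"
        by (rule lift_cong, (assumption | rule lins)+) (simp add: act_assoc y)
      also have "\<dots> = pu ?v (tensor_lift (scalars S) (\<lambda>y z. ev (dual_act q g) y \<otimes>\<^bsub>S\<^esub> ev f z) (comult C c2) \<odot>\<^bsub>C\<^esub> ?w)"
        by (rule lin_lift[where \<phi> = "\<lambda>s. pu ?v (s \<odot>\<^bsub>C\<^esub> ?w)", symmetric]; (assumption | rule lins)+)
      finally show "tensor_lift MC (\<lambda>y z. ?E a0 b0 b1 p q c1 y z) (comult C c2) = pu ?v (ev (dual_act q g \<otimes>\<^bsub>dual\<^esub> f) c2 \<odot>\<^bsub>C\<^esub> ?w)"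
        by (simp only: ev_dual(5)[OF y(6)])
    qed
    finally show "tensor_lift MC (\<lambda>c1 c2. tensor_lift MC (\<lambda>y z. ?K a0 a1 c1 y z) (comult C c2)) (comult C c) = \<dots>" .
  qed
  also have "\<dots> = tensor_lift MC (\<lambda>a0 a1. tensor_lift MC (\<lambda>x u. ?L x u a1) (\<rho>A a0)) (\<rho>A a)"
    by (rule coassoc_lift[OF coassoc_rho lin_rho0 lin_comultB0, symmetric]; (assumption | rule lins)+)
  also have "\<dots> = tensor_lift MC (\<lambda>a0 a1. tact M (pu m c) (a0 \<otimes>\<^bsub>A\<^esub> b) (dual_act a1 g \<otimes>\<^bsub>dual\<^esub> f)) (\<rho>A a)"
    by (rule lift_cong, (assumption | rule lins)+, subst tact_pure, (assumption | rule lins)+,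
        rule rho_mult_lift[symmetric]; (assumption | rule lins)+)
  finally show ?thesis .
qed

lemma tmod_smash_tensor: "tmod (smash_tensor M)"
proof (rule smash_moduleI[where Z = MC and act = "tact M"])
  show "tact M (tact M z a f) b g =
      tensor_lift MC (\<lambda>a0 a1. tact M z (a0 \<otimes>\<^bsub>A\<^esub> b) (dual_act a1 g \<otimes>\<^bsub>dual\<^esub> f)) (\<rho>A a)"
    if z: "z \<in> carrier MC" and x [lins]: "a \<in> carrier A" "f \<in> carrier dual" "b \<in> carrier A" "g \<in> carrier dual" for z a f b g
    by (rule lin_eqI[where f = "\<lambda>z. tact M (tact M z a f) b g", OF z], (assumption | rule lins)+)
      (rule tact_assoc_pure, (assumption | rule lins | erule mem_over_SD)+)
  show "tact M z \<one>\<^bsub>A\<^esub> \<one>\<^bsub>dual\<^esub> = z" if z: "z \<in> carrier MC" for z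
  proof (rule lin_eqI[where f = "\<lambda>z. tact M z \<one>\<^bsub>A\<^esub> \<one>\<^bsub>dual\<^esub>" and g = "\<lambda>z. z",
        OF z smod_over_S[OF M] smod_C smod_stensor[OF smod_over_S[OF M] smod_C]], (assumption | rule lins A.one_closed)+)
    fix m c assume "m \<in> carrier (over_S M)" and c [lins]: "c \<in> carrier C"
    then have m [lins]: "m \<in> carrier M" by simp
    note [lins] = A.one_closed B.one_closed
    have "tact M (pu m c) \<one>\<^bsub>A\<^esub> \<one>\<^bsub>dual\<^esub> = tensor_lift MC (\<lambda>c1 c2. pu (m \<star>\<^bsub>M\<^esub> \<one>\<^bsub>A\<^esub>) (ev \<one>\<^bsub>dual\<^esub> c2 \<odot>\<^bsub>C\<^esub> actC c1 \<one>\<^bsub>B\<^esub>)) (comult C c)"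
      by (subst tact_pure, (assumption | rule lins)+, rule rho_one_lift; (assumption | rule lins)+)
    also have "\<dots> = tensor_lift MC (\<lambda>c1 c2. counit C c2 \<odot>\<^bsub>MC\<^esub> pu m c1) (comult C c)"
      by (rule lift_cong, (assumption | rule lins)+)
        (simp add: right_semimodule.ract_one[OF M] act_one pure_smult_right smod_over_S smod_C M mem_counit m)
    also have "\<dots> = pu m c"
      by (rule lin_counit_lift; (assumption | rule lins)+)
    finally show "tact M (pu m c) \<one>\<^bsub>A\<^esub> \<one>\<^bsub>dual\<^esub> = pu m c" .
  qed
qed (assumption | rule lins smash_tensor_ract | simp)+

text \<open>The A-action underlying \<open>smash_tensor M\<close> is diagonal through
  \<open>\<rho>A\<close>, in contrast to \<open>triv M\<close>.\<close>

lemma tact_one_dual: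
  assumes [lins]: "m \<in> carrier M" "c \<in> carrier C" "b \<in> carrier A"
  shows "tact M (pu m c) b \<one>\<^bsub>dual\<^esub> = tensor_lift MC (\<lambda>b0 b1. pu (m \<star>\<^bsub>M\<^esub> b0) (actC c b1)) (\<rho>A b)"
proof (subst tact_pure, (assumption | rule lins)+, rule lift_cong, (assumption | rule lins)+)
  fix b0 b1 assume b [lins]: "b0 \<in> carrier A" "b1 \<in> carrier B"
  have "tensor_lift MC (\<lambda>c1 c2. pu (m \<star>\<^bsub>M\<^esub> b0) (ev \<one>\<^bsub>dual\<^esub> c2 \<odot>\<^bsub>C\<^esub> actC c1 b1)) (comult C c) =
     tensor_lift MC (\<lambda>c1 c2. counit C c2 \<odot>\<^bsub>MC\<^esub> pu (m \<star>\<^bsub>M\<^esub> b0) (actC c1 b1)) (comult C c)"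
    by (rule lift_cong, (assumption | rule lins)+)
      (simp add: pure_smult_right smod_over_S smod_C M mem_counit mem_ract mem_act assms b)
  also have "\<dots> = pu (m \<star>\<^bsub>M\<^esub> b0) (actC c b1)"
    by (rule lin_counit_lift; (assumption | rule lins)+)
  finally show "tensor_lift MC (\<lambda>c1 c2. pu (m \<star>\<^bsub>M\<^esub> b0) (ev \<one>\<^bsub>dual\<^esub> c2 \<odot>\<^bsub>C\<^esub> actC c1 b1)) (comult C c) = \<dots>" .
qed

text \<open>A witness at \<open>m \<otimes> c\<close> is the sum of
  \<open>(m \<otimes> c1) \<otimes> c2\<close>, the coaction induced by the comultiplication of
  \<open>C\<close>. Other tensors follow because rational elements are closed under
  addition.\<close>

lemma rational_smash_tensor:
  assumes u: "u \<in> carrier MC"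
  shows "rational (smash_tensor M) u"
proof -
  let ?Y = "smash_tensor M"
  note Y = tmod_smash_tensor
  have sY [lins]: "amod (over_A ?Y)" by (rule amod_over_A[OF Y])
  \<comment> \<open>Scalars reach \<open>M \<otimes> C\<close> through the smash action or through
    the tensor product. They agree because \<open>tact\<close> is linear in its argument from
    \<open>A\<close> and the unit acts trivially.\<close>
  have TSs: "s \<odot>\<^bsub>TS ?Y\<^esub> v = s \<odot>\<^bsub>MC\<^esub> v" if v [lins]: "v \<in> carrier MC" and s [lins]: "s \<in> carrier S" for s v
  proof -
    have "s \<odot>\<^bsub>TS ?Y\<^esub> v = tact M v (s \<odot>\<^bsub>A\<^esub> \<one>\<^bsub>A\<^esub>) \<one>\<^bsub>dual\<^esub>"
      unfolding smult_TS by (rule smash_tensor_ract_pure; (assumption | rule lins A.one_closed)+)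
    also have "\<dots> = s \<odot>\<^bsub>MC\<^esub> tact M v \<one>\<^bsub>A\<^esub> \<one>\<^bsub>dual\<^esub>"
      by (rule lin_smult[where f = "\<lambda>a. tact M v a \<one>\<^bsub>dual\<^esub>"]; (assumption | rule lins A.one_closed)+)
    also have "tact M v \<one>\<^bsub>A\<^esub> \<one>\<^bsub>dual\<^esub> = v"
      using smash_tensor_ract_pure[OF v A.one_closed mem_one_dual] tract_one[OF Y, of v] v by simp
    finally show ?thesis .
  qed
  have lY: "tensor_lift (TS ?Y) = tensor_lift MC"
    by (rule tensor_lift_carrier_cong) simp_all
  have ren [lins]: "lin P (TS ?Y) F" if "lin P MC F" for P :: "('s, 'p, 'q) module_scheme" and F
    using that TSs by (auto simp: left_linear_def additive_map_def Pi_iff)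
  have mem [lins]: "v \<in> carrier (TS ?Y)" "v \<in> carrier (over_A ?Y)" if "v \<in> carrier MC" for v
    using that by simp_all
  show ?thesis
    using smod_over_S[OF M] smod_C u
  proof (induction u rule: stensor_induct)
    case zero
    then show ?case using rational_zero[OF Y] by simp
  next
    case (add x y)
    then show ?case using rational_add[OF Y, of x y] by simp
  next
    case (pure m c)
    then have m [lins]: "m \<in> carrier M" "c \<in> carrier C" by simp_all
    let ?w = "tensor_lift (TS ?Y \<boxtimes> C) (\<lambda>c1 c2. pure_tensor S (TS ?Y) C (pu m c1) c2) (comult C c)"
    have w [lins]: "?w \<in> carrier (TS ?Y \<boxtimes> C)"
      by (assumption | rule lins)+
    have "pu m c \<star>\<^bsub>?Y\<^esub> t = pairing (over_A ?Y) ?w t" if t: "t \<in> carrier AD" for t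
    proof (rule lin_eqI[where f = "\<lambda>t. pu m c \<star>\<^bsub>?Y\<^esub> t", OF t])
      fix b g assume x [lins]: "b \<in> carrier A" "g \<in> carrier dual"
      have p [lins]: "pu m c \<in> carrier MC" by (assumption | rule lins)+
      have t [lins]: "hash b g \<in> carrier AD" by (assumption | rule lins)+
      have "pairing (over_A ?Y) ?w (hash b g) = tensor_lift (TS ?Y) (\<lambda>c1 c2. pairing (over_A ?Y) (pure_tensor S (TS ?Y) C (pu m c1) c2) (hash b g)) (comult C c)"
        by (rule lin_lift[where \<phi> = "\<lambda>z. pairing (over_A ?Y) z (hash b g)"]; (assumption | rule lins)+)
      also have "\<dots> = tensor_lift MC (\<lambda>c1 c2. tensor_lift MC (\<lambda>b0 b1. pu (m \<star>\<^bsub>M\<^esub> b0) (ev g c2 \<odot>\<^bsub>C\<^esub> actC c1 b1)) (\<rho>A b)) (comult C c)"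
        unfolding lY
      proof (rule lift_cong, (assumption | rule lins)+)
        fix c1 c2 assume c [lins]: "c1 \<in> carrier C" "c2 \<in> carrier C"
        have p1 [lins]: "pu m c1 \<in> carrier MC" by (assumption | rule lins)+
        have "pairing (over_A ?Y) (pure_tensor S (TS ?Y) C (pu m c1) c2) (hash b g) = ev g c2 \<odot>\<^bsub>TS ?Y\<^esub> (pu m c1 \<star>\<^bsub>over_A ?Y\<^esub> b)"
          by (rule pairing_pure; (assumption | rule lins)+)
        also have "pu m c1 \<star>\<^bsub>over_A ?Y\<^esub> b = tact M (pu m c1) b \<one>\<^bsub>dual\<^esub>"
          using smash_tensor_ract_pure[OF p1 x(1) mem_one_dual] by simp
        also have "ev g c2 \<odot>\<^bsub>TS ?Y\<^esub> \<dots> = ev g c2 \<odot>\<^bsub>MC\<^esub> tensor_lift MC (\<lambda>b0 b1. pu (m \<star>\<^bsub>M\<^esub> b0) (actC c1 b1)) (\<rho>A b)"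
          unfolding tact_one_dual[OF m(1) c(1) x(1)] by (rule TSs; (assumption | rule lins)+)
        also have "\<dots> = tensor_lift MC (\<lambda>b0 b1. ev g c2 \<odot>\<^bsub>MC\<^esub> pu (m \<star>\<^bsub>M\<^esub> b0) (actC c1 b1)) (\<rho>A b)"
          by (rule lin_lift[where \<phi> = "\<lambda>v. ev g c2 \<odot>\<^bsub>MC\<^esub> v"]; (assumption | rule lins)+)
        also have "\<dots> = tensor_lift MC (\<lambda>b0 b1. pu (m \<star>\<^bsub>M\<^esub> b0) (ev g c2 \<odot>\<^bsub>C\<^esub> actC c1 b1)) (\<rho>A b)"
          by (rule lift_cong, (assumption | rule lins)+)
            (simp add: pure_smult_right smod_over_S smod_C M mem_ev mem_ract mem_act m c x)
        finally show "pairing (over_A ?Y) (pure_tensor S (TS ?Y) C (pu m c1) c2) (hash b g) = \<dots>" .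
      qed
      also have "\<dots> = tact M (pu m c) b g"
        unfolding tact_pure[OF m x] by (rule lift_swap; (assumption | rule lins)+)
      finally show "pu m c \<star>\<^bsub>?Y\<^esub> hash b g = pairing (over_A ?Y) ?w (hash b g)"
        using smash_tensor_ract_pure[OF p x] by simp
    qed (assumption | rule lins Y | simp)+
    then show ?case
      unfolding rational_def using w by blast
  qed
qed

end

text \<open>\<open>A\<close> as a right semimodule over itself, for which \<open>smash_tensor\<close> is \<open>coring_smash\<close>.\<close>

definition regular :: "('a, 'a) rmodule" where
  "regular = \<lparr>carrier = carrier A, mult = undefined, one = undefined, zero = \<zero>\<^bsub>A\<^esub>, add = add A, ract = mult A\<rparr>"

lemma regular_simps [simp]:
  "carrier regular = carrier A" "\<zero>\<^bsub>regular\<^esub> = \<zero>\<^bsub>A\<^esub>" "add regular = add A" "a \<star>\<^bsub>regular\<^esub> b = a \<otimes>\<^bsub>A\<^esub> b"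
  by (simp_all add: regular_def)

lemma amod_regular: "amod regular"
  by (intro right_semimodule.intro right_semimodule_axioms.intro A.semiring_axioms
      abelian_monoid_carrier_cong[OF A.abelian_monoid_axioms])
    (simp_all add: A.l_distr A.r_distr A.m_assoc)

lemma regular_agree:
  "carrier (over_S regular \<boxtimes> C) = carrier (A \<boxtimes> C)" "\<zero>\<^bsub>over_S regular \<boxtimes> C\<^esub> = \<zero>\<^bsub>A \<boxtimes> C\<^esub>"
  "add (over_S regular \<boxtimes> C) = add (A \<boxtimes> C)" "pure (over_S regular) C = pure A C"
  "tensor_lift (over_S regular \<boxtimes> C) = tensor_lift (A \<boxtimes> C)"
  by (rule stensor_agree; simp add: smult_over_S scalar_central)+

lemma coring_smash_eq: "coring_smash = smash_tensor regular"
  unfolding coring_smash_def smash_tensor_def Let_def regular_agree by (simp add: ev_def)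

end

subsection \<open>Direct sums\<close>

definition ds_inj :: "'i set \<Rightarrow> ('i \<Rightarrow> ('m, 'r) rmodule) \<Rightarrow> 'i \<Rightarrow> 'm \<Rightarrow> ('i \<Rightarrow> 'm)" where
  "ds_inj I M i y = (\<lambda>j\<in>I. if j = i then y else \<zero>\<^bsub>M j\<^esub>)"

lemma direct_sum_simps:
  "carrier (direct_sum I M) = {x \<in> \<Pi>\<^sub>E i\<in>I. carrier (M i). finite {i \<in> I. x i \<noteq> \<zero>\<^bsub>M i\<^esub>}}"
  "\<zero>\<^bsub>direct_sum I M\<^esub> = (\<lambda>i\<in>I. \<zero>\<^bsub>M i\<^esub>)"
  "x \<oplus>\<^bsub>direct_sum I M\<^esub> y = (\<lambda>i\<in>I. x i \<oplus>\<^bsub>M i\<^esub> y i)"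
  "x \<star>\<^bsub>direct_sum I M\<^esub> r = (\<lambda>i\<in>I. x i \<star>\<^bsub>M i\<^esub> r)"
  by (simp_all add: direct_sum_def)

lemma finsum_ract:
  assumes "right_semimodule R Z" "finite F" "f \<in> F \<rightarrow> carrier Z" "r \<in> carrier R"
  shows "(\<Oplus>\<^bsub>Z\<^esub>i\<in>F. f i) \<star>\<^bsub>Z\<^esub> r = (\<Oplus>\<^bsub>Z\<^esub>i\<in>F. f i \<star>\<^bsub>Z\<^esub> r)"
proof -
  interpret Z: right_semimodule R Z by fact
  show ?thesis
    using assms(2,3)
  proof (induction F)
    case (insert i F)
    then show ?case
      using assms(4) Z.M.finsum_closed[of f F] by (simp add: Z.ract_l_distr Z.ract_closed Pi_iff)
  qed (use assms(4) in \<open>simp add: Z.ract_l_null\<close>)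
qed

context
  fixes R :: "('r, 'x) ring_scheme" and I :: "'i set" and M :: "'i \<Rightarrow> ('m, 'r) rmodule"
  assumes R: "semiring R" and M: "\<And>i. i \<in> I \<Longrightarrow> right_semimodule R (M i)"
begin

abbreviation "DS \<equiv> direct_sum I M"

lemma summand:
  assumes "i \<in> I"
  shows "\<zero>\<^bsub>M i\<^esub> \<in> carrier (M i)"
    "x \<in> carrier (M i) \<Longrightarrow> y \<in> carrier (M i) \<Longrightarrow> x \<oplus>\<^bsub>M i\<^esub> y \<in> carrier (M i)"
    "x \<in> carrier (M i) \<Longrightarrow> \<zero>\<^bsub>M i\<^esub> \<oplus>\<^bsub>M i\<^esub> x = x" "x \<in> carrier (M i) \<Longrightarrow> x \<oplus>\<^bsub>M i\<^esub> \<zero>\<^bsub>M i\<^esub> = x"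
    "x \<in> carrier (M i) \<Longrightarrow> r \<in> carrier R \<Longrightarrow> x \<star>\<^bsub>M i\<^esub> r \<in> carrier (M i)"
    "r \<in> carrier R \<Longrightarrow> \<zero>\<^bsub>M i\<^esub> \<star>\<^bsub>M i\<^esub> r = \<zero>\<^bsub>M i\<^esub>"
proof -
  interpret Mi: right_semimodule R "M i" by (rule M[OF assms])
  show "\<zero>\<^bsub>M i\<^esub> \<in> carrier (M i)"
    "x \<in> carrier (M i) \<Longrightarrow> y \<in> carrier (M i) \<Longrightarrow> x \<oplus>\<^bsub>M i\<^esub> y \<in> carrier (M i)"
    "x \<in> carrier (M i) \<Longrightarrow> \<zero>\<^bsub>M i\<^esub> \<oplus>\<^bsub>M i\<^esub> x = x" "x \<in> carrier (M i) \<Longrightarrow> x \<oplus>\<^bsub>M i\<^esub> \<zero>\<^bsub>M i\<^esub> = x"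
    "x \<in> carrier (M i) \<Longrightarrow> r \<in> carrier R \<Longrightarrow> x \<star>\<^bsub>M i\<^esub> r \<in> carrier (M i)"
    "r \<in> carrier R \<Longrightarrow> \<zero>\<^bsub>M i\<^esub> \<star>\<^bsub>M i\<^esub> r = \<zero>\<^bsub>M i\<^esub>"
    by (simp_all add: Mi.ract_closed Mi.ract_l_null)
qed

lemma ds_component: "x \<in> carrier DS \<Longrightarrow> i \<in> I \<Longrightarrow> x i \<in> carrier (M i)"
  by (auto simp: direct_sum_simps)

lemma ds_add_closed:
  assumes "x \<in> carrier DS" "y \<in> carrier DS"
  shows "x \<oplus>\<^bsub>DS\<^esub> y \<in> carrier DS"
proof -
  have "{i \<in> I. x i \<oplus>\<^bsub>M i\<^esub> y i \<noteq> \<zero>\<^bsub>M i\<^esub>} \<subseteq> {i \<in> I. x i \<noteq> \<zero>\<^bsub>M i\<^esub>} \<union> {i \<in> I. y i \<noteq> \<zero>\<^bsub>M i\<^esub>}"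
    using summand by auto
  then have "finite {i \<in> I. x i \<oplus>\<^bsub>M i\<^esub> y i \<noteq> \<zero>\<^bsub>M i\<^esub>}"
    by (rule finite_subset) (use assms in \<open>simp add: direct_sum_simps\<close>)
  moreover have "{i \<in> I. (x \<oplus>\<^bsub>DS\<^esub> y) i \<noteq> \<zero>\<^bsub>M i\<^esub>} = {i \<in> I. x i \<oplus>\<^bsub>M i\<^esub> y i \<noteq> \<zero>\<^bsub>M i\<^esub>}"
    by (auto simp: direct_sum_simps)
  ultimately show ?thesis
    using assms summand(2) by (auto simp: direct_sum_simps(1,3) PiE_iff)
qed

lemma ds_ract_closed:
  assumes "x \<in> carrier DS" "r \<in> carrier R"
  shows "x \<star>\<^bsub>DS\<^esub> r \<in> carrier DS"
proof -
  have "{i \<in> I. x i \<star>\<^bsub>M i\<^esub> r \<noteq> \<zero>\<^bsub>M i\<^esub>} \<subseteq> {i \<in> I. x i \<noteq> \<zero>\<^bsub>M i\<^esub>}"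
    using summand(6) assms(2) by auto
  then have "finite {i \<in> I. x i \<star>\<^bsub>M i\<^esub> r \<noteq> \<zero>\<^bsub>M i\<^esub>}"
    by (rule finite_subset) (use assms in \<open>simp add: direct_sum_simps\<close>)
  moreover have "{i \<in> I. (x \<star>\<^bsub>DS\<^esub> r) i \<noteq> \<zero>\<^bsub>M i\<^esub>} = {i \<in> I. x i \<star>\<^bsub>M i\<^esub> r \<noteq> \<zero>\<^bsub>M i\<^esub>}"
    by (auto simp: direct_sum_simps)
  ultimately show ?thesis
    using assms summand(5) by (auto simp: direct_sum_simps(1,4) PiE_iff)
qed

lemma ds_eqI:
  "x \<in> carrier DS \<Longrightarrow> y \<in> carrier DS \<Longrightarrow> (\<And>i. i \<in> I \<Longrightarrow> x i = y i) \<Longrightarrow> x = y"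
  by (auto simp: direct_sum_simps intro: PiE_ext)

lemma ds_zero_closed: "\<zero>\<^bsub>DS\<^esub> \<in> carrier DS"
  using summand by (simp add: direct_sum_simps)

lemma right_semimodule_direct_sum: "right_semimodule R DS"
proof -
  have 1: "abelian_monoid DS"
  proof (rule abelian_monoidI)
    fix x y z assume x: "x \<in> carrier DS" "y \<in> carrier DS" "z \<in> carrier DS"
    show "x \<oplus>\<^bsub>DS\<^esub> y \<oplus>\<^bsub>DS\<^esub> z = x \<oplus>\<^bsub>DS\<^esub> (y \<oplus>\<^bsub>DS\<^esub> z)"
    proof (rule ds_eqI)
      fix i assume i: "i \<in> I"
      interpret Mi: right_semimodule R "M i" by (rule M[OF i])
      show "(x \<oplus>\<^bsub>DS\<^esub> y \<oplus>\<^bsub>DS\<^esub> z) i = (x \<oplus>\<^bsub>DS\<^esub> (y \<oplus>\<^bsub>DS\<^esub> z)) i"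
        using x[THEN ds_component] i by (simp add: direct_sum_simps Mi.M.a_assoc)
    qed (use x ds_add_closed in auto)
  next
    fix x y assume x: "x \<in> carrier DS" "y \<in> carrier DS"
    show "x \<oplus>\<^bsub>DS\<^esub> y = y \<oplus>\<^bsub>DS\<^esub> x"
    proof (rule ds_eqI)
      fix i assume i: "i \<in> I"
      interpret Mi: right_semimodule R "M i" by (rule M[OF i])
      show "(x \<oplus>\<^bsub>DS\<^esub> y) i = (y \<oplus>\<^bsub>DS\<^esub> x) i"
        using x[THEN ds_component] i by (simp add: direct_sum_simps Mi.M.a_comm)
    qed (use x ds_add_closed in auto)
  next
    fix x assume x: "x \<in> carrier DS"
    show "\<zero>\<^bsub>DS\<^esub> \<oplus>\<^bsub>DS\<^esub> x = x"
      by (rule ds_eqI[OF ds_add_closed[OF ds_zero_closed x] x])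
        (use ds_component[OF x] summand(3) in \<open>simp add: direct_sum_simps(2,3)\<close>)
  qed (use ds_add_closed ds_zero_closed in auto)
  have 2: "(x \<oplus>\<^bsub>DS\<^esub> y) \<star>\<^bsub>DS\<^esub> r = x \<star>\<^bsub>DS\<^esub> r \<oplus>\<^bsub>DS\<^esub> y \<star>\<^bsub>DS\<^esub> r"
    "x \<star>\<^bsub>DS\<^esub> (r \<oplus>\<^bsub>R\<^esub> r') = x \<star>\<^bsub>DS\<^esub> r \<oplus>\<^bsub>DS\<^esub> x \<star>\<^bsub>DS\<^esub> r'"
    "x \<star>\<^bsub>DS\<^esub> (r \<otimes>\<^bsub>R\<^esub> r') = x \<star>\<^bsub>DS\<^esub> r \<star>\<^bsub>DS\<^esub> r'"
    "x \<star>\<^bsub>DS\<^esub> \<one>\<^bsub>R\<^esub> = x" "\<zero>\<^bsub>DS\<^esub> \<star>\<^bsub>DS\<^esub> r = \<zero>\<^bsub>DS\<^esub>" "x \<star>\<^bsub>DS\<^esub> \<zero>\<^bsub>R\<^esub> = \<zero>\<^bsub>DS\<^esub>"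
    if x: "x \<in> carrier DS" "y \<in> carrier DS" and r: "r \<in> carrier R" "r' \<in> carrier R" for x y r r'
  proof -
    interpret R: semiring R by (rule R)
    have e: "((x \<oplus>\<^bsub>DS\<^esub> y) \<star>\<^bsub>DS\<^esub> r) i = (x \<star>\<^bsub>DS\<^esub> r \<oplus>\<^bsub>DS\<^esub> y \<star>\<^bsub>DS\<^esub> r) i"
      "(x \<star>\<^bsub>DS\<^esub> (r \<oplus>\<^bsub>R\<^esub> r')) i = (x \<star>\<^bsub>DS\<^esub> r \<oplus>\<^bsub>DS\<^esub> x \<star>\<^bsub>DS\<^esub> r') i"
      "(x \<star>\<^bsub>DS\<^esub> (r \<otimes>\<^bsub>R\<^esub> r')) i = (x \<star>\<^bsub>DS\<^esub> r \<star>\<^bsub>DS\<^esub> r') i"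
      "(x \<star>\<^bsub>DS\<^esub> \<one>\<^bsub>R\<^esub>) i = x i" "(\<zero>\<^bsub>DS\<^esub> \<star>\<^bsub>DS\<^esub> r) i = \<zero>\<^bsub>DS\<^esub> i" "(x \<star>\<^bsub>DS\<^esub> \<zero>\<^bsub>R\<^esub>) i = \<zero>\<^bsub>DS\<^esub> i" if i: "i \<in> I" for i
    proof -
      interpret Mi: right_semimodule R "M i" by (rule M[OF i])
      show "((x \<oplus>\<^bsub>DS\<^esub> y) \<star>\<^bsub>DS\<^esub> r) i = (x \<star>\<^bsub>DS\<^esub> r \<oplus>\<^bsub>DS\<^esub> y \<star>\<^bsub>DS\<^esub> r) i"
        "(x \<star>\<^bsub>DS\<^esub> (r \<oplus>\<^bsub>R\<^esub> r')) i = (x \<star>\<^bsub>DS\<^esub> r \<oplus>\<^bsub>DS\<^esub> x \<star>\<^bsub>DS\<^esub> r') i"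
        "(x \<star>\<^bsub>DS\<^esub> (r \<otimes>\<^bsub>R\<^esub> r')) i = (x \<star>\<^bsub>DS\<^esub> r \<star>\<^bsub>DS\<^esub> r') i"
        "(x \<star>\<^bsub>DS\<^esub> \<one>\<^bsub>R\<^esub>) i = x i" "(\<zero>\<^bsub>DS\<^esub> \<star>\<^bsub>DS\<^esub> r) i = \<zero>\<^bsub>DS\<^esub> i" "(x \<star>\<^bsub>DS\<^esub> \<zero>\<^bsub>R\<^esub>) i = \<zero>\<^bsub>DS\<^esub> i"
        using x[THEN ds_component] i r by (simp_all add: direct_sum_simps Mi.ract_l_distr Mi.ract_r_distr
            Mi.ract_assoc Mi.ract_one Mi.ract_l_null Mi.ract_r_null)
    qed
    show "(x \<oplus>\<^bsub>DS\<^esub> y) \<star>\<^bsub>DS\<^esub> r = x \<star>\<^bsub>DS\<^esub> r \<oplus>\<^bsub>DS\<^esub> y \<star>\<^bsub>DS\<^esub> r"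
      "x \<star>\<^bsub>DS\<^esub> (r \<oplus>\<^bsub>R\<^esub> r') = x \<star>\<^bsub>DS\<^esub> r \<oplus>\<^bsub>DS\<^esub> x \<star>\<^bsub>DS\<^esub> r'"
      "x \<star>\<^bsub>DS\<^esub> (r \<otimes>\<^bsub>R\<^esub> r') = x \<star>\<^bsub>DS\<^esub> r \<star>\<^bsub>DS\<^esub> r'"
      "x \<star>\<^bsub>DS\<^esub> \<one>\<^bsub>R\<^esub> = x" "\<zero>\<^bsub>DS\<^esub> \<star>\<^bsub>DS\<^esub> r = \<zero>\<^bsub>DS\<^esub>" "x \<star>\<^bsub>DS\<^esub> \<zero>\<^bsub>R\<^esub> = \<zero>\<^bsub>DS\<^esub>"
      using x r by (auto intro!: ds_eqI e ds_add_closed ds_ract_closed ds_zero_closed)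
  qed
  note R0 = abelian_monoid.zero_closed[OF semiring.axioms(1)[OF R]] and D0 = ds_zero_closed
  show ?thesis
    by (intro right_semimodule.intro right_semimodule_axioms.intro R 1)
      (assumption | rule ds_ract_closed 2(1)[OF _ _ _ R0] 2(2)[OF _ D0] 2(3)[OF _ D0] 2(4)[OF _ D0 R0 R0]
        2(5)[OF D0 D0 _ R0] 2(6)[OF _ D0 R0 R0])+
qed

lemma ds_inj_component: "j \<in> I \<Longrightarrow> ds_inj I M i y j = (if j = i then y else \<zero>\<^bsub>M j\<^esub>)"
  by (simp add: ds_inj_def)

lemma ds_inj_closed:
  assumes "i \<in> I" "y \<in> carrier (M i)"
  shows "ds_inj I M i y \<in> carrier DS"
proof -
  have "finite {j \<in> I. ds_inj I M i y j \<noteq> \<zero>\<^bsub>M j\<^esub>}"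
    by (rule finite_subset[of _ "{i}"]) (auto simp: ds_inj_def)
  then show ?thesis
    using assms summand by (auto simp: direct_sum_simps ds_inj_def)
qed

lemma right_linear_ds_inj:
  assumes i: "i \<in> I"
  shows "right_linear R (M i) DS (ds_inj I M i)"
proof -
  interpret D: right_semimodule R DS by (rule right_semimodule_direct_sum)
  have "ds_inj I M i \<zero>\<^bsub>M i\<^esub> = \<zero>\<^bsub>DS\<^esub>"
    by (rule ds_eqI[OF ds_inj_closed[OF i summand(1)[OF i]] ds_zero_closed])
      (simp add: ds_inj_component direct_sum_simps(2))
  moreover have "ds_inj I M i (x \<oplus>\<^bsub>M i\<^esub> y) = ds_inj I M i x \<oplus>\<^bsub>DS\<^esub> ds_inj I M i y"
    if "x \<in> carrier (M i)" "y \<in> carrier (M i)" for x y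
    by (rule ds_eqI[OF ds_inj_closed[OF i summand(2)[OF i that]] ds_add_closed[OF that[THEN ds_inj_closed[OF i]]]])
      (use summand(1,3) in \<open>auto simp: ds_inj_component direct_sum_simps(3)\<close>)
  moreover have "ds_inj I M i (x \<star>\<^bsub>M i\<^esub> r) = ds_inj I M i x \<star>\<^bsub>DS\<^esub> r"
    if "x \<in> carrier (M i)" "r \<in> carrier R" for x r
    by (rule ds_eqI[OF ds_inj_closed[OF i summand(5)[OF i that]] ds_ract_closed[OF ds_inj_closed[OF i that(1)] that(2)]])
      (use summand(6)[OF _ that(2)] in \<open>auto simp: ds_inj_component direct_sum_simps(4)\<close>)
  ultimately show ?thesis
    using ds_inj_closed[OF i] by (auto simp: right_linear_def additive_map_def)
qed

text \<open>Induction on the finite support: replacing one component by zero splits off an element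
  of a single summand.\<close>

lemma direct_sum_induct [consumes 1, case_names zero inj add]:
  assumes "x \<in> carrier DS" "P \<zero>\<^bsub>DS\<^esub>"
    and inj: "\<And>i y. i \<in> I \<Longrightarrow> y \<in> carrier (M i) \<Longrightarrow> P (ds_inj I M i y)"
    and add: "\<And>x y. x \<in> carrier DS \<Longrightarrow> y \<in> carrier DS \<Longrightarrow> P x \<Longrightarrow> P y \<Longrightarrow> P (x \<oplus>\<^bsub>DS\<^esub> y)"
  shows "P x"
proof -
  have "finite {i \<in> I. x i \<noteq> \<zero>\<^bsub>M i\<^esub>}"
    using assms(1) by (simp add: direct_sum_simps)
  then show ?thesis
    using assms(1)
  proof (induction "{i \<in> I. x i \<noteq> \<zero>\<^bsub>M i\<^esub>}" arbitrary: x rule: finite_induct)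
    case empty
    then have "x = \<zero>\<^bsub>DS\<^esub>"
      by (intro ds_eqI ds_zero_closed) (auto simp: direct_sum_simps(2))
    then show ?case using assms(2) by simp
  next
    case (insert i F)
    then have i: "i \<in> I" by blast
    let ?x = "\<lambda>j\<in>I. if j = i then \<zero>\<^bsub>M i\<^esub> else x j"
    have s: "{j \<in> I. ?x j \<noteq> \<zero>\<^bsub>M j\<^esub>} = F"
      using insert.hyps by auto
    then have x: "?x \<in> carrier DS"
      using insert.hyps(1) insert.prems summand(1)[OF i] by (auto simp: direct_sum_simps(1))
    have "P ?x"
      by (rule insert.hyps(3)[OF s[symmetric] x])
    moreover have "P (ds_inj I M i (x i))"
      using inj i ds_component[OF insert.prems] by blast
    ultimately have "P (?x \<oplus>\<^bsub>DS\<^esub> ds_inj I M i (x i))"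
      using x i ds_inj_closed ds_component[OF insert.prems] by (intro add) auto
    moreover have "?x \<oplus>\<^bsub>DS\<^esub> ds_inj I M i (x i) = x"
      by (rule ds_eqI[OF ds_add_closed[OF x ds_inj_closed[OF i ds_component[OF insert.prems i]]] insert.prems])
        (use ds_component[OF insert.prems] summand(3,4) in \<open>auto simp: direct_sum_simps(3) ds_inj_component\<close>)
    ultimately show ?case by simp
  qed
qed

text \<open>The map sums \<open>\<phi> i (x i)\<close> over the support of \<open>x\<close>.
  Supports may shrink under addition and action, so \<open>sup\<close> allows any larger finite
  index set, the extra terms being zero.\<close>

lemma direct_sum_map:
  assumes Z: "right_semimodule R Z" and \<phi>: "\<And>i. i \<in> I \<Longrightarrow> right_linear R (M i) Z (\<phi> i)"
  shows "\<exists>\<Phi>. right_linear R DS Z \<Phi> \<and> (\<forall>i\<in>I. \<forall>y\<in>carrier (M i). \<Phi> (ds_inj I M i y) = \<phi> i y)"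
proof -
  interpret Z: right_semimodule R Z by fact
  let ?s = "\<lambda>x. {i \<in> I. x i \<noteq> \<zero>\<^bsub>M i\<^esub>}"
  define \<Phi> where "\<Phi> x = (\<Oplus>\<^bsub>Z\<^esub>i\<in>?s x. \<phi> i (x i))" for x
  have c: "\<phi> i y \<in> carrier Z" "\<phi> i \<zero>\<^bsub>M i\<^esub> = \<zero>\<^bsub>Z\<^esub>" if "i \<in> I" "y \<in> carrier (M i)" for i y
    using \<phi>[OF that(1)] that(2) by (auto simp: right_linear_def additive_map_def)
  have z: "\<phi> i \<zero>\<^bsub>M i\<^esub> = \<zero>\<^bsub>Z\<^esub>" if "i \<in> I" for i
    using c(2)[OF that summand(1)[OF that]] .
  have sup: "\<Phi> x = (\<Oplus>\<^bsub>Z\<^esub>i\<in>F. \<phi> i (x i))" if "x \<in> carrier DS" "finite F" "?s x \<subseteq> F" "F \<subseteq> I" for x F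
    unfolding \<Phi>_def
    by (rule Z.M.add.finprod_mono_neutral_cong_left) (use that c z ds_component in \<open>auto simp: subset_iff\<close>)
  have fin: "finite (?s x)" if "x \<in> carrier DS" for x
    using that by (simp add: direct_sum_simps)
  have "right_linear R DS Z \<Phi>"
    unfolding right_linear_def additive_map_def
  proof (intro conjI ballI funcsetI)
    show "\<Phi> x \<in> carrier Z" if "x \<in> carrier DS" for x
      unfolding \<Phi>_def by (rule Z.M.finsum_closed) (use that c ds_component in auto)
    show "\<Phi> \<zero>\<^bsub>DS\<^esub> = \<zero>\<^bsub>Z\<^esub>"
      using sup[OF ds_zero_closed, of "{}"] by (auto simp: direct_sum_simps(2))
    show "\<Phi> (x \<oplus>\<^bsub>DS\<^esub> y) = \<Phi> x \<oplus>\<^bsub>Z\<^esub> \<Phi> y" if x: "x \<in> carrier DS" "y \<in> carrier DS" for x y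
    proof -
      let ?F = "?s x \<union> ?s y"
      have F: "finite ?F" "?F \<subseteq> I" "?s (x \<oplus>\<^bsub>DS\<^esub> y) \<subseteq> ?F"
        using fin x summand(1,3) by (auto simp: direct_sum_simps(3))
      have "\<Phi> (x \<oplus>\<^bsub>DS\<^esub> y) = (\<Oplus>\<^bsub>Z\<^esub>i\<in>?F. \<phi> i (x i) \<oplus>\<^bsub>Z\<^esub> \<phi> i (y i))"
        unfolding sup[OF ds_add_closed[OF x] F(1,3,2)]
        by (rule Z.M.finsum_cong')
          (use \<phi> x ds_component c in \<open>auto simp: direct_sum_simps(3) right_linear_def additive_map_def\<close>)
      also have "\<dots> = (\<Oplus>\<^bsub>Z\<^esub>i\<in>?F. \<phi> i (x i)) \<oplus>\<^bsub>Z\<^esub> (\<Oplus>\<^bsub>Z\<^esub>i\<in>?F. \<phi> i (y i))"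
        by (rule Z.M.finsum_addf) (use x ds_component c in auto)
      finally show ?thesis
        using sup[OF x(1) F(1) _ F(2)] sup[OF x(2) F(1) _ F(2)] by simp
    qed
    show "\<Phi> (x \<star>\<^bsub>DS\<^esub> r) = \<Phi> x \<star>\<^bsub>Z\<^esub> r" if x: "x \<in> carrier DS" and r: "r \<in> carrier R" for x r
    proof -
      have s: "?s (x \<star>\<^bsub>DS\<^esub> r) \<subseteq> ?s x"
        using summand(6) r by (auto simp: direct_sum_simps(4))
      have "\<Phi> (x \<star>\<^bsub>DS\<^esub> r) = (\<Oplus>\<^bsub>Z\<^esub>i\<in>?s x. \<phi> i (x i) \<star>\<^bsub>Z\<^esub> r)"
        unfolding sup[OF ds_ract_closed[OF x r] fin[OF x] s Collect_restrict]
        by (rule Z.M.finsum_cong')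
          (use \<phi> x r ds_component c in \<open>auto simp: direct_sum_simps(4) right_linear_def Z.ract_closed\<close>)
      also have "\<dots> = \<Phi> x \<star>\<^bsub>Z\<^esub> r"
        unfolding \<Phi>_def by (rule finsum_ract[OF Z fin[OF x] _ r, symmetric]) (use x ds_component c in auto)
      finally show ?thesis .
    qed
  qed
  moreover have "\<Phi> (ds_inj I M i y) = \<phi> i y" if i: "i \<in> I" and y: "y \<in> carrier (M i)" for i y
  proof -
    have "\<Phi> (ds_inj I M i y) = (\<Oplus>\<^bsub>Z\<^esub>j\<in>{i}. \<phi> j (ds_inj I M i y j))"
      by (rule sup[OF ds_inj_closed[OF i y]]) (use i in \<open>auto simp: ds_inj_def\<close>)
    then show ?thesis
      using i y c by (simp add: ds_inj_component)
  qed
  ultimately show ?thesis by blast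
qed

end

text \<open>An element is determined by its graph over its finite support, a finite set of pairs
  from \<open>'u\<close>, and such sets are no more numerous than lists of pairs.\<close>

lemma direct_sum_lepoll:
  fixes I :: "'u set" and M :: "'u \<Rightarrow> ('u, 'r) rmodule"
  assumes "infinite (UNIV :: 'u set)"
  shows "carrier (direct_sum I M) \<lesssim> (UNIV :: 'u set)"
proof -
  let ?g = "\<lambda>x. {(i, x i) | i. i \<in> I \<and> x i \<noteq> \<zero>\<^bsub>M i\<^esub>}"
  have "inj_on ?g (carrier (direct_sum I M))"
  proof (rule inj_onI)
    fix x y assume x: "x \<in> carrier (direct_sum I M)" "y \<in> carrier (direct_sum I M)" and eq: "?g x = ?g y"
    have "x i = y i" if "i \<in> I" for i
    proof (cases "x i = \<zero>\<^bsub>M i\<^esub>")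
      case True
      then have "(i, y i) \<notin> ?g x" by blast
      then show ?thesis using True eq that by auto
    next
      case False
      then have "(i, x i) \<in> ?g y" using that unfolding eq[symmetric] by blast
      then show ?thesis by blast
    qed
    then show "x = y"
      using x by (auto simp: direct_sum_simps intro: PiE_ext)
  qed
  moreover have "?g ` carrier (direct_sum I M) \<subseteq> set ` lists (UNIV :: ('u \<times> 'u) set)"
  proof
    fix F assume "F \<in> ?g ` carrier (direct_sum I M)"
    then obtain x where x: "x \<in> carrier (direct_sum I M)" "F = ?g x" by blast
    then have "F = (\<lambda>i. (i, x i)) ` {i \<in> I. x i \<noteq> \<zero>\<^bsub>M i\<^esub>}" by blast
    then have "finite F"
      using x(1) by (simp add: direct_sum_simps)
    then obtain xs where "set xs = F"
      using finite_list by blast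
    then show "F \<in> set ` lists (UNIV :: ('u \<times> 'u) set)" by auto
  qed
  ultimately have "carrier (direct_sum I M) \<lesssim> set ` lists (UNIV :: ('u \<times> 'u) set)"
    unfolding lepoll_def by blast
  also have "\<dots> \<lesssim> lists (UNIV :: ('u \<times> 'u) set)"
    by (rule image_lepoll)
  also have "\<dots> \<lesssim> (UNIV :: 'u set)"
    using times_lepoll[OF assms, of "UNIV :: 'u set" "UNIV :: 'u set"] by (intro lists_lepoll assms) simp
  finally show ?thesis .
qed

context doi_koppinen_alpha
begin

subsection \<open>The category \<open>\<sigma>[\<C>]\<close>\<close>

abbreviation "objT \<equiv> Obj (rmodule_cat smash :: (('u, ('a, 'c \<Rightarrow> 's) tens) rmodule, 'u \<Rightarrow> 'u) cat)"

lemma objT_iff: "M \<in> objT \<longleftrightarrow> tmod M \<and> canonical_rmodule smash M"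
  by (simp add: rmodule_cat_def)

lemma tmod_coring_smash: "tmod coring_smash" and rational_coring_smash: "u \<in> carrier coring_smash \<Longrightarrow> rational coring_smash u"
  unfolding coring_smash_eq using tmod_smash_tensor[OF amod_regular] rational_smash_tensor[OF amod_regular] by simp_all

text \<open>As \<sigma> is the least closed class, this gives one inclusion. Images and copies are
  covered by \<open>rational_map\<close>, direct sums because every element is a finite sum of
  elements from the summands, subsemimodules by \<open>rational_sub\<close>.\<close>

lemma sigma_closed_rational: "sigma_closed smash coring_smash (Obj ratC)"
  unfolding sigma_closed_def
proof (intro conjI ballI allI impI; (elim conjE)?)
  show "Obj ratC \<subseteq> objT"
    by (auto simp: rat_obj_iff objT_iff)
next
  fix N assume N: "N \<in> objT" and "rmodule_iso smash coring_smash N"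
  then obtain f where f: "right_linear smash coring_smash N f" "bij_betw f (carrier coring_smash) (carrier N)"
    by (auto simp: rmodule_iso_def)
  have "rational N n" if n: "n \<in> carrier N" for n
  proof -
    obtain x where x: "x \<in> carrier coring_smash" "n = f x"
      using f(2) n by (auto simp: bij_betw_def)
    then show ?thesis
      using rational_map[OF tmod_coring_smash _ f(1) x(1) rational_coring_smash] N by (simp add: objT_iff)
  qed
  then show "N \<in> Obj ratC"
    using N by (simp add: rat_obj_iff objT_iff)
next
  fix I :: "'u set" and M N
  assume N: "N \<in> objT" and M: "\<forall>i\<in>I. M i \<in> Obj ratC" and "rmodule_iso smash (direct_sum I M) N"
  then obtain f where f: "right_linear smash (direct_sum I M) N f" "bij_betw f (carrier (direct_sum I M)) (carrier N)"
    by (auto simp: rmodule_iso_def)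
  have N': "tmod N" using N by (simp add: objT_iff)
  have Mi: "tmod (M i)" "y \<in> carrier (M i) \<Longrightarrow> rational (M i) y" if "i \<in> I" for i y
    using M that by (auto simp: rat_obj_iff)
  note fa = f(1)[unfolded right_linear_def additive_map_def]
  have "rational N (f x)" if x: "x \<in> carrier (direct_sum I M)" for x
  proof (rule direct_sum_induct[where P = "\<lambda>x. rational N (f x)" and M = M and I = I, OF semiring_smash _ x])
    show "tmod (M i)" if "i \<in> I" for i by (rule Mi(1)[OF that])
    show "rational N (f \<zero>\<^bsub>direct_sum I M\<^esub>)"
      using rational_zero[OF N'] fa by simp
    show "rational N (f (ds_inj I M i y))" if i: "i \<in> I" and y: "y \<in> carrier (M i)" for i y
    proof -
      have "right_linear smash (M i) (direct_sum I M) (ds_inj I M i)"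
        by (rule right_linear_ds_inj[OF semiring_smash Mi(1) i])
      then show ?thesis
        by (rule rational_map[OF Mi(1)[OF i] N' right_linear_compose[OF _ f(1)] y Mi(2)[OF i y]])
    qed
    show "rational N (f (x \<oplus>\<^bsub>direct_sum I M\<^esub> y))"
      if "x \<in> carrier (direct_sum I M)" "y \<in> carrier (direct_sum I M)" "rational N (f x)" "rational N (f y)" for x y
      using rational_add[OF N', of "f x" "f y"] fa that by (auto simp: Pi_iff)
  qed
  then have "rational N n" if "n \<in> f ` carrier (direct_sum I M)" for n
    using that by (elim imageE) simp
  with f(2) have "rational N n" if "n \<in> carrier N" for n
    using that by (simp add: bij_betw_def)
  then show "N \<in> Obj ratC"
    using N by (simp add: rat_obj_iff objT_iff)
next
  fix M N f assume M: "M \<in> Obj ratC" and N: "N \<in> objT" and f: "right_linear smash M N f" "f ` carrier M = carrier N"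
  have "rational N (f m)" if "m \<in> carrier M" for m
    using rational_map[OF _ _ f(1) that] M N that by (simp add: rat_obj_iff objT_iff)
  then have "\<forall>n\<in>f ` carrier M. rational N n"
    by blast
  then show "N \<in> Obj ratC"
    using N unfolding f(2) by (simp add: rat_obj_iff objT_iff)
next
  fix M N assume M: "M \<in> Obj ratC" and N: "N \<in> objT" and sub: "subsemimodule smash N M"
  have "rational N n" if n: "n \<in> carrier N" for n
    by (rule rational_sub[OF _ _ sub n]) (use M N sub n in \<open>auto simp: rat_obj_iff objT_iff subsemimodule_def\<close>)
  then show "N \<in> Obj ratC"
    using N by (simp add: rat_obj_iff objT_iff)
qed

lemma
  fixes Z :: "('z, ('a, 'c \<Rightarrow> 's) tens, 'y) rmodule_scheme" and k :: "'z \<Rightarrow> 'u"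
  assumes "tmod Z" "inj_on k (carrier Z)"
  shows push_objT: "push smash Z k \<in> objT"
    and push_linear: "right_linear smash Z (push smash Z k) k"
    and push_inv: "right_linear smash (push smash Z k) Z (inv_into (carrier Z) k)"
    and push_iso: "rmodule_iso smash Z (push smash Z k)"
proof -
  note c = congruent_map_inj[OF assms(2)]
  show "push smash Z k \<in> objT"
    using right_semimodule_push[OF assms(1) c] canonical_push by (auto simp: objT_iff)
  show l: "right_linear smash Z (push smash Z k) k"
    by (rule right_linear_push[OF assms(1) c])
  have b: "bij_betw k (carrier Z) (carrier (push smash Z k))"
    using assms(2) by (simp add: bij_betw_def push_simps)
  then show "right_linear smash (push smash Z k) Z (inv_into (carrier Z) k)"
    by (rule right_linear_inv[OF assms(1) l])
  show "rmodule_iso smash Z (push smash Z k)"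
    using l b unfolding rmodule_iso_def by blast
qed

text \<open>Outside their context these rules carry the assumptions on \<open>M\<close> as premises,
  which backchaining would leave as side conditions. The next context declares the first and the
  last anew for its own \<open>M\<close>.\<close>

declare amod_X [lins del] mem_X [lins del] mem_coaction [lins del]

section \<open>Rational semimodules as subobjects of images of direct sums of the coring\<close>

context
  fixes M :: "('u, ('a, 'c \<Rightarrow> 's) tens) rmodule"
  assumes M: "tmod M" and rat: "\<And>m. m \<in> carrier M \<Longrightarrow> rational M m"
begin

abbreviation "XM \<equiv> to_dk M"
abbreviation "YM \<equiv> smash_tensor XM"
abbreviation "XC \<equiv> over_S XM \<boxtimes> C"

lemma amod_XM [lins]: "amod XM"
  by (rule amod_X[OF M rat])

lemma coaction_XM [lins]: "m \<in> carrier M \<Longrightarrow> coaction M m \<in> carrier XC"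
  by (rule coaction(1)[OF M rat])

lemma pairing_coaction: "m \<in> carrier M \<Longrightarrow> t \<in> carrier AD \<Longrightarrow> pairing XM (coaction M m) t = m \<star>\<^bsub>M\<^esub> t"
  by (rule coaction(2)[OF M rat])

lemma lin_coaction_XM: "lin (over_S XM) XC (coaction M)"
  by (rule lin_coaction[OF M rat])

lemma lin_ract_XM:
  assumes "m \<in> carrier M"
  shows "lin AD (over_S XM) (\<lambda>t. m \<star>\<^bsub>M\<^esub> t)"
  using lin_tract02[OF M assms]
  by (simp add: left_linear_def additive_map_def smult_over_S semimodule.smult_closed[OF smod_A] mem_tract[OF M assms])

text \<open>Paired with \<open>b # g\<close>, the left side is \<open>m (a # f) (b # g)\<close>.
  Expanding the smash product and the coaction of \<open>m\<close> gives the sum of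
  \<open>((a1 g) * f)(m1) m0 a0 b\<close>, which is also the pairing of the right side.\<close>

lemma coaction_tact:
  assumes [lins]: "m \<in> carrier M" "a \<in> carrier A" "f \<in> carrier dual"
  shows "coaction M (m \<star>\<^bsub>M\<^esub> hash a f) = tact XM (coaction M m) a f"
proof (rule X_eqI[OF M rat])
  have mt: "m \<star>\<^bsub>M\<^esub> hash a f \<in> carrier M"
    by (rule mem_tract[OF M]; (assumption | rule lins)+)
  then show "coaction M (m \<star>\<^bsub>M\<^esub> hash a f) \<in> carrier XC" by (rule lins)
  show "tact XM (coaction M m) a f \<in> carrier XC"
    by (assumption | rule lins)+
  fix b g assume x [lins]: "b \<in> carrier A" "g \<in> carrier dual"
  have t [lins]: "hash b g \<in> carrier AD" by (assumption | rule lins)+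
  note lm = lin_ract_XM[OF assms(1)]
  have "pairing XM (coaction M (m \<star>\<^bsub>M\<^esub> hash a f)) (hash b g) = m \<star>\<^bsub>M\<^esub> hash a f \<star>\<^bsub>M\<^esub> hash b g"
    by (rule pairing_coaction[OF mt t])
  also have "\<dots> = m \<star>\<^bsub>M\<^esub> smash_pure_mult a f b g"
    by (simp add: tract_assoc[OF M] assms mem_hash t smash_pure x)
  also have "\<dots> = tensor_lift (over_S XM) (\<lambda>a0 a1. m \<star>\<^bsub>M\<^esub> hash (a0 \<otimes>\<^bsub>A\<^esub> b) (dual_act a1 g \<otimes>\<^bsub>dual\<^esub> f)) (\<rho>A a)"
    by (rule lin_lift[OF _ _ _ lm]; (assumption | rule lins)+)
  also have "\<dots> = tensor_lift (over_S XM) (\<lambda>a0 a1. tensor_lift (over_S XM) (\<lambda>m0 m1.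
      ev (dual_act a1 g \<otimes>\<^bsub>dual\<^esub> f) m1 \<odot>\<^bsub>over_S XM\<^esub> (m0 \<star>\<^bsub>XM\<^esub> (a0 \<otimes>\<^bsub>A\<^esub> b))) (coaction M m)) (\<rho>A a)"
    by (rule lift_cong, (assumption | rule lins)+, rule coaction_eval[OF M rat, symmetric]; (assumption | rule lins)+)
  also have "\<dots> = tensor_lift (over_S XM) (\<lambda>m0 m1. tensor_lift (over_S XM) (\<lambda>a0 a1.
      ev (dual_act a1 g \<otimes>\<^bsub>dual\<^esub> f) m1 \<odot>\<^bsub>over_S XM\<^esub> (m0 \<star>\<^bsub>XM\<^esub> (a0 \<otimes>\<^bsub>A\<^esub> b))) (\<rho>A a)) (coaction M m)"
    by (rule lift_swap; (assumption | rule lins | erule mem_over_SD)+)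
  also have "\<dots> = tensor_lift (over_S XM) (\<lambda>m0 m1. pairing XM (tensor_lift XC (\<lambda>a0 a1. tensor_lift XC (\<lambda>c1 c2.
      pure (over_S XM) C (m0 \<star>\<^bsub>XM\<^esub> a0) (ev f c2 \<odot>\<^bsub>C\<^esub> actC c1 a1)) (comult C m1)) (\<rho>A a)) (hash b g)) (coaction M m)"
  proof (rule lift_cong, (assumption | rule lins)+)
    fix m0 m1 assume m: "m0 \<in> carrier (over_S XM)" and m1 [lins]: "m1 \<in> carrier C"
    then have m0 [lins]: "m0 \<in> carrier XM" by simp
    have "pairing XM (tensor_lift XC (\<lambda>a0 a1. tensor_lift XC (\<lambda>c1 c2.
      pure (over_S XM) C (m0 \<star>\<^bsub>XM\<^esub> a0) (ev f c2 \<odot>\<^bsub>C\<^esub> actC c1 a1)) (comult C m1)) (\<rho>A a)) (hash b g) =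
      tensor_lift (over_S XM) (\<lambda>a0 a1. pairing XM (tensor_lift XC (\<lambda>c1 c2.
      pure (over_S XM) C (m0 \<star>\<^bsub>XM\<^esub> a0) (ev f c2 \<odot>\<^bsub>C\<^esub> actC c1 a1)) (comult C m1)) (hash b g)) (\<rho>A a)"
      by (rule lin_lift[where \<phi> = "\<lambda>z. pairing XM z (hash b g)"]; (assumption | rule lins)+)
    also have "\<dots> = tensor_lift (over_S XM) (\<lambda>a0 a1. ev (dual_act a1 g \<otimes>\<^bsub>dual\<^esub> f) m1 \<odot>\<^bsub>over_S XM\<^esub> (m0 \<star>\<^bsub>XM\<^esub> (a0 \<otimes>\<^bsub>A\<^esub> b))) (\<rho>A a)"
    proof (rule lift_cong, (assumption | rule lins)+)
      fix a0 a1 assume a [lins]: "a0 \<in> carrier A" "a1 \<in> carrier B"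
      let ?v = "m0 \<star>\<^bsub>XM\<^esub> (a0 \<otimes>\<^bsub>A\<^esub> b)"
      have v: "m0 \<star>\<^bsub>XM\<^esub> a0 \<star>\<^bsub>XM\<^esub> b = ?v" "?v \<in> carrier (over_S XM)"
        using right_semimodule.ract_assoc[OF amod_XM m0 a(1) x(1)] mem_ract[OF amod_XM m0, of "a0 \<otimes>\<^bsub>A\<^esub> b"] a x
        by (simp_all del: to_dk_simps(4))
      have "pairing XM (tensor_lift XC (\<lambda>c1 c2. pure (over_S XM) C (m0 \<star>\<^bsub>XM\<^esub> a0) (ev f c2 \<odot>\<^bsub>C\<^esub> actC c1 a1)) (comult C m1)) (hash b g) =
        tensor_lift (over_S XM) (\<lambda>c1 c2. pairing XM (pure (over_S XM) C (m0 \<star>\<^bsub>XM\<^esub> a0) (ev f c2 \<odot>\<^bsub>C\<^esub> actC c1 a1)) (hash b g)) (comult C m1)"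
        by (rule lin_lift[where \<phi> = "\<lambda>z. pairing XM z (hash b g)"]; (assumption | rule lins)+)
      also have "\<dots> = tensor_lift (over_S XM) (\<lambda>c1 c2. (ev (dual_act a1 g) c1 \<otimes>\<^bsub>S\<^esub> ev f c2) \<odot>\<^bsub>over_S XM\<^esub> ?v) (comult C m1)"
      proof (rule lift_cong, (assumption | rule lins)+)
        fix c1 c2 assume c [lins]: "c1 \<in> carrier C" "c2 \<in> carrier C"
        have "pairing XM (pure (over_S XM) C (m0 \<star>\<^bsub>XM\<^esub> a0) (ev f c2 \<odot>\<^bsub>C\<^esub> actC c1 a1)) (hash b g) =
          ev g (ev f c2 \<odot>\<^bsub>C\<^esub> actC c1 a1) \<odot>\<^bsub>over_S XM\<^esub> (m0 \<star>\<^bsub>XM\<^esub> a0 \<star>\<^bsub>XM\<^esub> b)"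
          by (rule pairing_pure; (assumption | rule lins)+)
        also have "ev g (ev f c2 \<odot>\<^bsub>C\<^esub> actC c1 a1) = ev (dual_act a1 g) c1 \<otimes>\<^bsub>S\<^esub> ev f c2"
          using lin_smult[OF lin_ev2[OF x(2) lin_id] mem_ev[OF c(2) assms(3)] mem_act[OF c(1) a(2)]]
          by (simp add: c a x assms mem_ev mem_act S.m_comm)
        finally show "pairing XM (pure (over_S XM) C (m0 \<star>\<^bsub>XM\<^esub> a0) (ev f c2 \<odot>\<^bsub>C\<^esub> actC c1 a1)) (hash b g) =
          (ev (dual_act a1 g) c1 \<otimes>\<^bsub>S\<^esub> ev f c2) \<odot>\<^bsub>over_S XM\<^esub> ?v"
          unfolding v(1) .
      qed
      also have "\<dots> = tensor_lift (scalars S) (\<lambda>c1 c2. ev (dual_act a1 g) c1 \<otimes>\<^bsub>S\<^esub> ev f c2) (comult C m1) \<odot>\<^bsub>over_S XM\<^esub> ?v"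
        by (rule lin_lift[where \<phi> = "\<lambda>s. s \<odot>\<^bsub>over_S XM\<^esub> ?v", symmetric]; (assumption | rule lins v(2))+)
      finally show "pairing XM (tensor_lift XC (\<lambda>c1 c2. pure (over_S XM) C (m0 \<star>\<^bsub>XM\<^esub> a0) (ev f c2 \<odot>\<^bsub>C\<^esub> actC c1 a1)) (comult C m1)) (hash b g) =
        ev (dual_act a1 g \<otimes>\<^bsub>dual\<^esub> f) m1 \<odot>\<^bsub>over_S XM\<^esub> ?v"
        by (simp only: ev_dual(5)[OF m1])
    qed
    finally show "tensor_lift (over_S XM) (\<lambda>a0 a1. ev (dual_act a1 g \<otimes>\<^bsub>dual\<^esub> f) m1 \<odot>\<^bsub>over_S XM\<^esub> (m0 \<star>\<^bsub>XM\<^esub> (a0 \<otimes>\<^bsub>A\<^esub> b))) (\<rho>A a) =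
       pairing XM (tensor_lift XC (\<lambda>a0 a1. tensor_lift XC (\<lambda>c1 c2.
      pure (over_S XM) C (m0 \<star>\<^bsub>XM\<^esub> a0) (ev f c2 \<odot>\<^bsub>C\<^esub> actC c1 a1)) (comult C m1)) (\<rho>A a)) (hash b g)" ..
  qed
  also have "\<dots> = pairing XM (tact XM (coaction M m) a f) (hash b g)"
    unfolding tact_def
    by (rule lin_lift[where \<phi> = "\<lambda>z. pairing XM z (hash b g)", symmetric]; (assumption | rule lins | erule mem_over_SD)+)
  finally show "pairing XM (coaction M (m \<star>\<^bsub>M\<^esub> hash a f)) (hash b g) = pairing XM (tact XM (coaction M m) a f) (hash b g)" .
qed

lemma right_linear_coaction: "right_linear smash M YM (coaction M)"
proof -
  note A = amod_XM and l = lin_coaction_XM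
  have "coaction M (m \<star>\<^bsub>M\<^esub> t) = coaction M m \<star>\<^bsub>YM\<^esub> t" if m: "m \<in> carrier M" and t: "t \<in> carrier AD" for m t
  proof -
    note c = coaction_XM[OF m] and lm = lin_ract_XM[OF m]
    have "coaction M (m \<star>\<^bsub>M\<^esub> t) = tensor_lift XC (tact XM (coaction M m)) t"
    proof (rule lin_eqI[where f = "\<lambda>t. coaction M (m \<star>\<^bsub>M\<^esub> t)", OF t])
      fix a f assume a: "a \<in> carrier A" "f \<in> carrier dual"
      show "coaction M (m \<star>\<^bsub>M\<^esub> hash a f) = tensor_lift XC (tact XM (coaction M m)) (hash a f)"
        unfolding coaction_tact[OF m a] by (rule lift_pure[symmetric]; (assumption | rule lins A a c)+)
    qed (assumption | rule lins A lin_compose[OF lm l] c)+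
    then show ?thesis
      by (simp add: smash_tensor_ract[OF A c t])
  qed
  then show ?thesis
    using lin_additive[OF l] by (simp add: right_linear_def additive_map_def smash_simps(1))
qed

text \<open>The counit law provides a left inverse.\<close>

lemma inj_coaction: "inj_on (coaction M) (carrier M)"
  by (rule inj_on_inverseI[where g = "tensor_lift (over_S XM) (\<lambda>m0 m1. counit C m1 \<odot>\<^bsub>over_S XM\<^esub> m0)"])
    (rule coaction_counit[OF M rat])

text \<open>The map \<open>a \<otimes> c \<mapsto> m a \<otimes> c\<close> multiplies from the left,
  while the smash product acts from the right. Taken over all \<open>m\<close>, the images of these
  maps generate \<open>M \<otimes> C\<close>, as \<open>1 \<otimes> c\<close> goes to
  \<open>m \<otimes> c\<close>.\<close>

lemma right_linear_translate:
  assumes m: "m \<in> carrier M"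
  shows "right_linear smash coring_smash YM (tmap (over_S XM) C (\<lambda>a. m \<star>\<^bsub>XM\<^esub> a))"
proof -
  note A = amod_XM
  have m' [lins]: "m \<in> carrier XM" using m by simp
  let ?t = "tmap (over_S XM) C (\<lambda>a. m \<star>\<^bsub>XM\<^esub> a)"
  note lA = lin_ract02[OF A m']
  note l = lin_tmap[OF smod_A smod_over_S[OF A] smod_C lA]
  note p = tmap_pure[OF smod_A smod_over_S[OF A] smod_C lA]
  note rA = regular_agree smash_tensor_simps
  \<comment> \<open>\<open>over_S regular\<close> and \<open>A\<close> are different records with
    the same S-action, because multiplication by \<open>s 1\<close> is multiplication by
    \<open>s\<close>.\<close>
  have lr: "lin (A \<boxtimes> C) (A \<boxtimes> C) F" if "lin (over_S regular \<boxtimes> C) (over_S regular \<boxtimes> C) F" for F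
  proof -
    have "s \<odot>\<^bsub>over_S regular \<boxtimes> C\<^esub> u = s \<odot>\<^bsub>A \<boxtimes> C\<^esub> u" if "s \<in> carrier S" "u \<in> carrier (A \<boxtimes> C)" for s u
      unfolding smult_stensor regular_agree
      by (rule lift_cong[OF that(2) smod_A smod_C]) (simp add: smult_over_S scalar_central that(1))
    then show ?thesis
      using that by (simp add: left_linear_def additive_map_def regular_agree Pi_iff)
  qed
  have "?t (tact regular u b g) = tact XM (?t u) b g" if u: "u \<in> carrier (A \<boxtimes> C)" and x [lins]: "b \<in> carrier A" "g \<in> carrier dual" for u b g
  proof (rule lin_eqI[where f = "\<lambda>u. ?t (tact regular u b g)" and g = "\<lambda>u. tact XM (?t u) b g", OF u smod_A smod_C
        smod_stensor[OF smod_over_S[OF A] smod_C]])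
    show "lin (A \<boxtimes> C) XC (\<lambda>u. ?t (tact regular u b g))"
      by (rule lin_compose[OF lr[OF lin_tact1[OF amod_regular x lin_id]] l])
    show "lin (A \<boxtimes> C) XC (\<lambda>u. tact XM (?t u) b g)"
      by (rule lin_tact1[OF A x l])
    fix a c assume a [lins]: "a \<in> carrier A" "c \<in> carrier C"
    have "?t (tact regular (pure A C a c) b g) = ?t (tensor_lift (A \<boxtimes> C) (\<lambda>b0 b1. tensor_lift (A \<boxtimes> C) (\<lambda>c1 c2.
     pure A C (a \<otimes>\<^bsub>A\<^esub> b0) (ev g c2 \<odot>\<^bsub>C\<^esub> actC c1 b1)) (comult C c)) (\<rho>A b))"
      using tact_pure[OF amod_regular, of a c b g] a x by (simp add: regular_agree)
    also have "\<dots> = tensor_lift XC (\<lambda>b0 b1. ?t (tensor_lift (A \<boxtimes> C) (\<lambda>c1 c2.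
     pure A C (a \<otimes>\<^bsub>A\<^esub> b0) (ev g c2 \<odot>\<^bsub>C\<^esub> actC c1 b1)) (comult C c))) (\<rho>A b)"
      by (rule lin_lift[where \<phi> = ?t, OF _ _ _ l]; (assumption | rule lins)+)
    also have "\<dots> = tensor_lift XC (\<lambda>b0 b1. tensor_lift XC (\<lambda>c1 c2.
     ?t (pure A C (a \<otimes>\<^bsub>A\<^esub> b0) (ev g c2 \<odot>\<^bsub>C\<^esub> actC c1 b1))) (comult C c)) (\<rho>A b)"
      by (rule lift_cong, (assumption | rule lins)+, rule lin_lift[where \<phi> = ?t, OF _ _ _ l]; (assumption | rule lins)+)
    also have "\<dots> = tensor_lift XC (\<lambda>b0 b1. tensor_lift XC (\<lambda>c1 c2.
     pure (over_S XM) C (m \<star>\<^bsub>XM\<^esub> a \<star>\<^bsub>XM\<^esub> b0) (ev g c2 \<odot>\<^bsub>C\<^esub> actC c1 b1)) (comult C c)) (\<rho>A b)"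
      by (intro lift_cong[OF mem_rho[OF x(1)] smod_A smod_B] lift_cong[OF mem_comult[OF a(2)] smod_C smod_C])
        (simp add: p semimodule.smult_closed[OF smod_C] mem_ev mem_act a x right_semimodule.ract_assoc[OF A m'] del: to_dk_simps(4))
    also have "\<dots> = tact XM (pure (over_S XM) C (m \<star>\<^bsub>XM\<^esub> a) c) b g"
      by (rule tact_pure[symmetric]; (assumption | rule lins)+)
    finally show "?t (tact regular (pure A C a c) b g) = tact XM (?t (pure A C a c)) b g"
      unfolding p[OF a] .
  qed
  note tt = this
  have "?t (u \<star>\<^bsub>coring_smash\<^esub> t) = ?t u \<star>\<^bsub>YM\<^esub> t" if u: "u \<in> carrier (A \<boxtimes> C)" and t: "t \<in> carrier AD" for u t
  proof -
    have ur: "u \<in> carrier (over_S regular \<boxtimes> C)" using u by (simp add: regular_agree)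
    have uY: "?t u \<in> carrier XC" by (rule lin_closed[OF l u])
    have lu: "lin AD (A \<boxtimes> C) (\<lambda>t. tensor_lift (A \<boxtimes> C) (tact regular u) t)"
    proof -
      have "lin AD (over_S regular \<boxtimes> C) (tensor_lift (over_S regular \<boxtimes> C) (tact regular u))"
        by (rule lin_lift_arg0; (assumption | rule lins amod_regular ur)+)
      moreover have "s \<odot>\<^bsub>over_S regular \<boxtimes> C\<^esub> v = s \<odot>\<^bsub>A \<boxtimes> C\<^esub> v" if "s \<in> carrier S" "v \<in> carrier (A \<boxtimes> C)" for s v
        unfolding smult_stensor regular_agree
        by (rule lift_cong[OF that(2) smod_A smod_C]) (simp add: smult_over_S scalar_central that(1))
      ultimately show ?thesis
        by (simp add: left_linear_def additive_map_def regular_agree Pi_iff)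
    qed
    have "?t (tensor_lift (A \<boxtimes> C) (tact regular u) t) = tensor_lift XC (tact XM (?t u)) t"
    proof (rule lin_eqI[where f = "\<lambda>t. ?t (tensor_lift (A \<boxtimes> C) (tact regular u) t)"
          and g = "tensor_lift XC (tact XM (?t u))", OF t smod_A smod_dual
          smod_stensor[OF smod_over_S[OF A] smod_C]])
      show "lin AD XC (\<lambda>t. ?t (tensor_lift (A \<boxtimes> C) (tact regular u) t))"
        by (rule lin_compose[OF lu l])
      show "lin AD XC (tensor_lift XC (tact XM (?t u)))"
        by (rule lin_lift_arg0; (assumption | rule lins uY)+)
      fix b g assume x: "b \<in> carrier A" "g \<in> carrier dual"
      have "tensor_lift (A \<boxtimes> C) (tact regular u) (hash b g) = tact regular u b g"
        using smash_tensor_ract_pure[OF amod_regular ur x] smash_tensor_ract[OF amod_regular ur mem_hash[OF x]]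
        by (simp add: regular_agree)
      then show "?t (tensor_lift (A \<boxtimes> C) (tact regular u) (hash b g)) = tensor_lift XC (tact XM (?t u)) (hash b g)"
        using smash_tensor_ract_pure[OF A uY x] smash_tensor_ract[OF A uY mem_hash[OF x]] tt[OF u x] by simp
    qed
    then show ?thesis
      unfolding coring_smash_eq
      using smash_tensor_ract[OF amod_regular ur t] smash_tensor_ract[OF A uY t] by (simp add: regular_agree)
  qed
  then show ?thesis
    using lin_additive[OF l]
    by (simp add: right_linear_def additive_map_def coring_smash_eq regular_agree smash_simps(1))
qed

text \<open>The class \<open>K\<close> consists of objects on \<open>'u\<close>, so every stage of
  the construction is replaced by a copy under \<open>push\<close>; the cardinal bounds provide the
  injections.\<close>

lemma rational_in_sigma:
  assumes can: "canonical_rmodule smash M" and K: "sigma_closed smash coring_smash K"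
  shows "M \<in> K"
proof -
  note A = amod_XM
  have K_iso: "N \<in> K" if "N \<in> objT" "rmodule_iso smash coring_smash N" for N
    using K that unfolding sigma_closed_def by blast
  have K_sum: "N \<in> K" if "N \<in> objT" "\<And>i. i \<in> I \<Longrightarrow> L i \<in> K" "rmodule_iso smash (direct_sum I L) N" for N L and I :: "'u set"
  proof -
    have "\<forall>(I :: 'u set) L. \<forall>N\<in>objT. (\<forall>i\<in>I. L i \<in> K) \<and> rmodule_iso smash (direct_sum I L) N \<longrightarrow> N \<in> K"
      using K unfolding sigma_closed_def by (elim conjE) assumption
    from this[rule_format, of N I L] that show ?thesis by simp
  qed
  have K_image: "N \<in> K" if "L \<in> K" "N \<in> objT" "right_linear smash L N f" "f ` carrier L = carrier N" for L N f
  proof -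
    have "\<forall>L\<in>K. \<forall>N\<in>objT. \<forall>f. right_linear smash L N f \<and> f ` carrier L = carrier N \<longrightarrow> N \<in> K"
      using K unfolding sigma_closed_def by (elim conjE) assumption
    with that show ?thesis by blast
  qed
  have K_sub: "N \<in> K" if "L \<in> K" "N \<in> objT" "subsemimodule smash N L" for L N
  proof -
    have "\<forall>L\<in>K. \<forall>N\<in>objT. subsemimodule smash N L \<longrightarrow> N \<in> K"
      using K unfolding sigma_closed_def by (elim conjE) assumption
    with that show ?thesis by blast
  qed
  have Tcor: "tmod coring_smash" by (rule tmod_coring_smash)
  have TY: "tmod YM" by (rule tmod_smash_tensor[OF A])
  have "carrier coring_smash \<lesssim> (UNIV :: 'u set)"
    unfolding coring_smash_eq smash_tensor_simps stensor_simps
    by (rule tensor_lepoll[OF inf _ C_lepoll]) (simp add: A_lepoll)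
  then obtain k0 :: "('a, 'c) tens \<Rightarrow> 'u" where k0: "inj_on k0 (carrier coring_smash)"
    by (auto simp: lepoll_def)
  define X' where "X' = push smash coring_smash k0"
  have X': "X' \<in> K"
    unfolding X'_def by (rule K_iso[OF push_objT[OF Tcor k0] push_iso[OF Tcor k0]])
  have TX': "tmod X'"
    using push_objT[OF Tcor k0] by (simp add: X'_def objT_iff)
  \<comment> \<open>One copy of the coring for each element \<open>m\<close> of \<open>M\<close>, to
    be mapped to \<open>YM\<close> by translation with \<open>m\<close>. The index set is the
    carrier of \<open>M\<close>, a set in \<open>'u\<close>.\<close>
  let ?D = "direct_sum (carrier M) (\<lambda>_. X')"
  have TD: "tmod ?D" by (rule right_semimodule_direct_sum[OF semiring_smash TX'])
  obtain k1 :: "('u \<Rightarrow> 'u) \<Rightarrow> 'u" where k1: "inj_on k1 (carrier ?D)"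
    using direct_sum_lepoll[OF inf] by (auto simp: lepoll_def)
  define N where "N = push smash ?D k1"
  have N: "N \<in> K"
    unfolding N_def by (rule K_sum[OF push_objT[OF TD k1] X' push_iso[OF TD k1]])
  have "carrier YM \<lesssim> (UNIV :: 'u set)"
    unfolding smash_tensor_simps stensor_simps by (rule tensor_lepoll[OF inf _ C_lepoll]) (simp add: subset_imp_lepoll)
  then obtain k2 :: "('u, 'c) tens \<Rightarrow> 'u" where k2: "inj_on k2 (carrier YM)"
    by (auto simp: lepoll_def)
  define Y' where "Y' = push smash YM k2"
  let ?\<tau> = "\<lambda>m. tmap (over_S XM) C (\<lambda>a. m \<star>\<^bsub>XM\<^esub> a)"
  let ?\<phi> = "\<lambda>m y. ?\<tau> m (inv_into (carrier coring_smash) k0 y)"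
  have \<phi>: "right_linear smash X' YM (?\<phi> m)" if "m \<in> carrier M" for m
    unfolding X'_def by (rule right_linear_compose[OF push_inv[OF Tcor k0] right_linear_translate[OF that]])
  obtain \<Phi> where \<Phi>: "right_linear smash ?D YM \<Phi>"
    "\<And>m y. m \<in> carrier M \<Longrightarrow> y \<in> carrier X' \<Longrightarrow> \<Phi> (ds_inj (carrier M) (\<lambda>_. X') m y) = ?\<phi> m y"
  proof -
    have "\<exists>\<Phi>. right_linear smash ?D YM \<Phi> \<and> (\<forall>m\<in>carrier M. \<forall>y\<in>carrier X'. \<Phi> (ds_inj (carrier M) (\<lambda>_. X') m y) = ?\<phi> m y)"
      by (rule direct_sum_map[OF semiring_smash TX' TY \<phi>])
    then show thesis using that by blast
  qed
  note \<Phi>a = \<Phi>(1)[unfolded right_linear_def additive_map_def]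
  have surj: "u \<in> \<Phi> ` carrier ?D" if "u \<in> carrier YM" for u
  proof -
    have "u \<in> carrier (over_S XM \<boxtimes> C)" using that by simp
    with smod_over_S[OF A] smod_C show ?thesis
    proof (induction u rule: stensor_induct)
      case zero
      show ?case
        using \<Phi>a ds_zero_closed[OF semiring_smash TX', of "carrier M"] by (auto intro!: image_eqI)
    next
      case (pure m c)
      then have m: "m \<in> carrier M" by simp
      have o: "pure_tensor S A C \<one>\<^bsub>A\<^esub> c \<in> carrier coring_smash"
        unfolding coring_smash_eq smash_tensor_simps regular_agree by (rule mem_pure[OF smod_A smod_C A.one_closed pure(2)])
      \<comment> \<open>The tensor \<open>m \<otimes> c\<close> is hit by
        \<open>1 \<otimes> c\<close> placed in the component with index \<open>m\<close>.\<close>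
      let ?y = "k0 (pure_tensor S A C \<one>\<^bsub>A\<^esub> c)"
      have y: "?y \<in> carrier X'"
        using o by (simp add: X'_def push_simps)
      have "\<Phi> (ds_inj (carrier M) (\<lambda>_. X') m ?y) = ?\<tau> m (pure_tensor S A C \<one>\<^bsub>A\<^esub> c)"
        using \<Phi>(2)[OF m y] inv_into_f_f[OF k0 o] by simp
      also have "\<dots> = pure_tensor S (over_S XM) C (m \<star>\<^bsub>XM\<^esub> \<one>\<^bsub>A\<^esub>) c"
        using m pure(2) by (intro tmap_pure[OF smod_A smod_over_S[OF A] smod_C lin_ract02[OF A]]) simp_all
      also have "m \<star>\<^bsub>XM\<^esub> \<one>\<^bsub>A\<^esub> = m"
        using right_semimodule.ract_one[OF A] m by (simp del: to_dk_simps(4))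
      finally show ?case
        using ds_inj_closed[OF semiring_smash TX' m y] by (auto intro!: image_eqI)
    next
      case (add x y)
      then obtain v w where v: "v \<in> carrier ?D" "w \<in> carrier ?D" "x = \<Phi> v" "y = \<Phi> w" by blast
      then show ?case
        using \<Phi>a ds_add_closed[OF semiring_smash TX' v(1,2)] by (intro image_eqI[of _ _ "v \<oplus>\<^bsub>?D\<^esub> w"]) auto
    qed
  qed
  have Y': "Y' \<in> K"
  proof (rule K_image[OF N])
    show "Y' \<in> objT" unfolding Y'_def by (rule push_objT[OF TY k2])
    show "right_linear smash N Y' (\<lambda>x. k2 (\<Phi> (inv_into (carrier ?D) k1 x)))"
      unfolding N_def Y'_def
      by (rule right_linear_compose[OF push_inv[OF TD k1] right_linear_compose[OF \<Phi>(1) push_linear[OF TY k2]]])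
    have "\<Phi> ` carrier ?D = carrier YM"
      using surj \<Phi>a by auto
    moreover have "(\<lambda>x. k2 (\<Phi> (inv_into (carrier ?D) k1 x))) ` carrier N = k2 ` \<Phi> ` carrier ?D"
      unfolding N_def push_simps image_image by (rule image_cong[OF HOL.refl]) (simp add: inv_into_f_f[OF k1])
    ultimately show "(\<lambda>x. k2 (\<Phi> (inv_into (carrier ?D) k1 x))) ` carrier N = carrier Y'"
      by (simp only: Y'_def push_simps)
  qed
  let ?k = "\<lambda>m. k2 (coaction M m)"
  note \<rho> = right_linear_coaction
  have \<rho>c: "coaction M m \<in> carrier YM" if "m \<in> carrier M" for m
    using \<rho> that by (auto simp: right_linear_def additive_map_def)
  have k: "inj_on ?k (carrier M)"
    using inj_coaction k2 \<rho>c by (auto simp: inj_on_def)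
  have kl: "right_linear smash M Y' ?k"
    unfolding Y'_def by (rule right_linear_compose[OF \<rho> push_linear[OF TY k2]])
  note kp = push_add[OF M congruent_map_inj[OF k]] push_ract[OF M congruent_map_inj[OF k]]
  \<comment> \<open>\<open>?P\<close> is the copy of \<open>M\<close> inside \<open>Y'\<close>, cut
    out by the coaction.\<close>
  let ?P = "push smash M ?k"
  have "?P \<in> K"
  proof (rule K_sub[OF Y' push_objT[OF M k]])
    show "subsemimodule smash ?P Y'"
      using kl by (auto simp: subsemimodule_def push_simps kp right_linear_def additive_map_def)
  qed
  \<comment> \<open>From the copy \<open>M\<close> itself is recovered as a homomorphic image, under
    the inverse bijection.\<close>
  then show "M \<in> K"
  proof (rule K_image)
    show "M \<in> objT" using M can by (simp add: objT_iff)
    show "right_linear smash ?P M (inv_into (carrier M) ?k)" by (rule push_inv[OF M k])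
    show "inv_into (carrier M) ?k ` carrier ?P = carrier M"
      unfolding push_simps using inj_on_imp_bij_betw[OF k, THEN bij_betw_inv_into] by (simp add: bij_betw_def)
  qed
qed

end

text \<open>Both are full subcategories of the same category of right smash semimodules, so
  comparing their objects suffices.\<close>

theorem rat_eq_sigma: "ratC = sigma_cat smash coring_smash"
proof -
  have "Obj ratC = objT \<inter> \<Inter> {K. sigma_closed smash coring_smash K}"
  proof
    show "objT \<inter> \<Inter> {K. sigma_closed smash coring_smash K} \<subseteq> Obj ratC"
      using sigma_closed_rational by blast
    show "Obj ratC \<subseteq> objT \<inter> \<Inter> {K. sigma_closed smash coring_smash K}"
      using rational_in_sigma by (auto simp: rat_obj_iff objT_iff)
  qed
  then show ?thesis
    by (simp add: sigma_cat_def rat_cat_def full_subcategory_def)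
qed

end

theorem theorem3p9:
  fixes S :: "'s ring"
    and B :: "('s, 'b) coalgebra"
    and A :: "('s, 'a) module"
    and \<rho>A :: "'a \<Rightarrow> ('a, 'b) tens"
    and C :: "('s, 'c) coalgebra"
    and actC :: "'c \<Rightarrow> 'b \<Rightarrow> 'c"
  assumes "semiring S" and "comm_monoid S" and "\<one>\<^bsub>S\<^esub> \<noteq> \<zero>\<^bsub>S\<^esub>"
    and "doi_koppinen S B A \<rho>A C actC"
    and "infinite (UNIV :: 'u set)"
    and "carrier A \<lesssim> (UNIV :: 'u set)" and "carrier C \<lesssim> (UNIV :: 'u set)"
    and "doi_koppinen_data.alpha_condition S A \<rho>A C actC TYPE('u)"
  shows "isomorphic_categories
           (doi_koppinen_data.dk_cat S A \<rho>A C actC :: (('u, 'a, 'c) dk_module, 'u \<Rightarrow> 'u) cat)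
           (doi_koppinen_data.rat_cat S A \<rho>A C actC :: (('u, ('a, 'c \<Rightarrow> 's) tens) rmodule, 'u \<Rightarrow> 'u) cat)
       \<and> (doi_koppinen_data.rat_cat S A \<rho>A C actC :: (('u, ('a, 'c \<Rightarrow> 's) tens) rmodule, 'u \<Rightarrow> 'u) cat)
         = sigma_cat (doi_koppinen_data.smash S A \<rho>A C actC)
                     (doi_koppinen_data.coring_smash S A \<rho>A C actC)"
proof -
  interpret doi_koppinen_alpha S B A \<rho>A C actC "TYPE('u)"
    using assms by (intro doi_koppinen_alpha.intro doi_koppinen_alpha_axioms.intro
        doi_koppinen_setting.intro commutative_semiring.intro)
  show ?thesis
    using isomorphic_dk_rat rat_eq_sigma by blast
qed

end
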